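(* Let $\mu$ be a $d\times d'$-matrix valued signed measure on $\mathbb{R}_+$ satisfying $\int_{\mathbb{R}_+}(1\wedge\theta^{-1/2})\,|\mu|(d\theta)<\infty$. Assume that $Q\in\mathbb{S}^d_+$ and that $N-\lambda I_m\in\mathbb{S}^m_+$ for some $\lambda>0$. Then there exists a unique solution $\Gamma\in C([0,T],L^1(\mu\otimes\mu))$ to the kernel Riccati equation $$\Gamma_t(\theta,\tau)=\int_t^T e^{-(\theta+\tau)(s-t)}\,\mathcal{R}(\Gamma_s)(\theta,\tau)\,ds,\qquad 0\le t\le T,\quad \mu\otimes\mu\text{-a.e.},$$ such that $\Gamma_t\in\mathbb{S}^d_+(\mu\otimes\mu)$ for all $t\le T$. Furthermore, there exists a constant $M>0$ such that $$\int_{\mathbb{R}_+}|\mu|(d\tau)\,|\Gamma_t(\theta,\tau)|\le M,\qquad \mu\text{-a.e. }\theta,\quad 0\le t\le T.$$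
   Context: Fix $T>0$, $d,d',m\in\mathbb{N}$ and constant matrices $B,D\in\mathbb{R}^{d'\times d}$, $C,F\in\mathbb{R}^{d'\times m}$, $Q\in\mathbb{R}^{d\times d}$, $N\in\mathbb{R}^{m\times m}$. $^\top$ denotes transposition, $|\cdot|$ a matrix norm, $I_m$ the $m\times m$ identity, and $\mathbb{S}^k_+$ the cone of symmetric positive semidefinite $k\times k$ real matrices. $|\mu|$ denotes the total variation measure of $\mu$; $\mu$ is not necessarily finite. "$\mu$-a.e." means $|\mu|$-a.e., and "$\mu\otimes\mu$-a.e." means $|\mu|\otimes|\mu|$-a.e. $L^1(\mu\otimes\mu)$ is the Banach space of ($\mu\otimes\mu$-a.e. equivalence classes of) measurable $\Phi:\mathbb{R}_+^2\to\mathbb{R}^{d\times d}$ with $\|\Phi\|_{L^1(\mu\otimes\mu)}=\int_{\mathbb{R}_+^2}|\mu|(d\theta)|\Phi(\theta,\tau)||\mu|(d\tau)<\infty$; $L^\infty(\mu\otimes\mu)$ is the set of measurable $\Phi:\mathbb{R}_+^2\to\mathbb{R}^{d\times d}$ bounded $\mu\otimes\mu$-a.e.; $L^1(\mu)$ is the space of measurable $\varphi:\mathbb{R}_+\to\mathbb{R}^{d'}$ with $\int_{\mathbb{R}_+}|\mu|(d\theta)|\varphi(\theta)|<\infty$. $\mathbb{S}^d_+(\mu\otimes\mu)$ is the set of $\Gamma\in L^\infty(\mu\otimes\mu)$ which are symmetric, i.e. $\Gamma(\theta,\tau)=\Gamma(\tau,\theta)^\top$ $\mu\otimes\mu$-a.e.,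 and nonnegative, i.e. $\int_{\mathbb{R}_+^2}\varphi(\theta)^\top\mu(d\theta)^\top\Gamma(\theta,\tau)\mu(d\tau)\varphi(\tau)\ge 0$ for all $\varphi\in L^1(\mu)$. The nonlinearity is $$\mathcal{R}(\Gamma)(\theta,\tau)=Q+D^\top\int_{\mathbb{R}_+^2}\mu(d\theta')^\top\Gamma(\theta',\tau')\mu(d\tau')\,D+B^\top\int_{\mathbb{R}_+}\mu(d\theta')^\top\Gamma(\theta',\tau)+\int_{\mathbb{R}_+}\Gamma(\theta,\tau')\mu(d\tau')\,B-S(\Gamma)(\theta)^\top\hat N(\Gamma)^{-1}S(\Gamma)(\tau),$$ with $$S(\Gamma)(\tau)=C^\top\int_{\mathbb{R}_+}\mu(d\theta)^\top\Gamma(\theta,\tau)+F^\top\int_{\mathbb{R}_+^2}\mu(d\theta')^\top\Gamma(\theta',\tau')\mu(d\tau')\,D,$$ $$\hat N(\Gamma)=N+F^\top\int_{\mathbb{R}_+^2}\mu(d\theta)^\top\Gamma(\theta,\tau)\mu(d\tau)\,F.$$ A solution to the kernel Riccati equation is a function $\Gamma\in C([0,T],L^1(\mu\otimes\mu))$ satisfying the displayed integral equation; in particular $\hat N(\Gamma_t)$ is required to be invertible for all $t\le T$. *)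

theory Defs
  imports "HOL-Analysis.Analysis"
begin

text \<open>
  Conventions. A \<open>p \<times> q\<close> matrix has type \<open>real ^ 'q ^ 'p\<close>, and the matrix norm is the
  library norm on that type (the Frobenius norm). The half line is \<open>{0..}\<close>.
\<close>

section \<open>Signed measures on the half line that need not be finite\<close>

text \<open>
  If positive and negative parts are both infinite, a signed measure has no value on unbounded
  sets. As usual for locally finite measures, it is a set function on the bounded Borel sets.
\<close>

definition bounded_borel :: "real set set" where
  "bounded_borel = {A \<in> sets borel. A \<subseteq> {0..} \<and> bounded A}"

definition signed_measure :: "(real set \<Rightarrow> 'a::euclidean_space) \<Rightarrow> bool" where
  "signed_measure \<mu> \<longleftrightarrow>
     (\<forall>A :: nat \<Rightarrow> real set. range A \<subseteq> bounded_borel \<longrightarrow> disjoint_family A \<longrightarrow> bounded (\<Union>n. A n) \<longrightarrow>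
        (\<lambda>n. \<mu> (A n)) sums \<mu> (\<Union>n. A n))"

text \<open>
  The total variation is the supremum over countable Borel partitions (into bounded sets); unlike
  \<open>\<mu>\<close> it is defined on all Borel sets of the half line.
\<close>

definition total_variation :: "(real set \<Rightarrow> 'a::euclidean_space) \<Rightarrow> real measure" where
  "total_variation \<mu> = measure_of {0..} (sets (restrict_space borel {0..}))
     (\<lambda>E. SUP P\<in>{P :: nat \<Rightarrow> real set. range P \<subseteq> bounded_borel \<and> disjoint_family P \<and> (\<Union>n. P n) = E}.
            \<Sum>n. ennreal (norm (\<mu> (P n))))"

text \<open>
  Integrals against \<open>\<mu>\<close> are defined through its polar decomposition: \<open>\<mu>(d\<theta>) = h(\<theta>) |\<mu>|(d\<theta>)\<close>. Such
  an \<open>h\<close> exists by the Radon--Nikodym theorem and is unique \<open>|\<mu>|\<close>-almost everywhere, so that no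
  integral below depends on the choice.
\<close>

definition polar_density :: "(real set \<Rightarrow> 'a::euclidean_space) \<Rightarrow> real \<Rightarrow> 'a" where
  "polar_density \<mu> = (SOME h. h \<in> borel_measurable (total_variation \<mu>) \<and>
     (\<forall>A\<in>bounded_borel. set_integrable (total_variation \<mu>) A h \<and>
        \<mu> A = (LINT \<theta>:A|total_variation \<mu>. h \<theta>)))"

abbreviation tv_prod :: "(real set \<Rightarrow> 'a::euclidean_space) \<Rightarrow> (real \<times> real) measure" where
  "tv_prod \<mu> \<equiv> total_variation \<mu> \<Otimes>\<^sub>M total_variation \<mu>"

text \<open>\<open>\<integral> \<mu>(d\<theta>')\<^sup>T \<Gamma>(\<theta>',\<tau>)\<close>, \<open>\<integral> \<Gamma>(\<theta>,\<tau>') \<mu>(d\<tau>')\<close> and \<open>\<integral>\<integral> \<mu>(d\<theta>')\<^sup>T \<Gamma>(\<theta>',\<tau>') \<mu>(d\<tau>')\<close>\<close>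

definition int_left :: "(real set \<Rightarrow> real^'e^'d) \<Rightarrow> (real \<Rightarrow> real \<Rightarrow> real^'d^'d) \<Rightarrow> real \<Rightarrow> real^'d^'e" where
  "int_left \<mu> \<Gamma> \<tau> = (LINT \<theta>'|total_variation \<mu>. transpose (polar_density \<mu> \<theta>') ** \<Gamma> \<theta>' \<tau>)"

definition int_right :: "(real set \<Rightarrow> real^'e^'d) \<Rightarrow> (real \<Rightarrow> real \<Rightarrow> real^'d^'d) \<Rightarrow> real \<Rightarrow> real^'e^'d" where
  "int_right \<mu> \<Gamma> \<theta> = (LINT \<tau>'|total_variation \<mu>. \<Gamma> \<theta> \<tau>' ** polar_density \<mu> \<tau>')"

definition int_both :: "(real set \<Rightarrow> real^'e^'d) \<Rightarrow> (real \<Rightarrow> real \<Rightarrow> real^'d^'d) \<Rightarrow> real^'e^'e" where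
  "int_both \<mu> \<Gamma> = (LINT (\<theta>', \<tau>')|tv_prod \<mu>.
     transpose (polar_density \<mu> \<theta>') ** \<Gamma> \<theta>' \<tau>' ** polar_density \<mu> \<tau>')"


section \<open>Matrices and kernels\<close>

definition psd :: "real^'n^'n \<Rightarrow> bool" where
  "psd A \<longleftrightarrow> transpose A = A \<and> (\<forall>x. 0 \<le> x \<bullet> (A *v x))"

text \<open>Kernels are functions representing their \<open>\<mu> \<otimes> \<mu>\<close>-a.e. equivalence classes.\<close>

definition kernel_L1 :: "(real set \<Rightarrow> real^'e^'d) \<Rightarrow> (real \<Rightarrow> real \<Rightarrow> real^'d^'d) \<Rightarrow> bool" where
  "kernel_L1 \<mu> \<Phi> \<longleftrightarrow> integrable (tv_prod \<mu>) (\<lambda>(\<theta>, \<tau>). \<Phi> \<theta> \<tau>)"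

definition kernel_L1_norm :: "(real set \<Rightarrow> real^'e^'d) \<Rightarrow> (real \<Rightarrow> real \<Rightarrow> real^'d^'d) \<Rightarrow> real" where
  "kernel_L1_norm \<mu> \<Phi> = (LINT (\<theta>, \<tau>)|tv_prod \<mu>. norm (\<Phi> \<theta> \<tau>))"

definition kernel_Linf :: "(real set \<Rightarrow> real^'e^'d) \<Rightarrow> (real \<Rightarrow> real \<Rightarrow> real^'d^'d) \<Rightarrow> bool" where
  "kernel_Linf \<mu> \<Phi> \<longleftrightarrow> (\<lambda>(\<theta>, \<tau>). \<Phi> \<theta> \<tau>) \<in> borel_measurable (tv_prod \<mu>) \<and>
     (\<exists>K. AE (\<theta>, \<tau>) in tv_prod \<mu>. norm (\<Phi> \<theta> \<tau>) \<le> K)"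

definition kernel_psd :: "(real set \<Rightarrow> real^'e^'d) \<Rightarrow> (real \<Rightarrow> real \<Rightarrow> real^'d^'d) \<Rightarrow> bool" where
  "kernel_psd \<mu> \<Gamma> \<longleftrightarrow> kernel_Linf \<mu> \<Gamma> \<and>
     (AE (\<theta>, \<tau>) in tv_prod \<mu>. \<Gamma> \<theta> \<tau> = transpose (\<Gamma> \<tau> \<theta>)) \<and>
     (\<forall>\<phi> :: real \<Rightarrow> real^'e. integrable (total_variation \<mu>) \<phi> \<longrightarrow>
        0 \<le> (LINT (\<theta>, \<tau>)|tv_prod \<mu>.
               (polar_density \<mu> \<theta> *v \<phi> \<theta>) \<bullet> (\<Gamma> \<theta> \<tau> *v (polar_density \<mu> \<tau> *v \<phi> \<tau>))))"

text \<open>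
  An element of \<open>C([0,T], L\<^sup>1(\<mu> \<otimes> \<mu>))\<close> is given by a representative that is jointly measurable in
  \<open>(t, \<theta>, \<tau>)\<close>. One always exists; choosing the representatives of \<open>\<Gamma> t\<close> independently for each \<open>t\<close>
  would leave pointwise integrals in \<open>t\<close> without meaning.
\<close>

definition continuous_kernel_L1 ::
  "real \<Rightarrow> (real set \<Rightarrow> real^'e^'d) \<Rightarrow> (real \<Rightarrow> real \<Rightarrow> real \<Rightarrow> real^'d^'d) \<Rightarrow> bool" where
  "continuous_kernel_L1 T \<mu> \<Gamma> \<longleftrightarrow>
     (\<lambda>(t, \<theta>, \<tau>). \<Gamma> t \<theta> \<tau>) \<in> borel_measurable (restrict_space borel {0..T} \<Otimes>\<^sub>M tv_prod \<mu>) \<and>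
     (\<forall>t\<in>{0..T}. kernel_L1 \<mu> (\<Gamma> t)) \<and>
     (\<forall>t\<in>{0..T}. ((\<lambda>s. kernel_L1_norm \<mu> (\<lambda>\<theta> \<tau>. \<Gamma> s \<theta> \<tau> - \<Gamma> t \<theta> \<tau>)) \<longlongrightarrow> 0) (at t within {0..T}))"


section \<open>The kernel Riccati equation\<close>

definition riccati_Nhat ::
  "(real set \<Rightarrow> real^'e^'d) \<Rightarrow> real^'m^'e \<Rightarrow> real^'m^'m \<Rightarrow> (real \<Rightarrow> real \<Rightarrow> real^'d^'d) \<Rightarrow> real^'m^'m" where
  "riccati_Nhat \<mu> F N \<Gamma> = N + transpose F ** int_both \<mu> \<Gamma> ** F"

definition riccati_S ::
  "(real set \<Rightarrow> real^'e^'d) \<Rightarrow> real^'m^'e \<Rightarrow> real^'d^'e \<Rightarrow> real^'m^'e \<Rightarrow>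
     (real \<Rightarrow> real \<Rightarrow> real^'d^'d) \<Rightarrow> real \<Rightarrow> real^'d^'m" where
  "riccati_S \<mu> C D F \<Gamma> \<tau> =
     transpose C ** int_left \<mu> \<Gamma> \<tau> + transpose F ** int_both \<mu> \<Gamma> ** D"

definition riccati_R ::
  "(real set \<Rightarrow> real^'e^'d) \<Rightarrow> real^'d^'e \<Rightarrow> real^'m^'e \<Rightarrow> real^'d^'e \<Rightarrow> real^'m^'e \<Rightarrow>
     real^'d^'d \<Rightarrow> real^'m^'m \<Rightarrow> (real \<Rightarrow> real \<Rightarrow> real^'d^'d) \<Rightarrow> real \<Rightarrow> real \<Rightarrow> real^'d^'d" where
  "riccati_R \<mu> B C D F Q N \<Gamma> \<theta> \<tau> =
     Q + transpose D ** int_both \<mu> \<Gamma> ** D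
       + transpose B ** int_left \<mu> \<Gamma> \<tau>
       + int_right \<mu> \<Gamma> \<theta> ** B
       - transpose (riccati_S \<mu> C D F \<Gamma> \<theta>) ** matrix_inv (riccati_Nhat \<mu> F N \<Gamma>)
           ** riccati_S \<mu> C D F \<Gamma> \<tau>"

definition riccati_solution ::
  "real \<Rightarrow> (real set \<Rightarrow> real^'e^'d) \<Rightarrow> real^'d^'e \<Rightarrow> real^'m^'e \<Rightarrow> real^'d^'e \<Rightarrow> real^'m^'e \<Rightarrow>
     real^'d^'d \<Rightarrow> real^'m^'m \<Rightarrow> (real \<Rightarrow> real \<Rightarrow> real \<Rightarrow> real^'d^'d) \<Rightarrow> bool" where
  "riccati_solution T \<mu> B C D F Q N \<Gamma> \<longleftrightarrow>
     continuous_kernel_L1 T \<mu> \<Gamma> \<and>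
     (\<forall>t\<in>{0..T}. invertible (riccati_Nhat \<mu> F N (\<Gamma> t))) \<and>
     (\<forall>t\<in>{0..T}. AE (\<theta>, \<tau>) in tv_prod \<mu>.
        set_integrable lborel {t..T}
          (\<lambda>s. exp (- (\<theta> + \<tau>) * (s - t)) *\<^sub>R riccati_R \<mu> B C D F Q N (\<Gamma> s) \<theta> \<tau>) \<and>
        \<Gamma> t \<theta> \<tau> =
          (LINT s:{t..T}|lborel. exp (- (\<theta> + \<tau>) * (s - t)) *\<^sub>R riccati_R \<mu> B C D F Q N (\<Gamma> s) \<theta> \<tau>))"

end

theory Submission imports Defs begin

text \<open>
  The measure enters through its total variation \<open>|\<mu>|\<close> and its polar density \<open>h\<close>, a bounded function
  with \<open>\<mu>(d\<theta>) = h(\<theta>) |\<mu>|(d\<theta>)\<close>. This turns the equation into one for kernels on a measure space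
  with a rate function \<open>r(\<theta>) = \<theta>\<close> and an integrable weight \<open>w(\<theta>) = 1 / sqrt (max 1 \<theta>)\<close>. Solutions are
  sought among kernels with \<open>|\<Gamma>(\<theta>,\<tau>)| \<le> K w(\<theta>) w(\<tau>)\<close>; the bound at the end of the theorem follows
  from this one by integrating in \<open>\<tau>\<close>.

  Existence is a monotone iteration in the order given by quadratic forms. Completing the square
  writes the form of \<open>\<R>(\<Gamma>)\<close> at a test function \<open>\<psi>\<close> as a minimum over control values
  \<open>x \<in> \<real>\<^sup>m\<close> of an expression that is linear in \<open>\<Gamma>\<close>. One of its terms, twice the pairing of \<open>\<psi>\<close>
  with \<open>\<mu> u\<close> for \<open>u = B \<integral>\<psi> + C x\<close>, has no sign, so \<open>\<R>\<close> is not monotone. But that term plus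
  \<open>n\<close> times the form at \<open>\<psi>\<close> plus \<open>1/n\<close> times the form at \<open>\<mu> u\<close> is \<open>n\<close> times the form at
  \<open>\<psi> + \<mu> u / n\<close>, which is monotone in \<open>\<Gamma>\<close>. The third summand amounts to an additional noise with
  coefficients \<open>B, C\<close> and intensity \<open>1/n\<close> and gives a perturbed nonlinearity \<open>\<R>\<^sub>n\<close>; the second adds
  \<open>n \<Gamma>\<close> to the source, which is compensated by replacing the decay rate \<open>\<theta> + \<tau>\<close> by \<open>\<theta> + \<tau> + n\<close>
  (lemma \<open>exp_integral_shift\<close>). So \<open>\<Gamma> \<mapsto> \<R>\<^sub>n(\<Gamma>) + n \<Gamma>\<close> is a minimum of positive monotone maps
  (\<open>control_cost_min\<close>, \<open>Gop_mono\<close>), and iterating the mild equation downwards from a supersolution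
  converges to a solution of the equation for \<open>\<R>\<^sub>n\<close> (\<open>step_fixed_point\<close>). As \<open>\<R>\<^sub>n\<close> decreases
  in \<open>n\<close>, the solution for \<open>n\<close> is a supersolution for \<open>n + 1\<close>; the solutions decrease with \<open>n\<close>, and
  their limit solves the original equation (\<open>solution_from_supersolution\<close>).

  Monotone limits of kernels exist pointwise and are dominated pointwise, provided that positivity
  sees single points. Forms are therefore tested not only against \<open>|\<mu>|\<close> but against every measure of
  which \<open>|\<mu>|\<close> is a part, in particular \<open>|\<mu>|\<close> with added point masses. Test functions
  supported at two points then give the positivity of \<open>2 \<times> 2\<close> block matrices
  (\<open>pd_pointwise\<close>), and with it bounds and convergence (\<open>kern_of_dominated\<close>,
  \<open>decreasing_kern_convergent\<close>).

  A supersolution is a multiple of \<open>p\<^sub>t \<integral>\<^bsub>[t,T]\<^esub> exp (-(\<theta> + \<tau> + 2 L) (s - t)) ds\<close> with \<open>p\<close> decreasing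
  exponentially in \<open>t\<close> (\<open>supersolution_exists\<close>). For large \<open>L\<close> its double integral against
  \<open>\<mu>\<close> is as small relative to \<open>p\<close> as desired, since \<open>\<integral> (\<theta> + L) powr (-1/2) |\<mu>|(d\<theta>)\<close> tends to \<open>0\<close>. This
  is where the moment condition on \<open>\<mu>\<close> is used in full strength.

  For uniqueness, let \<open>\<Gamma>'\<close> be any solution and \<open>\<Gamma>\<close> the one constructed. Both have coercive
  \<open>N\<close>-matrices, so that the difference of the nonlinearities at \<open>(\<theta>,\<tau>)\<close> is at most a constant times
  \<open>\<delta> + a(\<theta>) + a(\<tau>) + a(\<theta>) a(\<tau>)\<close>, with \<open>a(\<theta>)\<close> a multiple of \<open>\<integral> |\<Gamma>' - \<Gamma>|(\<tau>,\<theta>) |\<mu>|(d\<tau>)\<close> and \<open>\<delta>\<close>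
  a multiple of the \<open>L\<^sup>1\<close> distance (\<open>Rgen_diff_AE\<close>). Integrating this against
  \<open>exp (-(\<theta> + \<tau>) u)\<close> bounds the distance at time \<open>t\<close> by the integral over \<open>s \<in> [t,T]\<close> of the distance at time
  \<open>s\<close> times \<open>1 + k(s - t)\<^sup>2\<close>, where \<open>k\<close> is the Laplace transform of \<open>|\<mu>|\<close>. By the moment condition
  \<open>k\<^sup>2\<close> is integrable near \<open>0\<close>, and a Gronwall argument shows that the distance vanishes
  (\<open>gronwall\<close>, \<open>mild_solution_unique\<close>).
\<close>

section \<open>Total variation and polar density\<close>

definition variation :: "(real set \<Rightarrow> 'a::euclidean_space) \<Rightarrow> real set \<Rightarrow> ennreal" where
  "variation \<mu> E = (SUP P\<in>{P :: nat \<Rightarrow> real set. range P \<subseteq> bounded_borel \<and> disjoint_family P \<and> (\<Union>n. P n) = E}.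
            \<Sum>n. ennreal (norm (\<mu> (P n))))"

abbreviation half_line_borel :: "real set set" where
  "half_line_borel \<equiv> sets (restrict_space borel {0..})"

lemma half_line_borel_iff: "E \<in> half_line_borel \<longleftrightarrow> E \<in> sets borel \<and> E \<subseteq> {0..}"
  by (subst sets_restrict_space_iff) auto

lemma bounded_borel_subset: "A \<in> bounded_borel \<Longrightarrow> B \<in> sets borel \<Longrightarrow> B \<subseteq> A \<Longrightarrow> B \<in> bounded_borel"
  unfolding bounded_borel_def using bounded_subset by blast

lemma empty_bounded_borel [simp]: "{} \<in> bounded_borel"
  by (simp add: bounded_borel_def)

lemma ennreal_norm_sums_le:
  fixes x :: "nat \<Rightarrow> 'a::real_normed_vector"
  assumes "x sums l"
  shows "ennreal (norm l) \<le> (\<Sum>n. ennreal (norm (x n)))"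
proof (rule LIMSEQ_le_const2)
  show "(\<lambda>n. ennreal (norm (\<Sum>i<n. x i))) \<longlonglongrightarrow> ennreal (norm l)"
    using assms unfolding sums_def by (intro tendsto_intros) 
  show "\<exists>N. \<forall>n\<ge>N. ennreal (norm (\<Sum>i<n. x i)) \<le> (\<Sum>n. ennreal (norm (x n)))"
  proof (intro exI allI impI)
    fix n :: nat
    have "ennreal (norm (\<Sum>i<n. x i)) \<le> ennreal (\<Sum>i<n. norm (x i))"
      by (intro ennreal_leI norm_sum)
    also have "\<dots> = (\<Sum>i<n. ennreal (norm (x i)))"
      by (subst sum_ennreal) auto
    also have "\<dots> \<le> (\<Sum>n. ennreal (norm (x n)))"
      by (intro sum_le_suminf) auto
    finally show "ennreal (norm (\<Sum>i<n. x i)) \<le> (\<Sum>n. ennreal (norm (x n)))" .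
  qed
qed

lemma ennreal_suminf_swap:
  fixes f :: "nat \<Rightarrow> nat \<Rightarrow> ennreal"
  shows "(\<Sum>i. \<Sum>j. f i j) = (\<Sum>j. \<Sum>i. f i j)"
proof -
  have "(\<Sum>i. \<Sum>j. f i j) = (\<Sum>i. \<integral>\<^sup>+j. f i j \<partial>count_space UNIV)"
    by (simp add: nn_integral_count_space_nat)
  also have "\<dots> = (\<integral>\<^sup>+j. (\<Sum>i. f i j) \<partial>count_space UNIV)"
    by (subst nn_integral_suminf) auto
  also have "\<dots> = (\<Sum>j. \<Sum>i. f i j)"
    by (simp add: nn_integral_count_space_nat)
  finally show ?thesis .
qed

context
  fixes \<mu> :: "real set \<Rightarrow> 'a::euclidean_space"
  assumes \<mu>: "signed_measure \<mu>"
begin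

lemma signed_measure_sums:
  assumes "range A \<subseteq> bounded_borel" "disjoint_family A" "bounded (\<Union>n. A n)"
  shows "(\<lambda>n. \<mu> (A n)) sums \<mu> (\<Union>n. A n)"
  using \<mu> assms unfolding signed_measure_def by blast

lemma signed_measure_empty [simp]: "\<mu> {} = 0"
proof -
  have "(\<lambda>n::nat. \<mu> {}) sums \<mu> (\<Union>n::nat. {})"
    by (rule signed_measure_sums) (auto simp: disjoint_family_on_def)
  then have "(\<lambda>n::nat. \<mu> {}) \<longlonglongrightarrow> 0"
    by (auto simp: sums_iff intro: summable_LIMSEQ_zero)
  then show ?thesis
    by (simp add: LIMSEQ_const_iff)
qed

lemma half_line_partition:
  assumes "E \<in> half_line_borel"
  shows "\<exists>P::nat \<Rightarrow> real set. range P \<subseteq> bounded_borel \<and> disjoint_family P \<and> (\<Union>n. P n) = E"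
proof (intro exI conjI)
  let ?P = "\<lambda>n::nat. E \<inter> {real n..<real n + 1}"
  show "range ?P \<subseteq> bounded_borel"
    using assms by (auto simp: bounded_borel_def half_line_borel_iff)
  show "disjoint_family ?P"
    unfolding disjoint_family_on_def
  proof (intro ballI impI)
    fix m n :: nat assume "m \<noteq> n"
    then have "real m + 1 \<le> real n \<or> real n + 1 \<le> real m" by linarith
    then show "?P m \<inter> ?P n = {}" by auto
  qed
  show "(\<Union>n. ?P n) = E"
  proof
    show "E \<subseteq> (\<Union>n. ?P n)"
    proof
      fix x assume "x \<in> E"
      then have "0 \<le> x" using assms by (auto simp: half_line_borel_iff)
      then have "x \<in> ?P (nat \<lfloor>x\<rfloor>)" using \<open>x \<in> E\<close> by (auto simp: of_nat_nat)
      then show "x \<in> (\<Union>n. ?P n)" by blast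
    qed
  qed auto
qed

lemma variation_ge:
  assumes "range P \<subseteq> bounded_borel" "disjoint_family P" "(\<Union>n. P n) = E"
  shows "(\<Sum>n. ennreal (norm (\<mu> (P n)))) \<le> variation \<mu> E"
  unfolding variation_def using assms by (intro SUP_upper) auto

lemma norm_le_variation:
  assumes "A \<in> bounded_borel"
  shows "ennreal (norm (\<mu> A)) \<le> variation \<mu> A"
proof -
  let ?P = "\<lambda>n::nat. if n = 0 then A else {}"
  have "ennreal (norm (\<mu> A)) = (\<Sum>n\<in>{0::nat}. ennreal (norm (\<mu> (?P n))))" by simp
  also have "\<dots> \<le> (\<Sum>n. ennreal (norm (\<mu> (?P n))))"
    by (rule sum_le_suminf) (rule summableI, simp_all)
  also have "\<dots> \<le> variation \<mu> A"
  proof (rule variation_ge)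
    show "range ?P \<subseteq> bounded_borel" using assms by (simp add: image_subset_iff)
    show "disjoint_family ?P" by (simp add: disjoint_family_on_def)
    have "x \<in> ?P 0" if "x \<in> A" for x using that by simp
    then show "(\<Union>n. ?P n) = A" by (auto split: if_splits)
  qed
  finally show ?thesis .
qed

text \<open>
  A partition of \<open>A\<close> and a partition of \<open>B\<close> interleave to a partition of \<open>A \<union> B\<close>.
\<close>

lemma variation_add_le:
  assumes "A \<in> half_line_borel" "B \<in> half_line_borel" "A \<inter> B = {}"
  shows "variation \<mu> A + variation \<mu> B \<le> variation \<mu> (A \<union> B)"
proof -
  define part where "part E = {P :: nat \<Rightarrow> real set. range P \<subseteq> bounded_borel \<and> disjoint_family P \<and> (\<Union>n. P n) = E}" for E
  define s where "s P = (\<Sum>n. ennreal (norm (\<mu> (P n))))" for P :: "nat \<Rightarrow> real set"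
  have var: "variation \<mu> E = (SUP P\<in>part E. s P)" for E
    unfolding variation_def part_def s_def ..
  have ne: "part A \<noteq> {}" "part B \<noteq> {}"
    using half_line_partition[OF assms(1)] half_line_partition[OF assms(2)] unfolding part_def by blast+
  have "s p + s q \<le> variation \<mu> (A \<union> B)" if pq: "p \<in> part A" "q \<in> part B" for p q
  proof -
    define r where "r n = (if even n then p (n div 2) else q (n div 2))" for n
    have r0: "r (2 * n) = p n" "r (Suc (2 * n)) = q n" "r (n * 2) = p n" "r (Suc (n * 2)) = q n" for n
      by (simp_all add: r_def)
    have rr: "r i \<inter> r j = {}" if "i \<noteq> j" for i j
    proof -
      have d: "p (i div 2) \<inter> p (j div 2) = {}" if "even i" "even j"
      proof -
        have "i div 2 \<noteq> j div 2" using that \<open>i \<noteq> j\<close> by presburger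
        then show ?thesis using pq(1) unfolding part_def disjoint_family_on_def by simp
      qed
      have d': "q (i div 2) \<inter> q (j div 2) = {}" if "odd i" "odd j"
      proof -
        have "i div 2 \<noteq> j div 2" using that \<open>i \<noteq> j\<close> by presburger
        then show ?thesis using pq(2) unfolding part_def disjoint_family_on_def by simp
      qed
      have pq0: "p m \<inter> q n = {}" for m n
        using pq assms(3) unfolding part_def by blast
      then have qp0: "q m \<inter> p n = {}" for m n
        by (metis Int_commute)
      show ?thesis using d d' pq0 qp0 unfolding r_def by simp
    qed
    have "range r \<subseteq> bounded_borel"
      using pq unfolding part_def r_def by auto
    moreover have "disjoint_family r" using rr unfolding disjoint_family_on_def by blast
    moreover have "(\<Union>n. r n) = A \<union> B"
    proof
      show "(\<Union>n. r n) \<subseteq> A \<union> B" using pq unfolding part_def r_def by auto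
      have "A = (\<Union>n. r (2 * n))" "B = (\<Union>n. r (Suc (2 * n)))"
        using pq unfolding part_def r0 by simp_all
      then show "A \<union> B \<subseteq> (\<Union>n. r n)" by blast
    qed
    ultimately have "s r \<le> variation \<mu> (A \<union> B)"
      unfolding s_def by (rule variation_ge)
    moreover have "s p + s q \<le> s r"
    proof -
      have eq: "(\<Sum>i<n. ennreal (norm (\<mu> (p i))) + ennreal (norm (\<mu> (q i)))) = (\<Sum>i<2*n. ennreal (norm (\<mu> (r i))))" for n
        by (induction n) (simp_all add: r0 ac_simps)
      have "s p + s q = (\<Sum>i. ennreal (norm (\<mu> (p i))) + ennreal (norm (\<mu> (q i))))"
        unfolding s_def by (rule suminf_add) auto
      also have "\<dots> \<le> s r"
      proof (rule suminf_le_const)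
        fix n
        show "(\<Sum>i<n. ennreal (norm (\<mu> (p i))) + ennreal (norm (\<mu> (q i)))) \<le> s r"
          unfolding eq s_def by (rule sum_le_suminf) auto
      qed simp
      finally show ?thesis .
    qed
    ultimately show ?thesis by order
  qed
  then have "variation \<mu> A + s q \<le> variation \<mu> (A \<union> B)" if "q \<in> part B" for q
    unfolding var[of A] ennreal_SUP_add_left[OF ne(1), symmetric] using that by (intro SUP_least) auto
  then show ?thesis
    unfolding var[of B] ennreal_SUP_add_right[OF ne(2)] by (intro SUP_least) auto
qed

lemma variation_mono:
  assumes "A \<in> half_line_borel" "B \<in> half_line_borel" "A \<subseteq> B"
  shows "variation \<mu> A \<le> variation \<mu> B"
proof -
  have "variation \<mu> A \<le> variation \<mu> A + variation \<mu> (B - A)" by simp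
  also have "\<dots> \<le> variation \<mu> (A \<union> (B - A))"
    using assms by (intro variation_add_le) auto
  also have "A \<union> (B - A) = B" using assms by auto
  finally show ?thesis .
qed

lemma variation_empty [simp]: "variation \<mu> {} = 0"
  unfolding variation_def
  by (intro antisym SUP_least) (auto simp: image_subset_iff)

text \<open>
  One inequality is superadditivity. For the other, a partition of the union is refined by the sets
  \<open>E n\<close>; by the \<open>\<sigma>\<close>-additivity of \<open>\<mu>\<close> and the triangle inequality a refinement can only increase
  the sum of the norms.
\<close>

lemma variation_countably_additive: "countably_additive half_line_borel (variation \<mu>)"
proof (rule countably_additiveI)
  fix E :: "nat \<Rightarrow> real set"
  assume E: "range E \<subseteq> half_line_borel" "disjoint_family E" "(\<Union>n. E n) \<in> half_line_borel"
  show "(\<Sum>n. variation \<mu> (E n)) = variation \<mu> (\<Union>n. E n)"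
  proof (rule antisym)
    show "(\<Sum>n. variation \<mu> (E n)) \<le> variation \<mu> (\<Union>n. E n)"
    proof (rule suminf_le_const)
      fix n
      have "(\<Sum>i<n. variation \<mu> (E i)) \<le> variation \<mu> (\<Union>i<n. E i)"
      proof (induction n)
        case (Suc n)
        have "(\<Sum>i<Suc n. variation \<mu> (E i)) \<le> variation \<mu> (\<Union>i<n. E i) + variation \<mu> (E n)"
          using Suc by (simp add: add_right_mono)
        also have "\<dots> \<le> variation \<mu> ((\<Union>i<n. E i) \<union> E n)"
        proof (rule variation_add_le)
          show "(\<Union>i<n. E i) \<in> half_line_borel" using E(1) by (intro sets.finite_UN) auto
          show "E n \<in> half_line_borel" using E(1) by auto
          have "E i \<inter> E n = {}" if "i < n" for i
            using E(2) that unfolding disjoint_family_on_def by simp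
          then show "(\<Union>i<n. E i) \<inter> E n = {}" by blast
        qed
        also have "(\<Union>i<n. E i) \<union> E n = (\<Union>i<Suc n. E i)" by (auto simp: lessThan_Suc)
        finally show ?case .
      qed simp
      also have "\<dots> \<le> variation \<mu> (\<Union>n. E n)"
      proof (rule variation_mono)
        show "(\<Union>i<n. E i) \<in> half_line_borel" using E(1) by (intro sets.finite_UN) auto
      qed (use E(3) in auto)
      finally show "(\<Sum>i<n. variation \<mu> (E i)) \<le> variation \<mu> (\<Union>n. E n)" .
    qed simp
  next
    show "variation \<mu> (\<Union>n. E n) \<le> (\<Sum>n. variation \<mu> (E n))"
      unfolding variation_def[of _ "\<Union>n. E n"]
    proof (rule SUP_least, clarify)
      fix P :: "nat \<Rightarrow> real set"
      assume P: "range P \<subseteq> bounded_borel" "disjoint_family P" "(\<Union>n. P n) = (\<Union>n. E n)"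
      have Pb: "P k \<in> bounded_borel" for k using P(1) by auto
      have PE: "P k \<inter> E n \<in> bounded_borel" for k n
        by (rule bounded_borel_subset[OF Pb[of k]])
          (use E(1) Pb[of k] in \<open>auto simp: half_line_borel_iff bounded_borel_def image_subset_iff\<close>)
      have "ennreal (norm (\<mu> (P k))) \<le> (\<Sum>n. ennreal (norm (\<mu> (P k \<inter> E n))))" for k
      proof -
        have un: "(\<Union>n. P k \<inter> E n) = P k" using P(3) by blast
        have "(\<lambda>n. \<mu> (P k \<inter> E n)) sums \<mu> (\<Union>n. P k \<inter> E n)"
        proof (rule signed_measure_sums)
          show "range (\<lambda>n. P k \<inter> E n) \<subseteq> bounded_borel" using PE by auto
          show "disjoint_family (\<lambda>n. P k \<inter> E n)" using E(2) unfolding disjoint_family_on_def by blast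
          show "bounded (\<Union>n. P k \<inter> E n)" using Pb[of k] unfolding un by (simp add: bounded_borel_def)
        qed
        then show ?thesis unfolding un by (rule ennreal_norm_sums_le)
      qed
      then have "(\<Sum>k. ennreal (norm (\<mu> (P k)))) \<le> (\<Sum>k. \<Sum>n. ennreal (norm (\<mu> (P k \<inter> E n))))"
        by (intro suminf_le) auto
      also have "\<dots> = (\<Sum>n. \<Sum>k. ennreal (norm (\<mu> (P k \<inter> E n))))"
        by (rule ennreal_suminf_swap)
      also have "\<dots> \<le> (\<Sum>n. variation \<mu> (E n))"
      proof (intro suminf_le variation_ge)
        fix n
        show "range (\<lambda>k. P k \<inter> E n) \<subseteq> bounded_borel" using PE by auto
        show "disjoint_family (\<lambda>k. P k \<inter> E n)" using P(2) unfolding disjoint_family_on_def by blast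
        show "(\<Union>k. P k \<inter> E n) = E n" using P(3) by blast
      qed auto
      finally show "(\<Sum>k. ennreal (norm (\<mu> (P k)))) \<le> (\<Sum>n. variation \<mu> (E n))" .
    qed
  qed
qed

end

lemma space_total_variation [simp]: "space (total_variation \<mu>) = {0..}"
  and sets_total_variation [measurable_cong]: "sets (total_variation \<mu>) = half_line_borel"
proof -
  interpret sigma_algebra "{0..} :: real set" half_line_borel
    using sets.sigma_algebra_axioms[of "restrict_space borel ({0..}::real set)"] by simp
  show "space (total_variation \<mu>) = {0..}" "sets (total_variation \<mu>) = half_line_borel"
    unfolding total_variation_def by simp_all
qed

lemma emeasure_total_variation:
  assumes "signed_measure \<mu>" "E \<in> half_line_borel"
  shows "emeasure (total_variation \<mu>) E = variation \<mu> E"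
proof (rule emeasure_measure_of)
  show "total_variation \<mu> = measure_of {0..} half_line_borel (variation \<mu>)"
    unfolding total_variation_def variation_def ..
  show "half_line_borel \<subseteq> Pow {0..}"
    by (auto simp: half_line_borel_iff)
  show "positive (sets (total_variation \<mu>)) (variation \<mu>)"
    using variation_empty[OF assms(1)] by (simp add: positive_def)
  show "countably_additive (sets (total_variation \<mu>)) (variation \<mu>)"
    unfolding sets_total_variation by (rule variation_countably_additive[OF assms(1)])
  show "E \<in> sets (total_variation \<mu>)"
    unfolding sets_total_variation by (rule assms(2))
qed

lemma bounded_borel_half_line: "A \<in> bounded_borel \<Longrightarrow> A \<in> half_line_borel"
  unfolding half_line_borel_iff bounded_borel_def by blast

lemma bounded_borel_sets_total_variation: "A \<in> bounded_borel \<Longrightarrow> A \<in> sets (total_variation \<mu>)"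
  unfolding sets_total_variation by (rule bounded_borel_half_line)

lemma norm_signed_measure_le:
  assumes "signed_measure \<mu>" "A \<in> bounded_borel"
  shows "ennreal (norm (\<mu> A)) \<le> emeasure (total_variation \<mu>) A"
  using norm_le_variation[OF assms] 
  unfolding emeasure_total_variation[OF assms(1) bounded_borel_half_line[OF assms(2)]] .

text \<open>
  The integral over the set where \<open>f\<close> is negative is both nonpositive and nonnegative.
\<close>

lemma AE_nonneg_if_set_integrals_nonneg:
  fixes f :: "'a \<Rightarrow> real"
  assumes f: "set_integrable M I f" and I: "I \<in> sets M"
    and nn: "\<And>A. A \<in> sets M \<Longrightarrow> A \<subseteq> I \<Longrightarrow> 0 \<le> (LINT x:A|M. f x)"
  shows "AE x in M. x \<in> I \<longrightarrow> 0 \<le> f x"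
proof -
  define g where "g x = indicator I x * f x" for x
  have g: "integrable M g" using f unfolding set_integrable_def g_def by simp
  then have [measurable]: "g \<in> borel_measurable M" by simp
  define A where "A = {x\<in>space M. g x < 0}"
  have A: "A \<in> sets M" unfolding A_def by measurable
  have AI: "A \<subseteq> I" unfolding A_def g_def by (auto simp: indicator_def split: if_splits)
  have eq: "indicator A x * f x = indicator A x * g x" for x
    using AI by (auto simp: indicator_def g_def)
  have i: "integrable M (\<lambda>x. - (indicator A x * g x))"
    using integrable_real_mult_indicator[OF A g] by (simp add: mult.commute)
  have n: "0 \<le> - (indicator A x * g x)" for x by (auto simp: A_def indicator_def)
  have "0 \<le> (\<integral>x. indicator A x * g x \<partial>M)"
    using nn[OF A AI] by (simp add: set_lebesgue_integral_def eq)
  moreover have "0 \<le> (\<integral>x. - (indicator A x * g x) \<partial>M)" using n by (intro integral_nonneg_AE) auto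
  ultimately have "(\<integral>x. - (indicator A x * g x) \<partial>M) = 0" by simp
  then have "AE x in M. - (indicator A x * g x) = 0"
    using integral_nonneg_eq_0_iff_AE[OF i] n by auto
  then show ?thesis
  proof eventually_elim
    case (elim x)
    show ?case
    proof (cases "x \<in> space M")
      case True
      then show ?thesis using elim by (auto simp: indicator_def A_def g_def split: if_splits) 
    next
      case False
      then show ?thesis using I sets.sets_into_space by blast
    qed
  qed
qed

locale locally_finite_signed_measure =
  fixes \<mu> :: "real set \<Rightarrow> 'a::euclidean_space"
  assumes signed: "signed_measure \<mu>"
    and locally_finite: "\<And>R. emeasure (total_variation \<mu>) {0..R} < \<infinity>"
begin

abbreviation tv :: "real measure" where "tv \<equiv> total_variation \<mu>"

lemma interval_bounded_borel: "{0..R} \<in> bounded_borel"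
  by (simp add: bounded_borel_def)

lemma tv_finite: "A \<in> bounded_borel \<Longrightarrow> emeasure tv A < \<infinity>"
proof -
  assume A: "A \<in> bounded_borel"
  then obtain R where "A \<subseteq> {0..R}"
    by (auto simp: bounded_borel_def bounded_real subset_iff) (metis abs_le_D1)
  then have "emeasure tv A \<le> emeasure tv {0..R}"
    by (intro emeasure_mono bounded_borel_sets_total_variation interval_bounded_borel)
  then show ?thesis using locally_finite[of R] by order
qed

lemma sigma_finite_tv: "sigma_finite_measure tv"
proof (rule sigma_finite_measure.intro, intro exI conjI)
  let ?A = "range (\<lambda>n::nat. {0..real n})"
  show "countable ?A" by simp
  show "?A \<subseteq> sets tv"
    using interval_bounded_borel bounded_borel_sets_total_variation by blast
  show "\<Union> ?A = space tv" unfolding space_total_variation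
    using real_arch_simple by fastforce
  show "\<forall>a\<in>?A. emeasure tv a \<noteq> \<infinity>" using locally_finite by (metis imageE less_irrefl)
qed

sublocale tv: sigma_finite_measure tv by (rule sigma_finite_tv)

lemma emeasure_tv_eq: "A \<in> bounded_borel \<Longrightarrow> emeasure tv A = ennreal (measure tv A)"
  using tv_finite by (intro emeasure_eq_ennreal_measure) (auto simp: less_top)

lemma norm_\<mu>_le: "A \<in> bounded_borel \<Longrightarrow> norm (\<mu> A) \<le> measure tv A"
  using norm_signed_measure_le[OF signed, of A] emeasure_tv_eq[of A] by simp

lemma inner_\<mu>_le: 
  assumes "A \<in> bounded_borel" "norm b \<le> 1"
  shows "\<bar>\<mu> A \<bullet> b\<bar> \<le> measure tv A"
proof -
  have "\<bar>\<mu> A \<bullet> b\<bar> \<le> norm (\<mu> A) * norm b" by (rule Cauchy_Schwarz_ineq2)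
  also have "\<dots> \<le> norm (\<mu> A) * 1" using assms by (intro mult_left_mono) auto
  finally show ?thesis using norm_\<mu>_le[OF assms(1)] by simp
qed

text \<open>
  The Radon--Nikodym theorem does not apply to \<open>\<mu>\<close> itself, which is neither positive nor defined on
  unbounded sets. But \<open>A \<mapsto> \<mu> A \<bullet> b + |\<mu>|(A)\<close> lies between \<open>0\<close> and \<open>2 |\<mu>|(A)\<close> on bounded sets, so it
  extends to a measure that is absolutely continuous with respect to \<open>|\<mu>|\<close>. Its density exceeds the
  one sought by \<open>1\<close>.
\<close>

lemma polar_component_exists:
  assumes b: "norm b \<le> 1"
  shows "\<exists>f\<in>borel_measurable tv. \<forall>A\<in>bounded_borel.
           set_integrable tv A f \<and> \<mu> A \<bullet> b = (LINT \<theta>:A|tv. (f \<theta> :: real))"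
proof -
  define I where "I n = {real n..<real n + 1}" for n
  have I: "I n \<in> bounded_borel" for n by (auto simp: bounded_borel_def I_def)
  have dI: "disjoint_family I"
    unfolding disjoint_family_on_def I_def
  proof (intro ballI impI)
    fix m n :: nat assume "m \<noteq> n"
    then have "real m + 1 \<le> real n \<or> real n + 1 \<le> real m" by linarith
    then show "{real m..<real m + 1} \<inter> {real n..<real n + 1} = {}" by auto
  qed
  have UI: "(\<Union>n. A \<inter> I n) = A" if "A \<subseteq> {0..}" for A
  proof
    show "A \<subseteq> (\<Union>n. A \<inter> I n)"
    proof
      fix x assume "x \<in> A"
      then have "0 \<le> x" using that by auto
      then have "x \<in> A \<inter> I (nat \<lfloor>x\<rfloor>)" using \<open>x \<in> A\<close> by (auto simp: I_def of_nat_nat)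
      then show "x \<in> (\<Union>n. A \<inter> I n)" by blast
    qed
  qed auto
  define \<nu> where "\<nu> A = \<mu> A \<bullet> b + measure tv A" for A
  have \<nu>0: "0 \<le> \<nu> A" and \<nu>2: "\<nu> A \<le> 2 * measure tv A" if "A \<in> bounded_borel" for A
    using inner_\<mu>_le[OF that b] by (auto simp: \<nu>_def)
  have \<nu>_sums: "(\<Sum>n. ennreal (\<nu> (A n))) = ennreal (\<nu> (\<Union>n. A n))"
    if A: "range A \<subseteq> bounded_borel" "disjoint_family A" "(\<Union>n. A n) \<in> bounded_borel" for A :: "nat \<Rightarrow> real set"
  proof (rule suminf_ennreal_eq)
    show "0 \<le> \<nu> (A i)" for i using A by (intro \<nu>0) auto
    have "(\<lambda>n. \<mu> (A n)) sums \<mu> (\<Union>n. A n)"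
      using A by (intro signed_measure_sums[OF signed]) (auto simp: bounded_borel_def)
    then have "(\<lambda>n. \<mu> (A n) \<bullet> b) sums (\<mu> (\<Union>n. A n) \<bullet> b)"
      by (rule bounded_linear.sums[OF bounded_linear_inner_left])
    moreover have "(\<lambda>n. measure tv (A n)) sums measure tv (\<Union>n. A n)"
    proof (rule measure_UNION)
      show "range A \<subseteq> sets tv" using A(1) bounded_borel_sets_total_variation by blast
      show "emeasure tv (\<Union>n. A n) \<noteq> \<infinity>" using tv_finite[OF A(3)] by simp
    qed (rule A(2))
    ultimately show "(\<lambda>i. \<nu> (A i)) sums \<nu> (\<Union>n. A n)"
      unfolding \<nu>_def by (rule sums_add)
  qed
  define n where "n A = (\<Sum>k. ennreal (\<nu> (A \<inter> I k)))" for A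
  define N where "N = measure_of {0..} half_line_borel n"
  interpret S: sigma_algebra "{0..} :: real set" half_line_borel
    using sets.sigma_algebra_axioms[of "restrict_space borel ({0..}::real set)"] by simp
  have setsN: "sets N = sets tv" unfolding N_def sets_total_variation by simp
  have cut: "A \<inter> I k \<in> bounded_borel" if "A \<in> half_line_borel" for A k
    using that I[of k] by (auto simp: half_line_borel_iff bounded_borel_def intro: bounded_subset)
  have N: "emeasure N A = n A" if "A \<in> half_line_borel" for A
  proof (rule emeasure_measure_of[OF N_def])
    show "half_line_borel \<subseteq> Pow {0..}" by (auto simp: half_line_borel_iff)
    show "positive (sets N) n" by (simp add: positive_def n_def \<nu>_def signed_measure_empty[OF signed])
    show "A \<in> sets N" using that unfolding setsN sets_total_variation .
    show "countably_additive (sets N) n"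
      unfolding setsN sets_total_variation
    proof (rule countably_additiveI)
      fix A :: "nat \<Rightarrow> real set"
      assume A: "range A \<subseteq> half_line_borel" "disjoint_family A" "(\<Union>i. A i) \<in> half_line_borel"
      have "(\<Sum>i. n (A i)) = (\<Sum>k. \<Sum>i. ennreal (\<nu> (A i \<inter> I k)))"
        unfolding n_def by (rule ennreal_suminf_swap)
      also have "\<dots> = (\<Sum>k. ennreal (\<nu> (\<Union>i. A i \<inter> I k)))"
      proof (rule suminf_cong, rule \<nu>_sums)
        fix k
        show "range (\<lambda>i. A i \<inter> I k) \<subseteq> bounded_borel" using A(1) cut by auto
        show "disjoint_family (\<lambda>i. A i \<inter> I k)" using A(2) unfolding disjoint_family_on_def by blast
        show "(\<Union>i. A i \<inter> I k) \<in> bounded_borel" using cut[OF A(3), of k] by (simp add: Int_commute)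
      qed
      also have "\<dots> = n (\<Union>i. A i)" unfolding n_def by (simp add: Int_commute)
      finally show "(\<Sum>i. n (A i)) = n (\<Union>i. A i)" .
    qed
  qed
  have nb: "n A = ennreal (\<nu> A)" if "A \<in> bounded_borel" for A
  proof -
    have A: "A \<in> half_line_borel" using that by (auto simp: bounded_borel_def half_line_borel_iff)
    have un: "(\<Union>k. A \<inter> I k) = A" using A by (intro UI) (auto simp: half_line_borel_iff)
    have "n A = ennreal (\<nu> (\<Union>k. A \<inter> I k))"
      unfolding n_def using cut[OF A] that dI unfolding un
      by (intro \<nu>_sums[of "\<lambda>k. A \<inter> I k", unfolded un]) (auto simp: disjoint_family_on_def)
    then show ?thesis unfolding un .
  qed
  have ac: "absolutely_continuous tv N"
    unfolding absolutely_continuous_def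
  proof
    fix A assume A: "A \<in> null_sets tv"
    then have A': "A \<in> half_line_borel" by (simp add: null_sets_def sets_total_variation)
    have "\<nu> (A \<inter> I k) \<le> 0" for k
    proof -
      have "A \<inter> I k \<in> null_sets tv"
        using A bounded_borel_sets_total_variation[OF I, of k] by (intro null_set_Int2)
      then show ?thesis using \<nu>2[OF cut[OF A', of k]] by (simp add: measure_def null_sets_def)
    qed
    then have "n A = 0" unfolding n_def by (simp add: ennreal_neg)
    then show "A \<in> null_sets N" using N[OF A'] A' by (simp add: null_sets_def setsN sets_total_variation)
  qed
  obtain g where g[measurable]: "g \<in> borel_measurable tv" and gN: "density tv g = N"
    using tv.Radon_Nikodym[OF ac setsN] by auto
  have gA: "(\<integral>\<^sup>+x. g x * indicator A x \<partial>tv) = ennreal (\<nu> A)" if "A \<in> bounded_borel" for A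
    using emeasure_density[OF g, of A] gN N[of A] nb[OF that] that
    by (simp add: sets_total_variation half_line_borel_iff bounded_borel_def)
  have gfin: "AE x in tv. x \<in> A \<longrightarrow> g x \<noteq> \<infinity>" if "A \<in> bounded_borel" for A
  proof -
    have [measurable]: "A \<in> sets tv" using that by (rule bounded_borel_sets_total_variation)
    have "AE x in tv. g x * indicator A x \<noteq> \<infinity>"
      using gA[OF that] by (intro nn_integral_PInf_AE) auto
    then show ?thesis by eventually_elim (auto simp: indicator_def)
  qed
  let ?f = "\<lambda>x. enn2real (g x) - 1"
  show ?thesis
  proof (intro bexI ballI conjI)
    show "?f \<in> borel_measurable tv" by measurable
    fix A assume A: "A \<in> bounded_borel"
    have [measurable]: "A \<in> sets tv" using A by (rule bounded_borel_sets_total_variation)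
    have hb: "has_bochner_integral tv (\<lambda>x. indicator A x * enn2real (g x)) (\<nu> A)"
    proof (rule has_bochner_integral_nn_integral)
      have "(\<integral>\<^sup>+x. ennreal (indicator A x * enn2real (g x)) \<partial>tv) = (\<integral>\<^sup>+x. g x * indicator A x \<partial>tv)"
        using gfin[OF A] by (intro nn_integral_cong_AE) (auto simp: indicator_def less_top)
      then show "(\<integral>\<^sup>+x. ennreal (indicator A x * enn2real (g x)) \<partial>tv) = ennreal (\<nu> A)"
        using gA[OF A] by simp
      show "0 \<le> \<nu> A" by (rule \<nu>0[OF A])
    qed (auto simp: indicator_def)
    have ind: "has_bochner_integral tv (\<lambda>x. indicator A x :: real) (measure tv A)"
      using tv_finite[OF A] by (intro has_bochner_integral_real_indicator) auto
    have hb2: "has_bochner_integral tv (\<lambda>x. indicator A x *\<^sub>R ?f x) (\<nu> A - measure tv A)"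
      using has_bochner_integral_diff[OF hb ind] by (simp add: algebra_simps)
    show "set_integrable tv A ?f"
      using hb2 unfolding set_integrable_def by (rule integrable.intros)
    show "\<mu> A \<bullet> b = (LINT \<theta>:A|tv. ?f \<theta>)"
      using has_bochner_integral_integral_eq[OF hb2] unfolding set_lebesgue_integral_def \<nu>_def by simp
  qed
qed

lemma
  shows polar_density_measurable [measurable]: "polar_density \<mu> \<in> borel_measurable tv"
    and polar_density_set_integrable: "A \<in> bounded_borel \<Longrightarrow> set_integrable tv A (polar_density \<mu>)"
    and set_integral_polar_density: "A \<in> bounded_borel \<Longrightarrow> \<mu> A = (LINT \<theta>:A|tv. polar_density \<mu> \<theta>)"
proof -
  have "\<exists>h. h \<in> borel_measurable tv \<and>
     (\<forall>A\<in>bounded_borel. set_integrable tv A h \<and> \<mu> A = (LINT \<theta>:A|tv. h \<theta>))"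
  proof -
    obtain f where f: "\<And>b. b \<in> Basis \<Longrightarrow> f b \<in> borel_measurable tv \<and> (\<forall>A\<in>bounded_borel.
           set_integrable tv A (f b) \<and> \<mu> A \<bullet> b = (LINT \<theta>:A|tv. (f b \<theta> :: real)))"
      using polar_component_exists norm_Basis by (metis order_refl)
    let ?h = "\<lambda>x. \<Sum>b\<in>Basis. f b x *\<^sub>R b"
    have [measurable]: "?h \<in> borel_measurable tv"
      using f by (intro borel_measurable_sum borel_measurable_scaleR) auto
    moreover have "set_integrable tv A ?h \<and> \<mu> A = (LINT \<theta>:A|tv. ?h \<theta>)" if A: "A \<in> bounded_borel" for A
    proof -
      have i: "integrable tv (\<lambda>x. (indicator A x *\<^sub>R f b x) *\<^sub>R b)" if "b \<in> Basis" for b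
        using f[OF that] A unfolding set_integrable_def by (intro integrable_scaleR_left) auto
      have eq: "indicator A x *\<^sub>R ?h x = (\<Sum>b\<in>Basis. (indicator A x *\<^sub>R f b x) *\<^sub>R b)" for x
        by (simp add: scaleR_right.sum)
      have "set_integrable tv A ?h"
        unfolding set_integrable_def eq by (intro Bochner_Integration.integrable_sum i)
      moreover have "(LINT \<theta>:A|tv. ?h \<theta>) = (\<Sum>b\<in>Basis. (LINT \<theta>:A|tv. f b \<theta>) *\<^sub>R b)"
        unfolding set_lebesgue_integral_def eq using i f A
        by (subst Bochner_Integration.integral_sum) (auto simp: set_integrable_def intro!: sum.cong integral_scaleR_left)
      moreover have "\<dots> = (\<Sum>b\<in>Basis. (\<mu> A \<bullet> b) *\<^sub>R b)"
        using f A by (intro sum.cong) auto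
      ultimately show ?thesis by (simp add: euclidean_representation)
    qed
    ultimately show ?thesis by blast
  qed
  from someI_ex[OF this]
  show "polar_density \<mu> \<in> borel_measurable tv" 
    and "A \<in> bounded_borel \<Longrightarrow> set_integrable tv A (polar_density \<mu>)"
    and "A \<in> bounded_borel \<Longrightarrow> \<mu> A = (LINT \<theta>:A|tv. polar_density \<mu> \<theta>)"
    unfolding polar_density_def[symmetric] by blast+
qed

lemma polar_density_inner_le:
  assumes b: "norm b \<le> 1"
  shows "AE \<theta> in tv. polar_density \<mu> \<theta> \<bullet> b \<le> 1"
proof -
  have "AE \<theta> in tv. \<theta> \<in> {0..real n} \<longrightarrow> 0 \<le> 1 - polar_density \<mu> \<theta> \<bullet> b" for n
  proof (rule AE_nonneg_if_set_integrals_nonneg)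
    let ?I = "{0..real n}"
    have I: "?I \<in> bounded_borel" by (auto simp: bounded_borel_def)
    show "?I \<in> sets tv" using I by (rule bounded_borel_sets_total_variation)
    have si: "set_integrable tv A (\<lambda>\<theta>. 1 - polar_density \<mu> \<theta> \<bullet> b)"
      and eq: "(LINT \<theta>:A|tv. 1 - polar_density \<mu> \<theta> \<bullet> b) = measure tv A - \<mu> A \<bullet> b"
      if A: "A \<in> bounded_borel" for A
    proof -
      have ind: "has_bochner_integral tv (\<lambda>x. indicator A x :: real) (measure tv A)"
        using tv_finite[OF A] bounded_borel_sets_total_variation[OF A]
        by (intro has_bochner_integral_real_indicator) auto
      have h: "has_bochner_integral tv (\<lambda>x. indicator A x *\<^sub>R polar_density \<mu> x) (\<mu> A)"
        using polar_density_set_integrable[OF A] set_integral_polar_density[OF A]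
        unfolding has_bochner_integral_iff set_integrable_def set_lebesgue_integral_def by simp
      have "has_bochner_integral tv (\<lambda>x. indicator A x *\<^sub>R (1 - polar_density \<mu> x \<bullet> b)) (measure tv A - \<mu> A \<bullet> b)"
        using has_bochner_integral_diff[OF ind has_bochner_integral_inner_left[OF h, of b]] 
        by (simp add: algebra_simps)
      then show "set_integrable tv A (\<lambda>\<theta>. 1 - polar_density \<mu> \<theta> \<bullet> b)" 
        "(LINT \<theta>:A|tv. 1 - polar_density \<mu> \<theta> \<bullet> b) = measure tv A - \<mu> A \<bullet> b"
        unfolding has_bochner_integral_iff set_integrable_def set_lebesgue_integral_def by auto
    qed
    show "set_integrable tv ?I (\<lambda>\<theta>. 1 - polar_density \<mu> \<theta> \<bullet> b)" by (rule si[OF I])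
    fix A assume "A \<in> sets tv" "A \<subseteq> ?I"
    then have A: "A \<in> bounded_borel"
      by (intro bounded_borel_subset[OF I]) (auto simp: sets_total_variation half_line_borel_iff)
    show "0 \<le> (LINT \<theta>:A|tv. 1 - polar_density \<mu> \<theta> \<bullet> b)"
      unfolding eq[OF A] using inner_\<mu>_le[OF A b] by simp
  qed
  then have "AE \<theta> in tv. \<forall>n. \<theta> \<in> {0..real n} \<longrightarrow> 0 \<le> 1 - polar_density \<mu> \<theta> \<bullet> b"
    unfolding AE_all_countable by blast
  then show ?thesis using AE_space
  proof eventually_elim
    case (elim \<theta>)
    then show ?case using real_arch_simple[of \<theta>] by auto
  qed
qed

text \<open>
  Components are bounded by \<open>1\<close> because \<open>\<bar>\<mu> A \<bullet> b\<bar> \<le> |\<mu>|(A)\<close> for all \<open>A\<close>; passing from components to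
  the norm costs the dimension.
\<close>

lemma norm_polar_density_le: "AE \<theta> in tv. norm (polar_density \<mu> \<theta>) \<le> real DIM('a)"
proof -
  have "AE \<theta> in tv. \<bar>polar_density \<mu> \<theta> \<bullet> b\<bar> \<le> 1" if "b \<in> Basis" for b
    using polar_density_inner_le[of b] polar_density_inner_le[of "- b"] that
    by (auto elim!: eventually_elim2)
  then have "AE \<theta> in tv. \<forall>b\<in>Basis. \<bar>polar_density \<mu> \<theta> \<bullet> b\<bar> \<le> 1"
    by (intro AE_finite_allI) auto
  then show ?thesis
  proof eventually_elim
    case (elim \<theta>)
    have "norm (polar_density \<mu> \<theta>) \<le> (\<Sum>b\<in>Basis. \<bar>polar_density \<mu> \<theta> \<bullet> b\<bar>)" by (rule norm_le_l1)
    also have "\<dots> \<le> (\<Sum>b\<in>(Basis::'a set). 1)" using elim by (intro sum_mono) auto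
    finally show ?case by simp
  qed
qed

end

section \<open>Matrices\<close>

lemma norm_matrix_vector_mult_le: "norm (A *v x) \<le> norm A * norm x" for A :: "real^'n^'m"
proof -
  have "norm (A *v x) = L2_set (\<lambda>i. \<bar>A $ i \<bullet> x\<bar>) UNIV"
    by (simp add: norm_vec_def matrix_vector_mult_def inner_vec_def)
  also have "\<dots> \<le> L2_set (\<lambda>i. norm (A $ i) * norm x) UNIV"
    by (intro L2_set_mono) (auto simp: Cauchy_Schwarz_ineq2)
  also have "\<dots> = norm A * norm x"
    by (simp add: norm_vec_def[of A] L2_set_left_distrib)
  finally show ?thesis .
qed

lemma norm_transpose [simp]: "norm (transpose A) = norm A" for A :: "real^'n^'m"
proof -
  have sq: "(norm B)\<^sup>2 = (\<Sum>i\<in>UNIV. \<Sum>j\<in>UNIV. (B $ i $ j)\<^sup>2)" for B :: "real^'p^'q"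
    by (simp add: norm_vec_def L2_set_def sum_nonneg)
  have "(norm (transpose A))\<^sup>2 = (norm A)\<^sup>2"
    unfolding sq by (subst sum.swap) (simp add: transpose_def)
  then show ?thesis by simp
qed

lemma matrix_mult_row: "(A ** B) $ i = transpose B *v (A $ i)" for A :: "real^'n^'m" and B :: "real^'p^'n"
  by (simp add: matrix_matrix_mult_def matrix_vector_mult_def transpose_def vec_eq_iff mult.commute)

lemma norm_matrix_mult_le: "norm (A ** B) \<le> norm A * norm B" for A :: "real^'n^'m" and B :: "real^'p^'n"
proof -
  have le: "norm (transpose B *v y) \<le> norm y * norm B" for y
    using norm_matrix_vector_mult_le[of "transpose B" y] unfolding norm_transpose by (simp only: mult.commute)
  have "norm (A ** B) = L2_set (\<lambda>i. norm (transpose B *v (A $ i))) UNIV"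
    by (simp add: norm_vec_def[of "A ** B"] matrix_mult_row)
  also have "\<dots> \<le> L2_set (\<lambda>i. norm (A $ i) * norm B) UNIV"
    by (intro L2_set_mono le norm_ge_zero)
  also have "\<dots> = norm A * norm B"
    by (simp add: norm_vec_def[of A] L2_set_left_distrib)
  finally show ?thesis .
qed

lemma bounded_bilinear_matrix_mult: "bounded_bilinear ((**) :: real^'n^'m \<Rightarrow> real^'p^'n \<Rightarrow> real^'p^'m)"
proof (rule bounded_bilinear.intro)
  show "\<exists>K. \<forall>(a::real^'n^'m) (b::real^'p^'n). norm (a ** b) \<le> norm a * norm b * K"
    using norm_matrix_mult_le by (intro exI[of _ 1]) auto
qed (simp_all add: matrix_matrix_mult_def vec_eq_iff sum_distrib_left mult.assoc mult.left_commute
      algebra_simps sum.distrib)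

lemma bounded_bilinear_matrix_vector: "bounded_bilinear ((*v) :: real^'n^'m \<Rightarrow> real^'n \<Rightarrow> real^'m)"
proof (rule bounded_bilinear.intro)
  show "\<exists>K. \<forall>(a::real^'n^'m) b. norm (a *v b) \<le> norm a * norm b * K"
    using norm_matrix_vector_mult_le by (intro exI[of _ 1]) auto
qed (simp_all add: matrix_vector_mult_def vec_eq_iff sum_distrib_left mult.assoc mult.left_commute
      algebra_simps sum.distrib)

lemmas matrix_mult_diff_left = bounded_bilinear.diff_left[OF bounded_bilinear_matrix_mult]
  and matrix_mult_diff_right = bounded_bilinear.diff_right[OF bounded_bilinear_matrix_mult]
  and matrix_mult_zero_left = bounded_bilinear.zero_left[OF bounded_bilinear_matrix_mult]
  and bounded_linear_matrix_mult_left = bounded_bilinear.bounded_linear_left[OF bounded_bilinear_matrix_mult]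
  and bounded_linear_matrix_vector_left = bounded_bilinear.bounded_linear_left[OF bounded_bilinear_matrix_vector]
  and bounded_linear_matrix_vector_right = bounded_bilinear.bounded_linear_right[OF bounded_bilinear_matrix_vector]

lemma
  fixes A B :: "real^'n^'m"
  shows transpose_add: "transpose (A + B) = transpose A + transpose B"
    and transpose_diff: "transpose (A - B) = transpose A - transpose B"
    and transpose_scaleR: "transpose (c *\<^sub>R A) = c *\<^sub>R transpose A"
  by (simp_all add: transpose_def vec_eq_iff)

lemma bounded_linear_transpose: "bounded_linear (transpose :: real^'n^'m \<Rightarrow> real^'m^'n)"
  by (rule bounded_linear_intro[of _ 1]) (simp_all add: transpose_add transpose_scaleR)

lemma borel_measurable_matrix_mult [measurable (raw)]:
  assumes "f \<in> borel_measurable M" "g \<in> borel_measurable M"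
  shows "(\<lambda>x. (f x :: real^'n^'m) ** (g x :: real^'p^'n)) \<in> borel_measurable M"
  by (rule borel_measurable_continuous_Pair[OF assms])
     (intro bounded_bilinear.continuous_on[OF bounded_bilinear_matrix_mult] continuous_intros)

lemma borel_measurable_matrix_vector [measurable (raw)]:
  assumes "f \<in> borel_measurable M" "g \<in> borel_measurable M"
  shows "(\<lambda>x. (f x :: real^'n^'m) *v (g x :: real^'n)) \<in> borel_measurable M"
  by (rule borel_measurable_continuous_Pair[OF assms])
     (intro bounded_bilinear.continuous_on[OF bounded_bilinear_matrix_vector] continuous_intros)

lemma borel_measurable_transpose [measurable (raw)]:
  assumes "f \<in> borel_measurable M"
  shows "(\<lambda>x. transpose (f x :: real^'n^'m)) \<in> borel_measurable M"
  using assms by (intro borel_measurable_continuous_on[OF linear_continuous_on[OF bounded_linear_transpose]]) auto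

lemma borel_measurable_vec_nth' [measurable (raw)]:
  assumes "f \<in> borel_measurable M"
  shows "(\<lambda>x. (f x :: 'a::euclidean_space^'n) $ i) \<in> borel_measurable M"
  using assms by (intro borel_measurable_continuous_on[OF linear_continuous_on[OF bounded_linear_vec_nth]]) auto

lemma tendsto_matrix_mult:
  "(f \<longlongrightarrow> A) F \<Longrightarrow> (g \<longlongrightarrow> B) F \<Longrightarrow> ((\<lambda>x. (f x :: real^'n^'m) ** (g x :: real^'p^'n)) \<longlongrightarrow> A ** B) F"
  by (rule bounded_bilinear.tendsto[OF bounded_bilinear_matrix_mult])

lemma tendsto_transpose:
  "(f \<longlongrightarrow> A) F \<Longrightarrow> ((\<lambda>x. transpose (f x :: real^'n^'m)) \<longlongrightarrow> transpose A) F"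
  by (rule bounded_linear.tendsto[OF bounded_linear_transpose])

lemma tendsto_matrix_vector:
  "(f \<longlongrightarrow> A) F \<Longrightarrow> (g \<longlongrightarrow> B) F \<Longrightarrow> ((\<lambda>x. (f x :: real^'n^'m) *v (g x :: real^'n)) \<longlongrightarrow> A *v B) F"
  by (rule bounded_bilinear.tendsto[OF bounded_bilinear_matrix_vector])

text \<open>
  Cramer's rule gives a formula for the inverse that is Borel on all matrices and continuous
  on the invertible ones.
\<close>

definition cramer_inv :: "real^'n^'n \<Rightarrow> real^'n^'n" where
  "cramer_inv A = (\<chi> k j. det (\<chi> i l. if l = k then (if i = j then 1 else 0) else A $ i $ l) / det A)"

lemma
  fixes A :: "real^'n^'n"
  assumes "invertible A"
  shows matrix_inv_right: "A ** matrix_inv A = mat 1" and matrix_inv_left: "matrix_inv A ** A = mat 1"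
  using someI_ex[OF assms[unfolded invertible_def]] unfolding matrix_inv_def by auto

lemma matrix_inv_eq_cramer:
  assumes "invertible A"
  shows "matrix_inv A = cramer_inv A"
proof -
  have d: "det A \<noteq> 0" using assms by (simp add: invertible_det_nz)
  have 1: "matrix_inv A *v axis j 1 = (\<chi> k. det (\<chi> i l. if l = k then axis j 1 $ i else A $ i $ l) / det A)" for j
    unfolding cramer[OF d, symmetric] using matrix_inv_right[OF assms] by (simp add: matrix_vector_mul_assoc)
  have 2: "(matrix_inv A *v axis j 1) $ k = matrix_inv A $ k $ j" for j k
    by (simp add: matrix_vector_mult_basis column_def)
  have ax: "axis j (1::real) $ i = (if i = j then 1 else 0)" for i j by (simp add: axis_def)
  have "matrix_inv A $ k $ j = cramer_inv A $ k $ j" for j k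
    unfolding 2[symmetric] 1 cramer_inv_def by (simp only: vec_lambda_beta ax)
  then show ?thesis by (simp only: vec_eq_iff simp_thms)
qed

lemma borel_measurable_det [measurable (raw)]:
  assumes [measurable]: "f \<in> borel_measurable M"
  shows "(\<lambda>x. det (f x :: real^'n^'n)) \<in> borel_measurable M"
  unfolding det_def by measurable

lemma borel_measurable_vec_lambda' [measurable (raw)]:
  assumes "\<And>i. (\<lambda>x. f x i) \<in> borel_measurable M"
  shows "(\<lambda>x. (\<chi> i. f x i) :: 'a::euclidean_space^'n) \<in> borel_measurable M"
proof (rule borel_measurable_euclidean_space[THEN iffD2], rule ballI)
  fix b :: "'a^'n" assume "b \<in> Basis"
  then obtain i u where b: "b = axis i u" "u \<in> Basis" by (auto simp: Basis_vec_def)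
  show "(\<lambda>x. (\<chi> i. f x i) \<bullet> b) \<in> borel_measurable M"
    using assms[of i] unfolding b by (simp add: inner_axis)
qed

lemma borel_measurable_cramer_inv [measurable (raw)]:
  assumes [measurable]: "f \<in> borel_measurable M"
  shows "(\<lambda>x. cramer_inv (f x :: real^'n^'n)) \<in> borel_measurable M"
proof -
  have [measurable]: "(\<lambda>x. (if P then a else f x $ i $ l) :: real) \<in> borel_measurable M" for P a i l
    by (cases P) auto
  show ?thesis
    unfolding cramer_inv_def by measurable
qed

lemma tendsto_vec_lambda:
  assumes "\<And>i. ((\<lambda>x. f x i) \<longlongrightarrow> l i) F"
  shows "((\<lambda>x. (\<chi> i. f x i)) \<longlongrightarrow> (\<chi> i. l i)) F"
  using assms by (intro vec_tendstoI) simp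

lemma tendsto_det:
  assumes "(f \<longlongrightarrow> A) F"
  shows "((\<lambda>x. det (f x :: real^'n^'n)) \<longlongrightarrow> det A) F"
  unfolding det_def by (intro tendsto_intros assms)

lemma tendsto_cramer_inv:
  assumes f: "(f \<longlongrightarrow> A) F" and A: "invertible A"
  shows "((\<lambda>x. cramer_inv (f x :: real^'n^'n)) \<longlongrightarrow> cramer_inv A) F"
proof -
  have c: "((\<lambda>x. if P then a else f x $ i $ l) \<longlongrightarrow> (if P then a else A $ i $ l)) F" for P a i l
    by (cases P) (auto intro!: tendsto_intros f)
  show ?thesis
    unfolding cramer_inv_def using A
    by (intro tendsto_vec_lambda tendsto_divide tendsto_det c f) (simp add: invertible_det_nz)
qed

lemma coercive_invertible:
  fixes A :: "real^'n^'n"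
  assumes "l > 0" and co: "\<And>x. l * (x \<bullet> x) \<le> x \<bullet> (A *v x)"
  shows "invertible A"
proof -
  have "x = 0" if "A *v x = 0" for x
  proof -
    have "x \<bullet> x \<le> 0" using co[of x] that \<open>l > 0\<close> by (simp add: mult_le_0_iff)
    then show ?thesis by (metis inner_gt_zero_iff not_le)
  qed
  then show ?thesis
    using invertible_left_inverse matrix_left_invertible_ker by blast
qed

text \<open>
  Coercivity bounds the operator norm of the inverse by \<open>1 / l\<close>; the dimensional factor comes from the
  comparison with the Frobenius norm, entry by entry.
\<close>

lemma norm_inv_coercive_le:
  fixes A :: "real^'n^'n"
  assumes "l > 0" and co: "\<And>x. l * (x \<bullet> x) \<le> x \<bullet> (A *v x)"
  shows "norm (matrix_inv A) \<le> (real CARD('n))\<^sup>2 / l"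
proof -
  have inv: "invertible A" by (rule coercive_invertible[OF assms])
  have le: "norm (matrix_inv A *v y) \<le> norm y / l" for y
  proof -
    define x where "x = matrix_inv A *v y"
    have y: "A *v x = y" unfolding x_def using matrix_inv_right[OF inv] by (simp add: matrix_vector_mul_assoc)
    have "l * (norm x)\<^sup>2 \<le> norm x * norm y"
      using co[of x] norm_cauchy_schwarz[of x y] by (simp add: y power2_norm_eq_inner)
    then have "l * norm x \<le> norm y"
      by (cases "x = 0") (auto simp: power2_eq_square mult.assoc mult.left_commute)
    then show ?thesis unfolding x_def using \<open>l > 0\<close> by (simp add: field_simps)
  qed
  have e: "\<bar>matrix_inv A $ i $ j\<bar> \<le> 1 / l" for i j
  proof -
    have "\<bar>matrix_inv A $ i $ j\<bar> = \<bar>(matrix_inv A *v axis j 1) $ i\<bar>"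
      by (simp add: matrix_vector_mult_basis column_def)
    also have "\<dots> \<le> norm (matrix_inv A *v axis j 1)" by (rule component_le_norm_cart)
    also have "\<dots> \<le> 1 / l" using le[of "axis j 1"] by (simp add: norm_axis_1)
    finally show ?thesis .
  qed
  have "norm (matrix_inv A) \<le> (\<Sum>i\<in>UNIV. norm (matrix_inv A $ i))" 
    unfolding norm_vec_def[of "matrix_inv A"] by (rule L2_set_le_sum) simp
  also have "\<dots> \<le> (\<Sum>i\<in>(UNIV::'n set). \<Sum>j\<in>(UNIV::'n set). \<bar>matrix_inv A $ i $ j\<bar>)"
    by (intro sum_mono norm_le_l1_cart)
  also have "\<dots> \<le> (\<Sum>i\<in>(UNIV::'n set). \<Sum>j\<in>(UNIV::'n set). 1 / l)"
    by (intro sum_mono e)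
  also have "\<dots> = (real CARD('n))\<^sup>2 / l" by (simp add: power2_eq_square)
  finally show ?thesis .
qed

section \<open>Adding atoms to a measure\<close>

text \<open>
  Unit point masses make quadratic forms sensitive to the values of a kernel at single points, in
  particular on the diagonal, which a measure without atoms does not see.
\<close>

definition add_atoms :: "'x measure \<Rightarrow> 'x set \<Rightarrow> 'x measure" where
  "add_atoms M A = measure_of (space M) (sets M) (\<lambda>E. emeasure M E + (\<Sum>a\<in>A. indicator E a))"

lemma space_add_atoms [simp]: "space (add_atoms M A) = space M"
  and sets_add_atoms [simp, measurable_cong]: "sets (add_atoms M A) = sets M"
  by (simp_all add: add_atoms_def)

lemma emeasure_add_atoms:
  assumes "E \<in> sets M" "finite A"
  shows "emeasure (add_atoms M A) E = emeasure M E + (\<Sum>a\<in>A. indicator E a)"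
proof (rule emeasure_measure_of[OF add_atoms_def])
  show "sets M \<subseteq> Pow (space M)" using sets.space_closed by blast
  show "positive (sets (add_atoms M A)) (\<lambda>E. emeasure M E + (\<Sum>a\<in>A. indicator E a))"
    by (simp add: positive_def)
  show "E \<in> sets (add_atoms M A)" using assms by simp
  show "countably_additive (sets (add_atoms M A)) (\<lambda>E. emeasure M E + (\<Sum>a\<in>A. indicator E a))"
    unfolding sets_add_atoms
  proof (rule countably_additiveI)
    fix E :: "nat \<Rightarrow> 'a set" assume E: "range E \<subseteq> sets M" "disjoint_family E" "(\<Union>i. E i) \<in> sets M"
    have 1: "(\<Sum>i. emeasure M (E i)) = emeasure M (\<Union>i. E i)"
      by (rule suminf_emeasure[OF E(1,2)])
    have 2: "(\<Sum>i. \<Sum>a\<in>A. indicator (E i) a :: ennreal) = (\<Sum>a\<in>A. indicator (\<Union>i. E i) a)"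
    proof -
      have "(\<Sum>i. \<Sum>a\<in>A. indicator (E i) a :: ennreal) = (\<Sum>a\<in>A. \<Sum>i. indicator (E i) a)"
        by (rule suminf_sum) simp
      also have "\<dots> = (\<Sum>a\<in>A. indicator (\<Union>i. E i) a)"
        by (intro sum.cong refl suminf_indicator E(2))
      finally show ?thesis .
    qed
    show "(\<Sum>i. emeasure M (E i) + (\<Sum>a\<in>A. indicator (E i) a)) = emeasure M (\<Union>i. E i) + (\<Sum>a\<in>A. indicator (\<Union>i. E i) a)"
      unfolding 1[symmetric] 2[symmetric] by (rule suminf_add[symmetric]) auto
  qed
qed

lemma nn_integral_add_atoms:
  assumes f: "f \<in> borel_measurable M" and A: "finite A" "A \<subseteq> space M"
  shows "(\<integral>\<^sup>+x. f x \<partial>add_atoms M A) = (\<integral>\<^sup>+x. f x \<partial>M) + (\<Sum>a\<in>A. f a)"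
  using f
proof (induction rule: borel_measurable_induct)
  case (cong f g)
  have 1: "(\<integral>\<^sup>+x. f x \<partial>add_atoms M A) = (\<integral>\<^sup>+x. g x \<partial>add_atoms M A)"
    and 2: "(\<integral>\<^sup>+x. f x \<partial>M) = (\<integral>\<^sup>+x. g x \<partial>M)"
    using cong(3) by (auto intro!: nn_integral_cong)
  have 3: "(\<Sum>a\<in>A. f a) = (\<Sum>a\<in>A. g a)" using cong(3) A(2) by (intro sum.cong) auto
  show ?case unfolding 1 2 3 by (rule cong.IH)
next
  case (set E)
  then show ?case using emeasure_add_atoms[OF set A(1)] by simp
next
  case (mult u c)
  then show ?case by (simp add: nn_integral_cmult distrib_left sum_distrib_left)
next
  case (add u v)
  then show ?case by (simp add: nn_integral_add sum.distrib ac_simps)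
next
  case (seq U)
  note [measurable] = seq(1)
  have inc: "incseq U" by fact
  have mono: "incseq (\<lambda>i. U i a)" for a using inc by (auto simp: incseq_def le_fun_def)
  have sum: "(SUP i. \<Sum>a\<in>A. U i a) = (\<Sum>a\<in>A. SUP i. U i a)"
    by (rule ennreal_SUP_sum) (rule mono)
  have eq: "(SUP i. U i) = (\<lambda>x. SUP i. U i x)" by (auto simp: fun_eq_iff image_comp)
  have "(\<integral>\<^sup>+x. (SUP i. U i x) \<partial>add_atoms M A) = (SUP i. \<integral>\<^sup>+x. U i x \<partial>add_atoms M A)"
    by (rule nn_integral_monotone_convergence_SUP[OF inc]) simp
  also have "\<dots> = (SUP i. (\<integral>\<^sup>+x. U i x \<partial>M) + (\<Sum>a\<in>A. U i a))"
    using seq by simp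
  also have "\<dots> = (SUP i. (\<integral>\<^sup>+x. U i x \<partial>M)) + (SUP i. \<Sum>a\<in>A. U i a)"
    using inc mono
    by (intro ennreal_SUP_add) (auto simp: incseq_def le_fun_def intro!: nn_integral_mono sum_mono)
  also have "\<dots> = (\<integral>\<^sup>+x. (SUP i. U i x) \<partial>M) + (\<Sum>a\<in>A. SUP i. U i a)"
    by (subst nn_integral_monotone_convergence_SUP[OF inc]) (simp_all add: sum)
  finally show ?case unfolding eq .
qed

lemma sigma_finite_add_atoms:
  assumes "sigma_finite_measure M" "finite A"
  shows "sigma_finite_measure (add_atoms M A)"
proof -
  interpret sigma_finite_measure M by fact
  obtain S where S: "countable S" "S \<subseteq> sets M" "\<Union>S = space M" "\<forall>a\<in>S. emeasure M a \<noteq> \<infinity>"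
    using sigma_finite_countable by blast
  show ?thesis
  proof (rule sigma_finite_measure.intro, intro exI conjI ballI)
    show "countable S" "S \<subseteq> sets (add_atoms M A)" "\<Union>S = space (add_atoms M A)" using S by auto
    fix a assume a: "a \<in> S"
    then have "emeasure (add_atoms M A) a = emeasure M a + (\<Sum>x\<in>A. indicator a x)"
      using S assms by (intro emeasure_add_atoms) auto
    moreover have "(\<Sum>x\<in>A. indicator a x :: ennreal) \<le> (\<Sum>x\<in>A. 1)"
      by (intro sum_mono) (auto simp: indicator_def)
    then have "(\<Sum>x\<in>A. indicator a x :: ennreal) \<noteq> \<infinity>"
      by (auto simp: top_unique) 
    ultimately show "emeasure (add_atoms M A) a \<noteq> \<infinity>"
      using S a by auto
  qed
qed

text \<open>
  A point of \<open>A\<close> whose mass in \<open>M\<close> is \<open>m\<close> has mass \<open>m + 1\<close> after the addition, so that the density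
  there has to be \<open>m / (m + 1)\<close>.
\<close>

lemma density_add_atoms:
  assumes sf: "sigma_finite_measure M" and A: "finite A" "A \<subseteq> space M"
    and sing: "\<And>a. a \<in> A \<Longrightarrow> {a} \<in> sets M"
  defines "\<rho> \<equiv> \<lambda>x. if x \<in> A then measure M {x} / (measure M {x} + 1) else 1"
  shows "\<rho> \<in> borel_measurable M" "M = density (add_atoms M A) (\<lambda>x. ennreal (\<rho> x))"
    "0 \<le> \<rho> x" "\<rho> x \<le> 1"
proof -
  interpret sigma_finite_measure M by fact
  have fin: "emeasure M {a} = ennreal (measure M {a})" if "a \<in> A" for a
  proof -
    obtain S :: "nat \<Rightarrow> 'a set" where S: "range S \<subseteq> sets M" "(\<Union>i. S i) = space M" "\<And>i. emeasure M (S i) \<noteq> \<infinity>"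
      using sigma_finite by metis
    have "a \<in> (\<Union>i. S i)" using A that unfolding S(2) by auto
    then obtain i where i: "a \<in> S i" by auto
    have "emeasure M {a} \<le> emeasure M (S i)" using i S(1) by (intro emeasure_mono) auto
    then show ?thesis using S(3)[of i] by (intro emeasure_eq_ennreal_measure) (auto simp: top_unique)
  qed
  define k where "k a = 1 / (measure M {a} + 1)" for a
  have m0: "0 \<le> measure M {a}" for a by simp
  have k0: "0 \<le> k a" for a unfolding k_def using m0 by simp
  have rho: "\<rho> x = 1 - (\<Sum>a\<in>A. k a * indicator {a} x)" for x
  proof -
    have "(\<Sum>a\<in>A. k a * indicator {a} x) = (if x \<in> A then k x else 0)"
      using A(1) by (simp add: indicator_def if_distrib eq_commute cong: if_cong)
    moreover have "1 - k x = measure M {x} / (measure M {x} + 1)"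
    proof -
      have "measure M {x} + 1 \<noteq> 0" using m0[of x] by linarith
      then show ?thesis unfolding k_def by (simp add: field_simps)
    qed
    ultimately show ?thesis unfolding \<rho>_def by auto
  qed
  show [measurable]: "\<rho> \<in> borel_measurable M"
  proof -
    have "(\<lambda>x. 1 - (\<Sum>a\<in>A. k a * indicator {a} x)) \<in> borel_measurable M"
      using sing by (intro borel_measurable_diff borel_measurable_sum borel_measurable_times) auto
    then show ?thesis unfolding rho[symmetric] .
  qed
  show r0: "0 \<le> \<rho> x" "\<rho> x \<le> 1" for x 
  proof -
    have "0 < measure M {x} + 1" using m0[of x] by linarith
    then show "0 \<le> \<rho> x" "\<rho> x \<le> 1" unfolding \<rho>_def by (auto simp: divide_le_eq_1)
  qed
  show "M = density (add_atoms M A) (\<lambda>x. ennreal (\<rho> x))"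
  proof (rule measure_eqI)
    fix E assume E: "E \<in> sets M"
    have pw: "indicator E x = ennreal (\<rho> x) * indicator E x + (\<Sum>a\<in>A. ennreal (k a) * indicator ({a} \<inter> E) x)" for x
    proof -
      have "(\<Sum>a\<in>A. ennreal (k a) * indicator ({a} \<inter> E) x) = (\<Sum>a\<in>A. ennreal (k a * indicator {a} x)) * indicator E x"
        by (simp add: sum_distrib_right ennreal_mult k0 indicator_inter_arith mult.assoc ennreal_indicator)
      also have "(\<Sum>a\<in>A. ennreal (k a * indicator {a} x)) = ennreal (1 - \<rho> x)"
        unfolding rho by (simp add: sum_ennreal k0)
      finally show ?thesis
        using r0[of x] by (simp add: distrib_right[symmetric] ennreal_plus[symmetric] del: ennreal_plus)
    qed
    have "emeasure M E = (\<integral>\<^sup>+x. indicator E x \<partial>M)" using E by simp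
    also have "\<dots> = (\<integral>\<^sup>+x. ennreal (\<rho> x) * indicator E x + (\<Sum>a\<in>A. ennreal (k a) * indicator ({a} \<inter> E) x) \<partial>M)"
      by (intro nn_integral_cong pw)
    also have "\<dots> = (\<integral>\<^sup>+x. ennreal (\<rho> x) * indicator E x \<partial>M) + (\<Sum>a\<in>A. ennreal (k a) * emeasure M ({a} \<inter> E))"
      using E sing
      by (subst nn_integral_add) (auto simp: nn_integral_sum nn_integral_cmult_indicator intro!: borel_measurable_sum)
    also have "(\<Sum>a\<in>A. ennreal (k a) * emeasure M ({a} \<inter> E)) = (\<Sum>a\<in>A. ennreal (\<rho> a) * indicator E a)"
    proof (rule sum.cong)
      fix a assume a: "a \<in> A"
      have "ennreal (k a) * ennreal (measure M {a}) = ennreal (\<rho> a)"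
        using a k0[of a] by (simp add: ennreal_mult[symmetric] \<rho>_def k_def)
      then show "ennreal (k a) * emeasure M ({a} \<inter> E) = ennreal (\<rho> a) * indicator E a"
        using fin[OF a] by (cases "a \<in> E") auto
    qed simp
    also have "(\<integral>\<^sup>+x. ennreal (\<rho> x) * indicator E x \<partial>M) + (\<Sum>a\<in>A. ennreal (\<rho> a) * indicator E a)
        = (\<integral>\<^sup>+x. ennreal (\<rho> x) * indicator E x \<partial>add_atoms M A)"
      using E A by (intro nn_integral_add_atoms[symmetric]) auto
    also have "\<dots> = emeasure (density (add_atoms M A) (\<lambda>x. ennreal (\<rho> x))) E"
      using E by (subst emeasure_density) auto
    finally show "emeasure M E = emeasure (density (add_atoms M A) (\<lambda>x. ennreal (\<rho> x))) E" .
  qed simp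
qed

section \<open>Kernels as quadratic forms\<close>

lemma norm_integral_le:
  fixes f :: "'a \<Rightarrow> 'b::{banach, second_countable_topology}"
  assumes g: "integrable M g" and le: "AE x in M. norm (f x) \<le> g x"
  shows "norm (integral\<^sup>L M f) \<le> integral\<^sup>L M g"
proof (cases "integrable M f")
  case True
  then have "norm (integral\<^sup>L M f) \<le> (\<integral>x. norm (f x) \<partial>M)" by simp
  also have "\<dots> \<le> integral\<^sup>L M g" using True g le by (intro integral_mono_AE) auto
  finally show ?thesis .
next
  case False
  have "0 \<le> integral\<^sup>L M g"
    using le by (intro integral_nonneg_AE) (auto elim!: eventually_mono intro: order_trans[OF norm_ge_zero])
  then show ?thesis using False by (simp add: not_integrable_integral_eq)
qed

lemma (in pair_sigma_finite) integrable_times_fst_snd: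
  fixes f :: "'a \<Rightarrow> real" and g :: "'b \<Rightarrow> real"
  assumes f: "integrable M1 f" and g: "integrable M2 g"
  shows "integrable (M1 \<Otimes>\<^sub>M M2) (\<lambda>z. f (fst z) * g (snd z))"
proof (rule Fubini_integrable)
  show "(\<lambda>z. f (fst z) * g (snd z)) \<in> borel_measurable (M1 \<Otimes>\<^sub>M M2)" using f g by measurable
  show "integrable M1 (\<lambda>x. \<integral>y. norm (f (fst (x, y)) * g (snd (x, y))) \<partial>M2)"
    using f g by (simp add: abs_mult)
  show "AE x in M1. integrable M2 (\<lambda>y. f (fst (x, y)) * g (snd (x, y)))"
    using g by simp
qed

lemma (in pair_sigma_finite) integral_inner_fst_snd:
  fixes f :: "'a \<Rightarrow> real^'n" and g :: "'b \<Rightarrow> real^'m" and Z :: "real^'m^'n"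
  assumes f: "integrable M1 f" and g: "integrable M2 g"
  shows "integrable (M1 \<Otimes>\<^sub>M M2) (\<lambda>z. f (fst z) \<bullet> (Z *v g (snd z)))"
    and "(\<integral>z. f (fst z) \<bullet> (Z *v g (snd z)) \<partial>(M1 \<Otimes>\<^sub>M M2)) = (\<integral>x. f x \<partial>M1) \<bullet> (Z *v (\<integral>y. g y \<partial>M2))"
proof -
  note [measurable] = borel_measurable_integrable[OF f] borel_measurable_integrable[OF g]
  have gZ: "integrable M2 (\<lambda>y. Z *v g y)" "(\<integral>y. Z *v g y \<partial>M2) = Z *v (\<integral>y. g y \<partial>M2)"
    using g bounded_linear_matrix_vector_right
    by (auto intro: integrable_bounded_linear integral_bounded_linear)
  show i: "integrable (M1 \<Otimes>\<^sub>M M2) (\<lambda>z. f (fst z) \<bullet> (Z *v g (snd z)))"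
  proof (rule Bochner_Integration.integrable_bound)
    show "integrable (M1 \<Otimes>\<^sub>M M2) (\<lambda>z. norm (f (fst z)) * norm (Z *v g (snd z)))"
      using integrable_norm[OF f] integrable_norm[OF gZ(1)] by (rule integrable_times_fst_snd)
    show "(\<lambda>z. f (fst z) \<bullet> (Z *v g (snd z))) \<in> borel_measurable (M1 \<Otimes>\<^sub>M M2)" by measurable
    show "AE z in M1 \<Otimes>\<^sub>M M2. norm (f (fst z) \<bullet> (Z *v g (snd z))) \<le> norm (norm (f (fst z)) * norm (Z *v g (snd z)))"
      by (auto simp: Cauchy_Schwarz_ineq2)
  qed
  have "(\<integral>z. f (fst z) \<bullet> (Z *v g (snd z)) \<partial>(M1 \<Otimes>\<^sub>M M2)) = (\<integral>x. \<integral>y. f x \<bullet> (Z *v g y) \<partial>M2 \<partial>M1)"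
    using integral_fst'[OF i] by simp
  also have "\<dots> = (\<integral>x. f x \<bullet> (Z *v (\<integral>y. g y \<partial>M2)) \<partial>M1)"
    using gZ by simp
  also have "\<dots> = (\<integral>x. f x \<partial>M1) \<bullet> (Z *v (\<integral>y. g y \<partial>M2))"
    using f by simp
  finally show "(\<integral>z. f (fst z) \<bullet> (Z *v g (snd z)) \<partial>(M1 \<Otimes>\<^sub>M M2)) = (\<integral>x. f x \<partial>M1) \<bullet> (Z *v (\<integral>y. g y \<partial>M2))" .
qed

lemma abs_inner_matrix_le: "\<bar>x \<bullet> (A *v y)\<bar> \<le> norm x * (norm A * norm y)" for A :: "real^'n^'m"
  by (rule order_trans[OF Cauchy_Schwarz_ineq2])
     (intro mult_left_mono norm_matrix_vector_mult_le norm_ge_zero)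

text \<open>
  For \<open>s > 0\<close> this is \<open>min 1 (s powr (-1/2))\<close>, and \<open>weight 0 = 1\<close>.
\<close>

definition weight :: "real \<Rightarrow> real" where "weight s = 1 / sqrt (max 1 s)"

lemma weight_pos: "0 < weight s" and weight_le_1: "weight s \<le> 1"
  by (auto simp: weight_def real_le_rsqrt)

lemma weight_nonneg: "0 \<le> weight s" using weight_pos[of s] by simp

lemma borel_measurable_weight [measurable (raw)]:
  assumes [measurable]: "f \<in> borel_measurable M"
  shows "(\<lambda>x. weight (f x)) \<in> borel_measurable M"
  unfolding weight_def by measurable

text \<open>
  In the application \<open>M\<close> is \<open>|\<mu>|\<close> and the rate \<open>r\<close> is the identity of the half line.
\<close>

locale weighted_measure = sigma_finite_measure M for M :: "'x measure" +
  fixes r :: "'x \<Rightarrow> real"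
  assumes r_measurable [measurable]: "r \<in> borel_measurable M"
    and r_nonneg: "0 \<le> r x"
    and integrable_weight: "integrable M (\<lambda>x. weight (r x))"
    and singleton_sets: "a \<in> space M \<Longrightarrow> {a} \<in> sets M"
begin

abbreviation w :: "'x \<Rightarrow> real" where "w x \<equiv> weight (r x)"

sublocale MM: pair_sigma_finite M M ..

text \<open>
  The bound and the symmetry hold at every point and not just almost everywhere. The two weights are
  what integrating \<open>exp (- (r x + r y) * u)\<close> in time yields (lemma \<open>integral_exp_le\<close> below).
\<close>

definition kern :: "real \<Rightarrow> ('x \<Rightarrow> 'x \<Rightarrow> real^'d^'d) \<Rightarrow> bool" where
  "kern K \<Gamma> \<longleftrightarrow> (\<lambda>z. \<Gamma> (fst z) (snd z)) \<in> borel_measurable (M \<Otimes>\<^sub>M M) \<and>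
     (\<forall>x y. norm (\<Gamma> x y) \<le> K * w x * w y) \<and> (\<forall>x y. transpose (\<Gamma> y x) = \<Gamma> x y)"

definition form :: "'x measure \<Rightarrow> ('x \<Rightarrow> 'x \<Rightarrow> real^'d^'d) \<Rightarrow> ('x \<Rightarrow> real^'d) \<Rightarrow> ('x \<Rightarrow> real^'d) \<Rightarrow> real" where
  "form \<nu> \<Gamma> \<phi> \<psi> = (\<integral>z. \<phi> (fst z) \<bullet> (\<Gamma> (fst z) (snd z) *v \<psi> (snd z)) \<partial>(\<nu> \<Otimes>\<^sub>M \<nu>))"

lemma kern_measurable: "kern K \<Gamma> \<Longrightarrow> (\<lambda>z. \<Gamma> (fst z) (snd z)) \<in> borel_measurable (M \<Otimes>\<^sub>M M)"
  and kern_bound: "kern K \<Gamma> \<Longrightarrow> norm (\<Gamma> x y) \<le> K * w x * w y"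
  and kern_sym: "kern K \<Gamma> \<Longrightarrow> transpose (\<Gamma> y x) = \<Gamma> x y"
  by (auto simp: kern_def)

lemma kern_section_measurable:
  assumes "kern K \<Gamma>" "y \<in> space M"
  shows "(\<lambda>x. \<Gamma> x y) \<in> borel_measurable M" "(\<lambda>x. \<Gamma> y x) \<in> borel_measurable M"
proof -
  note [measurable] = kern_measurable[OF assms(1)]
  have "(\<lambda>x. (\<lambda>z. \<Gamma> (fst z) (snd z)) (x, y)) \<in> borel_measurable M"
    using assms(2) by measurable
  then show "(\<lambda>x. \<Gamma> x y) \<in> borel_measurable M" by simp
  have "(\<lambda>x. (\<lambda>z. \<Gamma> (fst z) (snd z)) (y, x)) \<in> borel_measurable M"
    using assms(2) by measurable
  then show "(\<lambda>x. \<Gamma> y x) \<in> borel_measurable M" by simp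
qed

lemma kern_nonneg: "kern K \<Gamma> \<Longrightarrow> 0 \<le> K"
proof -
  assume k: "kern K \<Gamma>"
  fix x :: 'x
  have "0 \<le> K * (w x * w x)" using kern_bound[OF k, of x x] norm_ge_zero[of "\<Gamma> x x"] by (simp add: mult.assoc del: norm_ge_zero)
  moreover have "0 < w x * w x" using weight_pos[of "r x"] by simp
  ultimately show "0 \<le> K" by (meson mult_neg_pos not_le)
qed

lemma kern_diff: 
  assumes "kern K \<Gamma>" "kern L \<Delta>"
  shows "kern (K + L) (\<lambda>x y. \<Gamma> x y - \<Delta> x y)"
  unfolding kern_def
proof (intro conjI allI)
  show "(\<lambda>z. \<Gamma> (fst z) (snd z) - \<Delta> (fst z) (snd z)) \<in> borel_measurable (M \<Otimes>\<^sub>M M)"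
    using assms by (intro borel_measurable_diff kern_measurable)
  show "norm (\<Gamma> x y - \<Delta> x y) \<le> (K + L) * w x * w y" for x y
    using norm_triangle_ineq4[of "\<Gamma> x y" "\<Delta> x y"] kern_bound[OF assms(1), of x y] kern_bound[OF assms(2), of x y]
    by (simp add: algebra_simps)
  show "transpose (\<Gamma> y x - \<Delta> y x) = \<Gamma> x y - \<Delta> x y" for x y
    using assms by (simp add: transpose_diff kern_sym)
qed

end

text \<open>
  The measure \<open>M\<close> is contained in \<open>\<nu>\<close> with a density \<open>\<rho> \<le> 1\<close>. Forms are tested against all such \<open>\<nu>\<close>.
\<close>

locale dominating_measure = weighted_measure M r for M :: "'x measure" and r +
  fixes \<nu> :: "'x measure" and \<rho> :: "'x \<Rightarrow> real"
  assumes sets_\<nu> [measurable_cong]: "sets \<nu> = sets M"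
    and sigma_finite_\<nu>: "sigma_finite_measure \<nu>"
    and integrable_weight_\<nu>: "integrable \<nu> (\<lambda>x. weight (r x))"
    and \<rho>_measurable [measurable]: "\<rho> \<in> borel_measurable M"
    and \<rho>_nonneg: "0 \<le> \<rho> x" and \<rho>_le_1: "\<rho> x \<le> 1"
    and M_eq_density: "M = density \<nu> (\<lambda>x. ennreal (\<rho> x))"
begin

sublocale nu: sigma_finite_measure \<nu> by (rule sigma_finite_\<nu>)
sublocale nu2: pair_sigma_finite \<nu> \<nu> ..

lemma space_\<nu>: "space \<nu> = space M" using sets_\<nu> by (rule sets_eq_imp_space_eq)

text \<open>
  The natural test functions for kernels with \<open>norm (\<Gamma> x y) \<le> K * w x * w y\<close>: the form converges
  absolutely on them.
\<close>

definition Lw :: "('x \<Rightarrow> real^'d) \<Rightarrow> bool" where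
  "Lw \<psi> \<longleftrightarrow> \<psi> \<in> borel_measurable M \<and> integrable \<nu> (\<lambda>x. w x * norm (\<psi> x))"

lemma Lw_measurable: "Lw \<psi> \<Longrightarrow> \<psi> \<in> borel_measurable M"
  by (simp add: Lw_def)

lemma integrable_Lw: "integrable \<nu> \<psi> \<Longrightarrow> Lw \<psi>"
  unfolding Lw_def
proof (intro conjI)
  assume i: "integrable \<nu> \<psi>"
  from borel_measurable_integrable[OF this] show [measurable]: "\<psi> \<in> borel_measurable M"
    by (simp cong: measurable_cong_sets add: measurable_cong_sets[OF sets_\<nu> refl])
  show "integrable \<nu> (\<lambda>x. w x * norm (\<psi> x))"
  proof (rule Bochner_Integration.integrable_bound[OF integrable_norm[OF i]])
    show "AE x in \<nu>. norm (w x * norm (\<psi> x)) \<le> norm (norm (\<psi> x))"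
      using weight_le_1 weight_nonneg by (intro always_eventually allI) (simp add: abs_mult mult_left_le_one_le)
  qed measurable
qed

lemma Lw_add: assumes "Lw \<phi>" "Lw \<psi>" shows "Lw (\<lambda>x. \<phi> x + \<psi> x)"
  unfolding Lw_def
proof (intro conjI)
  note [measurable] = Lw_measurable[OF assms(1)] Lw_measurable[OF assms(2)]
  show "(\<lambda>x. \<phi> x + \<psi> x) \<in> borel_measurable M" by measurable
  show "integrable \<nu> (\<lambda>x. w x * norm (\<phi> x + \<psi> x))"
  proof (rule Bochner_Integration.integrable_bound)
    show "integrable \<nu> (\<lambda>x. w x * norm (\<phi> x) + w x * norm (\<psi> x))"
      using assms by (auto simp: Lw_def)
    show "AE x in \<nu>. norm (w x * norm (\<phi> x + \<psi> x)) \<le> norm (w x * norm (\<phi> x) + w x * norm (\<psi> x))"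
      using weight_nonneg by (intro always_eventually allI)
        (simp add: abs_mult distrib_left[symmetric] mult_left_mono norm_triangle_ineq)
  qed measurable
qed

lemma Lw_scaleR: assumes "Lw \<psi>" shows "Lw (\<lambda>x. a *\<^sub>R \<psi> x)"
  using assms by (auto simp: Lw_def mult.left_commute)

lemma form_measurable:
  fixes \<Gamma> :: "'x \<Rightarrow> 'x \<Rightarrow> real^'d^'d"
  assumes "(\<lambda>z. \<Gamma> (fst z) (snd z)) \<in> borel_measurable (M \<Otimes>\<^sub>M M)" "\<phi> \<in> borel_measurable M" "\<psi> \<in> borel_measurable M"
  shows "(\<lambda>z. \<phi> (fst z) \<bullet> (\<Gamma> (fst z) (snd z) *v \<psi> (snd z))) \<in> borel_measurable (\<nu> \<Otimes>\<^sub>M \<nu>)"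
proof -
  have m: "\<phi> \<in> borel_measurable \<nu>" "\<psi> \<in> borel_measurable \<nu>"
    "(\<lambda>z. \<Gamma> (fst z) (snd z)) \<in> borel_measurable (\<nu> \<Otimes>\<^sub>M \<nu>)"
    using assms by (simp_all cong: measurable_cong_sets sets_pair_measure_cong
      add: measurable_cong_sets[OF sets_\<nu> refl] measurable_cong_sets[OF sets_pair_measure_cong[OF sets_\<nu> sets_\<nu>] refl])
  have "(\<lambda>z. \<phi> (fst z)) \<in> borel_measurable (\<nu> \<Otimes>\<^sub>M \<nu>)" "(\<lambda>z. \<psi> (snd z)) \<in> borel_measurable (\<nu> \<Otimes>\<^sub>M \<nu>)"
    using m(1,2) by measurable
  then show ?thesis
    by (intro borel_measurable_inner borel_measurable_matrix_vector m(3))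
qed

lemma form_integrable:
  assumes k: "kern K \<Gamma>" and f: "Lw \<phi>" and p: "Lw \<psi>"
  shows "integrable (\<nu> \<Otimes>\<^sub>M \<nu>) (\<lambda>z. \<phi> (fst z) \<bullet> (\<Gamma> (fst z) (snd z) *v \<psi> (snd z)))"
proof (rule Bochner_Integration.integrable_bound)
  show "integrable (\<nu> \<Otimes>\<^sub>M \<nu>) (\<lambda>z. K * ((w (fst z) * norm (\<phi> (fst z))) * (w (snd z) * norm (\<psi> (snd z)))))"
    using nu2.integrable_times_fst_snd[of "\<lambda>x. w x * norm (\<phi> x)" "\<lambda>x. w x * norm (\<psi> x)"] f p 
    unfolding Lw_def by (intro integrable_mult_right) auto
  show "(\<lambda>z. \<phi> (fst z) \<bullet> (\<Gamma> (fst z) (snd z) *v \<psi> (snd z))) \<in> borel_measurable (\<nu> \<Otimes>\<^sub>M \<nu>)"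
    by (intro form_measurable kern_measurable[OF k] Lw_measurable f p)
  show "AE z in \<nu> \<Otimes>\<^sub>M \<nu>. norm (\<phi> (fst z) \<bullet> (\<Gamma> (fst z) (snd z) *v \<psi> (snd z)))
         \<le> norm (K * ((w (fst z) * norm (\<phi> (fst z))) * (w (snd z) * norm (\<psi> (snd z)))))"
  proof (intro always_eventually allI)
    fix z :: "'x \<times> 'x"
    let ?x = "fst z" and ?y = "snd z"
    have "norm (\<phi> ?x \<bullet> (\<Gamma> ?x ?y *v \<psi> ?y)) \<le> norm (\<phi> ?x) * (norm (\<Gamma> ?x ?y) * norm (\<psi> ?y))"
      unfolding real_norm_def by (rule abs_inner_matrix_le)
    also have "\<dots> \<le> norm (\<phi> ?x) * ((K * w ?x * w ?y) * norm (\<psi> ?y))"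
      by (intro mult_left_mono mult_right_mono kern_bound[OF k]) auto
    also have "\<dots> = K * ((w ?x * norm (\<phi> ?x)) * (w ?y * norm (\<psi> ?y)))" by (simp add: ac_simps)
    also have "\<dots> \<le> norm \<dots>" by simp
    finally show "norm (\<phi> ?x \<bullet> (\<Gamma> ?x ?y *v \<psi> ?y)) \<le> norm (K * ((w ?x * norm (\<phi> ?x)) * (w ?y * norm (\<psi> ?y))))" .
  qed
qed

lemma form_sym:
  assumes k: "kern K \<Gamma>" and f: "\<phi> \<in> borel_measurable M" and p: "\<psi> \<in> borel_measurable M"
  shows "form \<nu> \<Gamma> \<phi> \<psi> = form \<nu> \<Gamma> \<psi> \<phi>"
proof -
  have "form \<nu> \<Gamma> \<phi> \<psi> = (\<integral>(x, y). \<phi> y \<bullet> (\<Gamma> y x *v \<psi> x) \<partial>(\<nu> \<Otimes>\<^sub>M \<nu>))"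
    unfolding form_def using nu2.integral_product_swap[OF form_measurable[OF kern_measurable[OF k] f p]]
    by (simp add: case_prod_beta)
  also have "\<dots> = form \<nu> \<Gamma> \<psi> \<phi>"
  proof -
    have "\<phi> y \<bullet> (\<Gamma> y x *v \<psi> x) = \<psi> x \<bullet> (\<Gamma> x y *v \<phi> y)" for x y
      using kern_sym[OF k, of y x] dot_lmul_matrix[of "\<phi> y" "\<Gamma> y x" "\<psi> x"]
      by (metis inner_commute transpose_matrix_vector)
    then show ?thesis unfolding form_def by (simp add: split_beta')
  qed
  finally show ?thesis .
qed

lemma form_add_scaleR:
  assumes k: "kern K \<Gamma>" and p: "Lw \<psi>" and x: "Lw \<eta>"
  shows "form \<nu> \<Gamma> (\<lambda>x. \<psi> x + a *\<^sub>R \<eta> x) (\<lambda>x. \<psi> x + a *\<^sub>R \<eta> x)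
    = form \<nu> \<Gamma> \<psi> \<psi> + 2 * a * form \<nu> \<Gamma> \<eta> \<psi> + a\<^sup>2 * form \<nu> \<Gamma> \<eta> \<eta>"
proof -
  have i: "integrable (\<nu> \<Otimes>\<^sub>M \<nu>) (\<lambda>z. \<phi> (fst z) \<bullet> (\<Gamma> (fst z) (snd z) *v \<phi>' (snd z)))" if "Lw \<phi>" "Lw \<phi>'" for \<phi> \<phi>'
    by (rule form_integrable[OF k that])
  have eq: "(\<psi> x + a *\<^sub>R \<eta> x) \<bullet> (G *v (\<psi> y + a *\<^sub>R \<eta> y)) = \<psi> x \<bullet> (G *v \<psi> y) + a * (\<psi> x \<bullet> (G *v \<eta> y))
      + a * (\<eta> x \<bullet> (G *v \<psi> y)) + a\<^sup>2 * (\<eta> x \<bullet> (G *v \<eta> y))" for x y and G :: "real^'a^'a"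
    by (simp add: matrix_vector_right_distrib inner_add_left inner_add_right matrix_vector_mult_scaleR power2_eq_square algebra_simps)
  have "form \<nu> \<Gamma> (\<lambda>x. \<psi> x + a *\<^sub>R \<eta> x) (\<lambda>x. \<psi> x + a *\<^sub>R \<eta> x)
    = form \<nu> \<Gamma> \<psi> \<psi> + a * form \<nu> \<Gamma> \<psi> \<eta> + a * form \<nu> \<Gamma> \<eta> \<psi> + a\<^sup>2 * form \<nu> \<Gamma> \<eta> \<eta>"
    unfolding form_def eq using i p x by simp
  then show ?thesis using form_sym[OF k Lw_measurable[OF p] Lw_measurable[OF x]] by simp
qed

lemma form_diff:
  assumes "kern K \<Gamma>" "kern L \<Delta>" "Lw \<phi>" "Lw \<psi>"
  shows "form \<nu> (\<lambda>x y. \<Gamma> x y - \<Delta> x y) \<phi> \<psi> = form \<nu> \<Gamma> \<phi> \<psi> - form \<nu> \<Delta> \<phi> \<psi>"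
  unfolding form_def
  using form_integrable[OF assms(1,3,4)] form_integrable[OF assms(2,3,4)]
  by (simp add: matrix_vector_mult_diff_rdistrib inner_diff_right)

lemma integral_M_eq:
  fixes f :: "'x \<Rightarrow> 'b::{banach, second_countable_topology}"
  assumes [measurable]: "f \<in> borel_measurable M"
  shows "integral\<^sup>L M f = (\<integral>x. \<rho> x *\<^sub>R f x \<partial>\<nu>)"
proof -
  have "integral\<^sup>L M f = integral\<^sup>L (density \<nu> (\<lambda>x. ennreal (\<rho> x))) f"
    by (subst M_eq_density) simp
  also have "\<dots> = (\<integral>x. \<rho> x *\<^sub>R f x \<partial>\<nu>)"
    using \<rho>_nonneg by (intro integral_density) auto
  finally show ?thesis .
qed

lemma AE_M_iff: "(AE x in M. P x) \<longleftrightarrow> (AE x in \<nu>. 0 < \<rho> x \<longrightarrow> P x)"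
proof -
  have "(AE x in M. P x) \<longleftrightarrow> (AE x in density \<nu> (\<lambda>x. ennreal (\<rho> x)). P x)"
    by (subst M_eq_density) simp
  also have "\<dots> \<longleftrightarrow> (AE x in \<nu>. 0 < \<rho> x \<longrightarrow> P x)"
    by (subst AE_density) auto
  finally show ?thesis .
qed

end

context weighted_measure begin

text \<open>
  The quantifier over \<open>\<nu>\<close> turns positivity into a statement about individual points; see
  \<open>pd_pointwise\<close>. There are two notions because the nonlinearity produces kernels that are bounded but
  do not decay. Their forms converge for integrable test functions only, which is what \<open>pd1\<close> asks
  for. Integration in time leads from \<open>pd1\<close> to \<open>pd\<close>; see \<open>J_pd\<close>.
\<close>

definition pd :: "('x \<Rightarrow> 'x \<Rightarrow> real^'d^'d) \<Rightarrow> bool" where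
  "pd \<Gamma> \<longleftrightarrow> (\<forall>\<nu> \<rho> \<psi>. dominating_measure M r \<nu> \<rho> \<longrightarrow> dominating_measure.Lw M r \<nu> \<psi> \<longrightarrow> 0 \<le> form \<nu> \<Gamma> \<psi> \<psi>)"

definition pd1 :: "('x \<Rightarrow> 'x \<Rightarrow> real^'d^'d) \<Rightarrow> bool" where
  "pd1 G \<longleftrightarrow> (\<forall>\<nu> \<rho> \<psi>. dominating_measure M r \<nu> \<rho> \<longrightarrow> integrable \<nu> \<psi> \<longrightarrow> 0 \<le> form \<nu> G \<psi> \<psi>)"

lemma pdD: "pd \<Gamma> \<Longrightarrow> dominating_measure M r \<nu> \<rho> \<Longrightarrow> dominating_measure.Lw M r \<nu> \<psi> \<Longrightarrow> 0 \<le> form \<nu> \<Gamma> \<psi> \<psi>"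
  unfolding pd_def by blast

lemma pd1D: "pd1 \<Gamma> \<Longrightarrow> dominating_measure M r \<nu> \<rho> \<Longrightarrow> integrable \<nu> \<psi> \<Longrightarrow> 0 \<le> form \<nu> \<Gamma> \<psi> \<psi>"
  unfolding pd1_def by blast

lemma dominating_self: "dominating_measure M r M (\<lambda>_. 1)"
proof (intro dominating_measure.intro dominating_measure_axioms.intro)
  show "weighted_measure M r" by unfold_locales
  show "sigma_finite_measure M" by unfold_locales
  show "M = density M (\<lambda>x. ennreal 1)" by (simp add: density_1)
qed (auto simp: integrable_weight)

lemma dominating_add_atoms:
  assumes A: "finite A" "A \<subseteq> space M"
  shows "dominating_measure M r (add_atoms M A) (\<lambda>x. if x \<in> A then measure M {x} / (measure M {x} + 1) else 1)"
proof (intro dominating_measure.intro dominating_measure_axioms.intro)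
  show "weighted_measure M r" by unfold_locales
  have s: "\<And>a. a \<in> A \<Longrightarrow> {a} \<in> sets M" using A singleton_sets by auto
  note d = density_add_atoms[OF sigma_finite_measure_axioms A s]
  show "sigma_finite_measure (add_atoms M A)" by (rule sigma_finite_add_atoms[OF sigma_finite_measure_axioms A(1)])
  show "integrable (add_atoms M A) w"
  proof (rule integrableI_bounded)
    show "w \<in> borel_measurable (add_atoms M A)" by simp
    have "(\<integral>\<^sup>+x. ennreal (norm (w x)) \<partial>M) < \<infinity>"
      using integrable_weight unfolding integrable_iff_bounded by simp
    then show "(\<integral>\<^sup>+x. ennreal (norm (w x)) \<partial>add_atoms M A) < \<infinity>"
      using A weight_nonneg by (subst nn_integral_add_atoms) (auto simp: sum_ennreal less_top)
  qed
  show "(\<lambda>x. if x \<in> A then measure M {x} / (measure M {x} + 1) else 1) \<in> borel_measurable M"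
    using d(1) by simp
  show "M = density (add_atoms M A) (\<lambda>x. ennreal (if x \<in> A then measure M {x} / (measure M {x} + 1) else 1))"
    using d(2) by simp
  show "0 \<le> (if x \<in> A then measure M {x} / (measure M {x} + 1) else 1)" 
    "(if x \<in> A then measure M {x} / (measure M {x} + 1) else 1) \<le> 1" for x
    using d(3,4)[of x] by simp_all
qed simp

lemma form_add_atoms_pair:
  fixes p q :: "real^'d" and \<Gamma> :: "'x \<Rightarrow> 'x \<Rightarrow> real^'d^'d"
  assumes A': "finite A" "A \<subseteq> space M" and ab: "a \<in> A" "b \<in> A"
  defines "\<nu> \<equiv> add_atoms M A"
  shows "emeasure \<nu> {a} \<noteq> \<infinity>" "emeasure \<nu> {a} \<noteq> 0"
    "integrable (\<nu> \<Otimes>\<^sub>M \<nu>) (\<lambda>z. (indicator {a} (fst z) *\<^sub>R p) \<bullet> (\<Gamma> (fst z) (snd z) *v (indicator {b} (snd z) *\<^sub>R q)))"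
    "form \<nu> \<Gamma> (\<lambda>x. indicator {a} x *\<^sub>R p) (\<lambda>x. indicator {b} x *\<^sub>R q)
      = measure \<nu> {a} * measure \<nu> {b} * (p \<bullet> (\<Gamma> a b *v q))"
proof -
  have sp: "a \<in> space M" "b \<in> space M" using A' ab by auto
  interpret dominating_measure M r \<nu> "(\<lambda>x. if x \<in> A then measure M {x} / (measure M {x} + 1) else 1)"
    unfolding \<nu>_def by (rule dominating_add_atoms[OF A'])
  have fin: "emeasure \<nu> {x} < \<infinity>" if "x \<in> space M" for x
  proof -
    have "ennreal (w x) * emeasure \<nu> {x} = (\<integral>\<^sup>+y. ennreal (w y) * indicator {x} y \<partial>\<nu>)"
      using singleton_sets[OF that] by (subst nn_integral_indicator_singleton'[symmetric]) (auto simp: \<nu>_def mult.commute)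
    also have "\<dots> \<le> (\<integral>\<^sup>+y. ennreal (w y) \<partial>\<nu>)"
      by (intro nn_integral_mono) (auto simp: indicator_def)
    also have "\<dots> < \<infinity>"
      using integrable_weight_\<nu> weight_nonneg unfolding integrable_iff_bounded by simp
    finally show ?thesis using weight_pos[of "r x"] by (auto simp: ennreal_mult_less_top)
  qed
  show "emeasure \<nu> {a} \<noteq> \<infinity>" using fin[OF sp(1)] by simp
  have "emeasure \<nu> {a} = emeasure M {a} + (\<Sum>x\<in>A. indicator {a} x)"
    unfolding \<nu>_def using sp A'(1) singleton_sets by (intro emeasure_add_atoms) auto
  also have "(\<Sum>x\<in>A. indicator {a} x :: ennreal) = 1" using A'(1) ab by (simp add: indicator_def)
  finally show "emeasure \<nu> {a} \<noteq> 0" by simp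
  define E where "E = {a} \<times> {b}"
  have eq: "(indicator {a} (fst z) *\<^sub>R p) \<bullet> (\<Gamma> (fst z) (snd z) *v (indicator {b} (snd z) *\<^sub>R q))
     = indicator E z *\<^sub>R (p \<bullet> (\<Gamma> a b *v q))" for z
    by (cases z) (auto simp: indicator_def E_def)
  have sing: "{a} \<in> sets \<nu>" "{b} \<in> sets \<nu>" using sp singleton_sets by (auto simp: \<nu>_def)
  have em: "emeasure (\<nu> \<Otimes>\<^sub>M \<nu>) E = emeasure \<nu> {a} * emeasure \<nu> {b}"
    unfolding E_def by (rule nu.emeasure_pair_measure_Times[OF sing])
  have sE: "E \<in> sets (\<nu> \<Otimes>\<^sub>M \<nu>)" unfolding E_def using sing by (rule pair_measureI)
  have emf: "emeasure (\<nu> \<Otimes>\<^sub>M \<nu>) E < \<infinity>"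
    unfolding em using fin sp by (auto simp: ennreal_mult_less_top)
  show "integrable (\<nu> \<Otimes>\<^sub>M \<nu>) (\<lambda>z. (indicator {a} (fst z) *\<^sub>R p) \<bullet> (\<Gamma> (fst z) (snd z) *v (indicator {b} (snd z) *\<^sub>R q)))"
    unfolding eq using emf sE by (intro integrable_scaleR_left integrable_real_indicator) auto
  have "form \<nu> \<Gamma> (\<lambda>x. indicator {a} x *\<^sub>R p) (\<lambda>x. indicator {b} x *\<^sub>R q)
      = measure (\<nu> \<Otimes>\<^sub>M \<nu>) E *\<^sub>R (p \<bullet> (\<Gamma> a b *v q))"
    unfolding form_def eq using emf sE sets.sets_into_space[OF sE]
    by (subst integral_scaleR_left) (auto intro!: integrable_real_indicator simp: Int_absorb2)
  then show "form \<nu> \<Gamma> (\<lambda>x. indicator {a} x *\<^sub>R p) (\<lambda>x. indicator {b} x *\<^sub>R q)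
      = measure \<nu> {a} * measure \<nu> {b} * (p \<bullet> (\<Gamma> a b *v q))"
    using em by (simp add: measure_def enn2real_mult)
qed

text \<open>
  The test function is \<open>p\<close> at \<open>a\<close> plus \<open>q\<close> at \<open>b\<close>, each divided by the mass of the point in a measure
  with atoms at both. The case \<open>a = b\<close> is included.
\<close>

lemma pd_pointwise:
  fixes p q :: "real^'d"
  assumes k: "kern K \<Gamma>" and pd: "pd \<Gamma>" and ab: "a \<in> space M" "b \<in> space M"
  shows "0 \<le> p \<bullet> (\<Gamma> a a *v p) + q \<bullet> (\<Gamma> b b *v q) + 2 * (p \<bullet> (\<Gamma> a b *v q))"
proof -
  define \<nu> where "\<nu> = add_atoms M {a, b}"
  interpret dominating_measure M r \<nu> "(\<lambda>x. if x \<in> {a, b} then measure M {x} / (measure M {x} + 1) else 1)"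
    unfolding \<nu>_def using ab by (intro dominating_add_atoms) auto
  define \<phi> where "\<phi> x u = (\<lambda>y. indicator {x} y *\<^sub>R (1 / measure \<nu> {x}) *\<^sub>R u)" for x and u :: "real^'d"
  have fin: "emeasure \<nu> {x} \<noteq> \<infinity>" "emeasure \<nu> {x} \<noteq> 0" if "x \<in> {a, b}" for x
    using form_add_atoms_pair(1,2)[of "{a, b}" x x] that ab unfolding \<nu>_def by auto
  then have pos: "measure \<nu> {x} \<noteq> 0" if "x \<in> {a, b}" for x
    using that by (auto simp: measure_def enn2real_eq_0_iff)
  have sing: "{x} \<in> sets \<nu>" if "x \<in> {a, b}" for x using that ab singleton_sets by (auto simp: \<nu>_def)
  have Lw: "Lw (\<phi> x u)" if x: "x \<in> {a, b}" for x u
    unfolding \<phi>_def using fin[OF x] sing[OF x]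
    by (intro integrable_Lw integrable_scaleR_left integrable_real_indicator) (auto simp: less_top)
  have val: "form \<nu> \<Gamma> (\<phi> x u) (\<phi> y v) = u \<bullet> (\<Gamma> x y *v v)" if "x \<in> {a, b}" "y \<in> {a, b}" for x y u v
  proof -
    have n: "measure \<nu> {x} \<noteq> 0" "measure \<nu> {y} \<noteq> 0" using pos that by auto
    have "form \<nu> \<Gamma> (\<phi> x u) (\<phi> y v)
        = measure \<nu> {x} * measure \<nu> {y} * (((1 / measure \<nu> {x}) *\<^sub>R u) \<bullet> (\<Gamma> x y *v ((1 / measure \<nu> {y}) *\<^sub>R v)))"
      unfolding \<phi>_def \<nu>_def using that ab by (intro form_add_atoms_pair(4)) auto
    also have "\<dots> = u \<bullet> (\<Gamma> x y *v v)"
      using n by (simp add: matrix_vector_mult_scaleR)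
    finally show ?thesis .
  qed
  have *: "Lw (\<lambda>y. \<phi> a p y + \<phi> b q y)" by (intro Lw_add Lw) auto
  have "0 \<le> form \<nu> \<Gamma> (\<lambda>y. \<phi> a p y + 1 *\<^sub>R \<phi> b q y) (\<lambda>y. \<phi> a p y + 1 *\<^sub>R \<phi> b q y)"
    using pdD[OF pd dominating_measure_axioms *] by simp
  also have "\<dots> = form \<nu> \<Gamma> (\<phi> a p) (\<phi> a p) + 2 * 1 * form \<nu> \<Gamma> (\<phi> b q) (\<phi> a p) + 1\<^sup>2 * form \<nu> \<Gamma> (\<phi> b q) (\<phi> b q)"
    by (intro form_add_scaleR[OF k] Lw) auto
  also have "form \<nu> \<Gamma> (\<phi> b q) (\<phi> a p) = form \<nu> \<Gamma> (\<phi> a p) (\<phi> b q)"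
    by (intro form_sym[OF k] Lw_measurable Lw) auto
  finally show ?thesis by (simp add: val)
qed

end

section \<open>The Riccati nonlinearity as a minimum of quadratic forms\<close>

lemma inner_vector_matrix: "p \<bullet> (v v* A) = (A *v p) \<bullet> v" for A :: "real^'n^'m"
  by (metis dot_lmul_matrix inner_commute)

lemma inner_symmetric_matrix:
  fixes A :: "real^'n^'n"
  assumes "transpose A = A"
  shows "y \<bullet> (A *v x) = x \<bullet> (A *v y)"
  using assms inner_vector_matrix[of x y A] by (metis inner_commute transpose_matrix_vector)

lemma transpose_matrix_inv:
  fixes A :: "real^'n^'n"
  assumes "invertible A" "transpose A = A"
  shows "transpose (matrix_inv A) = matrix_inv A"
proof -
  have "transpose (matrix_inv A) ** A = mat 1"
    using matrix_transpose_mul[of A "matrix_inv A"] matrix_inv_right[OF assms(1)] assms(2)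
    by (simp add: transpose_mat)
  moreover have "transpose (matrix_inv A) = transpose (matrix_inv A) ** (A ** matrix_inv A)"
    using matrix_inv_right[OF assms(1)] by simp
  ultimately show ?thesis by (simp only: matrix_mul_assoc matrix_mul_lid)
qed

lemma complete_square:
  fixes A :: "real^'n^'n"
  assumes "invertible A" "transpose A = A"
  shows "x \<bullet> (A *v x) + 2 * (x \<bullet> s)
    = (x + matrix_inv A *v s) \<bullet> (A *v (x + matrix_inv A *v s)) - s \<bullet> (matrix_inv A *v s)"
proof -
  define z where "z = matrix_inv A *v s"
  have Az: "A *v z = s" using matrix_inv_right[OF assms(1)] by (simp add: z_def matrix_vector_mul_assoc)
  have "z \<bullet> (A *v x) = x \<bullet> s" using inner_symmetric_matrix[OF assms(2), of z x] Az by simp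
  then show ?thesis
    unfolding z_def[symmetric]
    by (simp add: matrix_vector_right_distrib Az inner_add_left inner_add_right inner_commute)
qed

lemma norm_sum3_le: "norm (a + b + c) \<le> A + B + C'" if "norm a \<le> A" "norm b \<le> B" "norm c \<le> C'"
  using that norm_triangle_ineq[of "a + b" c] norm_triangle_ineq[of a b] by linarith

lemma norm_matrix_mult2_le:
  fixes A :: "real^'n^'m" and X :: "real^'p^'n"
  assumes "norm A \<le> a" "norm X \<le> x"
  shows "norm (A ** X) \<le> a * x"
  using norm_matrix_mult_le[of A X] mult_mono[OF assms] by (meson norm_ge_zero order_trans assms)

lemma norm_matrix_mult3_le:
  fixes A :: "real^'n^'m" and X :: "real^'p^'n" and Z :: "real^'q^'p"
  assumes "norm A \<le> a" "norm X \<le> x" "norm Z \<le> z"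
  shows "norm (A ** X ** Z) \<le> a * x * z"
  using assms by (intro norm_matrix_mult2_le)

locale riccati_data = weighted_measure M r for M :: "'x measure" and r +
  fixes h :: "'x \<Rightarrow> real^'e^'d" and c :: real
    and B D :: "real^'d^'e" and C F :: "real^'m^'e" and Q :: "real^'d^'d" and N :: "real^'m^'m" and l :: real
  assumes h_measurable [measurable]: "h \<in> borel_measurable M"
    and h_bound: "AE x in M. norm (h x) \<le> c" and c_nonneg: "0 \<le> c"
    and psd_Q: "psd Q" and l_pos: "0 < l" and psd_N: "psd (N - l *\<^sub>R mat 1)"
begin

text \<open>
  For \<open>\<mu>(dx) = h x M(dx)\<close> these are the integrals of \<open>\<Gamma>\<close> against \<open>\<mu>\<close> from the left and from both sides;
  the latter is taken as an iterated integral.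
\<close>

definition Yop :: "('x \<Rightarrow> 'x \<Rightarrow> real^'d^'d) \<Rightarrow> 'x \<Rightarrow> real^'d^'e" where
  "Yop \<Gamma> y = (\<integral>x. transpose (h x) ** \<Gamma> x y \<partial>M)"

definition Xop :: "('x \<Rightarrow> 'x \<Rightarrow> real^'d^'d) \<Rightarrow> real^'e^'e" where
  "Xop \<Gamma> = (\<integral>y. Yop \<Gamma> y ** h y \<partial>M)"

text \<open>
  The nonlinearity as a function of \<open>X\<close> and of the values \<open>U\<close>, \<open>V\<close> of the left integral at its two
  arguments. The terms with \<open>\<epsilon>\<close> are those of an additional noise of intensity \<open>\<epsilon>\<close> whose coefficients
  are \<open>B\<close> and \<open>C\<close> where the given noise has \<open>D\<close> and \<open>F\<close>. The Riccati equation is the case \<open>\<epsilon> = 0\<close>; the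
  inverse is written with \<open>cramer_inv\<close> to have it measurable for every argument.
\<close>

definition Nalg :: "real \<Rightarrow> real^'e^'e \<Rightarrow> real^'m^'m" where
  "Nalg \<epsilon> X = N + transpose F ** X ** F + \<epsilon> *\<^sub>R (transpose C ** X ** C)"

definition Salg :: "real \<Rightarrow> real^'e^'e \<Rightarrow> real^'d^'e \<Rightarrow> real^'d^'m" where
  "Salg \<epsilon> X V = transpose C ** V + transpose F ** X ** D + \<epsilon> *\<^sub>R (transpose C ** X ** B)"

definition Ralg :: "real \<Rightarrow> real^'e^'e \<Rightarrow> real^'d^'e \<Rightarrow> real^'d^'e \<Rightarrow> real^'d^'d" where
  "Ralg \<epsilon> X U V = Q + transpose D ** X ** D + \<epsilon> *\<^sub>R (transpose B ** X ** B) + transpose B ** V + transpose U ** B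
     - transpose (Salg \<epsilon> X U) ** cramer_inv (Nalg \<epsilon> X) ** Salg \<epsilon> X V"

definition Rop :: "real \<Rightarrow> ('x \<Rightarrow> 'x \<Rightarrow> real^'d^'d) \<Rightarrow> 'x \<Rightarrow> 'x \<Rightarrow> real^'d^'d" where
  "Rop \<epsilon> \<Gamma> x y = Ralg \<epsilon> (Xop \<Gamma>) (Yop \<Gamma> x) (Yop \<Gamma> y)"

definition W1 :: real where "W1 = (\<integral>x. w x \<partial>M)"

lemma W1_nonneg: "0 \<le> W1"
  unfolding W1_def using weight_nonneg by (intro integral_nonneg_AE) auto

lemma sym_Q: "transpose Q = Q" and Q_nonneg: "0 \<le> x \<bullet> (Q *v x)"
  using psd_Q by (auto simp: psd_def)

lemma sym_N: "transpose N = N"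
proof -
  have "transpose N - l *\<^sub>R mat 1 = N - l *\<^sub>R mat 1"
    using psd_N unfolding psd_def by (simp add: transpose_diff transpose_scaleR transpose_mat)
  then show ?thesis by simp
qed

lemma N_coercive: "l * (x \<bullet> x) \<le> x \<bullet> (N *v x)"
  using psd_N unfolding psd_def
  by (simp add: matrix_vector_mult_diff_rdistrib scaleR_matrix_vector_assoc[symmetric] inner_diff_right)

lemma Y_bound_AE:
  assumes k: "kern K \<Gamma>"
  shows "AE x in M. norm (transpose (h x) ** \<Gamma> x y) \<le> c * K * w y * w x"
  using h_bound
proof eventually_elim
  case (elim x)
  have "norm (transpose (h x) ** \<Gamma> x y) \<le> c * (K * w x * w y)"
    using elim kern_bound[OF k, of x y] by (intro norm_matrix_mult2_le) simp_all
  then show ?case by (simp add: ac_simps)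
qed

lemma Y_integrable:
  assumes k: "kern K \<Gamma>" and y: "y \<in> space M"
  shows "integrable M (\<lambda>x. transpose (h x) ** \<Gamma> x y)"
proof (rule Bochner_Integration.integrable_bound)
  show "integrable M (\<lambda>x. c * K * w y * w x)" using integrable_weight by simp
  note [measurable] = kern_section_measurable[OF k y]
  show "(\<lambda>x. transpose (h x) ** \<Gamma> x y) \<in> borel_measurable M" by measurable
  show "AE x in M. norm (transpose (h x) ** \<Gamma> x y) \<le> norm (c * K * w y * w x)"
    using Y_bound_AE[OF k, of y] by eventually_elim (simp add: order_trans[OF _ abs_ge_self])
qed

lemma Y_bound:
  assumes k: "kern K \<Gamma>"
  shows "norm (Yop \<Gamma> y) \<le> c * K * W1 * w y"
proof -
  have "norm (Yop \<Gamma> y) \<le> (\<integral>x. c * K * w y * w x \<partial>M)"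
    unfolding Yop_def using integrable_weight by (intro norm_integral_le Y_bound_AE[OF k]) simp
  then show ?thesis by (simp add: W1_def ac_simps)
qed

lemma Y_measurable: "kern K \<Gamma> \<Longrightarrow> Yop \<Gamma> \<in> borel_measurable M"
proof -
  assume "kern K \<Gamma>"
  from kern_measurable[OF this] have [measurable]: "(\<lambda>(y, x). \<Gamma> x y) \<in> borel_measurable (M \<Otimes>\<^sub>M M)"
    using measurable_compose[OF measurable_pair_swap', of "\<lambda>z. \<Gamma> (fst z) (snd z)" M M borel]
    by (simp add: case_prod_beta' split_beta')
  have "(\<lambda>(y, x). transpose (h x) ** \<Gamma> x y) \<in> borel_measurable (M \<Otimes>\<^sub>M M)"
    using h_measurable by measurable
  then show ?thesis unfolding Yop_def by (rule borel_measurable_lebesgue_integral)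
qed

lemma X_bound_AE:
  assumes k: "kern K \<Gamma>"
  shows "AE y in M. norm (Yop \<Gamma> y ** h y) \<le> c * K * W1 * c * w y"
  using h_bound
proof eventually_elim
  case (elim y)
  have "norm (Yop \<Gamma> y ** h y) \<le> (c * K * W1 * w y) * c"
    using elim Y_bound[OF k, of y] by (intro norm_matrix_mult2_le)
  then show ?case by (simp add: ac_simps)
qed

lemma X_integrable:
  assumes k: "kern K \<Gamma>"
  shows "integrable M (\<lambda>y. Yop \<Gamma> y ** h y)"
proof (rule Bochner_Integration.integrable_bound)
  show "integrable M (\<lambda>y. c * K * W1 * c * w y)" using integrable_weight by simp
  note [measurable] = Y_measurable[OF k]
  show "(\<lambda>y. Yop \<Gamma> y ** h y) \<in> borel_measurable M" by measurable
  show "AE y in M. norm (Yop \<Gamma> y ** h y) \<le> norm (c * K * W1 * c * w y)"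
    using X_bound_AE[OF k] by eventually_elim (simp add: order_trans[OF _ abs_ge_self])
qed

lemma X_bound:
  assumes k: "kern K \<Gamma>"
  shows "norm (Xop \<Gamma>) \<le> c * K * W1 * c * W1"
proof -
  have "norm (Xop \<Gamma>) \<le> (\<integral>y. c * K * W1 * c * w y \<partial>M)"
    unfolding Xop_def using integrable_weight by (intro norm_integral_le X_bound_AE[OF k]) simp
  then show ?thesis by (simp add: W1_def ac_simps)
qed

lemma inner_Ralg:
  "p \<bullet> (Ralg \<epsilon> X U V *v q) = p \<bullet> (Q *v q) + (D *v p) \<bullet> (X *v (D *v q)) + \<epsilon> * ((B *v p) \<bullet> (X *v (B *v q)))
     + (B *v p) \<bullet> (V *v q) + (U *v p) \<bullet> (B *v q)
     - (Salg \<epsilon> X U *v p) \<bullet> (cramer_inv (Nalg \<epsilon> X) *v (Salg \<epsilon> X V *v q))"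
  unfolding Ralg_def
  by (simp add: matrix_vector_mult_add_rdistrib matrix_vector_mult_diff_rdistrib
      matrix_vector_mul_assoc[symmetric] inner_add_right inner_diff_right inner_vector_matrix
      scaleR_matrix_vector_assoc[symmetric])

lemma Salg_vector: "Salg \<epsilon> X V *v p = transpose C *v (V *v p) + transpose F *v (X *v (D *v p)) + \<epsilon> *\<^sub>R (transpose C *v (X *v (B *v p)))"
  unfolding Salg_def
  by (simp add: matrix_vector_mult_add_rdistrib matrix_vector_mul_assoc[symmetric]
      scaleR_matrix_vector_assoc[symmetric] del: transpose_matrix_vector)

lemma Nalg_inner: "x \<bullet> (Nalg \<epsilon> X *v z) = x \<bullet> (N *v z) + (F *v x) \<bullet> (X *v (F *v z)) + \<epsilon> * ((C *v x) \<bullet> (X *v (C *v z)))"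
  unfolding Nalg_def
  by (simp add: matrix_vector_mult_add_rdistrib matrix_vector_mul_assoc[symmetric]
      inner_add_right inner_vector_matrix scaleR_matrix_vector_assoc[symmetric])

lemma Nalg_coercive:
  assumes "\<And>u. 0 \<le> u \<bullet> (X *v u)" "0 \<le> \<epsilon>"
  shows "l * (x \<bullet> x) \<le> x \<bullet> (Nalg \<epsilon> X *v x)"
  unfolding Nalg_inner using N_coercive[of x] assms(1)[of "F *v x"] mult_nonneg_nonneg[OF assms(2) assms(1)[of "C *v x"]]
  by linarith

lemma transpose_sandwich: "transpose X = X \<Longrightarrow> transpose (transpose A ** X ** A) = transpose A ** X ** A"
  for A :: "real^'n^'k" and X :: "real^'k^'k"
  by (simp add: matrix_transpose_mul transpose_transpose matrix_mul_assoc)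

lemma Nalg_sym: "transpose X = X \<Longrightarrow> transpose (Nalg \<epsilon> X) = Nalg \<epsilon> X"
  unfolding Nalg_def by (simp add: transpose_add transpose_scaleR transpose_sandwich sym_N)

lemma Ralg_sym:
  assumes "transpose X = X" "invertible (Nalg \<epsilon> X)"
  shows "transpose (Ralg \<epsilon> X U V) = Ralg \<epsilon> X V U"
proof -
  have "transpose (cramer_inv (Nalg \<epsilon> X)) = cramer_inv (Nalg \<epsilon> X)"
    using transpose_matrix_inv[OF assms(2) Nalg_sym[OF assms(1)]] matrix_inv_eq_cramer[OF assms(2)] by simp
  then show ?thesis
    unfolding Ralg_def
    by (simp add: transpose_add transpose_diff transpose_scaleR transpose_sandwich assms(1) sym_Q
        matrix_transpose_mul transpose_transpose matrix_mul_assoc)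
qed

definition Sbound :: "real \<Rightarrow> real \<Rightarrow> real" where
  "Sbound k v = norm C * v + norm F * k * norm D + norm C * k * norm B"

lemma Salg_bound:
  assumes X: "norm X \<le> k" and V: "norm V \<le> v" and e: "0 \<le> \<epsilon>" "\<epsilon> \<le> 1"
  shows "norm (Salg \<epsilon> X V) \<le> Sbound k v"
  unfolding Salg_def Sbound_def
proof (rule norm_sum3_le)
  show "norm (transpose C ** V) \<le> norm C * v" using V by (intro norm_matrix_mult2_le) auto
  show "norm (transpose F ** X ** D) \<le> norm F * k * norm D" using X by (intro norm_matrix_mult3_le) auto
  have "norm (transpose C ** X ** B) \<le> norm C * k * norm B" using X by (intro norm_matrix_mult3_le) auto
  then show "norm (\<epsilon> *\<^sub>R (transpose C ** X ** B)) \<le> norm C * k * norm B"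
    using e mult_left_le_one_le[of "norm (transpose C ** X ** B)" \<epsilon>] by simp
qed

definition Rbound :: "real \<Rightarrow> real" where
  "Rbound k = norm Q + norm D * k * norm D + norm B * k * norm B + norm B * k + k * norm B
     + Sbound k k * ((real CARD('m))\<^sup>2 / l) * Sbound k k"

lemma Ralg_bound:
  assumes X: "norm X \<le> k" and U: "norm U \<le> k" and V: "norm V \<le> k" and e: "0 \<le> \<epsilon>" "\<epsilon> \<le> 1"
    and X0: "\<And>u. 0 \<le> u \<bullet> (X *v u)"
  shows "norm (Ralg \<epsilon> X U V) \<le> Rbound k"
proof -
  note co = Nalg_coercive[OF X0 e(1)]
  have inv: "norm (cramer_inv (Nalg \<epsilon> X)) \<le> (real CARD('m))\<^sup>2 / l"
    using norm_inv_coercive_le[OF l_pos co] matrix_inv_eq_cramer[OF coercive_invertible[OF l_pos co]] by simp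
  have 1: "norm (transpose D ** X ** D) \<le> norm D * k * norm D" using X by (intro norm_matrix_mult3_le) auto
  have "norm (transpose B ** X ** B) \<le> norm B * k * norm B" using X by (intro norm_matrix_mult3_le) auto
  then have 2: "norm (\<epsilon> *\<^sub>R (transpose B ** X ** B)) \<le> norm B * k * norm B"
    using e mult_left_le_one_le[of "norm (transpose B ** X ** B)" \<epsilon>] by simp
  have 3: "norm (transpose B ** V) \<le> norm B * k" using V by (intro norm_matrix_mult2_le) auto
  have 4: "norm (transpose U ** B) \<le> k * norm B" using U by (intro norm_matrix_mult2_le) auto
  have 5: "norm (transpose (Salg \<epsilon> X U) ** cramer_inv (Nalg \<epsilon> X) ** Salg \<epsilon> X V)
      \<le> Sbound k k * ((real CARD('m))\<^sup>2 / l) * Sbound k k"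
    using Salg_bound[OF X U e] Salg_bound[OF X V e] inv by (intro norm_matrix_mult3_le) auto
  have "norm (Ralg \<epsilon> X U V) \<le> norm (Q + transpose D ** X ** D + \<epsilon> *\<^sub>R (transpose B ** X ** B))
      + norm (transpose B ** V) + norm (transpose U ** B)
      + norm (transpose (Salg \<epsilon> X U) ** cramer_inv (Nalg \<epsilon> X) ** Salg \<epsilon> X V)"
    unfolding Ralg_def by (intro norm_triangle_le_diff norm_triangle_le add_mono order_refl)
  then show ?thesis
    unfolding Rbound_def using norm_sum3_le[OF order_refl[of "norm Q"] 1 2] 3 4 5 by linarith
qed

context
  fixes \<nu> \<rho>
  assumes dom: "dominating_measure M r \<nu> \<rho>"
begin

interpretation dominating_measure M r \<nu> \<rho> by (rule dom)

text \<open>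
  As a vector measure, \<open>\<mu> u\<close> has the density \<open>\<rho> h u\<close> with respect to \<open>\<nu>\<close>. Used as a test function it
  produces the integrals of a kernel against \<open>\<mu>\<close>, for every \<open>\<nu>\<close>.
\<close>

definition Hs :: "real^'e \<Rightarrow> 'x \<Rightarrow> real^'d" where
  "Hs u x = \<rho> x *\<^sub>R (h x *v u)"

lemma Lw_Hs: "Lw (Hs u)"
  unfolding Lw_def
proof (intro conjI)
  show m: "Hs u \<in> borel_measurable M" unfolding Hs_def[abs_def] by measurable
  show "integrable \<nu> (\<lambda>x. w x * norm (Hs u x))"
  proof (rule Bochner_Integration.integrable_bound)
    show "integrable \<nu> (\<lambda>x. w x * (c * norm u))" using integrable_weight_\<nu> by simp
    show "(\<lambda>x. w x * norm (Hs u x)) \<in> borel_measurable \<nu>" using m by measurable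
    show "AE x in \<nu>. norm (w x * norm (Hs u x)) \<le> norm (w x * (c * norm u))"
      using h_bound unfolding AE_M_iff
    proof eventually_elim
      case (elim x)
      have "norm (Hs u x) \<le> c * norm u"
      proof (cases "\<rho> x = 0")
        case True then show ?thesis using c_nonneg by (simp add: Hs_def)
      next
        case False
        then have "norm (h x) \<le> c" using elim \<rho>_nonneg[of x] by simp
        then have "norm (h x *v u) \<le> c * norm u"
          using norm_matrix_vector_mult_le[of "h x" u] by (meson mult_right_mono norm_ge_zero order_trans)
        moreover have "norm (Hs u x) \<le> norm (h x *v u)"
          using \<rho>_nonneg[of x] \<rho>_le_1[of x] by (simp add: Hs_def mult_left_le_one_le)
        ultimately show ?thesis by simp
      qed
      then show ?case using weight_nonneg c_nonneg by (simp add: abs_mult mult_left_mono)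
    qed
  qed
qed

lemma Y_psi_integrable:
  assumes k: "kern K \<Gamma>" and p: "Lw \<psi>"
  shows "integrable \<nu> (\<lambda>y. Yop \<Gamma> y *v \<psi> y)"
proof (rule Bochner_Integration.integrable_bound)
  show "integrable \<nu> (\<lambda>y. c * K * W1 * (w y * norm (\<psi> y)))" using p unfolding Lw_def by simp
  note [measurable] = Y_measurable[OF k] Lw_measurable[OF p]
  show "(\<lambda>y. Yop \<Gamma> y *v \<psi> y) \<in> borel_measurable \<nu>" by measurable
  show "AE y in \<nu>. norm (Yop \<Gamma> y *v \<psi> y) \<le> norm (c * K * W1 * (w y * norm (\<psi> y)))"
  proof (intro always_eventually allI)
    fix y
    have "norm (Yop \<Gamma> y *v \<psi> y) \<le> norm (Yop \<Gamma> y) * norm (\<psi> y)" by (rule norm_matrix_vector_mult_le)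
    also have "\<dots> \<le> (c * K * W1 * w y) * norm (\<psi> y)"
      by (intro mult_right_mono Y_bound[OF k]) auto
    also have "\<dots> \<le> norm (c * K * W1 * (w y * norm (\<psi> y)))" by (simp add: mult.assoc)
    finally show "norm (Yop \<Gamma> y *v \<psi> y) \<le> norm (c * K * W1 * (w y * norm (\<psi> y)))" .
  qed
qed

lemma form_Hs:
  assumes k: "kern K \<Gamma>" and p: "Lw \<psi>"
  shows "form \<nu> \<Gamma> (Hs u) \<psi> = u \<bullet> (\<integral>y. Yop \<Gamma> y *v \<psi> y \<partial>\<nu>)"
proof -
  note i = form_integrable[OF k Lw_Hs[of u] p]
  have "form \<nu> \<Gamma> (Hs u) \<psi> = (\<integral>y. \<integral>x. Hs u x \<bullet> (\<Gamma> x y *v \<psi> y) \<partial>\<nu> \<partial>\<nu>)"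
    unfolding form_def using nu2.integral_snd[of "\<lambda>x y. Hs u x \<bullet> (\<Gamma> x y *v \<psi> y)"] i
    by (simp add: split_beta')
  also have "\<dots> = (\<integral>y. u \<bullet> (Yop \<Gamma> y *v \<psi> y) \<partial>\<nu>)"
  proof (rule Bochner_Integration.integral_cong[OF refl])
    fix y assume "y \<in> space \<nu>"
    then have y: "y \<in> space M" by (simp add: space_\<nu>)
    note [measurable] = kern_section_measurable[OF k y]
    have eq: "(h x *v u) \<bullet> (G *v q) = u \<bullet> ((transpose (h x) ** G) *v q)" for x q and G :: "real^'d^'d"
      by (simp add: matrix_vector_mul_assoc[symmetric] inner_vector_matrix)
    have "(\<integral>x. Hs u x \<bullet> (\<Gamma> x y *v \<psi> y) \<partial>\<nu>) = (\<integral>x. \<rho> x *\<^sub>R (u \<bullet> ((transpose (h x) ** \<Gamma> x y) *v \<psi> y)) \<partial>\<nu>)"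
      by (simp add: Hs_def eq)
    also have "\<dots> = (\<integral>x. u \<bullet> ((transpose (h x) ** \<Gamma> x y) *v \<psi> y) \<partial>M)"
      by (rule integral_M_eq[symmetric]) measurable
    also have "\<dots> = u \<bullet> (\<integral>x. (transpose (h x) ** \<Gamma> x y) *v \<psi> y \<partial>M)"
      by (rule integral_inner_right) (intro integrable_bounded_linear[OF bounded_linear_matrix_vector_left] Y_integrable[OF k y])
    also have "\<dots> = u \<bullet> (Yop \<Gamma> y *v \<psi> y)"
      unfolding Yop_def
      by (subst integral_bounded_linear[OF bounded_linear_matrix_vector_left Y_integrable[OF k y]]) simp
    finally show "(\<integral>x. Hs u x \<bullet> (\<Gamma> x y *v \<psi> y) \<partial>\<nu>) = u \<bullet> (Yop \<Gamma> y *v \<psi> y)" .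
  qed
  also have "\<dots> = u \<bullet> (\<integral>y. Yop \<Gamma> y *v \<psi> y \<partial>\<nu>)"
    by (rule integral_inner_right) (intro Y_psi_integrable[OF k p])
  finally show ?thesis .
qed

lemma form_Hs_Hs:
  assumes k: "kern K \<Gamma>"
  shows "form \<nu> \<Gamma> (Hs u) (Hs v) = u \<bullet> (Xop \<Gamma> *v v)"
proof -
  note [measurable] = Y_measurable[OF k]
  have "(\<integral>y. Yop \<Gamma> y *v Hs v y \<partial>\<nu>) = (\<integral>y. \<rho> y *\<^sub>R ((Yop \<Gamma> y ** h y) *v v) \<partial>\<nu>)"
    by (simp add: Hs_def matrix_vector_mult_scaleR matrix_vector_mul_assoc)
  also have "\<dots> = (\<integral>y. (Yop \<Gamma> y ** h y) *v v \<partial>M)"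
    by (rule integral_M_eq[symmetric]) measurable
  also have "\<dots> = Xop \<Gamma> *v v"
    unfolding Xop_def
    by (subst integral_bounded_linear[OF bounded_linear_matrix_vector_left X_integrable[OF k]]) simp
  finally show ?thesis using form_Hs[OF k Lw_Hs] by simp
qed

text \<open>
  The kernel depends on each variable through an affine function of \<open>Yop \<Gamma>\<close>. The form can
  therefore see \<open>\<psi>\<close> only through the two vectors \<open>a\<close> and \<open>y\<close>.
\<close>

lemma form_Rop:
  fixes \<epsilon> :: real
  assumes k: "kern K \<Gamma>" and p: "integrable \<nu> \<psi>"
  defines "a \<equiv> \<integral>x. \<psi> x \<partial>\<nu>" and "y \<equiv> \<integral>x. Yop \<Gamma> x *v \<psi> x \<partial>\<nu>" and "X \<equiv> Xop \<Gamma>"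
  defines "s \<equiv> transpose C *v y + transpose F *v (X *v (D *v a)) + \<epsilon> *\<^sub>R (transpose C *v (X *v (B *v a)))"
  shows "integrable (\<nu> \<Otimes>\<^sub>M \<nu>) (\<lambda>z. \<psi> (fst z) \<bullet> (Rop \<epsilon> \<Gamma> (fst z) (snd z) *v \<psi> (snd z)))"
    and "form \<nu> (Rop \<epsilon> \<Gamma>) \<psi> \<psi> = a \<bullet> (Q *v a) + (D *v a) \<bullet> (X *v (D *v a)) + \<epsilon> * ((B *v a) \<bullet> (X *v (B *v a)))
      + 2 * ((B *v a) \<bullet> y) - s \<bullet> (cramer_inv (Nalg \<epsilon> X) *v s)"
proof -
  have Yp: "integrable \<nu> (\<lambda>x. Yop \<Gamma> x *v \<psi> x)" by (rule Y_psi_integrable[OF k integrable_Lw[OF p]])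
  have lin: "integrable \<nu> (\<lambda>x. A *v f x) \<and> (\<integral>x. A *v f x \<partial>\<nu>) = A *v (\<integral>x. f x \<partial>\<nu>)" if "integrable \<nu> f"
    for A :: "real^'n^'k" and f :: "'x \<Rightarrow> real^'n"
    using integrable_bounded_linear[OF bounded_linear_matrix_vector_right that]
      integral_bounded_linear[OF bounded_linear_matrix_vector_right that] by blast
  have Dp: "integrable \<nu> (\<lambda>x. D *v \<psi> x)" "(\<integral>x. D *v \<psi> x \<partial>\<nu>) = D *v a" using lin[OF p, of D] by (auto simp: a_def)
  have Bp: "integrable \<nu> (\<lambda>x. B *v \<psi> x)" "(\<integral>x. B *v \<psi> x \<partial>\<nu>) = B *v a" using lin[OF p, of B] by (auto simp: a_def)
  have CY: "integrable \<nu> (\<lambda>x. transpose C *v (Yop \<Gamma> x *v \<psi> x))" "(\<integral>x. transpose C *v (Yop \<Gamma> x *v \<psi> x) \<partial>\<nu>) = transpose C *v y"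
    using lin[OF Yp, of "transpose C"] by (auto simp: y_def simp del: transpose_matrix_vector)
  have FX: "integrable \<nu> (\<lambda>x. transpose F *v (X *v (D *v \<psi> x)))" "(\<integral>x. transpose F *v (X *v (D *v \<psi> x)) \<partial>\<nu>) = transpose F *v (X *v (D *v a))"
    using lin[OF conjunct1[OF lin[OF Dp(1), of X]], of "transpose F"] lin[OF Dp(1), of X] Dp(2)
    by (auto simp del: transpose_matrix_vector)
  have CX: "integrable \<nu> (\<lambda>x. transpose C *v (X *v (B *v \<psi> x)))" "(\<integral>x. transpose C *v (X *v (B *v \<psi> x)) \<partial>\<nu>) = transpose C *v (X *v (B *v a))"
    using lin[OF conjunct1[OF lin[OF Bp(1), of X]], of "transpose C"] lin[OF Bp(1), of X] Bp(2)
    by (auto simp del: transpose_matrix_vector)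
  have S: "integrable \<nu> (\<lambda>x. Salg \<epsilon> X (Yop \<Gamma> x) *v \<psi> x)" "(\<integral>x. Salg \<epsilon> X (Yop \<Gamma> x) *v \<psi> x \<partial>\<nu>) = s"
    unfolding Salg_vector s_def using CY FX CX by (simp_all del: transpose_matrix_vector)
  note t1 = nu2.integral_inner_fst_snd[OF p p, of Q]
  note t2 = nu2.integral_inner_fst_snd[OF Dp(1) Dp(1), of X]
  note t3 = nu2.integral_inner_fst_snd[OF Bp(1) Bp(1), of X]
  note t4 = nu2.integral_inner_fst_snd[OF Bp(1) Yp, of "mat 1", simplified]
  note t5 = nu2.integral_inner_fst_snd[OF Yp Bp(1), of "mat 1", simplified]
  note t6 = nu2.integral_inner_fst_snd[OF S(1) S(1), of "cramer_inv (Nalg \<epsilon> X)"]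
  note int = t1(1) t2(1) t3(1) t4(1) t5(1) t6(1)
  show "integrable (\<nu> \<Otimes>\<^sub>M \<nu>) (\<lambda>z. \<psi> (fst z) \<bullet> (Rop \<epsilon> \<Gamma> (fst z) (snd z) *v \<psi> (snd z)))"
    unfolding Rop_def inner_Ralg X_def[symmetric] using int by simp
  have "form \<nu> (Rop \<epsilon> \<Gamma>) \<psi> \<psi> = a \<bullet> (Q *v a) + (D *v a) \<bullet> (X *v (D *v a)) + \<epsilon> * ((B *v a) \<bullet> (X *v (B *v a)))
      + (B *v a) \<bullet> y + y \<bullet> (B *v a) - s \<bullet> (cramer_inv (Nalg \<epsilon> X) *v s)"
    unfolding form_def Rop_def inner_Ralg X_def[symmetric]
    using int t1(2) t2(2) t3(2) t4(2) t5(2) t6(2) Dp(2) Bp(2) S(2) 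
    by (simp add: a_def[symmetric] y_def[symmetric])
  then show "form \<nu> (Rop \<epsilon> \<Gamma>) \<psi> \<psi> = a \<bullet> (Q *v a) + (D *v a) \<bullet> (X *v (D *v a)) + \<epsilon> * ((B *v a) \<bullet> (X *v (B *v a)))
      + 2 * ((B *v a) \<bullet> y) - s \<bullet> (cramer_inv (Nalg \<epsilon> X) *v s)"
    by (simp add: inner_commute)
qed

text \<open>
  The cost of the control value \<open>x\<close> in state \<open>\<psi>\<close>: \<open>g\<close> and \<open>u\<close> are the noise coefficients after
  controlling. For positive \<open>\<Gamma>\<close> all terms are nonnegative, and none decreases when \<open>\<Gamma>\<close> increases.
\<close>

definition control_cost :: "real \<Rightarrow> ('x \<Rightarrow> 'x \<Rightarrow> real^'d^'d) \<Rightarrow> ('x \<Rightarrow> real^'d) \<Rightarrow> real^'m \<Rightarrow> real" where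
  "control_cost n \<Gamma> \<psi> x = (let a = (\<integral>x. \<psi> x \<partial>\<nu>); g = D *v a + F *v x; u = B *v a + C *v x in
     a \<bullet> (Q *v a) + x \<bullet> (N *v x) + form \<nu> \<Gamma> (Hs g) (Hs g)
     + n * form \<nu> \<Gamma> (\<lambda>z. \<psi> z + (1 / n) *\<^sub>R Hs u z) (\<lambda>z. \<psi> z + (1 / n) *\<^sub>R Hs u z))"

end

lemma Xop_nonneg:
  assumes k: "kern K \<Gamma>" and pd: "pd \<Gamma>"
  shows "0 \<le> u \<bullet> (Xop \<Gamma> *v u)"
  using pdD[OF pd dominating_self Lw_Hs[OF dominating_self]] form_Hs_Hs[OF dominating_self k] by simp

lemma Xop_sym:
  assumes k: "kern K \<Gamma>"
  shows "transpose (Xop \<Gamma>) = Xop \<Gamma>"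
proof -
  interpret d: dominating_measure M r M "\<lambda>_. 1" by (rule dominating_self)
  have "u \<bullet> (Xop \<Gamma> *v v) = v \<bullet> (Xop \<Gamma> *v u)" for u v
    using d.form_sym[OF k d.Lw_measurable[OF Lw_Hs[OF dominating_self]] d.Lw_measurable[OF Lw_Hs[OF dominating_self]]]
    unfolding form_Hs_Hs[OF dominating_self k] .
  from this[of "axis i 1" "axis j 1" for i j] have "Xop \<Gamma> $ i $ j = Xop \<Gamma> $ j $ i" for i j
    by (simp add: matrix_vector_mult_basis column_def inner_axis')
  then show ?thesis by (simp add: transpose_def vec_eq_iff)
qed

text \<open>
  Completing the square in \<open>x\<close>. Expanding \<open>n\<close> times the form at \<open>\<psi> + Hs u / n\<close> gives \<open>n\<close> times the form at \<open>\<psi>\<close>,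
  the cross term \<open>2 * (u \<bullet> y)\<close>, which has no sign by itself, and \<open>1 / n\<close> times \<open>u \<bullet> (X *v u)\<close>, which is
  the noise term of the perturbed nonlinearity with \<open>\<epsilon> = 1 / n\<close>.
\<close>

lemma control_cost_min:
  assumes dom: "dominating_measure M r \<nu> \<rho>"
  assumes k: "kern K \<Gamma>" and pd: "pd \<Gamma>" and p: "integrable \<nu> \<psi>" and n: "0 < n"
  shows "form \<nu> (Rop (1 / n) \<Gamma>) \<psi> \<psi> + n * form \<nu> \<Gamma> \<psi> \<psi> \<le> control_cost \<nu> \<rho> n \<Gamma> \<psi> x"
    and "\<exists>x. form \<nu> (Rop (1 / n) \<Gamma>) \<psi> \<psi> + n * form \<nu> \<Gamma> \<psi> \<psi> = control_cost \<nu> \<rho> n \<Gamma> \<psi> x"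
proof -
  interpret dominating_measure M r \<nu> \<rho> by (rule dom)
  define a where "a = (\<integral>x. \<psi> x \<partial>\<nu>)"
  define y where "y = (\<integral>x. Yop \<Gamma> x *v \<psi> x \<partial>\<nu>)"
  define X where "X = Xop \<Gamma>"
  define e where "e = 1 / n"
  define s where "s = transpose C *v y + transpose F *v (X *v (D *v a)) + e *\<^sub>R (transpose C *v (X *v (B *v a)))"
  define Nh where "Nh = Nalg e X"
  have e: "0 \<le> e" "n * e = 1" "n * e\<^sup>2 = e" using n by (auto simp: e_def power2_eq_square)
  have X0: "0 \<le> u \<bullet> (X *v u)" for u unfolding X_def by (rule Xop_nonneg[OF k pd])
  have Xs: "transpose X = X" unfolding X_def by (rule Xop_sym[OF k])
  note co = Nalg_coercive[OF X0 e(1), folded Nh_def]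
  have inv: "invertible Nh" by (rule coercive_invertible[OF l_pos co])
  have Nhs: "transpose Nh = Nh" unfolding Nh_def by (rule Nalg_sym[OF Xs])
  have Lp: "Lw \<psi>" by (rule integrable_Lw[OF p])
  have FR: "form \<nu> (Rop e \<Gamma>) \<psi> \<psi> = a \<bullet> (Q *v a) + (D *v a) \<bullet> (X *v (D *v a)) + e * ((B *v a) \<bullet> (X *v (B *v a)))
      + 2 * ((B *v a) \<bullet> y) - s \<bullet> (matrix_inv Nh *v s)"
    unfolding form_Rop(2)[OF dom k p] a_def[symmetric] y_def[symmetric] X_def[symmetric]
    unfolding s_def[symmetric] Nh_def[symmetric] matrix_inv_eq_cramer[OF inv] ..
  have J: "control_cost \<nu> \<rho> n \<Gamma> \<psi> x = form \<nu> (Rop e \<Gamma>) \<psi> \<psi> + n * form \<nu> \<Gamma> \<psi> \<psi>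
      + (x + matrix_inv Nh *v s) \<bullet> (Nh *v (x + matrix_inv Nh *v s))" for x
  proof -
    define g where "g = D *v a + F *v x"
    define u where "u = B *v a + C *v x"
    have f: "n * form \<nu> \<Gamma> (\<lambda>z. \<psi> z + e *\<^sub>R Hs \<rho> u z) (\<lambda>z. \<psi> z + e *\<^sub>R Hs \<rho> u z)
        = n * form \<nu> \<Gamma> \<psi> \<psi> + 2 * (u \<bullet> y) + e * (u \<bullet> (X *v u))"
      unfolding form_add_scaleR[OF k Lp Lw_Hs[OF dom]] form_Hs[OF dom k Lp] form_Hs_Hs[OF dom k]
        y_def[symmetric] X_def[symmetric]
      using e(2,3) by (simp add: distrib_left mult.assoc[symmetric] mult.commute[of n "_ * _"])
    have "control_cost \<nu> \<rho> n \<Gamma> \<psi> x = a \<bullet> (Q *v a) + x \<bullet> (N *v x) + g \<bullet> (X *v g) + (n * form \<nu> \<Gamma> \<psi> \<psi> + 2 * (u \<bullet> y) + e * (u \<bullet> (X *v u)))"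
      unfolding control_cost_def[OF dom] Let_def a_def[symmetric] g_def[symmetric] u_def[symmetric] e_def[symmetric] f
        form_Hs_Hs[OF dom k] X_def[symmetric] ..
    moreover have "g \<bullet> (X *v g) = (D *v a) \<bullet> (X *v (D *v a)) + 2 * ((F *v x) \<bullet> (X *v (D *v a))) + (F *v x) \<bullet> (X *v (F *v x))"
      unfolding g_def using inner_symmetric_matrix[OF Xs, of "D *v a" "F *v x"]
      by (simp add: matrix_vector_right_distrib inner_add_left inner_add_right)
    moreover have "u \<bullet> (X *v u) = (B *v a) \<bullet> (X *v (B *v a)) + 2 * ((C *v x) \<bullet> (X *v (B *v a))) + (C *v x) \<bullet> (X *v (C *v x))"
      unfolding u_def using inner_symmetric_matrix[OF Xs, of "B *v a" "C *v x"]
      by (simp add: matrix_vector_right_distrib inner_add_left inner_add_right)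
    moreover have "x \<bullet> s = (C *v x) \<bullet> y + (F *v x) \<bullet> (X *v (D *v a)) + e * ((C *v x) \<bullet> (X *v (B *v a)))"
      unfolding s_def by (simp add: inner_add_right inner_vector_matrix)
    moreover have "u \<bullet> y = (B *v a) \<bullet> y + (C *v x) \<bullet> y" unfolding u_def by (simp add: inner_add_left)
    moreover have "x \<bullet> (Nh *v x) = x \<bullet> (N *v x) + (F *v x) \<bullet> (X *v (F *v x)) + e * ((C *v x) \<bullet> (X *v (C *v x)))"
      unfolding Nh_def by (rule Nalg_inner)
    moreover note FR complete_square[OF inv Nhs, of x s]
    ultimately show ?thesis by (simp add: algebra_simps)
  qed
  have "0 \<le> z \<bullet> (Nh *v z)" for z
    using co[of z] l_pos by (meson inner_ge_zero less_imp_le mult_nonneg_nonneg order_trans)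
  then show "form \<nu> (Rop (1 / n) \<Gamma>) \<psi> \<psi> + n * form \<nu> \<Gamma> \<psi> \<psi> \<le> control_cost \<nu> \<rho> n \<Gamma> \<psi> x"
    unfolding J e_def by simp
  show "\<exists>x. form \<nu> (Rop (1 / n) \<Gamma>) \<psi> \<psi> + n * form \<nu> \<Gamma> \<psi> \<psi> = control_cost \<nu> \<rho> n \<Gamma> \<psi> x"
    unfolding J e_def by (intro exI[of _ "- (matrix_inv Nh *v s)"]) simp
qed

definition Gop :: "real \<Rightarrow> ('x \<Rightarrow> 'x \<Rightarrow> real^'d^'d) \<Rightarrow> 'x \<Rightarrow> 'x \<Rightarrow> real^'d^'d" where
  "Gop n \<Gamma> x y = Rop (1 / n) \<Gamma> x y + n *\<^sub>R \<Gamma> x y"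

lemma form_Gop:
  assumes dom: "dominating_measure M r \<nu> \<rho>"
    and k: "kern K \<Gamma>" and p: "integrable \<nu> \<psi>" and n: "0 < n"
  shows "integrable (\<nu> \<Otimes>\<^sub>M \<nu>) (\<lambda>z. \<psi> (fst z) \<bullet> (Gop n \<Gamma> (fst z) (snd z) *v \<psi> (snd z)))"
    and "form \<nu> (Gop n \<Gamma>) \<psi> \<psi> = form \<nu> (Rop (1 / n) \<Gamma>) \<psi> \<psi> + n * form \<nu> \<Gamma> \<psi> \<psi>"
proof -
  interpret dominating_measure M r \<nu> \<rho> by (rule dom)
  note i = form_Rop(1)[OF dom k p, of "1 / n"] form_integrable[OF k integrable_Lw[OF p] integrable_Lw[OF p]]
  have eq: "p \<bullet> (Gop n \<Gamma> x y *v q) = p \<bullet> (Rop (1 / n) \<Gamma> x y *v q) + n * (p \<bullet> (\<Gamma> x y *v q))" for p q x y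
    by (simp add: Gop_def matrix_vector_mult_add_rdistrib inner_add_right scaleR_matrix_vector_assoc[symmetric])
  show "integrable (\<nu> \<Otimes>\<^sub>M \<nu>) (\<lambda>z. \<psi> (fst z) \<bullet> (Gop n \<Gamma> (fst z) (snd z) *v \<psi> (snd z)))"
    unfolding eq using i by simp
  show "form \<nu> (Gop n \<Gamma>) \<psi> \<psi> = form \<nu> (Rop (1 / n) \<Gamma>) \<psi> \<psi> + n * form \<nu> \<Gamma> \<psi> \<psi>"
    unfolding form_def eq using i by simp
qed

lemma Gop_pd1:
  assumes k: "kern K \<Gamma>" and pd: "pd \<Gamma>" and n: "0 < n"
  shows "pd1 (Gop n \<Gamma>)"
  unfolding pd1_def
proof (intro allI impI)
  fix \<nu> \<rho> and \<psi> :: "'x \<Rightarrow> real^'d"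
  assume dom: "dominating_measure M r \<nu> \<rho>" and p: "integrable \<nu> \<psi>"
  interpret dominating_measure M r \<nu> \<rho> by (rule dom)
  obtain x where x: "form \<nu> (Rop (1 / n) \<Gamma>) \<psi> \<psi> + n * form \<nu> \<Gamma> \<psi> \<psi> = control_cost \<nu> \<rho> n \<Gamma> \<psi> x"
    using control_cost_min(2)[OF dom k pd p n] by blast
  have "0 \<le> x \<bullet> (N *v x)" using N_coercive[of x] l_pos by (meson inner_ge_zero less_imp_le mult_nonneg_nonneg order_trans)
  then have "0 \<le> control_cost \<nu> \<rho> n \<Gamma> \<psi> x"
    unfolding control_cost_def[OF dom] Let_def using n
    by (intro add_nonneg_nonneg mult_nonneg_nonneg pdD[OF pd dom] Q_nonneg Lw_add Lw_scaleR Lw_Hs[OF dom] integrable_Lw[OF p]) auto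
  then show "0 \<le> form \<nu> (Gop n \<Gamma>) \<psi> \<psi>"
    unfolding form_Gop(2)[OF dom k p n] x .
qed

lemma form_le_of_pd:
  fixes \<Gamma> \<Gamma>' :: "'x \<Rightarrow> 'x \<Rightarrow> real^'d^'d"
  assumes dom: "dominating_measure M r \<nu> \<rho>" and k: "kern K \<Gamma>" and k': "kern K' \<Gamma>'" and pd: "pd (\<lambda>x y. \<Gamma>' x y - \<Gamma> x y)"
    and L: "dominating_measure.Lw M r \<nu> \<psi>"
  shows "form \<nu> \<Gamma> \<psi> \<psi> \<le> form \<nu> \<Gamma>' \<psi> \<psi>"
proof -
  interpret dominating_measure M r \<nu> \<rho> by (rule dom)
  show ?thesis using pdD[OF pd dom L] form_diff[OF k' k L L] by simp
qed

lemma pd_of_diff: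
  fixes \<Gamma> \<Gamma>' :: "'x \<Rightarrow> 'x \<Rightarrow> real^'d^'d"
  assumes k: "kern K \<Gamma>" and k': "kern K' \<Gamma>'" and pd: "pd \<Gamma>" and d: "pd (\<lambda>x y. \<Gamma>' x y - \<Gamma> x y)"
  shows "pd \<Gamma>'"
  unfolding pd_def
proof (intro allI impI)
  fix \<nu> \<rho> and \<psi> :: "'x \<Rightarrow> real^'d"
  assume dom: "dominating_measure M r \<nu> \<rho>" and L: "dominating_measure.Lw M r \<nu> \<psi>"
  show "0 \<le> form \<nu> \<Gamma>' \<psi> \<psi>"
    using form_le_of_pd[OF dom k k' d L] pdD[OF pd dom L] by simp
qed

lemma pd_diff_trans:
  fixes \<Gamma>1 \<Gamma>2 \<Gamma>3 :: "'x \<Rightarrow> 'x \<Rightarrow> real^'d^'d"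
  assumes k1: "kern K1 \<Gamma>1" and k2: "kern K2 \<Gamma>2" and k3: "kern K3 \<Gamma>3"
    and a: "pd (\<lambda>x y. \<Gamma>1 x y - \<Gamma>2 x y)" and b: "pd (\<lambda>x y. \<Gamma>2 x y - \<Gamma>3 x y)"
  shows "pd (\<lambda>x y. \<Gamma>1 x y - \<Gamma>3 x y)"
proof (rule pd_of_diff[OF kern_diff[OF k2 k3] kern_diff[OF k1 k3] b])
  show "pd (\<lambda>x y. (\<Gamma>1 x y - \<Gamma>3 x y) - (\<Gamma>2 x y - \<Gamma>3 x y))" using a by simp
qed

text \<open>
  A minimum of monotone functions is monotone: the minimiser for the larger kernel is inserted into
  the cost of the smaller one.
\<close>

lemma Gop_mono:
  assumes k: "kern K \<Gamma>" and k': "kern K' \<Gamma>'" and pd: "pd \<Gamma>" and d: "pd (\<lambda>x y. \<Gamma>' x y - \<Gamma> x y)" and n: "0 < n"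
  shows "pd1 (\<lambda>x y. Gop n \<Gamma>' x y - Gop n \<Gamma> x y)"
  unfolding pd1_def
proof (intro allI impI)
  fix \<nu> \<rho> and \<psi> :: "'x \<Rightarrow> real^'d"
  assume dom: "dominating_measure M r \<nu> \<rho>" and p: "integrable \<nu> \<psi>"
  interpret dominating_measure M r \<nu> \<rho> by (rule dom)
  note pd' = pd_of_diff[OF k k' pd d]
  note le = form_le_of_pd[OF dom k k' d]
  obtain x where x: "form \<nu> (Rop (1 / n) \<Gamma>') \<psi> \<psi> + n * form \<nu> \<Gamma>' \<psi> \<psi> = control_cost \<nu> \<rho> n \<Gamma>' \<psi> x"
    using control_cost_min(2)[OF dom k' pd' p n] by blast
  have "form \<nu> (Gop n \<Gamma>) \<psi> \<psi> \<le> control_cost \<nu> \<rho> n \<Gamma> \<psi> x"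
    unfolding form_Gop(2)[OF dom k p n] by (rule control_cost_min(1)[OF dom k pd p n])
  also have "\<dots> \<le> control_cost \<nu> \<rho> n \<Gamma>' \<psi> x"
    unfolding control_cost_def[OF dom] Let_def using n
    by (intro add_mono mult_left_mono le order_refl Lw_add Lw_scaleR Lw_Hs[OF dom] integrable_Lw[OF p]) auto
  also have "\<dots> = form \<nu> (Gop n \<Gamma>') \<psi> \<psi>" unfolding form_Gop(2)[OF dom k' p n] x ..
  finally have "form \<nu> (Gop n \<Gamma>) \<psi> \<psi> \<le> form \<nu> (Gop n \<Gamma>') \<psi> \<psi>" .
  moreover have "form \<nu> (\<lambda>x y. Gop n \<Gamma>' x y - Gop n \<Gamma> x y) \<psi> \<psi> = form \<nu> (Gop n \<Gamma>') \<psi> \<psi> - form \<nu> (Gop n \<Gamma>) \<psi> \<psi>"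
    unfolding form_def using form_Gop(1)[OF dom k p n] form_Gop(1)[OF dom k' p n]
    by (simp add: matrix_vector_mult_diff_rdistrib inner_diff_right)
  ultimately show "0 \<le> form \<nu> (\<lambda>x y. Gop n \<Gamma>' x y - Gop n \<Gamma> x y) \<psi> \<psi>" by simp
qed

end

section \<open>Integration in time against decaying exponentials\<close>

lemma has_bochner_integral_exp:
  fixes b t T :: real
  assumes "t \<le> T" "b \<noteq> 0"
  shows "has_bochner_integral lborel (\<lambda>s. indicator {t..T} s * exp (- b * (s - t))) ((1 - exp (- b * (T - t))) / b)"
proof -
  have "has_bochner_integral lborel (\<lambda>s. exp (- b * (s - t)) * indicator {t..T} s)
      (- exp (- b * (T - t)) / b - (- exp (- b * (t - t)) / b))"
  proof (rule has_bochner_integral_FTC_Icc_real[OF assms(1)])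
    fix s
    show "((\<lambda>s. - exp (- b * (s - t)) / b) has_real_derivative exp (- b * (s - t))) (at s)"
      using assms(2) by (auto intro!: derivative_eq_intros)
    show "isCont (\<lambda>s. exp (- b * (s - t))) s" by (intro continuous_intros)
  qed
  then show ?thesis by (simp add: mult.commute diff_divide_distrib)
qed

lemma integrable_exp: "integrable lborel (\<lambda>s. indicator {t..T} s * exp (- b * (s - t)))" for b t T :: real
proof -
  have "set_integrable lborel {t..T} (\<lambda>s. exp (- b * (s - t)))"
    by (intro borel_integrable_atLeastAtMost') (intro continuous_intros)
  then show ?thesis by (simp add: set_integrable_def)
qed

text \<open>
  If \<open>a1\<close> or \<open>a2\<close> exceeds \<open>1\<close>, the integral is at most \<open>1 / (a1 + a2)\<close>, and
  \<open>max 1 a1 * max 1 a2 \<le> (a1 + a2)\<^sup>2\<close>. Otherwise both weights are \<open>1\<close> and the length of the interval is a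
  bound.
\<close>

lemma integral_exp_le:
  fixes b t T :: real
  assumes "0 \<le> a1" "0 \<le> a2" "a1 + a2 \<le> b" "0 \<le> t" "t \<le> T"
  shows "(\<integral>s. indicator {t..T} s * exp (- b * (s - t)) \<partial>lborel) \<le> (1 + T) * weight a1 * weight a2"
proof (cases "a1 \<le> 1 \<and> a2 \<le> 1")
  case True
  have "(\<integral>s. indicator {t..T} s * exp (- b * (s - t)) \<partial>lborel) \<le> (\<integral>s. indicator {t..T} s \<partial>lborel)"
  proof (rule integral_mono[OF integrable_exp])
    fix s
    show "indicator {t..T} s * exp (- b * (s - t)) \<le> (indicator {t..T} s :: real)"
      using assms by (auto simp: indicator_def mult_nonneg_nonneg)
  qed (use assms in simp)
  also have "\<dots> \<le> 1 + T" using assms by simp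
  finally show ?thesis using True by (simp add: weight_def)
next
  case False
  then have b: "0 < a1 + a2" "0 < b" using assms by auto
  have "(\<integral>s. indicator {t..T} s * exp (- b * (s - t)) \<partial>lborel) = (1 - exp (- b * (T - t))) / b"
    using b assms by (intro has_bochner_integral_integral_eq has_bochner_integral_exp) auto
  also have "\<dots> \<le> 1 / b" using b by (intro divide_right_mono) auto
  also have "\<dots> \<le> 1 / (a1 + a2)" using b assms by (intro divide_left_mono) auto
  also have "\<dots> \<le> weight a1 * weight a2"
  proof -
    have "sqrt (max 1 a1) * sqrt (max 1 a2) \<le> a1 + a2"
    proof (rule power2_le_imp_le)
      have "max 1 a1 * max 1 a2 \<le> (a1 + a2)\<^sup>2"
      proof -
        have a: "a1 * a2 \<le> (a1 + a2)\<^sup>2" using assms by (simp add: power2_eq_square algebra_simps)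
        have c: "a \<le> (a + a')\<^sup>2" if "1 \<le> a" "0 \<le> a'" for a a' :: real
        proof -
          have "a * 1 \<le> (a + a') * (a + a')" using that by (intro mult_mono) auto
          then show ?thesis by (simp add: power2_eq_square)
        qed
        show ?thesis using False a c[of a1 a2] c[of a2 a1] assms by (auto simp: max_def add.commute)
      qed
      then show "(sqrt (max 1 a1) * sqrt (max 1 a2))\<^sup>2 \<le> (a1 + a2)\<^sup>2"
        by (simp add: power_mult_distrib)
    qed (use b in simp)
    then show ?thesis
      unfolding weight_def using b by (simp add: field_simps mult_pos_pos less_max_iff_disj)
  qed
  also have "\<dots> \<le> (1 + T) * (weight a1 * weight a2)"
    using mult_right_mono[of 1 "1 + T" "weight a1 * weight a2"] weight_nonneg assms by simp
  finally show ?thesis by (simp add: mult.assoc)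
qed

text \<open>
  After a positive time \<open>u\<close>, the factor \<open>exp (- r x * u)\<close> makes every function of the class \<open>Lw\<close>
  integrable.
\<close>

lemma exp_le_weight:
  assumes "0 \<le> a" "0 < u"
  shows "exp (- a * u) \<le> (1 + 1 / u) * weight a"
proof (cases "a \<le> 1")
  case True
  then show ?thesis using assms by (simp add: weight_def add_increasing2 mult_nonneg_nonneg)
next
  case False
  have "a * u \<le> exp (a * u)" using exp_ge_add_one_self[of "a * u"] by linarith
  then have "exp (- a * u) \<le> 1 / (a * u)" using False assms by (simp add: exp_minus field_simps)
  also have "\<dots> \<le> 1 / u * (1 / sqrt a)"
  proof -
    have "sqrt a \<le> a" using False by (intro real_le_lsqrt) (auto simp: power2_eq_square)
    then show ?thesis using False assms by (simp add: field_simps)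
  qed
  also have "\<dots> \<le> (1 + 1 / u) * (1 / sqrt a)" using False by (intro mult_right_mono) auto
  also have "1 / sqrt a = weight a" using False by (simp add: weight_def)
  finally show ?thesis .
qed

text \<open>
  Adding \<open>\<delta>\<close> times the solution to the source of a linear equation is the same as changing the
  decay rate by \<open>\<delta>\<close>.
\<close>

lemma exp_integral_shift:
  fixes g :: "real \<Rightarrow> 'b::euclidean_space" and c \<delta> :: real
  assumes g [measurable]: "g \<in> borel_measurable borel" and bd: "\<And>s. s \<in> {0..T} \<Longrightarrow> norm (g s) \<le> K"
  assumes f: "\<And>s. s \<in> {0..T} \<Longrightarrow> f s = (LINT v:{s..T}|lborel. exp (- c * (v - s)) *\<^sub>R g v)"
    and t: "t \<in> {0..T}"
  shows "f t = (LINT s:{t..T}|lborel. exp (- (c + \<delta>) * (s - t)) *\<^sub>R (g s + \<delta> *\<^sub>R f s))"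
proof -
  let ?E = "\<lambda>s v. \<delta> * exp (- (c + \<delta>) * (s - t)) * exp (- c * (v - s))"
  let ?\<Phi> = "\<lambda>s v. (if t \<le> s \<and> s \<le> v \<and> v \<le> T then ?E s v else 0) *\<^sub>R g v"
  have "continuous_on ({t..T} \<times> {t..T}) (\<lambda>z. ?E (fst z) (snd z))"
    by (intro continuous_intros)
  then have "bounded ((\<lambda>z. ?E (fst z) (snd z)) ` ({t..T} \<times> {t..T}))"
    by (intro compact_imp_bounded compact_continuous_image compact_Times compact_Icc)
  then obtain K2 where K2': "\<forall>x\<in>(\<lambda>z. ?E (fst z) (snd z)) ` ({t..T} \<times> {t..T}). \<bar>x\<bar> \<le> K2"
    unfolding bounded_real by blast
  have K2: "\<bar>?E s v\<bar> \<le> K2" if "s \<in> {t..T}" "v \<in> {t..T}" for s v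
  proof -
    have "(\<lambda>z. ?E (fst z) (snd z)) (s, v) \<in> (\<lambda>z. ?E (fst z) (snd z)) ` ({t..T} \<times> {t..T})"
      using that by (intro imageI) simp
    from bspec[OF K2' this] show ?thesis by (simp only: fst_conv snd_conv)
  qed
  have K0: "0 \<le> K" using bd[OF t] norm_ge_zero[of "g t"] by linarith
  have K20: "0 \<le> K2" using K2[of t t] t by (auto intro: order_trans[OF abs_ge_zero])
  have int: "integrable (lborel \<Otimes>\<^sub>M lborel) (\<lambda>z. ?\<Phi> (fst z) (snd z))"
  proof (rule Bochner_Integration.integrable_bound)
    show "integrable (lborel \<Otimes>\<^sub>M lborel) (\<lambda>z. K2 * K * (indicator {t..T} (fst z) * indicator {t..T} (snd z)))"
      using t by (intro integrable_mult_right lborel_pair.integrable_times_fst_snd) auto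
    show "(\<lambda>z. ?\<Phi> (fst z) (snd z)) \<in> borel_measurable (lborel \<Otimes>\<^sub>M lborel)"
      by measurable
    show "AE z in lborel \<Otimes>\<^sub>M lborel. norm (?\<Phi> (fst z) (snd z)) \<le> norm (K2 * K * (indicator {t..T} (fst z) * indicator {t..T} (snd z)))"
    proof (intro always_eventually allI)
      fix z :: "real \<times> real"
      obtain s v where z: "z = (s, v)" by force
      show "norm (?\<Phi> (fst z) (snd z)) \<le> norm (K2 * K * (indicator {t..T} (fst z) * indicator {t..T} (snd z)))"
      proof (cases "t \<le> s \<and> s \<le> v \<and> v \<le> T")
        case True
        then have "\<bar>?E s v\<bar> * norm (g v) \<le> K2 * K"
          using t K20 by (intro mult_mono K2 bd) auto
        then show ?thesis using True K0 K20 unfolding z by (simp add: abs_mult)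
      next
        case False
        show ?thesis unfolding z fst_conv snd_conv if_not_P[OF False] by simp
      qed
    qed
  qed
  have gi: "integrable lborel (\<lambda>v. indicator {u..T} v *\<^sub>R exp (- b * (v - u)) *\<^sub>R g v)" if "u \<in> {0..T}" for b u
  proof (rule Bochner_Integration.integrable_bound)
    show "integrable lborel (\<lambda>v. K * (indicator {u..T} v * exp (- b * (v - u))))"
      using integrable_exp by (intro integrable_mult_right)
    show "AE v in lborel. norm (indicator {u..T} v *\<^sub>R exp (- b * (v - u)) *\<^sub>R g v) \<le> norm (K * (indicator {u..T} v * exp (- b * (v - u))))"
      using bd that K0 by (intro always_eventually allI) (auto simp: indicator_def abs_mult mult.commute[of K] intro!: mult_left_mono)
  qed measurable
  have inner1: "(\<integral>v. ?\<Phi> s v \<partial>lborel) = indicator {t..T} s *\<^sub>R (\<delta> * exp (- (c + \<delta>) * (s - t))) *\<^sub>R f s" for s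
  proof (cases "s \<in> {t..T}")
    case True
    then have s: "s \<in> {0..T}" using t by auto
    have "(\<integral>v. ?\<Phi> s v \<partial>lborel) = (\<integral>v. (\<delta> * exp (- (c + \<delta>) * (s - t))) *\<^sub>R (indicator {s..T} v *\<^sub>R exp (- c * (v - s)) *\<^sub>R g v) \<partial>lborel)"
      using True by (intro Bochner_Integration.integral_cong) (auto simp: indicator_def)
    also have "\<dots> = (\<delta> * exp (- (c + \<delta>) * (s - t))) *\<^sub>R (\<integral>v. indicator {s..T} v *\<^sub>R exp (- c * (v - s)) *\<^sub>R g v \<partial>lborel)"
      by (rule integral_scaleR_right)
    finally show ?thesis unfolding f[OF s] set_lebesgue_integral_def using True by simp
  next
    case False
    then have "(\<integral>v. ?\<Phi> s v \<partial>lborel) = integral\<^sup>L lborel (\<lambda>v::real. 0)"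
      by (intro Bochner_Integration.integral_cong) auto
    then show ?thesis using False by simp
  qed
  have inner2: "(\<integral>s. ?\<Phi> s v \<partial>lborel) = indicator {t..T} v *\<^sub>R ((exp (- c * (v - t)) - exp (- (c + \<delta>) * (v - t))) *\<^sub>R g v)" for v
  proof (cases "v \<in> {t..T}")
    case True
    have hb: "has_bochner_integral lborel (\<lambda>s. ?E s v * indicator {t..v} s)
       (- exp (- c * (v - t)) * exp (- \<delta> * (v - t)) - (- exp (- c * (v - t)) * exp (- \<delta> * (t - t))))"
    proof (rule has_bochner_integral_FTC_Icc_real)
      show "t \<le> v" using True by simp
      fix s
      have e: "exp (- (c + \<delta>) * (s - t)) * exp (- c * (v - s)) = exp (- c * (v - t)) * exp (- \<delta> * (s - t))"
        by (simp add: exp_add[symmetric] algebra_simps)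
      show "((\<lambda>s. - exp (- c * (v - t)) * exp (- \<delta> * (s - t))) has_real_derivative ?E s v) (at s)"
        unfolding mult.assoc e by (auto intro!: derivative_eq_intros)
      show "isCont (\<lambda>s. ?E s v) s" by (intro continuous_intros)
    qed
    have "(\<integral>s. ?\<Phi> s v \<partial>lborel) = (\<integral>s. (?E s v * indicator {t..v} s) *\<^sub>R g v \<partial>lborel)"
      using True by (intro Bochner_Integration.integral_cong) (auto simp: indicator_def)
    also have "\<dots> = (\<integral>s. ?E s v * indicator {t..v} s \<partial>lborel) *\<^sub>R g v"
      using integrable.intros[OF hb] by (intro integral_scaleR_left) simp
    also have "(\<integral>s. ?E s v * indicator {t..v} s \<partial>lborel)
        = - exp (- c * (v - t)) * exp (- \<delta> * (v - t)) - (- exp (- c * (v - t)) * exp (- \<delta> * (t - t)))"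
      by (rule has_bochner_integral_integral_eq[OF hb])
    also have "\<dots> = exp (- c * (v - t)) - exp (- (c + \<delta>) * (v - t))"
      by (simp add: exp_add[symmetric] algebra_simps)
    finally show ?thesis using True by simp
  next
    case False
    then have "(\<integral>s. ?\<Phi> s v \<partial>lborel) = integral\<^sup>L lborel (\<lambda>s::real. 0)"
      by (intro Bochner_Integration.integral_cong) auto
    then show ?thesis using False by simp
  qed
  have int': "integrable (lborel \<Otimes>\<^sub>M lborel) (case_prod ?\<Phi>)"
    using int by (simp add: split_beta')
  have fub: "(\<integral>s. indicator {t..T} s *\<^sub>R (\<delta> * exp (- (c + \<delta>) * (s - t))) *\<^sub>R f s \<partial>lborel)
     = (\<integral>v. indicator {t..T} v *\<^sub>R ((exp (- c * (v - t)) - exp (- (c + \<delta>) * (v - t))) *\<^sub>R g v) \<partial>lborel)"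
    using lborel_pair.Fubini_integral[OF int'] unfolding inner1 inner2 by simp
  have i1: "integrable lborel (\<lambda>s. indicator {t..T} s *\<^sub>R (\<delta> * exp (- (c + \<delta>) * (s - t))) *\<^sub>R f s)"
    using lborel_pair.integrable_fst[OF int'] unfolding inner1 .
  have i2: "integrable lborel (\<lambda>s. indicator {t..T} s *\<^sub>R (exp (- b * (s - t)) *\<^sub>R g s))" for b
    by (rule gi[OF t])
  have "(LINT s:{t..T}|lborel. exp (- (c + \<delta>) * (s - t)) *\<^sub>R (g s + \<delta> *\<^sub>R f s))
     = (\<integral>s. indicator {t..T} s *\<^sub>R (exp (- (c + \<delta>) * (s - t)) *\<^sub>R g s)
         + indicator {t..T} s *\<^sub>R (\<delta> * exp (- (c + \<delta>) * (s - t))) *\<^sub>R f s \<partial>lborel)"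
    unfolding set_lebesgue_integral_def
    by (intro Bochner_Integration.integral_cong) (auto simp: scaleR_add_right mult.commute)
  also have "\<dots> = (\<integral>s. indicator {t..T} s *\<^sub>R (exp (- (c + \<delta>) * (s - t)) *\<^sub>R g s) \<partial>lborel)
     + (\<integral>v. indicator {t..T} v *\<^sub>R ((exp (- c * (v - t)) - exp (- (c + \<delta>) * (v - t))) *\<^sub>R g v) \<partial>lborel)"
    by (subst Bochner_Integration.integral_add[OF i2[of "c + \<delta>"] i1]) (simp only: fub)
  also have "\<dots> = (\<integral>s. indicator {t..T} s *\<^sub>R (exp (- c * (s - t)) *\<^sub>R g s) \<partial>lborel)"
    using i2[of "c + \<delta>"] i2[of c]
    by (simp only: scaleR_diff_left scaleR_diff_right Bochner_Integration.integral_diff) simp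
  also have "\<dots> = f t" unfolding f[OF t] set_lebesgue_integral_def ..
  finally show ?thesis ..
qed

section \<open>Limits of decreasing kernels\<close>

context weighted_measure begin

lemma form_tendsto:
  assumes dom: "dominating_measure M r \<nu> \<rho>"
    and k: "\<And>i. kern K (\<Gamma> i)" and L: "dominating_measure.Lw M r \<nu> \<psi>"
    and lim: "\<And>x y. x \<in> space M \<Longrightarrow> y \<in> space M \<Longrightarrow> (\<lambda>i. \<Gamma> i x y) \<longlonglongrightarrow> \<Gamma>' x y" and k': "kern K \<Gamma>'"
  shows "(\<lambda>i::nat. form \<nu> (\<Gamma> i) \<psi> \<psi>) \<longlonglongrightarrow> form \<nu> \<Gamma>' \<psi> \<psi>"
proof -
  interpret dominating_measure M r \<nu> \<rho> by (rule dom)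
  have m: "\<psi> \<in> borel_measurable M" by (rule Lw_measurable[OF L])
  show ?thesis
    unfolding form_def
  proof (rule integral_dominated_convergence)
    show "integrable (\<nu> \<Otimes>\<^sub>M \<nu>) (\<lambda>z. K * ((w (fst z) * norm (\<psi> (fst z))) * (w (snd z) * norm (\<psi> (snd z)))))"
      using nu2.integrable_times_fst_snd[of "\<lambda>x. w x * norm (\<psi> x)" "\<lambda>x. w x * norm (\<psi> x)"] L
      unfolding Lw_def by (intro integrable_mult_right) auto
    show "(\<lambda>z. \<psi> (fst z) \<bullet> (\<Gamma>' (fst z) (snd z) *v \<psi> (snd z))) \<in> borel_measurable (\<nu> \<Otimes>\<^sub>M \<nu>)"
      by (intro form_measurable kern_measurable[OF k'] m)
    show "(\<lambda>z. \<psi> (fst z) \<bullet> (\<Gamma> i (fst z) (snd z) *v \<psi> (snd z))) \<in> borel_measurable (\<nu> \<Otimes>\<^sub>M \<nu>)" for i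
      by (intro form_measurable kern_measurable[OF k] m)
    show "AE z in \<nu> \<Otimes>\<^sub>M \<nu>. (\<lambda>i. \<psi> (fst z) \<bullet> (\<Gamma> i (fst z) (snd z) *v \<psi> (snd z)))
        \<longlonglongrightarrow> \<psi> (fst z) \<bullet> (\<Gamma>' (fst z) (snd z) *v \<psi> (snd z))"
      by (rule AE_I2) (auto simp: space_pair_measure space_\<nu> intro!: tendsto_inner tendsto_const tendsto_matrix_vector lim)
    show "AE z in \<nu> \<Otimes>\<^sub>M \<nu>. norm (\<psi> (fst z) \<bullet> (\<Gamma> i (fst z) (snd z) *v \<psi> (snd z)))
       \<le> K * ((w (fst z) * norm (\<psi> (fst z))) * (w (snd z) * norm (\<psi> (snd z))))" for i
    proof (intro always_eventually allI)
      fix z :: "'x \<times> 'x"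
      let ?x = "fst z" and ?y = "snd z"
      have "norm (\<psi> ?x \<bullet> (\<Gamma> i ?x ?y *v \<psi> ?y)) \<le> norm (\<psi> ?x) * (norm (\<Gamma> i ?x ?y) * norm (\<psi> ?y))"
        unfolding real_norm_def by (rule abs_inner_matrix_le)
      also have "\<dots> \<le> norm (\<psi> ?x) * ((K * w ?x * w ?y) * norm (\<psi> ?y))"
        by (intro mult_left_mono mult_right_mono kern_bound[OF k]) auto
      finally show "norm (\<psi> ?x \<bullet> (\<Gamma> i ?x ?y *v \<psi> ?y)) \<le> K * ((w ?x * norm (\<psi> ?x)) * (w ?y * norm (\<psi> ?y)))"
        by (simp add: ac_simps)
    qed
  qed
qed

text \<open>
  Positivity of the \<open>2 \<times> 2\<close> blocks bounds the off-diagonal entries by the diagonal, and the diagonal of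
  \<open>\<Gamma>\<close> lies below that of \<open>\<Gamma>'\<close>. The new constant does not depend on \<open>K\<close>.
\<close>

lemma kern_of_dominated:
  fixes \<Gamma> \<Gamma>' :: "'x \<Rightarrow> 'x \<Rightarrow> real^'d^'d"
  assumes k: "kern K \<Gamma>" and k': "kern K' \<Gamma>'" and pd: "pd \<Gamma>" and d: "pd (\<lambda>x y. \<Gamma>' x y - \<Gamma> x y)"
    and z: "\<And>x y. x \<notin> space M \<or> y \<notin> space M \<Longrightarrow> \<Gamma> x y = 0"
  shows "kern ((real CARD('d))\<^sup>2 * K') \<Gamma>"
  unfolding kern_def
proof (intro conjI allI)
  show "(\<lambda>z. \<Gamma> (fst z) (snd z)) \<in> borel_measurable (M \<Otimes>\<^sub>M M)" by (rule kern_measurable[OF k])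
  show "transpose (\<Gamma> y x) = \<Gamma> x y" for x y by (rule kern_sym[OF k])
  fix a b
  have K': "0 \<le> K'" by (rule kern_nonneg[OF k'])
  show "norm (\<Gamma> a b) \<le> (real CARD('d))\<^sup>2 * K' * w a * w b"
  proof (cases "a \<in> space M \<and> b \<in> space M")
    case False
    then show ?thesis using z[of a b] K' weight_nonneg by simp
  next
    case True
    then have ab: "a \<in> space M" "b \<in> space M" by auto
    have diag: "p \<bullet> (\<Gamma> x x *v p) \<le> K' * (w x * w x) * (norm p)\<^sup>2" if "x \<in> space M" for x p
    proof -
      have "0 \<le> p \<bullet> ((\<Gamma>' x x - \<Gamma> x x) *v p)"
        using pd_pointwise[OF kern_diff[OF k' k] d that that, of p 0] by simp
      then have "p \<bullet> (\<Gamma> x x *v p) \<le> p \<bullet> (\<Gamma>' x x *v p)"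
        by (simp add: matrix_vector_mult_diff_rdistrib inner_diff_right)
      also have "\<dots> \<le> norm p * (norm (\<Gamma>' x x) * norm p)"
        using abs_inner_matrix_le[of p "\<Gamma>' x x" p] by linarith
      also have "\<dots> \<le> norm p * ((K' * w x * w x) * norm p)"
        by (intro mult_left_mono mult_right_mono kern_bound[OF k']) auto
      finally show ?thesis by (simp add: power2_eq_square ac_simps)
    qed
    have entry: "\<bar>\<Gamma> a b $ i $ j\<bar> \<le> K' * w a * w b" for i j
    proof -
      define p where "p = (1 / w a) *\<^sub>R axis i (1::real)"
      define q where "q = (1 / w b) *\<^sub>R axis j (1::real)"
      have wp: "w a \<noteq> 0" "w b \<noteq> 0" "0 < w a" "0 < w b" using weight_pos[of "r a"] weight_pos[of "r b"] by auto
      have np: "K' * (w a * w a) * (norm p)\<^sup>2 = K'" "K' * (w b * w b) * (norm q)\<^sup>2 = K'"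
        using wp by (auto simp: p_def q_def norm_axis_1 power2_eq_square)
      have v: "p \<bullet> (\<Gamma> a b *v q) = \<Gamma> a b $ i $ j / (w a * w b)"
        unfolding p_def q_def by (simp add: matrix_vector_mult_scaleR matrix_vector_mult_basis column_def inner_axis')
      have 1: "0 \<le> p \<bullet> (\<Gamma> a a *v p) + q \<bullet> (\<Gamma> b b *v q) + 2 * (p \<bullet> (\<Gamma> a b *v q))"
        by (rule pd_pointwise[OF k pd ab])
      have 2: "0 \<le> p \<bullet> (\<Gamma> a a *v p) + q \<bullet> (\<Gamma> b b *v q) - 2 * (p \<bullet> (\<Gamma> a b *v q))"
        using pd_pointwise[OF k pd ab, of "- p" q] by (simp add: linear_neg[OF matrix_vector_mul_linear])
      have "\<bar>p \<bullet> (\<Gamma> a b *v q)\<bar> \<le> K'"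
        using 1 2 diag[OF ab(1), of p] diag[OF ab(2), of q] unfolding np by linarith
      then show ?thesis unfolding v using wp by (simp add: abs_mult field_simps)
    qed
    have "norm (\<Gamma> a b) \<le> (\<Sum>i\<in>UNIV. norm (\<Gamma> a b $ i))"
      unfolding norm_vec_def[of "\<Gamma> a b"] by (rule L2_set_le_sum) simp
    also have "\<dots> \<le> (\<Sum>i\<in>(UNIV::'d set). \<Sum>j\<in>(UNIV::'d set). \<bar>\<Gamma> a b $ i $ j\<bar>)"
      by (intro sum_mono norm_le_l1_cart)
    also have "\<dots> \<le> (\<Sum>i\<in>(UNIV::'d set). \<Sum>j\<in>(UNIV::'d set). K' * w a * w b)"
      by (intro sum_mono entry)
    also have "\<dots> = (real CARD('d))\<^sup>2 * K' * w a * w b" by (simp add: power2_eq_square)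
    finally show ?thesis .
  qed
qed

text \<open>
  The forms at functions supported on two points are decreasing and nonnegative, hence convergent;
  polarisation recovers the matrix entries.
\<close>

lemma decreasing_kern_convergent:
  fixes \<Gamma> :: "nat \<Rightarrow> 'x \<Rightarrow> 'x \<Rightarrow> real^'d^'d"
  assumes k: "\<And>i. kern K (\<Gamma> i)" and pd: "\<And>i. pd (\<Gamma> i)" and d: "\<And>i. pd (\<lambda>x y. \<Gamma> i x y - \<Gamma> (Suc i) x y)"
    and ab: "a \<in> space M" "b \<in> space M"
  shows "convergent (\<lambda>i. \<Gamma> i a b)"
proof -
  have dec: "convergent (\<lambda>i. p \<bullet> (\<Gamma> i x x *v p) + q \<bullet> (\<Gamma> i y y *v q) + 2 * (p \<bullet> (\<Gamma> i x y *v q)))"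
    (is "convergent ?f") if xy: "x \<in> space M" "y \<in> space M" for x y p q
  proof -
    have "?f (Suc i) \<le> ?f i" for i
      using pd_pointwise[OF kern_diff[OF k k] d xy, of p i q]
      by (simp add: matrix_vector_mult_diff_rdistrib inner_diff_right)
    then have "decseq ?f" by (rule decseq_SucI)
    moreover have "0 \<le> ?f i" for i by (rule pd_pointwise[OF k pd xy])
    ultimately obtain L where "?f \<longlonglongrightarrow> L" using decseq_convergent by blast
    then show ?thesis by (auto simp: convergent_def)
  qed
  have bil: "convergent (\<lambda>i. p \<bullet> (\<Gamma> i a b *v q))" for p q
  proof -
    have 1: "convergent (\<lambda>i. p \<bullet> (\<Gamma> i a a *v p))" using dec[OF ab(1,1), of p 0] by simp
    have 2: "convergent (\<lambda>i. q \<bullet> (\<Gamma> i b b *v q))" using dec[OF ab(2,2), of q 0] by simp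
    have "convergent (\<lambda>i. (1 / 2) * ((p \<bullet> (\<Gamma> i a a *v p) + q \<bullet> (\<Gamma> i b b *v q) + 2 * (p \<bullet> (\<Gamma> i a b *v q)))
        - p \<bullet> (\<Gamma> i a a *v p) - q \<bullet> (\<Gamma> i b b *v q)))"
      by (intro convergent_mult convergent_const convergent_diff dec ab 1 2)
    then show ?thesis by simp
  qed
  have "convergent (\<lambda>i. \<Gamma> i a b $ m $ n)" for m n
    using bil[of "axis m 1" "axis n 1"] by (simp add: matrix_vector_mult_basis column_def inner_axis')
  then obtain L where "\<And>m n. (\<lambda>i. \<Gamma> i a b $ m $ n) \<longlonglongrightarrow> L m n"
    unfolding convergent_def by metis
  then have "(\<lambda>i. \<Gamma> i a b) \<longlonglongrightarrow> (\<chi> m n. L m n)"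
    by (intro vec_tendstoI) simp
  then show ?thesis by (auto simp: convergent_def)
qed

end

section \<open>Linear equations in mild form\<close>

locale riccati_time = riccati_data M r h c B D C F Q N l
  for M :: "'x measure" and r and h :: "'x \<Rightarrow> real^'e^'d" and c :: real
    and B D :: "real^'d^'e" and C F :: "real^'m^'e" and Q :: "real^'d^'d" and N :: "real^'m^'m" and l :: real +
  fixes T :: real
  assumes T_pos: "0 < T"
begin

definition pmeas :: "(real \<Rightarrow> 'x \<Rightarrow> 'x \<Rightarrow> real^'d^'d) \<Rightarrow> bool" where
  "pmeas G \<longleftrightarrow> (\<lambda>p. G (fst p) (fst (snd p)) (snd (snd p))) \<in> borel_measurable (borel \<Otimes>\<^sub>M (M \<Otimes>\<^sub>M M))"

definition bpath :: "real \<Rightarrow> (real \<Rightarrow> 'x \<Rightarrow> 'x \<Rightarrow> real^'d^'d) \<Rightarrow> bool" where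
  "bpath K G \<longleftrightarrow> pmeas G \<and> (\<forall>s\<in>{0..T}. \<forall>x y. norm (G s x y) \<le> K)"

text \<open>
  Paths vanish outside their domain, so that a solution can be characterised by an equation between
  functions.
\<close>

definition kpath :: "real \<Rightarrow> (real \<Rightarrow> 'x \<Rightarrow> 'x \<Rightarrow> real^'d^'d) \<Rightarrow> bool" where
  "kpath K \<Gamma> \<longleftrightarrow> pmeas \<Gamma> \<and> (\<forall>s. kern K (\<Gamma> s)) \<and>
     (\<forall>s x y. s \<notin> {0..T} \<or> x \<notin> space M \<or> y \<notin> space M \<longrightarrow> \<Gamma> s x y = 0)"

text \<open>
  The solution with terminal value \<open>0\<close> of the linear equation with source \<open>G\<close> and decay rate
  \<open>r x + r y + n\<close>.
\<close>

definition Jop :: "real \<Rightarrow> (real \<Rightarrow> 'x \<Rightarrow> 'x \<Rightarrow> real^'d^'d) \<Rightarrow> real \<Rightarrow> 'x \<Rightarrow> 'x \<Rightarrow> real^'d^'d" where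
  "Jop n G t x y = (if t \<in> {0..T} \<and> x \<in> space M \<and> y \<in> space M
     then (LINT s:{t..T}|lborel. exp (- (r x + r y + n) * (s - t)) *\<^sub>R G s x y) else 0)"

lemma pmeas_time_section:
  assumes "pmeas G" "x \<in> space M" "y \<in> space M"
  shows "(\<lambda>s. G s x y) \<in> borel_measurable borel"
proof -
  have "(\<lambda>s. (\<lambda>p. G (fst p) (fst (snd p)) (snd (snd p))) (s, (x, y))) \<in> borel_measurable borel"
    by (rule measurable_compose[OF _ assms(1)[unfolded pmeas_def]])
      (use assms(2,3) in \<open>auto intro!: measurable_Pair simp: space_pair_measure\<close>)
  then show ?thesis by simp
qed

lemma pmeas_space_section:
  assumes "pmeas G"
  shows "(\<lambda>z. G s (fst z) (snd z)) \<in> borel_measurable (M \<Otimes>\<^sub>M M)"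
proof -
  have "(\<lambda>z. (\<lambda>p. G (fst p) (fst (snd p)) (snd (snd p))) (s, z)) \<in> borel_measurable (M \<Otimes>\<^sub>M M)"
    by (rule measurable_compose[OF _ assms(1)[unfolded pmeas_def]]) auto
  then show ?thesis by simp
qed

lemma bpath_nonneg: "bpath K G \<Longrightarrow> 0 \<le> K"
  using T_pos unfolding bpath_def by (metis atLeastAtMost_iff less_imp_le norm_ge_zero order_refl order_trans)

lemma J_dominated:
  assumes "bpath K G" "t \<in> {0..T}"
  shows "norm (indicator {t..T} s *\<^sub>R (exp (- b * (s - t)) *\<^sub>R G s x y)) \<le> K * (indicator {t..T} s * exp (- b * (s - t)))"
  using assms unfolding bpath_def by (auto simp: indicator_def mult.commute[of K] intro!: mult_left_mono)

lemma J_integrable: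
  assumes b: "bpath K G" and t: "t \<in> {0..T}" and xy: "x \<in> space M" "y \<in> space M"
  shows "set_integrable lborel {t..T} (\<lambda>s. exp (- b * (s - t)) *\<^sub>R G s x y)"
  unfolding set_integrable_def
proof (rule Bochner_Integration.integrable_bound)
  show "integrable lborel (\<lambda>s. K * (indicator {t..T} s * exp (- b * (s - t))))"
    using integrable_exp by (intro integrable_mult_right)
  have [measurable]: "(\<lambda>s. G s x y) \<in> borel_measurable borel"
    using b xy by (intro pmeas_time_section) (auto simp: bpath_def)
  show "(\<lambda>s. indicator {t..T} s *\<^sub>R exp (- b * (s - t)) *\<^sub>R G s x y) \<in> borel_measurable lborel" by measurable
  show "AE s in lborel. norm (indicator {t..T} s *\<^sub>R exp (- b * (s - t)) *\<^sub>R G s x y) \<le> norm (K * (indicator {t..T} s * exp (- b * (s - t))))"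
    using J_dominated[OF b t] by (intro always_eventually allI) (metis abs_ge_self order_trans real_norm_def)
qed

lemma J_bound:
  assumes b: "bpath K G" and n: "0 \<le> n"
  shows "norm (Jop n G t x y) \<le> K * (1 + T) * w x * w y"
proof (cases "t \<in> {0..T} \<and> x \<in> space M \<and> y \<in> space M")
  case True
  have "norm (LINT s:{t..T}|lborel. exp (- (r x + r y + n) * (s - t)) *\<^sub>R G s x y)
     \<le> (\<integral>s. K * (indicator {t..T} s * exp (- (r x + r y + n) * (s - t))) \<partial>lborel)"
    unfolding set_lebesgue_integral_def using True
    by (intro norm_integral_le integrable_mult_right integrable_exp always_eventually allI J_dominated[OF b]) auto
  also have "\<dots> = K * (\<integral>s. indicator {t..T} s * exp (- (r x + r y + n) * (s - t)) \<partial>lborel)"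
    by simp
  also have "\<dots> \<le> K * ((1 + T) * w x * w y)"
    using True n r_nonneg by (intro mult_left_mono integral_exp_le bpath_nonneg[OF b]) auto
  finally show ?thesis using True by (simp add: Jop_def mult.assoc)
next
  case False
  show ?thesis unfolding Jop_def if_not_P[OF False] using bpath_nonneg[OF b] T_pos weight_nonneg by simp
qed

lemma J_pmeas:
  assumes b: "pmeas G"
  shows "pmeas (Jop n G)"
proof -
  let ?f = "\<lambda>p s. (if fst p \<le> s \<and> s \<le> T then 1 else 0) *\<^sub>R exp (- (r (fst (snd p)) + r (snd (snd p)) + n) * (s - fst p)) *\<^sub>R G s (fst (snd p)) (snd (snd p))"
  have G: "(\<lambda>q. (\<lambda>p. G (fst p) (fst (snd p)) (snd (snd p))) (snd q, snd (fst q))) \<in> borel_measurable ((borel \<Otimes>\<^sub>M (M \<Otimes>\<^sub>M M)) \<Otimes>\<^sub>M lborel)"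
    by (rule measurable_compose[OF _ b[unfolded pmeas_def]]) measurable
  then have [measurable]: "(\<lambda>q. G (snd q) (fst (snd (fst q))) (snd (snd (fst q)))) \<in> borel_measurable ((borel \<Otimes>\<^sub>M (M \<Otimes>\<^sub>M M)) \<Otimes>\<^sub>M lborel)"
    by simp
  have "(\<lambda>(p, s). ?f p s) \<in> borel_measurable ((borel \<Otimes>\<^sub>M (M \<Otimes>\<^sub>M M)) \<Otimes>\<^sub>M lborel)"
    unfolding split_beta' by measurable
  then have "(\<lambda>p. \<integral>s. ?f p s \<partial>lborel) \<in> borel_measurable (borel \<Otimes>\<^sub>M (M \<Otimes>\<^sub>M M))"
    by (rule lborel.borel_measurable_lebesgue_integral)
  then have *: "(\<lambda>p. if fst p \<in> {0..T} then \<integral>s. ?f p s \<partial>lborel else 0) \<in> borel_measurable (borel \<Otimes>\<^sub>M (M \<Otimes>\<^sub>M M))"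
    by measurable
  have ind: "indicator {t..T} s = (if t \<le> s \<and> s \<le> T then 1 else (0::real))" for t s by (simp add: indicator_def)
  show ?thesis
    unfolding pmeas_def
    by (rule measurable_cong[THEN iffD1, OF _ *]) (auto simp: Jop_def set_lebesgue_integral_def ind space_pair_measure)
qed

lemma J_kpath:
  assumes b: "bpath K G" and n: "0 \<le> n"
    and sym: "\<And>s x y. s \<in> {0..T} \<Longrightarrow> transpose (G s y x) = G s x y"
  shows "kpath (K * (1 + T)) (Jop n G)"
  unfolding kpath_def kern_def
proof (intro conjI allI impI)
  show p: "pmeas (Jop n G)" using b by (intro J_pmeas) (simp add: bpath_def)
  show "(\<lambda>z. Jop n G s (fst z) (snd z)) \<in> borel_measurable (M \<Otimes>\<^sub>M M)" for s by (rule pmeas_space_section[OF p])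
  show "norm (Jop n G s x y) \<le> K * (1 + T) * w x * w y" for s x y by (rule J_bound[OF b n])
  show "s \<notin> {0..T} \<or> x \<notin> space M \<or> y \<notin> space M \<Longrightarrow> Jop n G s x y = 0" for s x y by (auto simp: Jop_def)
  show "transpose (Jop n G s y x) = Jop n G s x y" for s x y
  proof (cases "s \<in> {0..T} \<and> x \<in> space M \<and> y \<in> space M")
    case True
    have "transpose (LINT v:{s..T}|lborel. exp (- (r y + r x + n) * (v - s)) *\<^sub>R G v y x)
       = (LINT v:{s..T}|lborel. transpose (exp (- (r y + r x + n) * (v - s)) *\<^sub>R G v y x))"
      using J_integrable[OF b, of s y x "r y + r x + n"] True
      unfolding set_lebesgue_integral_def set_integrable_def
      by (subst integral_bounded_linear[OF bounded_linear_transpose, symmetric]) (auto simp: transpose_scaleR)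
    also have "\<dots> = (LINT v:{s..T}|lborel. exp (- (r x + r y + n) * (v - s)) *\<^sub>R G v x y)"
      using sym True by (intro set_lebesgue_integral_cong) (auto simp: transpose_scaleR add.commute)
    finally show ?thesis using True by (simp add: Jop_def)
  next
    case False then show ?thesis by (auto simp: Jop_def transpose_def vec_eq_iff)
  qed
qed

lemma J_diff:
  assumes "bpath K G" "bpath K' G'"
  shows "Jop n G t x y - Jop n G' t x y = Jop n (\<lambda>s x y. G s x y - G' s x y) t x y"
  using J_integrable[OF assms(1), of t x y "r x + r y + n"] J_integrable[OF assms(2), of t x y "r x + r y + n"]
  by (auto simp: Jop_def scaleR_diff_right)

lemma bpath_diff:
  assumes "bpath K G" "bpath K' G'"
  shows "bpath (K + K') (\<lambda>s x y. G s x y - G' s x y)"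
  unfolding bpath_def pmeas_def
proof (intro conjI ballI allI)
  show "(\<lambda>p. G (fst p) (fst (snd p)) (snd (snd p)) - G' (fst p) (fst (snd p)) (snd (snd p))) \<in> borel_measurable (borel \<Otimes>\<^sub>M (M \<Otimes>\<^sub>M M))"
    using assms by (intro borel_measurable_diff) (auto simp: bpath_def pmeas_def)
  fix s x y assume "s \<in> {0..T}"
  then have "norm (G s x y) \<le> K" "norm (G' s x y) \<le> K'" using assms by (auto simp: bpath_def)
  then show "norm (G s x y - G' s x y) \<le> K + K'" using norm_triangle_ineq4[of "G s x y" "G' s x y"] by linarith
qed

text \<open>
  By Fubini the form is an integral over \<open>s \<ge> t\<close> of the forms of \<open>G s\<close> at \<open>\<lambda>x. exp (- r x * (s - t)) *\<^sub>R \<psi> x\<close>,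
  because the exponential is a product of a function of \<open>x\<close> and one of \<open>y\<close>. For \<open>s > t\<close> this function is
  integrable even if \<open>\<psi>\<close> is just of class \<open>Lw\<close>, so that \<open>pd1\<close> applies to it.
\<close>

lemma J_pd:
  assumes b: "bpath K G" and n: "0 \<le> n" and t: "t \<in> {0..T}" and pd: "\<And>s. s \<in> {0..T} \<Longrightarrow> pd1 (G s)"
  shows "pd (Jop n G t)"
  unfolding pd_def
proof (intro allI impI)
  fix \<nu> \<rho> and \<psi> :: "'x \<Rightarrow> real^'d"
  assume dom: "dominating_measure M r \<nu> \<rho>" and L: "dominating_measure.Lw M r \<nu> \<psi>"
  interpret dominating_measure M r \<nu> \<rho> by (rule dom)
  interpret P: sigma_finite_measure "\<nu> \<Otimes>\<^sub>M \<nu>" by (rule nu2.sigma_finite_measure_axioms)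
  interpret PL: pair_sigma_finite "\<nu> \<Otimes>\<^sub>M \<nu>" lborel ..
  let ?b = "\<lambda>z. r (fst z) + r (snd z) + n"
  define f where "f z s = (if t \<le> s \<and> s \<le> T then 1 else 0) * (exp (- ?b z * (s - t)) * (\<psi> (fst z) \<bullet> (G s (fst z) (snd z) *v \<psi> (snd z))))" for z s
  have K0: "0 \<le> K" by (rule bpath_nonneg[OF b])
  have ind: "indicator {t..T} s = (if t \<le> s \<and> s \<le> T then 1 else (0::real))" for s by (simp add: indicator_def)
  note [measurable] = Lw_measurable[OF L]
  have pm: "pmeas G" using b by (simp add: bpath_def)
  have set2: "sets (borel \<Otimes>\<^sub>M (M \<Otimes>\<^sub>M M)) = sets (borel \<Otimes>\<^sub>M (\<nu> \<Otimes>\<^sub>M \<nu>))"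
    by (intro sets_pair_measure_cong sets_\<nu>[symmetric] refl)
  have pm': "(\<lambda>p. G (fst p) (fst (snd p)) (snd (snd p))) \<in> borel_measurable (borel \<Otimes>\<^sub>M (\<nu> \<Otimes>\<^sub>M \<nu>))"
    using pm unfolding pmeas_def by (simp only: measurable_cong_sets[OF set2 refl])
  have G: "(\<lambda>q. (\<lambda>p. G (fst p) (fst (snd p)) (snd (snd p))) (snd q, fst q)) \<in> borel_measurable ((\<nu> \<Otimes>\<^sub>M \<nu>) \<Otimes>\<^sub>M lborel)"
    by (rule measurable_compose[OF _ pm']) measurable
  then have [measurable]: "(\<lambda>q. G (snd q) (fst (fst q)) (snd (fst q))) \<in> borel_measurable ((\<nu> \<Otimes>\<^sub>M \<nu>) \<Otimes>\<^sub>M lborel)"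
    by simp
  have fmeas: "(\<lambda>q. f (fst q) (snd q)) \<in> borel_measurable ((\<nu> \<Otimes>\<^sub>M \<nu>) \<Otimes>\<^sub>M lborel)"
    unfolding f_def by measurable
  have ib: "\<bar>\<psi> (fst z) \<bullet> (G s (fst z) (snd z) *v \<psi> (snd z))\<bar> \<le> K * (norm (\<psi> (fst z)) * norm (\<psi> (snd z)))"
    if "s \<in> {0..T}" for z s
  proof -
    have "\<bar>\<psi> (fst z) \<bullet> (G s (fst z) (snd z) *v \<psi> (snd z))\<bar> \<le> norm (\<psi> (fst z)) * (norm (G s (fst z) (snd z)) * norm (\<psi> (snd z)))"
      by (rule abs_inner_matrix_le)
    also have "\<dots> \<le> norm (\<psi> (fst z)) * (K * norm (\<psi> (snd z)))"
      using b that unfolding bpath_def by (intro mult_left_mono mult_right_mono) auto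
    finally show ?thesis by (simp add: ac_simps)
  qed
  have fb: "norm (f z s) \<le> K * (norm (\<psi> (fst z)) * norm (\<psi> (snd z))) * (indicator {t..T} s * exp (- ?b z * (s - t)))" for z s
    using ib[of s z] t by (auto simp: f_def ind abs_mult mult.commute[of "K * _"] intro!: mult_left_mono)
  have bi: "integrable lborel (\<lambda>s. K * (norm (\<psi> (fst z)) * norm (\<psi> (snd z))) * (indicator {t..T} s * exp (- ?b z * (s - t))))" for z
    by (intro integrable_mult_right integrable_exp)
  have fi: "integrable lborel (f z)" if z: "z \<in> space (\<nu> \<Otimes>\<^sub>M \<nu>)" for z
  proof (rule Bochner_Integration.integrable_bound[OF bi[of z]])
    have "(\<lambda>s. (\<lambda>q. f (fst q) (snd q)) (z, s)) \<in> borel_measurable lborel"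
      by (rule measurable_compose[OF measurable_Pair1'[OF z] fmeas])
    then show "f z \<in> borel_measurable lborel" by simp
    show "AE s in lborel. norm (f z s) \<le> norm (K * (norm (\<psi> (fst z)) * norm (\<psi> (snd z))) * (indicator {t..T} s * exp (- ?b z * (s - t))))"
      by (intro always_eventually allI, rule order_trans[OF fb], unfold real_norm_def, rule abs_ge_self)
  qed
  have int: "integrable ((\<nu> \<Otimes>\<^sub>M \<nu>) \<Otimes>\<^sub>M lborel) (\<lambda>q. f (fst q) (snd q))"
  proof (rule PL.Fubini_integrable[OF fmeas])
    show "AE z in \<nu> \<Otimes>\<^sub>M \<nu>. integrable lborel (\<lambda>s. f (fst (z, s)) (snd (z, s)))"
      using fi by (intro AE_I2) simp
    show "integrable (\<nu> \<Otimes>\<^sub>M \<nu>) (\<lambda>z. \<integral>s. norm (f (fst (z, s)) (snd (z, s))) \<partial>lborel)"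
    proof (rule Bochner_Integration.integrable_bound)
      show "integrable (\<nu> \<Otimes>\<^sub>M \<nu>) (\<lambda>z. K * (1 + T) * ((w (fst z) * norm (\<psi> (fst z))) * (w (snd z) * norm (\<psi> (snd z)))))"
        using nu2.integrable_times_fst_snd[of "\<lambda>x. w x * norm (\<psi> x)" "\<lambda>x. w x * norm (\<psi> x)"] L
        unfolding Lw_def by (intro integrable_mult_right) auto
      have "(\<lambda>(z, s). norm (f z s)) \<in> borel_measurable ((\<nu> \<Otimes>\<^sub>M \<nu>) \<Otimes>\<^sub>M lborel)"
        using measurable_compose[OF fmeas borel_measurable_norm] by (simp add: split_beta')
      then show "(\<lambda>z. \<integral>s. norm (f (fst (z, s)) (snd (z, s))) \<partial>lborel) \<in> borel_measurable (\<nu> \<Otimes>\<^sub>M \<nu>)"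
        using lborel.borel_measurable_lebesgue_integral[of "\<lambda>z s. norm (f z s)"] by simp
      show "AE z in \<nu> \<Otimes>\<^sub>M \<nu>. norm (\<integral>s. norm (f (fst (z, s)) (snd (z, s))) \<partial>lborel)
         \<le> norm (K * (1 + T) * ((w (fst z) * norm (\<psi> (fst z))) * (w (snd z) * norm (\<psi> (snd z)))))"
      proof (rule AE_I2)
        fix z assume z: "z \<in> space (\<nu> \<Otimes>\<^sub>M \<nu>)"
        have "norm (\<integral>s. norm (f z s) \<partial>lborel) \<le> (\<integral>s. K * (norm (\<psi> (fst z)) * norm (\<psi> (snd z))) * (indicator {t..T} s * exp (- ?b z * (s - t))) \<partial>lborel)"
          using fb[of z] by (intro norm_integral_le[OF bi]) simp
        also have "\<dots> = K * (norm (\<psi> (fst z)) * norm (\<psi> (snd z))) * (\<integral>s. indicator {t..T} s * exp (- ?b z * (s - t)) \<partial>lborel)"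
          by simp
        also have "\<dots> \<le> K * (norm (\<psi> (fst z)) * norm (\<psi> (snd z))) * ((1 + T) * w (fst z) * w (snd z))"
          using t n K0 r_nonneg by (intro mult_left_mono integral_exp_le) auto
        also have "\<dots> \<le> norm (K * (1 + T) * ((w (fst z) * norm (\<psi> (fst z))) * (w (snd z) * norm (\<psi> (snd z)))))"
          by (simp add: ac_simps order_trans[OF _ abs_ge_self])
        finally show "norm (\<integral>s. norm (f (fst (z, s)) (snd (z, s))) \<partial>lborel)
         \<le> norm (K * (1 + T) * ((w (fst z) * norm (\<psi> (fst z))) * (w (snd z) * norm (\<psi> (snd z)))))" by simp
      qed
    qed
  qed
  have "form \<nu> (Jop n G t) \<psi> \<psi> = (\<integral>z. \<integral>s. f z s \<partial>lborel \<partial>(\<nu> \<Otimes>\<^sub>M \<nu>))"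
    unfolding form_def
  proof (rule Bochner_Integration.integral_cong[OF refl])
    fix z assume z: "z \<in> space (\<nu> \<Otimes>\<^sub>M \<nu>)"
    then have zz: "fst z \<in> space M" "snd z \<in> space M" by (auto simp: space_pair_measure space_\<nu>)
    note i = J_integrable[OF b t zz, of "?b z", unfolded set_integrable_def]
    have bl: "bounded_linear (\<lambda>A. \<psi> (fst z) \<bullet> (A *v \<psi> (snd z)))"
      by (rule bounded_linear_compose[OF bounded_linear_inner_right bounded_linear_matrix_vector_left])
    have "\<psi> (fst z) \<bullet> (Jop n G t (fst z) (snd z) *v \<psi> (snd z))
       = (\<integral>s. \<psi> (fst z) \<bullet> ((indicator {t..T} s *\<^sub>R (exp (- ?b z * (s - t)) *\<^sub>R G s (fst z) (snd z))) *v \<psi> (snd z)) \<partial>lborel)"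
      using t zz unfolding Jop_def set_lebesgue_integral_def
      by (subst integral_bounded_linear[OF bl i]) simp
    also have "\<dots> = (\<integral>s. f z s \<partial>lborel)"
      by (intro Bochner_Integration.integral_cong refl) (simp add: f_def ind scaleR_matrix_vector_assoc[symmetric])
    finally show "\<psi> (fst z) \<bullet> (Jop n G t (fst z) (snd z) *v \<psi> (snd z)) = (\<integral>s. f z s \<partial>lborel)" .
  qed
  also have "\<dots> = (\<integral>s. \<integral>z. f z s \<partial>(\<nu> \<Otimes>\<^sub>M \<nu>) \<partial>lborel)"
    using PL.Fubini_integral[of f] int by (simp add: split_beta')
  also have "\<dots> \<ge> 0"
  proof (rule integral_nonneg_AE)
    have "AE s in lborel. s \<noteq> t" by (rule AE_lborel_singleton)
    then show "AE s in lborel. 0 \<le> (\<integral>z. f z s \<partial>(\<nu> \<Otimes>\<^sub>M \<nu>))"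
    proof eventually_elim
      case (elim s)
      show ?case
      proof (cases "t \<le> s \<and> s \<le> T")
        case True
        then have u: "0 < s - t" using elim by auto
        let ?\<psi> = "\<lambda>x. exp (- r x * (s - t)) *\<^sub>R \<psi> x"
        have "integrable \<nu> ?\<psi>"
        proof (rule Bochner_Integration.integrable_bound)
          show "integrable \<nu> (\<lambda>x. (1 + 1 / (s - t)) * (w x * norm (\<psi> x)))" using L unfolding Lw_def by simp
          show "?\<psi> \<in> borel_measurable \<nu>" by measurable
          show "AE x in \<nu>. norm (?\<psi> x) \<le> norm ((1 + 1 / (s - t)) * (w x * norm (\<psi> x)))"
          proof (intro always_eventually allI)
            fix x
            have "norm (?\<psi> x) \<le> ((1 + 1 / (s - t)) * w x) * norm (\<psi> x)"
              using exp_le_weight[OF r_nonneg u, of x] by (simp add: mult_right_mono)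
            then show "norm (?\<psi> x) \<le> norm ((1 + 1 / (s - t)) * (w x * norm (\<psi> x)))"
              by (simp add: mult.assoc order_trans[OF _ abs_ge_self])
          qed
        qed
        then have "0 \<le> form \<nu> (G s) ?\<psi> ?\<psi>" using True t by (intro pd1D[OF pd dom]) auto
        then have "0 \<le> exp (- n * (s - t)) * form \<nu> (G s) ?\<psi> ?\<psi>" by simp
        also have "\<dots> = (\<integral>z. f z s \<partial>(\<nu> \<Otimes>\<^sub>M \<nu>))"
        proof -
          have e: "exp (- (a + b + n) * (s - t)) = exp (- n * (s - t)) * (exp (- b * (s - t)) * exp (- a * (s - t)))" for a b
            by (simp add: exp_add[symmetric] algebra_simps)
          have "f z s = exp (- n * (s - t)) * (?\<psi> (fst z) \<bullet> (G s (fst z) (snd z) *v ?\<psi> (snd z)))" for z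
            unfolding f_def e matrix_vector_mult_scaleR inner_scaleR_left inner_scaleR_right
            using True by (simp only: if_True simp_thms mult_1_left mult.assoc)
          then show ?thesis unfolding form_def by (simp only: integral_mult_right_zero)
        qed
        finally show ?thesis .
      next
        case False
        show ?thesis unfolding f_def if_not_P[OF False] by simp
      qed
    qed
  qed
  finally show "0 \<le> form \<nu> (Jop n G t) \<psi> \<psi>" .
qed

lemma J_shift:
  assumes b: "bpath K G" and eq: "\<And>s. s \<in> {0..T} \<Longrightarrow> \<Gamma> s x y = Jop n G s x y"
    and t: "t \<in> {0..T}" and xy: "x \<in> space M" "y \<in> space M"
  shows "\<Gamma> t x y = Jop (n + \<delta>) (\<lambda>s x y. G s x y + \<delta> *\<^sub>R \<Gamma> s x y) t x y"
proof -
  have "\<Gamma> t x y = (LINT s:{t..T}|lborel. exp (- ((r x + r y + n) + \<delta>) * (s - t)) *\<^sub>R (G s x y + \<delta> *\<^sub>R \<Gamma> s x y))"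
  proof (rule exp_integral_shift[OF _ _ _ t])
    show "(\<lambda>s. G s x y) \<in> borel_measurable borel" using b xy by (intro pmeas_time_section) (auto simp: bpath_def)
    show "norm (G s x y) \<le> K" if "s \<in> {0..T}" for s using b that by (auto simp: bpath_def)
    show "\<Gamma> s x y = (LINT v:{s..T}|lborel. exp (- (r x + r y + n) * (v - s)) *\<^sub>R G v x y)" if "s \<in> {0..T}" for s
      using eq[OF that] that xy by (simp add: Jop_def)
  qed
  then show ?thesis using t xy by (simp add: Jop_def add.assoc)
qed

lemma J_tendsto:
  assumes b: "\<And>i. bpath K (G i)" and b': "bpath K G'"
    and lim: "\<And>s. s \<in> {0..T} \<Longrightarrow> (\<lambda>i. G i s x y) \<longlonglongrightarrow> G' s x y"
    and t: "t \<in> {0..T}" and xy: "x \<in> space M" "y \<in> space M"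
  shows "(\<lambda>i::nat. Jop k (G i) t x y) \<longlonglongrightarrow> Jop k G' t x y"
proof -
  have "(\<lambda>i. LINT s:{t..T}|lborel. exp (- (r x + r y + k) * (s - t)) *\<^sub>R G i s x y)
    \<longlonglongrightarrow> (LINT s:{t..T}|lborel. exp (- (r x + r y + k) * (s - t)) *\<^sub>R G' s x y)"
    unfolding set_lebesgue_integral_def
  proof (rule integral_dominated_convergence)
    show "integrable lborel (\<lambda>s. K * (indicator {t..T} s * exp (- (r x + r y + k) * (s - t))))"
      by (intro integrable_mult_right integrable_exp)
    show "(\<lambda>s. indicator {t..T} s *\<^sub>R exp (- (r x + r y + k) * (s - t)) *\<^sub>R G' s x y) \<in> borel_measurable lborel"
      using J_integrable[OF b' t xy] unfolding set_integrable_def by (rule borel_measurable_integrable)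
    show "(\<lambda>s. indicator {t..T} s *\<^sub>R exp (- (r x + r y + k) * (s - t)) *\<^sub>R G i s x y) \<in> borel_measurable lborel" for i
      using J_integrable[OF b t xy] unfolding set_integrable_def by (rule borel_measurable_integrable)
    show "AE s in lborel. (\<lambda>i. indicator {t..T} s *\<^sub>R exp (- (r x + r y + k) * (s - t)) *\<^sub>R G i s x y)
       \<longlonglongrightarrow> indicator {t..T} s *\<^sub>R exp (- (r x + r y + k) * (s - t)) *\<^sub>R G' s x y"
    proof (intro always_eventually allI)
      fix s
      show "(\<lambda>i. indicator {t..T} s *\<^sub>R exp (- (r x + r y + k) * (s - t)) *\<^sub>R G i s x y)
       \<longlonglongrightarrow> indicator {t..T} s *\<^sub>R exp (- (r x + r y + k) * (s - t)) *\<^sub>R G' s x y"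
        using t by (cases "s \<in> {t..T}") (auto intro!: tendsto_scaleR tendsto_const lim)
    qed
    show "AE s in lborel. norm (indicator {t..T} s *\<^sub>R exp (- (r x + r y + k) * (s - t)) *\<^sub>R G i s x y)
       \<le> K * (indicator {t..T} s * exp (- (r x + r y + k) * (s - t)))" for i
      by (intro always_eventually allI J_dominated[OF b t])
  qed
  then show ?thesis using t xy by (simp add: Jop_def)
qed

end

section \<open>Monotone iteration\<close>

context riccati_data begin

lemma Y_tendsto:
  assumes k: "\<And>i. kern K (\<Gamma> i)" and k': "kern K \<Gamma>'" and y: "y \<in> space M"
    and lim: "\<And>x y. x \<in> space M \<Longrightarrow> y \<in> space M \<Longrightarrow> (\<lambda>i. \<Gamma> i x y) \<longlonglongrightarrow> \<Gamma>' x y"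
  shows "(\<lambda>i::nat. Yop (\<Gamma> i) y) \<longlonglongrightarrow> Yop \<Gamma>' y"
  unfolding Yop_def
proof (rule integral_dominated_convergence)
  show "integrable M (\<lambda>x. c * K * w y * w x)" using integrable_weight by simp
  show "(\<lambda>x. transpose (h x) ** \<Gamma>' x y) \<in> borel_measurable M"
    by (rule borel_measurable_integrable[OF Y_integrable[OF k' y]])
  show "(\<lambda>x. transpose (h x) ** \<Gamma> i x y) \<in> borel_measurable M" for i
    by (rule borel_measurable_integrable[OF Y_integrable[OF k y]])
  show "AE x in M. (\<lambda>i. transpose (h x) ** \<Gamma> i x y) \<longlonglongrightarrow> transpose (h x) ** \<Gamma>' x y"
    by (rule AE_I2) (intro tendsto_matrix_mult tendsto_const lim y)
  show "AE x in M. norm (transpose (h x) ** \<Gamma> i x y) \<le> c * K * w y * w x" for i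
    by (rule Y_bound_AE[OF k])
qed

lemma X_tendsto:
  assumes k: "\<And>i. kern K (\<Gamma> i)" and k': "kern K \<Gamma>'"
    and lim: "\<And>x y. x \<in> space M \<Longrightarrow> y \<in> space M \<Longrightarrow> (\<lambda>i. \<Gamma> i x y) \<longlonglongrightarrow> \<Gamma>' x y"
  shows "(\<lambda>i::nat. Xop (\<Gamma> i)) \<longlonglongrightarrow> Xop \<Gamma>'"
  unfolding Xop_def
proof (rule integral_dominated_convergence)
  show "integrable M (\<lambda>y. c * K * W1 * c * w y)" using integrable_weight by simp
  show "(\<lambda>y. Yop \<Gamma>' y ** h y) \<in> borel_measurable M"
    by (rule borel_measurable_integrable[OF X_integrable[OF k']])
  show "(\<lambda>y. Yop (\<Gamma> i) y ** h y) \<in> borel_measurable M" for i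
    by (rule borel_measurable_integrable[OF X_integrable[OF k]])
  show "AE y in M. (\<lambda>i. Yop (\<Gamma> i) y ** h y) \<longlonglongrightarrow> Yop \<Gamma>' y ** h y"
    by (rule AE_I2) (intro tendsto_matrix_mult tendsto_const Y_tendsto[OF k k'] lim)
  show "AE y in M. norm (Yop (\<Gamma> i) y ** h y) \<le> c * K * W1 * c * w y" for i
    by (rule X_bound_AE[OF k])
qed

lemma Ralg_tendsto:
  assumes "(e \<longlongrightarrow> e') Fl" "(X \<longlongrightarrow> X') Fl" "(U \<longlongrightarrow> U') Fl" "(V \<longlongrightarrow> V') Fl" "invertible (Nalg e' X')"
  shows "((\<lambda>i. Ralg (e i) (X i) (U i) (V i)) \<longlongrightarrow> Ralg e' X' U' V') Fl"
proof -
  have N: "((\<lambda>i. Nalg (e i) (X i)) \<longlongrightarrow> Nalg e' X') Fl"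
    unfolding Nalg_def by (intro tendsto_intros tendsto_matrix_mult assms)
  have S: "((\<lambda>i. Salg (e i) (X i) (V i)) \<longlongrightarrow> Salg e' X' V') Fl" if "(V \<longlongrightarrow> V') Fl" for V V'
    unfolding Salg_def by (intro tendsto_intros tendsto_matrix_mult assms that)
  show ?thesis
    unfolding Ralg_def
    by (intro tendsto_intros tendsto_matrix_mult tendsto_transpose tendsto_cramer_inv S N assms)
qed

lemma Nalg_invertible:
  assumes k: "kern K \<Gamma>" and pd: "pd \<Gamma>" and e: "0 \<le> \<epsilon>"
  shows "invertible (Nalg \<epsilon> (Xop \<Gamma>))"
  by (rule coercive_invertible[OF l_pos Nalg_coercive[OF Xop_nonneg[OF k pd] e]])

lemma Rop_tendsto:
  assumes k: "\<And>i. kern K (\<Gamma> i)" and k': "kern K \<Gamma>'" and pd: "pd \<Gamma>'" and e: "e \<longlonglongrightarrow> e'" "0 \<le> e'"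
    and lim: "\<And>x y. x \<in> space M \<Longrightarrow> y \<in> space M \<Longrightarrow> (\<lambda>i. \<Gamma> i x y) \<longlonglongrightarrow> \<Gamma>' x y"
    and xy: "x \<in> space M" "y \<in> space M"
  shows "(\<lambda>i::nat. Rop (e i) (\<Gamma> i) x y) \<longlonglongrightarrow> Rop e' \<Gamma>' x y"
  unfolding Rop_def
  by (intro Ralg_tendsto e X_tendsto[OF k k' lim] Y_tendsto[OF k k'] lim xy Nalg_invertible[OF k' pd e(2)])

definition Rbd :: "real \<Rightarrow> real" where
  "Rbd K = Rbound (max (c * K * W1) (c * K * W1 * c * W1))"

lemma Rop_bound:
  assumes k: "kern K \<Gamma>" and pd: "pd \<Gamma>" and e: "0 \<le> \<epsilon>" "\<epsilon> \<le> 1"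
  shows "norm (Rop \<epsilon> \<Gamma> x y) \<le> Rbd K"
proof -
  have Y: "norm (Yop \<Gamma> x) \<le> max (c * K * W1) (c * K * W1 * c * W1)" for x
  proof -
    have "norm (Yop \<Gamma> x) \<le> c * K * W1 * w x" by (rule Y_bound[OF k])
    also have "\<dots> \<le> c * K * W1 * 1"
      using c_nonneg kern_nonneg[OF k] W1_nonneg weight_le_1 by (intro mult_left_mono mult_nonneg_nonneg) auto
    finally show ?thesis by simp
  qed
  show ?thesis
    unfolding Rop_def Rbd_def using X_bound[OF k]
    by (intro Ralg_bound Y e Xop_nonneg[OF k pd]) simp
qed

lemma Rop_sym: "kern K \<Gamma> \<Longrightarrow> pd \<Gamma> \<Longrightarrow> 0 \<le> \<epsilon> \<Longrightarrow> transpose (Rop \<epsilon> \<Gamma> y x) = Rop \<epsilon> \<Gamma> x y"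
  unfolding Rop_def by (intro Ralg_sym Xop_sym Nalg_invertible)

text \<open>
  For every control value the cost, without \<open>n\<close> times the form at \<open>\<psi>\<close>, depends on \<open>n\<close> through the
  noise term \<open>1 / n\<close> times the form at \<open>Hs u\<close> alone.
\<close>

lemma Rop_decreasing_in_n:
  assumes k: "kern K \<Gamma>" and pd: "pd \<Gamma>" and n: "0 < n" "n \<le> n'"
  shows "pd1 (\<lambda>x y. Rop (1 / n) \<Gamma> x y - Rop (1 / n') \<Gamma> x y)"
  unfolding pd1_def
proof (intro allI impI)
  fix \<nu> \<rho> and \<psi> :: "'x \<Rightarrow> real^'d"
  assume dom: "dominating_measure M r \<nu> \<rho>" and p: "integrable \<nu> \<psi>"
  interpret dominating_measure M r \<nu> \<rho> by (rule dom)
  have n': "0 < n'" using n by simp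
  have J: "control_cost \<nu> \<rho> n' \<Gamma> \<psi> x - n' * form \<nu> \<Gamma> \<psi> \<psi> \<le> control_cost \<nu> \<rho> n \<Gamma> \<psi> x - n * form \<nu> \<Gamma> \<psi> \<psi>" for x
  proof -
    define u where "u = B *v (\<integral>x. \<psi> x \<partial>\<nu>) + C *v x"
    define X where "X = form \<nu> \<Gamma> (Hs \<rho> u) (Hs \<rho> u)"
    define Y where "Y = form \<nu> \<Gamma> (Hs \<rho> u) \<psi>"
    have X0: "0 \<le> X" unfolding X_def by (rule pdD[OF pd dom Lw_Hs[OF dom]])
    have "m * form \<nu> \<Gamma> (\<lambda>z. \<psi> z + (1 / m) *\<^sub>R Hs \<rho> u z) (\<lambda>z. \<psi> z + (1 / m) *\<^sub>R Hs \<rho> u z) - m * form \<nu> \<Gamma> \<psi> \<psi>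
       = 2 * Y + (1 / m) * X" if "0 < m" for m
      unfolding form_add_scaleR[OF k integrable_Lw[OF p] Lw_Hs[OF dom]] X_def Y_def using that
      by (simp add: field_simps power2_eq_square)
    from this[OF n'] this[OF n(1)] have "n' * form \<nu> \<Gamma> (\<lambda>z. \<psi> z + (1 / n') *\<^sub>R Hs \<rho> u z) (\<lambda>z. \<psi> z + (1 / n') *\<^sub>R Hs \<rho> u z) - n' * form \<nu> \<Gamma> \<psi> \<psi>
      \<le> n * form \<nu> \<Gamma> (\<lambda>z. \<psi> z + (1 / n) *\<^sub>R Hs \<rho> u z) (\<lambda>z. \<psi> z + (1 / n) *\<^sub>R Hs \<rho> u z) - n * form \<nu> \<Gamma> \<psi> \<psi>"
      using mult_right_mono[OF _ X0, of "1 / n'" "1 / n"] n by (simp add: frac_le)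
    then show ?thesis
      unfolding control_cost_def[OF dom] Let_def u_def[symmetric] by linarith
  qed
  obtain x where x: "form \<nu> (Rop (1 / n) \<Gamma>) \<psi> \<psi> + n * form \<nu> \<Gamma> \<psi> \<psi> = control_cost \<nu> \<rho> n \<Gamma> \<psi> x"
    using control_cost_min(2)[OF dom k pd p n(1)] by blast
  have "form \<nu> (Rop (1 / n') \<Gamma>) \<psi> \<psi> \<le> form \<nu> (Rop (1 / n) \<Gamma>) \<psi> \<psi>"
    using control_cost_min(1)[OF dom k pd p n', of x] J[of x] x by linarith
  moreover have "form \<nu> (\<lambda>x y. Rop (1 / n) \<Gamma> x y - Rop (1 / n') \<Gamma> x y) \<psi> \<psi> = form \<nu> (Rop (1 / n) \<Gamma>) \<psi> \<psi> - form \<nu> (Rop (1 / n') \<Gamma>) \<psi> \<psi>"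
    unfolding form_def using form_Rop(1)[OF dom k p, of "1 / n"] form_Rop(1)[OF dom k p, of "1 / n'"] n
    by (simp add: matrix_vector_mult_diff_rdistrib inner_diff_right)
  ultimately show "0 \<le> form \<nu> (\<lambda>x y. Rop (1 / n) \<Gamma> x y - Rop (1 / n') \<Gamma> x y) \<psi> \<psi>" by simp
qed

end

context weighted_measure begin

lemma pd_tendsto:
  fixes \<Delta> :: "nat \<Rightarrow> 'x \<Rightarrow> 'x \<Rightarrow> real^'d^'d"
  assumes k: "\<And>i. kern K (\<Delta> i)" and k': "kern K \<Delta>'" and pd: "\<And>i. i \<ge> start \<Longrightarrow> pd (\<Delta> i)"
    and lim: "\<And>x y. x \<in> space M \<Longrightarrow> y \<in> space M \<Longrightarrow> (\<lambda>i. \<Delta> i x y) \<longlonglongrightarrow> \<Delta>' x y"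
  shows "pd \<Delta>'"
  unfolding pd_def
proof (intro allI impI)
  fix \<nu> \<rho> and \<psi> :: "'x \<Rightarrow> real^'d"
  assume dom: "dominating_measure M r \<nu> \<rho>" and L: "dominating_measure.Lw M r \<nu> \<psi>"
  show "0 \<le> form \<nu> \<Delta>' \<psi> \<psi>"
    using form_tendsto[OF dom k L lim k'] pdD[OF pd dom L] by (intro LIMSEQ_le_const) auto
qed

lemma kern_mono: "kern K \<Gamma> \<Longrightarrow> K \<le> L \<Longrightarrow> kern L \<Gamma>"
  unfolding kern_def using weight_nonneg by (meson mult_right_mono order_trans)

lemma kern_zero:
  fixes \<Gamma> :: "'x \<Rightarrow> 'x \<Rightarrow> real^'b^'b"
  shows "0 \<le> K \<Longrightarrow> (\<And>x y. \<Gamma> x y = 0) \<Longrightarrow> kern K \<Gamma>"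
proof -
  assume K: "0 \<le> K" and z: "\<And>x y. \<Gamma> x y = 0"
  have e: "\<Gamma> = (\<lambda>_ _. 0)" using z by (intro ext)
  have "transpose 0 = (0 :: real^'b^'b)" by (simp add: transpose_def vec_eq_iff)
  then show "kern K \<Gamma>" unfolding e kern_def using K weight_nonneg by simp
qed

lemma kern_scaleR:
  fixes \<Gamma> :: "'x \<Rightarrow> 'x \<Rightarrow> real^'d^'d"
  assumes "kern K \<Gamma>" "0 \<le> a"
  shows "kern (a * K) (\<lambda>x y. a *\<^sub>R \<Gamma> x y)"
  unfolding kern_def
proof (intro conjI allI)
  show "(\<lambda>z. a *\<^sub>R \<Gamma> (fst z) (snd z)) \<in> borel_measurable (M \<Otimes>\<^sub>M M)"
    using kern_measurable[OF assms(1)] by measurable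
  show "norm (a *\<^sub>R \<Gamma> x y) \<le> a * K * w x * w y" for x y
    using mult_left_mono[OF kern_bound[OF assms(1), of x y] assms(2)] assms(2) by (simp add: mult.assoc)
  show "transpose (a *\<^sub>R \<Gamma> y x) = a *\<^sub>R \<Gamma> x y" for x y
    by (simp add: transpose_scaleR kern_sym[OF assms(1)])
qed

lemma pd_scaleR:
  fixes \<Gamma> :: "'x \<Rightarrow> 'x \<Rightarrow> real^'d^'d"
  assumes "pd \<Gamma>" "0 \<le> a"
  shows "pd (\<lambda>x y. a *\<^sub>R \<Gamma> x y)"
proof -
  have "form \<nu> (\<lambda>x y. a *\<^sub>R \<Gamma> x y) \<psi> \<psi> = a * form \<nu> \<Gamma> \<psi> \<psi>" for \<nu> and \<psi> :: "'x \<Rightarrow> real^'d"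
    unfolding form_def by (simp add: scaleR_matrix_vector_assoc[symmetric])
  then show ?thesis using assms unfolding pd_def by simp
qed

end

context riccati_time begin

text \<open>
  \<open>mild_step n\<close> has the solutions of the equation with the perturbed nonlinearity \<open>Rop (1 / n)\<close> as its
  fixed points: adding \<open>n *\<^sub>R \<Gamma>\<close> to the source compensates the additional decay rate \<open>n\<close>.
\<close>

definition pd_path :: "real \<Rightarrow> (real \<Rightarrow> 'x \<Rightarrow> 'x \<Rightarrow> real^'d^'d) \<Rightarrow> bool" where
  "pd_path K \<Gamma> \<longleftrightarrow> kpath K \<Gamma> \<and> (\<forall>t\<in>{0..T}. pd (\<Gamma> t))"

definition mild_step :: "real \<Rightarrow> (real \<Rightarrow> 'x \<Rightarrow> 'x \<Rightarrow> real^'d^'d) \<Rightarrow> real \<Rightarrow> 'x \<Rightarrow> 'x \<Rightarrow> real^'d^'d" where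
  "mild_step n \<Gamma> = Jop n (\<lambda>s. Gop n (\<Gamma> s))"

lemma pd_pathD:
  assumes "pd_path K \<Gamma>"
  shows "pmeas \<Gamma>" "kern K (\<Gamma> s)" "t \<in> {0..T} \<Longrightarrow> pd (\<Gamma> t)"
    "s \<notin> {0..T} \<or> x \<notin> space M \<or> y \<notin> space M \<Longrightarrow> \<Gamma> s x y = 0"
  using assms unfolding pd_path_def kpath_def by blast+

lemma pmeas_Yop:
  assumes pm: "pmeas \<Gamma>"
  shows "(\<lambda>p. Yop (\<Gamma> (fst p)) (snd p)) \<in> borel_measurable (borel \<Otimes>\<^sub>M M)"
proof -
  have "(\<lambda>q. (\<lambda>p. \<Gamma> (fst p) (fst (snd p)) (snd (snd p))) (fst (fst q), (snd q, snd (fst q)))) \<in> borel_measurable ((borel \<Otimes>\<^sub>M M) \<Otimes>\<^sub>M M)"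
    by (rule measurable_compose[OF _ pm[unfolded pmeas_def]]) measurable
  then have [measurable]: "(\<lambda>q. \<Gamma> (fst (fst q)) (snd q) (snd (fst q))) \<in> borel_measurable ((borel \<Otimes>\<^sub>M M) \<Otimes>\<^sub>M M)"
    by simp
  have "(\<lambda>(p, x). transpose (h x) ** \<Gamma> (fst p) x (snd p)) \<in> borel_measurable ((borel \<Otimes>\<^sub>M M) \<Otimes>\<^sub>M M)"
    unfolding split_beta' by measurable
  then show ?thesis
    unfolding Yop_def by (rule borel_measurable_lebesgue_integral)
qed

lemma pmeas_Rop:
  assumes pm: "pmeas \<Gamma>"
  shows "pmeas (\<lambda>s. Rop \<epsilon> (\<Gamma> s))"
proof -
  note Y = pmeas_Yop[OF pm]
  then have "(\<lambda>(s, y). Yop (\<Gamma> s) y ** h y) \<in> borel_measurable (borel \<Otimes>\<^sub>M M)"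
    unfolding split_beta' by measurable
  then have X: "(\<lambda>s. Xop (\<Gamma> s)) \<in> borel_measurable borel"
    unfolding Xop_def by (rule borel_measurable_lebesgue_integral)
  have "(\<lambda>p. (\<lambda>p. Yop (\<Gamma> (fst p)) (snd p)) (fst p, fst (snd p))) \<in> borel_measurable (borel \<Otimes>\<^sub>M (M \<Otimes>\<^sub>M M))"
    "(\<lambda>p. (\<lambda>p. Yop (\<Gamma> (fst p)) (snd p)) (fst p, snd (snd p))) \<in> borel_measurable (borel \<Otimes>\<^sub>M (M \<Otimes>\<^sub>M M))"
    by (rule measurable_compose[OF _ Y], measurable)+
  then have Y12: "(\<lambda>p. Yop (\<Gamma> (fst p)) (fst (snd p))) \<in> borel_measurable (borel \<Otimes>\<^sub>M (M \<Otimes>\<^sub>M M))"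
    "(\<lambda>p. Yop (\<Gamma> (fst p)) (snd (snd p))) \<in> borel_measurable (borel \<Otimes>\<^sub>M (M \<Otimes>\<^sub>M M))"
    by simp_all
  have X1: "(\<lambda>p. Xop (\<Gamma> (fst p))) \<in> borel_measurable (borel \<Otimes>\<^sub>M (M \<Otimes>\<^sub>M M))"
    by (rule measurable_compose[OF measurable_fst X])
  show ?thesis
    unfolding pmeas_def Rop_def Ralg_def Salg_def Nalg_def
    by (intro borel_measurable_add borel_measurable_diff borel_measurable_scaleR borel_measurable_matrix_mult
      borel_measurable_transpose borel_measurable_cramer_inv borel_measurable_const Y12 X1)
qed

lemma bpath_Rop:
  assumes a: "pd_path K \<Gamma>" and e: "0 \<le> \<epsilon>" "\<epsilon> \<le> 1"
  shows "bpath (Rbd K) (\<lambda>s. Rop \<epsilon> (\<Gamma> s))"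
  unfolding bpath_def using a pmeas_Rop[OF pd_pathD(1)[OF a]]
  by (auto simp: pd_path_def intro!: Rop_bound[OF pd_pathD(2)[OF a] _ e])

lemma pd_path_bound: 
  assumes a: "pd_path K \<Gamma>" shows "norm (\<Gamma> s x y) \<le> K"
proof -
  have "norm (\<Gamma> s x y) \<le> K * w x * w y" by (rule kern_bound[OF pd_pathD(2)[OF a]])
  also have "\<dots> \<le> K * 1 * 1"
    using kern_nonneg[OF pd_pathD(2)[OF a]] weight_le_1 weight_nonneg by (intro mult_mono mult_left_mono) auto
  finally show ?thesis by simp
qed

lemma bpath_add_scaleR:
  assumes b: "bpath K G" and a: "pd_path L \<Gamma>"
  shows "bpath (K + \<bar>n\<bar> * L) (\<lambda>s x y. G s x y + n *\<^sub>R \<Gamma> s x y)"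
  unfolding bpath_def pmeas_def
proof (intro conjI ballI allI)
  show "(\<lambda>p. G (fst p) (fst (snd p)) (snd (snd p)) + n *\<^sub>R \<Gamma> (fst p) (fst (snd p)) (snd (snd p))) \<in> borel_measurable (borel \<Otimes>\<^sub>M (M \<Otimes>\<^sub>M M))"
    using b pd_pathD(1)[OF a] by (intro borel_measurable_add borel_measurable_scaleR borel_measurable_const) (auto simp: bpath_def pmeas_def)
  fix s x y assume "s \<in> {0..T}"
  then have "norm (G s x y) \<le> K" using b by (auto simp: bpath_def)
  moreover have "norm (n *\<^sub>R \<Gamma> s x y) \<le> \<bar>n\<bar> * L" using pd_path_bound[OF a, of s x y] by (simp add: mult_left_mono)
  ultimately show "norm (G s x y + n *\<^sub>R \<Gamma> s x y) \<le> K + \<bar>n\<bar> * L" by (intro norm_triangle_le add_mono)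
qed

lemma bpath_Gop:
  assumes a: "pd_path K \<Gamma>" and n: "1 \<le> n"
  shows "bpath (Rbd K + \<bar>n\<bar> * K) (\<lambda>s. Gop n (\<Gamma> s))"
  using bpath_add_scaleR[OF bpath_Rop[OF a, of "1 / n"] a, of n] n
  by (simp add: Gop_def[abs_def])

lemma step_pd_path:
  assumes a: "pd_path K \<Gamma>" and n: "1 \<le> n"
  shows "pd_path ((Rbd K + \<bar>n\<bar> * K) * (1 + T)) (mild_step n \<Gamma>)"
  unfolding pd_path_def mild_step_def
proof (intro conjI ballI)
  have n0: "0 \<le> n" "0 < n" "0 \<le> 1 / n" using n by auto
  show "kpath ((Rbd K + \<bar>n\<bar> * K) * (1 + T)) (Jop n (\<lambda>s. Gop n (\<Gamma> s)))"
  proof (rule J_kpath[OF bpath_Gop[OF a n] n0(1)])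
    fix s x y assume "s \<in> {0..T}"
    then show "transpose (Gop n (\<Gamma> s) y x) = Gop n (\<Gamma> s) x y"
      using Rop_sym[OF pd_pathD(2,3)[OF a] n0(3)] by (simp add: Gop_def transpose_add transpose_scaleR kern_sym[OF pd_pathD(2)[OF a]])
  qed
  show "pd (Jop n (\<lambda>s. Gop n (\<Gamma> s)) t)" if "t \<in> {0..T}" for t
    by (rule J_pd[OF bpath_Gop[OF a n] n0(1) that]) (rule Gop_pd1[OF pd_pathD(2,3)[OF a] n0(2)])
qed

lemma step_mono:
  assumes a: "pd_path K \<Gamma>" and a': "pd_path K' \<Gamma>'" and n: "1 \<le> n" and t: "t \<in> {0..T}"
    and d: "\<And>s. s \<in> {0..T} \<Longrightarrow> pd (\<lambda>x y. \<Gamma>' s x y - \<Gamma> s x y)"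
  shows "pd (\<lambda>x y. mild_step n \<Gamma>' t x y - mild_step n \<Gamma> t x y)"
proof -
  have n0: "0 \<le> n" "0 < n" using n by auto
  note b = bpath_Gop[OF a n] and b' = bpath_Gop[OF a' n]
  have "pd (Jop n (\<lambda>s x y. Gop n (\<Gamma>' s) x y - Gop n (\<Gamma> s) x y) t)"
    by (rule J_pd[OF bpath_diff[OF b' b] n0(1) t]) (intro Gop_mono[OF pd_pathD(2)[OF a] pd_pathD(2)[OF a'] pd_pathD(3)[OF a] d n0(2)])
  then show ?thesis unfolding mild_step_def J_diff[OF b' b] .
qed

text \<open>
  Everything follows from pointwise convergence, since all bounds are uniform in \<open>i\<close>.
\<close>

lemma decreasing_limit:
  assumes a: "\<And>i. pd_path K (\<Gamma> i)"
    and d: "\<And>i t. t \<in> {0..T} \<Longrightarrow> pd (\<lambda>x y. \<Gamma> i t x y - \<Gamma> (Suc i) t x y)"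
  shows "\<exists>\<Gamma>'. pd_path K \<Gamma>' \<and> (\<forall>t x y. (\<lambda>i. \<Gamma> i t x y) \<longlonglongrightarrow> \<Gamma>' t x y) \<and>
    (\<forall>i. \<forall>t\<in>{0..T}. pd (\<lambda>x y. \<Gamma> i t x y - \<Gamma>' t x y))"
proof -
  define \<Gamma>' where "\<Gamma>' t x y = lim (\<lambda>i. \<Gamma> i t x y)" for t x y
  have lim: "(\<lambda>i. \<Gamma> i t x y) \<longlonglongrightarrow> \<Gamma>' t x y" for t x y
  proof (cases "t \<in> {0..T} \<and> x \<in> space M \<and> y \<in> space M")
    case True
    then have "convergent (\<lambda>i. \<Gamma> i t x y)"
      by (intro decreasing_kern_convergent[where \<Gamma> = "\<lambda>i. \<Gamma> i t", OF pd_pathD(2)[OF a] pd_pathD(3)[OF a] d]) auto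
    then show ?thesis unfolding \<Gamma>'_def by (simp add: convergent_LIMSEQ_iff)
  next
    case False
    then have "\<Gamma> i t x y = 0" for i using pd_pathD(4)[OF a] by blast
    then show ?thesis unfolding \<Gamma>'_def by simp
  qed
  have pm: "pmeas \<Gamma>'"
    unfolding pmeas_def
    by (rule borel_measurable_LIMSEQ_metric[where f = "\<lambda>i p. \<Gamma> i (fst p) (fst (snd p)) (snd (snd p))"])
      (use pd_pathD(1)[OF a] lim in \<open>auto simp: pmeas_def\<close>)
  have kern: "kern K (\<Gamma>' s)" for s
    unfolding kern_def
  proof (intro conjI allI)
    show "(\<lambda>z. \<Gamma>' s (fst z) (snd z)) \<in> borel_measurable (M \<Otimes>\<^sub>M M)" by (rule pmeas_space_section[OF pm])
    show "norm (\<Gamma>' s x y) \<le> K * w x * w y" for x y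
      by (rule LIMSEQ_le_const2[OF tendsto_norm[OF lim]]) (use kern_bound[OF pd_pathD(2)[OF a]] in blast)
    show "transpose (\<Gamma>' s y x) = \<Gamma>' s x y" for x y
      by (rule LIMSEQ_unique[OF tendsto_transpose[OF lim]]) (simp add: kern_sym[OF pd_pathD(2)[OF a]] lim)
  qed
  have zero: "\<Gamma>' s x y = 0" if "s \<notin> {0..T} \<or> x \<notin> space M \<or> y \<notin> space M" for s x y
  proof -
    have "\<Gamma> i s x y = 0" for i using pd_pathD(4)[OF a that] .
    then show ?thesis using lim[of s x y] by (simp add: LIMSEQ_const_iff)
  qed
  have pd: "pd (\<Gamma>' t)" if "t \<in> {0..T}" for t
    by (rule pd_tendsto[OF pd_pathD(2)[OF a] kern pd_pathD(3)[OF a that] lim])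
  have chain: "pd (\<lambda>x y. \<Gamma> i t x y - \<Gamma> (i + j) t x y)" if t: "t \<in> {0..T}" for i j t
  proof (induction j)
    case 0 show ?case by (simp add: pd_def form_def)
  next
    case (Suc j)
    show ?case
      using pd_diff_trans[OF pd_pathD(2)[OF a] pd_pathD(2)[OF a] pd_pathD(2)[OF a] Suc d[OF t, of "i + j"]] by simp
  qed
  have "pd (\<lambda>x y. \<Gamma> i t x y - \<Gamma>' t x y)" if t: "t \<in> {0..T}" for i t
  proof (rule pd_tendsto[where \<Delta> = "\<lambda>j x y. \<Gamma> i t x y - \<Gamma> j t x y" and start = i])
    show "kern (K + K) (\<lambda>x y. \<Gamma> i t x y - \<Gamma> j t x y)" for j by (intro kern_diff pd_pathD(2)[OF a])
    show "kern (K + K) (\<lambda>x y. \<Gamma> i t x y - \<Gamma>' t x y)" by (intro kern_diff pd_pathD(2)[OF a] kern)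
    show "pd (\<lambda>x y. \<Gamma> i t x y - \<Gamma> j t x y)" if "i \<le> j" for j
      using chain[OF t, of i "j - i"] that by simp
    show "(\<lambda>j. \<Gamma> i t x y - \<Gamma> j t x y) \<longlonglongrightarrow> \<Gamma> i t x y - \<Gamma>' t x y" for x y
      by (intro tendsto_intros lim)
  qed
  moreover have "pd_path K \<Gamma>'" unfolding pd_path_def kpath_def using pm kern zero pd by blast
  ultimately show ?thesis using lim by blast
qed

lemma pd_path_dominated:
  assumes a: "pd_path K \<Gamma>" and a': "pd_path K' \<Gamma>'" and d: "\<And>t. t \<in> {0..T} \<Longrightarrow> pd (\<lambda>x y. \<Gamma>' t x y - \<Gamma> t x y)"
  shows "pd_path ((real CARD('d))\<^sup>2 * K') \<Gamma>"
  unfolding pd_path_def kpath_def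
proof (intro conjI allI ballI impI)
  show "kern ((real CARD('d))\<^sup>2 * K') (\<Gamma> s)" for s
  proof (cases "s \<in> {0..T}")
    case True
    show ?thesis by (rule kern_of_dominated[OF pd_pathD(2)[OF a] pd_pathD(2)[OF a'] pd_pathD(3)[OF a True] d[OF True]]) (rule pd_pathD(4)[OF a], blast)
  next
    case False
    then show ?thesis using pd_pathD(4)[OF a] kern_nonneg[OF pd_pathD(2)[OF a']] by (intro kern_zero) auto
  qed
qed (use pd_pathD[OF a] in blast)+

text \<open>
  The iterates decrease because \<open>mild_step\<close> is monotone and the first step goes down. The constants of
  \<open>step_pd_path\<close> grow along the iteration, so that the uniform bound comes from domination by the
  fixed path \<open>\<Gamma>t\<close>. It is kept apart from the starting point \<open>\<Gamma>0\<close> in order to have one bound for all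
  \<open>n\<close> when the iterations are chained.
\<close>

lemma step_fixed_point:
  assumes top: "pd_path K' \<Gamma>t" and a: "pd_path K \<Gamma>0" and n: "1 \<le> n"
    and le: "\<And>t. t \<in> {0..T} \<Longrightarrow> pd (\<lambda>x y. \<Gamma>t t x y - \<Gamma>0 t x y)"
    and super: "\<And>t. t \<in> {0..T} \<Longrightarrow> pd (\<lambda>x y. \<Gamma>0 t x y - mild_step n \<Gamma>0 t x y)"
  shows "\<exists>\<Gamma>. pd_path ((real CARD('d))\<^sup>2 * K') \<Gamma> \<and> mild_step n \<Gamma> = \<Gamma> \<and>
    (\<forall>t\<in>{0..T}. pd (\<lambda>x y. \<Gamma>0 t x y - \<Gamma> t x y))"
proof -
  define G where "G i = (mild_step n ^^ i) \<Gamma>0" for i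
  \<comment> \<open>The constant of \<open>kern_of_dominated\<close>, the same for all iterates.\<close>
  define K0 where "K0 = (real CARD('d))\<^sup>2 * K'"
  have GS: "G (Suc i) = mild_step n (G i)" for i by (simp add: G_def)
  have ind: "(\<exists>K. pd_path K (G i)) \<and> (\<forall>t\<in>{0..T}. pd (\<lambda>x y. G i t x y - G (Suc i) t x y))
      \<and> (\<forall>t\<in>{0..T}. pd (\<lambda>x y. \<Gamma>t t x y - G i t x y))" for i
  proof (induction i)
    case 0
    then show ?case using a super le by (auto simp: G_def)
  next
    case (Suc i)
    then obtain L where L: "pd_path L (G i)" by blast
    have L1: "pd_path ((Rbd L + \<bar>n\<bar> * L) * (1 + T)) (G (Suc i))" unfolding GS by (rule step_pd_path[OF L n])
    have "pd (\<lambda>x y. G (Suc i) t x y - G (Suc (Suc i)) t x y)" if "t \<in> {0..T}" for t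
      unfolding GS[of "Suc i"] GS[of i] 
      by (rule step_mono[OF L1[unfolded GS[of i]] L n that]) (use Suc GS[of i] in auto)
    moreover have "pd (\<lambda>x y. \<Gamma>t t x y - G (Suc i) t x y)" if "t \<in> {0..T}" for t
      using Suc that by (intro pd_diff_trans[OF pd_pathD(2)[OF top] pd_pathD(2)[OF L] pd_pathD(2)[OF L1]]) auto
    ultimately show ?case using L1 by blast
  qed
  have aG: "pd_path K0 (G i)" for i
  proof -
    obtain L where "pd_path L (G i)" using ind by blast
    then show ?thesis unfolding K0_def using ind[of i] by (intro pd_path_dominated[OF _ top]) auto
  qed
  have dG: "pd (\<lambda>x y. G i t x y - G (Suc i) t x y)" if "t \<in> {0..T}" for i t using ind that by blast
  obtain \<Gamma> where G0: "pd_path K0 \<Gamma>" "\<forall>t x y. (\<lambda>i. G i t x y) \<longlonglongrightarrow> \<Gamma> t x y"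
    "\<forall>i. \<forall>t\<in>{0..T}. pd (\<lambda>x y. G i t x y - \<Gamma> t x y)"
    using decreasing_limit[where \<Gamma> = G, OF aG dG] by blast
  note G = G0(1) G0(2,3)[rule_format]
  have "mild_step n \<Gamma> t x y = \<Gamma> t x y" for t x y
  proof (cases "t \<in> {0..T} \<and> x \<in> space M \<and> y \<in> space M")
    case True
    have "(\<lambda>i. mild_step n (G i) t x y) \<longlonglongrightarrow> mild_step n \<Gamma> t x y"
      unfolding mild_step_def
    proof (rule J_tendsto[OF bpath_Gop[OF aG n] bpath_Gop[OF G(1) n]])
      fix s assume s: "s \<in> {0..T}"
      show "(\<lambda>i. Gop n (G i s) x y) \<longlonglongrightarrow> Gop n (\<Gamma> s) x y"
        unfolding Gop_def using n True
        by (intro tendsto_intros Rop_tendsto[OF pd_pathD(2)[OF aG] pd_pathD(2)[OF G(1)] pd_pathD(3)[OF G(1) s]] G(2)) auto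
    qed (use True in auto)
    moreover have "(\<lambda>i. mild_step n (G i) t x y) \<longlonglongrightarrow> \<Gamma> t x y"
      using LIMSEQ_Suc[OF G(2)] unfolding GS .
    ultimately show ?thesis by (rule LIMSEQ_unique)
  next
    case False
    then have "\<Gamma> t x y = 0" using pd_pathD(4)[OF G(1)] by blast
    moreover have "mild_step n \<Gamma> t x y = 0" using False by (auto simp: mild_step_def Jop_def)
    ultimately show ?thesis by simp
  qed
  then have "mild_step n \<Gamma> = \<Gamma>" by (simp add: fun_eq_iff)
  moreover have "pd (\<lambda>x y. \<Gamma>0 t x y - \<Gamma> t x y)" if "t \<in> {0..T}" for t
    using G(3)[OF that, of 0] by (simp add: G_def)
  ultimately show ?thesis using G(1) unfolding K0_def by blast
qed

text \<open>
  In terms of the rate shifted by \<open>n + 1\<close>, the fixed point for \<open>n\<close> has the source \<open>Rop (1 / n) \<Gamma> + (n + 1) \<Gamma>\<close>,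
  which exceeds that of \<open>mild_step (n + 1)\<close>.
\<close>

lemma fixed_point_supersolution_next:
  assumes a: "pd_path K \<Gamma>" and n: "1 \<le> n" and fp: "mild_step n \<Gamma> = \<Gamma>" and t: "t \<in> {0..T}"
  shows "pd (\<lambda>x y. \<Gamma> t x y - mild_step (n + 1) \<Gamma> t x y)"
proof -
  have n0: "0 < n" "0 \<le> n + 1" "1 \<le> n + 1" using n by auto
  note b = bpath_Gop[OF a n] and b1 = bpath_Gop[OF a n0(3)]
  note b2 = bpath_add_scaleR[OF b a, of 1]
  let ?G = "\<lambda>s x y. Gop n (\<Gamma> s) x y + 1 *\<^sub>R \<Gamma> s x y"
  have eq: "\<Gamma> t x y = Jop (n + 1) ?G t x y" for x y
  proof (cases "x \<in> space M \<and> y \<in> space M")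
    case True
    show ?thesis by (rule J_shift[OF b _ t]) (use True fp in \<open>auto simp: mild_step_def dest: fun_cong\<close>)
  next
    case False
    then show ?thesis using pd_pathD(4)[OF a, of t x y] by (auto simp: Jop_def)
  qed
  have "pd (Jop (n + 1) (\<lambda>s x y. ?G s x y - Gop (n + 1) (\<Gamma> s) x y) t)"
  proof (rule J_pd[OF bpath_diff[OF b2 b1] n0(2) t])
    fix s assume s: "s \<in> {0..T}"
    have "(\<lambda>x y. ?G s x y - Gop (n + 1) (\<Gamma> s) x y) = (\<lambda>x y. Rop (1 / n) (\<Gamma> s) x y - Rop (1 / (n + 1)) (\<Gamma> s) x y)"
      by (simp add: Gop_def fun_eq_iff scaleR_add_left)
    then show "pd1 (\<lambda>x y. ?G s x y - Gop (n + 1) (\<Gamma> s) x y)"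
      using Rop_decreasing_in_n[OF pd_pathD(2)[OF a] pd_pathD(3)[OF a s] n0(1), of "n + 1"] by simp
  qed
  then show ?thesis unfolding J_diff[OF b2 b1, symmetric] eq[symmetric] mild_step_def .
qed

text \<open>
  Starting each iteration from the previous fixed point yields solutions for \<open>n = 1, 2, \<dots>\<close> that
  decrease in \<open>n\<close>. After the shift of the rate has been undone, the equation passes to the limit by
  dominated convergence.
\<close>

lemma solution_from_supersolution:
  assumes top: "pd_path K \<Gamma>t"
    and super: "\<And>t. t \<in> {0..T} \<Longrightarrow> pd (\<lambda>x y. \<Gamma>t t x y - mild_step 1 \<Gamma>t t x y)"
  shows "\<exists>K' \<Gamma>. pd_path K' \<Gamma> \<and> Jop 0 (\<lambda>s. Rop 0 (\<Gamma> s)) = \<Gamma>"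
proof -
  define K0 where "K0 = (real CARD('d))\<^sup>2 * K"
  define P where "P i \<Gamma> \<longleftrightarrow> pd_path K0 \<Gamma> \<and> mild_step (real (Suc i)) \<Gamma> = \<Gamma> \<and> (\<forall>t\<in>{0..T}. pd (\<lambda>x y. \<Gamma>t t x y - \<Gamma> t x y))" for i \<Gamma>
  have refl: "pd (\<lambda>x y. \<Gamma>t t x y - \<Gamma>t t x y)" for t by (simp add: pd_def form_def)
  have ex0: "\<exists>\<Gamma>. P 0 \<Gamma>"
  proof -
    obtain \<Gamma> where "pd_path ((real CARD('d))\<^sup>2 * K) \<Gamma>" "mild_step 1 \<Gamma> = \<Gamma>" "\<forall>t\<in>{0..T}. pd (\<lambda>x y. \<Gamma>t t x y - \<Gamma> t x y)"
      using step_fixed_point[OF top top order_refl refl super] by blast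
    then show ?thesis unfolding P_def K0_def by (intro exI[of _ \<Gamma>]) simp
  qed
  have exS: "\<exists>\<Gamma>'. P (Suc i) \<Gamma>' \<and> (\<forall>t\<in>{0..T}. pd (\<lambda>x y. \<Gamma> t x y - \<Gamma>' t x y))" if P: "P i \<Gamma>" for \<Gamma> i
  proof -
    have a: "pd_path K0 \<Gamma>" and fp: "mild_step (real (Suc i)) \<Gamma> = \<Gamma>" and le: "\<And>t. t \<in> {0..T} \<Longrightarrow> pd (\<lambda>x y. \<Gamma>t t x y - \<Gamma> t x y)"
      using P unfolding P_def by auto
    have n: "1 \<le> real (Suc i)" "1 \<le> real (Suc i) + 1" by auto
    obtain \<Gamma>' where G0: "pd_path ((real CARD('d))\<^sup>2 * K) \<Gamma>'" "mild_step (real (Suc i) + 1) \<Gamma>' = \<Gamma>'"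
      "\<forall>t\<in>{0..T}. pd (\<lambda>x y. \<Gamma> t x y - \<Gamma>' t x y)"
      using step_fixed_point[OF top a n(2) le fixed_point_supersolution_next[OF a n(1) fp]] by blast
    note G = G0(1,2) G0(3)[rule_format]
    have "pd (\<lambda>x y. \<Gamma>t t x y - \<Gamma>' t x y)" if "t \<in> {0..T}" for t
      by (rule pd_diff_trans[OF pd_pathD(2)[OF top] pd_pathD(2)[OF a] pd_pathD(2)[OF G(1)] le[OF that] G(3)[OF that]])
    then show ?thesis
      unfolding P_def K0_def using G by (intro exI[of _ \<Gamma>']) (simp add: add.commute)
  qed
  have "\<exists>f. \<forall>i. P i (f i) \<and> (\<forall>t\<in>{0..T}. pd (\<lambda>x y. f i t x y - f (Suc i) t x y))"
    by (rule dependent_nat_choice[where P = P and Q = "\<lambda>i \<Gamma> \<Gamma>'. \<forall>t\<in>{0..T}. pd (\<lambda>x y. \<Gamma> t x y - \<Gamma>' t x y)", OF ex0 exS])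
  then obtain G where G0: "\<forall>i. P i (G i) \<and> (\<forall>t\<in>{0..T}. pd (\<lambda>x y. G i t x y - G (Suc i) t x y))" ..
  have G: "P i (G i)" "t \<in> {0..T} \<Longrightarrow> pd (\<lambda>x y. G i t x y - G (Suc i) t x y)" for i t
    using G0 by blast+
  have aG: "pd_path K0 (G i)" for i using G(1) by (simp add: P_def)
  obtain \<Gamma> where L0: "pd_path K0 \<Gamma>" "\<forall>t x y. (\<lambda>i. G i t x y) \<longlonglongrightarrow> \<Gamma> t x y"
    using decreasing_limit[where \<Gamma> = G, OF aG G(2)] by blast
  note L = L0(1) L0(2)[rule_format]
  have eq: "G i t x y = Jop 0 (\<lambda>s. Rop (1 / real (Suc i)) (G i s)) t x y" if t: "t \<in> {0..T}" and xy: "x \<in> space M" "y \<in> space M" for i t x y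
  proof -
    have n: "1 \<le> real (Suc i)" by simp
    have fp: "G i s x y = Jop (real (Suc i)) (\<lambda>s. Gop (real (Suc i)) (G i s)) s x y" for s
    proof -
      have "mild_step (real (Suc i)) (G i) = G i" using G(1)[of i] unfolding P_def by blast
      then show ?thesis unfolding mild_step_def by (rule fun_cong[OF fun_cong[OF fun_cong[OF sym]]])
    qed
    show ?thesis
      using J_shift[where \<Gamma> = "G i" and G = "\<lambda>s. Gop (real (Suc i)) (G i s)" and \<delta> = "- real (Suc i)",
          OF bpath_Gop[OF aG[of i] n] fp t xy]
      by (simp add: Gop_def del: of_nat_Suc)
  qed
  have "Jop 0 (\<lambda>s. Rop 0 (\<Gamma> s)) t x y = \<Gamma> t x y" for t x y
  proof (cases "t \<in> {0..T} \<and> x \<in> space M \<and> y \<in> space M")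
    case True
    have "(\<lambda>i. Jop 0 (\<lambda>s. Rop (1 / real (Suc i)) (G i s)) t x y) \<longlonglongrightarrow> Jop 0 (\<lambda>s. Rop 0 (\<Gamma> s)) t x y"
    proof (rule J_tendsto[where K = "Rbd K0"])
      show "bpath (Rbd K0) (\<lambda>s. Rop (1 / real (Suc i)) (G i s))" for i by (rule bpath_Rop[OF aG]) auto
      show "bpath (Rbd K0) (\<lambda>s. Rop 0 (\<Gamma> s))" by (rule bpath_Rop[OF L(1)]) auto
      fix s assume s: "s \<in> {0..T}"
      show "(\<lambda>i. Rop (1 / real (Suc i)) (G i s) x y) \<longlonglongrightarrow> Rop 0 (\<Gamma> s) x y"
        using True LIMSEQ_inverse_real_of_nat
        by (intro Rop_tendsto[OF pd_pathD(2)[OF aG] pd_pathD(2)[OF L(1)] pd_pathD(3)[OF L(1) s]] L(2)) (auto simp: inverse_eq_divide)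
    qed (use True in auto)
    then have "(\<lambda>i. G i t x y) \<longlonglongrightarrow> Jop 0 (\<lambda>s. Rop 0 (\<Gamma> s)) t x y" using eq True by simp
    then show ?thesis using L(2) LIMSEQ_unique by blast
  next
    case False
    then have "\<Gamma> t x y = 0" using pd_pathD(4)[OF L(1)] by blast
    then show ?thesis using False by (auto simp: Jop_def)
  qed
  then have "Jop 0 (\<lambda>s. Rop 0 (\<Gamma> s)) = \<Gamma>" by (simp add: fun_eq_iff)
  then show ?thesis using L(1) by blast
qed

end

section \<open>A supersolution\<close>

context weighted_measure begin

text \<open>
  That this tends to \<open>0\<close> as \<open>L\<close> grows is the form in which the integrability of the weight is used,
  both for the supersolution and for uniqueness.
\<close>

definition kap :: "real \<Rightarrow> real" where
  "kap L = (\<integral>x. 1 / sqrt (r x + L) \<partial>M)"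

lemma integrable_kap: "1 \<le> L \<Longrightarrow> integrable M (\<lambda>x. 1 / sqrt (r x + L))"
proof (rule Bochner_Integration.integrable_bound[OF integrable_weight])
  assume L: "1 \<le> L"
  show "(\<lambda>x. 1 / sqrt (r x + L)) \<in> borel_measurable M" by measurable
  show "AE x in M. norm (1 / sqrt (r x + L)) \<le> norm (w x)"
  proof (intro always_eventually allI)
    fix x
    have "sqrt (max 1 (r x)) \<le> sqrt (r x + L)" using r_nonneg[of x] L by (intro real_sqrt_le_mono) auto
    then show "norm (1 / sqrt (r x + L)) \<le> norm (w x)"
      unfolding weight_def using r_nonneg[of x] L by (simp add: frac_le less_max_iff_disj)
  qed
qed

lemma kap_nonneg: "1 \<le> L \<Longrightarrow> 0 \<le> kap L"
  unfolding kap_def using r_nonneg by (intro integral_nonneg_AE) (auto simp: add_nonneg_nonneg)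

lemma kap_tendsto: "(\<lambda>n. kap (real n)) \<longlonglongrightarrow> 0"
proof -
  have "(\<lambda>n. kap (real (Suc n))) \<longlonglongrightarrow> (\<integral>x. 0 \<partial>M)"
    unfolding kap_def
  proof (rule integral_dominated_convergence[where w = w])
    show "integrable M w" by (rule integrable_weight)
    show "(\<lambda>x. 1 / sqrt (r x + real (Suc n))) \<in> borel_measurable M" for n by measurable
    show "AE x in M. (\<lambda>n. 1 / sqrt (r x + real (Suc n))) \<longlonglongrightarrow> 0"
    proof (intro always_eventually allI)
      fix x
      have "filterlim (\<lambda>n. r x + real (Suc n)) at_top sequentially"
        by (intro filterlim_tendsto_add_at_top[OF tendsto_const]
            filterlim_compose[OF filterlim_real_sequentially filterlim_Suc])
      then have "filterlim (\<lambda>n. sqrt (r x + real (Suc n))) at_top sequentially"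
        by (rule filterlim_compose[OF sqrt_at_top])
      then show "(\<lambda>n. 1 / sqrt (r x + real (Suc n))) \<longlonglongrightarrow> 0"
        by (intro tendsto_divide_0[OF tendsto_const]) (rule filterlim_at_top_imp_at_infinity)
    qed
    show "AE x in M. norm (1 / sqrt (r x + real (Suc n))) \<le> w x" for n
    proof (intro always_eventually allI)
      fix x
      have "sqrt (max 1 (r x)) \<le> sqrt (r x + real (Suc n))" using r_nonneg[of x] by (intro real_sqrt_le_mono) auto
      then show "norm (1 / sqrt (r x + real (Suc n))) \<le> w x"
        unfolding weight_def using r_nonneg[of x] by (simp add: frac_le less_max_iff_disj)
    qed
  qed simp
  then have "(\<lambda>n. kap (real (Suc n))) \<longlonglongrightarrow> 0" by (simp del: of_nat_Suc)
  then show ?thesis by (rule LIMSEQ_imp_Suc)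
qed

lemma kap_small: "0 < \<epsilon> \<Longrightarrow> \<exists>L\<ge>1. kap L < \<epsilon>"
proof -
  assume "0 < \<epsilon>"
  then have "\<forall>\<^sub>F n in sequentially. kap (real n) < \<epsilon> \<and> 1 \<le> n"
    using order_tendstoD(2)[OF kap_tendsto] eventually_ge_at_top[of 1] eventually_conj by blast
  then obtain n where "kap (real n) < \<epsilon>" "1 \<le> n"
    using eventually_happens by fastforce
  then show ?thesis by (intro exI[of _ "real n"]) auto
qed

lemma inverse_sum_le: "1 \<le> L \<Longrightarrow> 1 / (r x + r y + 2 * L) \<le> 1 / sqrt (r x + L) * (1 / sqrt (r y + L))"
proof -
  assume L: "1 \<le> L"
  have p: "0 < r x + L" "0 < r y + L" using r_nonneg[of x] r_nonneg[of y] L by auto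
  have "sqrt (r x + L) * sqrt (r y + L) \<le> (r x + L) + (r y + L)"
  proof (rule power2_le_imp_le)
    have "a * b \<le> (a + b)\<^sup>2" if "0 < a" "0 < b" for a b :: real
      using that by (simp add: power2_eq_square algebra_simps)
    from this[OF p] show "(sqrt (r x + L) * sqrt (r y + L))\<^sup>2 \<le> ((r x + L) + (r y + L))\<^sup>2"
      using p by (simp add: power_mult_distrib)
  qed (use p in simp)
  then have "1 / ((r x + L) + (r y + L)) \<le> 1 / (sqrt (r x + L) * sqrt (r y + L))"
    using p by (intro divide_left_mono) auto
  then show ?thesis by (simp add: algebra_simps)
qed

end

context riccati_time begin

lemma X_bound_kap:
  assumes bd: "\<And>x y. norm (\<Gamma> x y) \<le> K * (1 / sqrt (r x + L) * (1 / sqrt (r y + L)))" and L: "1 \<le> L" and K: "0 \<le> K"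
  shows "norm (Xop \<Gamma>) \<le> c * c * K * (kap L)\<^sup>2"
proof -
  let ?k = "\<lambda>x. 1 / sqrt (r x + L)"
  have Y: "norm (Yop \<Gamma> y) \<le> c * K * ?k y * kap L" for y
  proof -
    have "norm (Yop \<Gamma> y) \<le> (\<integral>x. c * K * ?k y * ?k x \<partial>M)"
      unfolding Yop_def
    proof (rule norm_integral_le)
      show "integrable M (\<lambda>x. c * K * ?k y * ?k x)" by (intro integrable_mult_right integrable_kap L)
      show "AE x in M. norm (transpose (h x) ** \<Gamma> x y) \<le> c * K * ?k y * ?k x"
        using h_bound
      proof eventually_elim
        case (elim x)
        have "norm (transpose (h x) ** \<Gamma> x y) \<le> c * (K * (?k x * ?k y))"
          using elim by (intro norm_matrix_mult2_le bd) simp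
        then show ?case by (simp add: ac_simps)
      qed
    qed
    also have "\<dots> = c * K * ?k y * kap L" unfolding kap_def by (rule integral_mult_right_zero)
    finally show ?thesis .
  qed
  have "norm (Xop \<Gamma>) \<le> (\<integral>y. c * K * kap L * c * ?k y \<partial>M)"
    unfolding Xop_def
  proof (rule norm_integral_le)
    show "integrable M (\<lambda>y. c * K * kap L * c * ?k y)" by (intro integrable_mult_right integrable_kap L)
    show "AE y in M. norm (Yop \<Gamma> y ** h y) \<le> c * K * kap L * c * ?k y"
      using h_bound
    proof eventually_elim
      case (elim y)
      have "norm (Yop \<Gamma> y ** h y) \<le> (c * K * ?k y * kap L) * c"
        using elim by (intro norm_matrix_mult2_le Y)
      then show ?case by (simp add: ac_simps)
    qed
  qed
  also have "\<dots> = c * K * kap L * c * kap L"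
    unfolding kap_def by (rule integral_mult_right_zero)
  finally show ?thesis by (simp add: power2_eq_square ac_simps)
qed

lemma pd1_const_one:
  assumes a: "0 \<le> a"
  shows "pd1 (\<lambda>x y. a *\<^sub>R (mat 1 :: real^'d^'d))"
  unfolding pd1_def
proof (intro allI impI)
  fix \<nu> \<rho> and \<psi> :: "'x \<Rightarrow> real^'d"
  assume dom: "dominating_measure M r \<nu> \<rho>" and p: "integrable \<nu> \<psi>"
  interpret dominating_measure M r \<nu> \<rho> by (rule dom)
  have "form \<nu> (\<lambda>x y. a *\<^sub>R mat 1) \<psi> \<psi> = (\<integral>x. \<psi> x \<partial>\<nu>) \<bullet> ((a *\<^sub>R mat 1) *v (\<integral>x. \<psi> x \<partial>\<nu>))"
    unfolding form_def by (rule nu2.integral_inner_fst_snd(2)[OF p p])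
  also have "\<dots> = a * ((\<integral>x. \<psi> x \<partial>\<nu>) \<bullet> (\<integral>x. \<psi> x \<partial>\<nu>))" by (simp add: scaleR_matrix_vector_assoc[symmetric])
  finally show "0 \<le> form \<nu> (\<lambda>x y. a *\<^sub>R mat 1) \<psi> \<psi>" using a by simp
qed

text \<open>
  The control value \<open>0\<close> gives an upper bound for the minimum, and the form at \<open>\<psi> + Hs u\<close> is at most
  twice the form at \<open>\<psi>\<close> plus twice the form at \<open>Hs u\<close>.
\<close>

lemma Gop_upper:
  assumes k: "kern K \<Gamma>" and pd: "pd \<Gamma>"
    and dom: "dominating_measure M r \<nu> \<rho>" and p: "integrable \<nu> \<psi>"
  shows "form \<nu> (Gop 1 \<Gamma>) \<psi> \<psi> \<le> (norm Q + ((norm D)\<^sup>2 + 2 * (norm B)\<^sup>2) * norm (Xop \<Gamma>)) * (norm (\<integral>x. \<psi> x \<partial>\<nu>))\<^sup>2 + 2 * form \<nu> \<Gamma> \<psi> \<psi>"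
proof -
  interpret dominating_measure M r \<nu> \<rho> by (rule dom)
  define a where "a = (\<integral>x. \<psi> x \<partial>\<nu>)"
  define X where "X = Xop \<Gamma>"
  have L: "Lw \<psi>" by (rule integrable_Lw[OF p])
  note e = form_add_scaleR[OF k L Lw_Hs[OF dom]]
  have quad: "v \<bullet> (A *v v) \<le> norm A * (norm v)\<^sup>2" for v and A :: "real^'n^'n"
    using abs_inner_matrix_le[of v A v] by (simp add: power2_eq_square ac_simps)
  have quad2: "(A *v a) \<bullet> (X *v (A *v a)) \<le> (norm A)\<^sup>2 * norm X * (norm a)\<^sup>2" for A :: "real^'d^'e"
  proof -
    have "(A *v a) \<bullet> (X *v (A *v a)) \<le> norm X * (norm (A *v a))\<^sup>2" by (rule quad)
    also have "\<dots> \<le> norm X * (norm A * norm a)\<^sup>2"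
      by (intro mult_left_mono power_mono norm_matrix_vector_mult_le) auto
    finally show ?thesis by (simp add: power_mult_distrib ac_simps)
  qed
  let ?u = "B *v a"
  have "0 \<le> form \<nu> \<Gamma> (\<lambda>z. \<psi> z + (-1) *\<^sub>R Hs \<rho> ?u z) (\<lambda>z. \<psi> z + (-1) *\<^sub>R Hs \<rho> ?u z)"
    by (intro pdD[OF pd dom] Lw_add Lw_scaleR Lw_Hs[OF dom] L)
  then have 1: "2 * form \<nu> \<Gamma> (Hs \<rho> ?u) \<psi> \<le> form \<nu> \<Gamma> \<psi> \<psi> + ?u \<bullet> (X *v ?u)"
    unfolding e form_Hs_Hs[OF dom k] X_def[symmetric] by simp
  have "form \<nu> (Gop 1 \<Gamma>) \<psi> \<psi> \<le> control_cost \<nu> \<rho> 1 \<Gamma> \<psi> 0"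
    unfolding form_Gop(2)[OF dom k p zero_less_one] by (rule control_cost_min(1)[OF dom k pd p zero_less_one])
  also have "\<dots> = a \<bullet> (Q *v a) + (D *v a) \<bullet> (X *v (D *v a)) + form \<nu> \<Gamma> (\<lambda>z. \<psi> z + 1 *\<^sub>R Hs \<rho> ?u z) (\<lambda>z. \<psi> z + 1 *\<^sub>R Hs \<rho> ?u z)"
    unfolding control_cost_def[OF dom] Let_def a_def[symmetric] by (simp add: form_Hs_Hs[OF dom k] X_def)
  also have "\<dots> \<le> a \<bullet> (Q *v a) + (D *v a) \<bullet> (X *v (D *v a)) + 2 * (?u \<bullet> (X *v ?u)) + 2 * form \<nu> \<Gamma> \<psi> \<psi>"
    unfolding e form_Hs_Hs[OF dom k] X_def[symmetric] using 1 by simp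
  also have "\<dots> \<le> norm Q * (norm a)\<^sup>2 + (norm D)\<^sup>2 * norm X * (norm a)\<^sup>2 + 2 * ((norm B)\<^sup>2 * norm X * (norm a)\<^sup>2) + 2 * form \<nu> \<Gamma> \<psi> \<psi>"
    by (intro add_mono mult_left_mono quad quad2) auto
  finally show ?thesis unfolding a_def X_def by (simp add: algebra_simps)
qed

lemma bpath_exp_one:
  assumes "0 \<le> k" "0 \<le> b"
  shows "bpath (k * exp (b * T) * norm (mat 1 :: real^'d^'d)) (\<lambda>s x y. (k * exp (b * (T - s))) *\<^sub>R mat 1)"
  unfolding bpath_def
proof (intro conjI ballI allI)
  show "pmeas (\<lambda>s x y. (k * exp (b * (T - s))) *\<^sub>R mat 1)"
    unfolding pmeas_def by measurable
  fix s assume "s \<in> {0..T}"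
  then have "exp (b * (T - s)) \<le> exp (b * T)" using assms by (simp add: mult_left_mono)
  then show "norm ((k * exp (b * (T - s))) *\<^sub>R (mat 1 :: real^'d^'d)) \<le> k * exp (b * T) * norm (mat 1 :: real^'d^'d)"
    using assms by (simp add: mult_left_mono mult_right_mono)
qed

text \<open>
  The path \<open>\<Gamma> = p\<^sub>t *\<^sub>R U\<close> below, with \<open>p\<^sub>t = c0 * exp ((2 * L + 1) * (T - t))\<close> and \<open>U\<close> of source \<open>1\<close> and
  rate \<open>r x + r y + 2 * L\<close>, has the source \<open>p\<close> and the rate \<open>r x + r y - 1\<close>, because the exponential in \<open>p\<close>
  trades against the rate. Moving \<open>2 *\<^sub>R \<Gamma>\<close> into the source makes the rate \<open>r x + r y + 1\<close>, that of
  \<open>mild_step 1\<close>. By \<open>Gop_upper\<close> it remains to have \<open>p\<close> above \<open>norm Q\<close> plus a multiple of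
  \<open>norm (Xop \<Gamma>)\<close>. Half of \<open>p\<close> pays for \<open>Q\<close> by the choice of \<open>c0\<close>, the other half for \<open>Xop \<Gamma>\<close>, which is at
  most \<open>p\<close> times a multiple of \<open>(kap L)\<^sup>2\<close>, by the choice of \<open>L\<close>.
\<close>

lemma supersolution_exists:
  "\<exists>K \<Gamma>. pd_path K \<Gamma> \<and> (\<forall>t\<in>{0..T}. pd (\<lambda>x y. \<Gamma> t x y - mild_step 1 \<Gamma> t x y))"
proof -
  define I where "I = norm (mat 1 :: real^'d^'d)"
  define A where "A = ((norm D)\<^sup>2 + 2 * (norm B)\<^sup>2) * (c * c * I)"
  have A0: "0 \<le> A" unfolding A_def I_def using c_nonneg by simp
  obtain L where L: "1 \<le> L" "kap L < min 1 (1 / (2 * (A + 1)))"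
    using kap_small[of "min 1 (1 / (2 * (A + 1)))"] A0 by auto
  have small: "A * (kap L)\<^sup>2 \<le> 1 / 2"
  proof -
    have "(kap L)\<^sup>2 \<le> kap L" using L kap_nonneg[OF L(1)] by (simp add: power2_eq_square mult_left_le_one_le)
    then have "A * (kap L)\<^sup>2 \<le> A * (1 / (2 * (A + 1)))" using L A0 by (intro mult_left_mono) auto
    also have "\<dots> \<le> 1 / 2" using A0 by (simp add: field_simps)
    finally show ?thesis .
  qed
  \<comment> \<open>\<open>norm Q \<le> c0 / 2\<close> leaves the other half of \<open>p\<close> for the term with \<open>Xop\<close>.\<close>
  define c0 where "c0 = 2 * norm Q + 1"
  define p where "p s = c0 * exp ((2 * L + 1) * (T - s))" for s
  have c00: "0 \<le> c0" by (simp add: c0_def)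
  have p0: "0 \<le> p s" for s unfolding p_def using c00 by simp
  define \<Gamma> where "\<Gamma> = Jop (- 1) (\<lambda>s x y. p s *\<^sub>R mat 1)"
  define U where "U = Jop (2 * L) (\<lambda>s x y. mat 1)"
  have bp: "bpath (c0 * exp ((2 * L + 1) * T) * I) (\<lambda>s x y. p s *\<^sub>R mat 1)"
    unfolding p_def I_def using c00 L by (intro bpath_exp_one) auto
  have b1: "bpath I (\<lambda>s x y. mat 1)" using bpath_exp_one[of 1 0] by (simp add: I_def)
  have L0: "0 \<le> 2 * L" using L by simp
  have eq: "\<Gamma> t x y = (if t \<in> {0..T} then p t else 0) *\<^sub>R U t x y" for t x y
  proof (cases "t \<in> {0..T} \<and> x \<in> space M \<and> y \<in> space M")
    case True
    have e: "exp (- (r x + r y + - 1) * (s - t)) * p s = p t * exp (- (r x + r y + 2 * L) * (s - t))" for s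
      unfolding p_def by (simp add: exp_add[symmetric] algebra_simps)
    have "\<Gamma> t x y = (LINT s:{t..T}|lborel. p t *\<^sub>R (exp (- (r x + r y + 2 * L) * (s - t)) *\<^sub>R mat 1))"
      unfolding \<Gamma>_def Jop_def using True by (simp only: if_True simp_thms scaleR_scaleR e)
    also have "\<dots> = p t *\<^sub>R U t x y"
    proof -
      have "(LINT s:{t..T}|lborel. p t *\<^sub>R (exp (- (r x + r y + 2 * L) * (s - t)) *\<^sub>R (mat 1 :: real^'d^'d)))
          = p t *\<^sub>R (LINT s:{t..T}|lborel. exp (- (r x + r y + 2 * L) * (s - t)) *\<^sub>R mat 1)"
        unfolding set_lebesgue_integral_def scaleR_left_commute[of _ "p t"] 
        by (rule integral_scaleR_right)
      then show ?thesis unfolding U_def Jop_def using True by (simp only: if_True simp_thms)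
    qed
    finally show ?thesis using True by simp
  next
    case False
    then show ?thesis unfolding \<Gamma>_def U_def Jop_def by auto
  qed
  have symI: "transpose (mat 1 :: real^'d^'d) = mat 1" by (simp add: transpose_mat)
  have kU: "kpath (I * (1 + T)) U" unfolding U_def by (rule J_kpath[OF b1 L0]) (rule symI)
  have pdU: "pd (U t)" if "t \<in> {0..T}" for t
    unfolding U_def by (rule J_pd[OF b1 L0 that]) (use pd1_const_one[of 1] in simp)
  define K where "K = c0 * exp ((2 * L + 1) * T) * (I * (1 + T))"
  have pK: "p t \<le> c0 * exp ((2 * L + 1) * T)" if "t \<in> {0..T}" for t
    unfolding p_def using that c00 L by (intro mult_left_mono) (auto intro!: mult_left_mono)
  have IT: "0 \<le> I * (1 + T)" unfolding I_def using T_pos by simp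
  have kG: "kern K (\<Gamma> t)" for t
  proof -
    have "kern ((if t \<in> {0..T} then p t else 0) * (I * (1 + T))) (\<lambda>x y. (if t \<in> {0..T} then p t else 0) *\<^sub>R U t x y)"
      using kU p0 by (intro kern_scaleR) (auto simp: kpath_def)
    then have "kern ((if t \<in> {0..T} then p t else 0) * (I * (1 + T))) (\<Gamma> t)" unfolding eq[symmetric] .
    then show ?thesis
      by (rule kern_mono) (unfold K_def, intro mult_right_mono IT, use pK c00 in auto)
  qed
  have pdG: "pd (\<Gamma> t)" if t: "t \<in> {0..T}" for t
  proof -
    have "pd (\<lambda>x y. (if t \<in> {0..T} then p t else 0) *\<^sub>R U t x y)" by (intro pd_scaleR pdU[OF t]) (use p0 in auto)
    then show ?thesis unfolding eq[symmetric] .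
  qed
  have "pmeas \<Gamma>" unfolding \<Gamma>_def by (rule J_pmeas) (use bp in \<open>simp add: bpath_def\<close>)
  then have pd_path: "pd_path K \<Gamma>"
    unfolding pd_path_def kpath_def using kG pdG by (auto simp: \<Gamma>_def Jop_def)
  have XG: "norm (Xop (\<Gamma> s)) \<le> c * c * (p s * I) * (kap L)\<^sup>2" if s: "s \<in> {0..T}" for s
  proof (rule X_bound_kap[OF _ L(1)])
    show "0 \<le> p s * I" using p0 by (simp add: I_def)
    fix x y
    have pos: "0 < r x + r y + 2 * L" using r_nonneg[of x] r_nonneg[of y] L by linarith
    have "norm (U s x y) \<le> I * (1 / (r x + r y + 2 * L))"
    proof (cases "x \<in> space M \<and> y \<in> space M")
      case True
      have "norm (U s x y) \<le> (\<integral>v. I * (indicator {s..T} v * exp (- (r x + r y + 2 * L) * (v - s))) \<partial>lborel)"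
      proof -
        have if_true: "s \<in> {0..T} \<and> x \<in> space M \<and> y \<in> space M" using True s by blast
        show ?thesis
          unfolding U_def Jop_def set_lebesgue_integral_def if_P[OF if_true]
          by (intro norm_integral_le integrable_mult_right integrable_exp always_eventually allI J_dominated[OF b1 s])
      qed
      also have "\<dots> = I * ((1 - exp (- (r x + r y + 2 * L) * (T - s))) / (r x + r y + 2 * L))"
        using has_bochner_integral_integral_eq[OF has_bochner_integral_exp[of s T "r x + r y + 2 * L"]] s pos by simp
      also have "\<dots> \<le> I * (1 / (r x + r y + 2 * L))"
        using pos by (intro mult_left_mono divide_right_mono) (auto simp: I_def)
      finally show ?thesis .
    next
      case False
      have "U s x y = 0" using False unfolding U_def Jop_def by auto
      then show ?thesis using pos by (simp add: I_def)
    qed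
    also have "\<dots> \<le> I * (1 / sqrt (r x + L) * (1 / sqrt (r y + L)))"
      by (intro mult_left_mono inverse_sum_le L) (simp add: I_def)
    finally have "norm (U s x y) \<le> I * (1 / sqrt (r x + L) * (1 / sqrt (r y + L)))" .
    from mult_left_mono[OF this p0[of s]] show "norm (\<Gamma> s x y) \<le> p s * I * (1 / sqrt (r x + L) * (1 / sqrt (r y + L)))"
      unfolding eq using s p0[of s] by (simp add: mult.assoc)
  qed
  have source: "norm Q + ((norm D)\<^sup>2 + 2 * (norm B)\<^sup>2) * norm (Xop (\<Gamma> s)) \<le> p s" if s: "s \<in> {0..T}" for s
  proof -
    have "((norm D)\<^sup>2 + 2 * (norm B)\<^sup>2) * norm (Xop (\<Gamma> s)) \<le> ((norm D)\<^sup>2 + 2 * (norm B)\<^sup>2) * (c * c * (p s * I) * (kap L)\<^sup>2)"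
      by (intro mult_left_mono XG s) simp
    also have "\<dots> = p s * (A * (kap L)\<^sup>2)" unfolding A_def by (simp add: ac_simps)
    also have "\<dots> \<le> p s * (1 / 2)" by (intro mult_left_mono small p0)
    finally have 1: "((norm D)\<^sup>2 + 2 * (norm B)\<^sup>2) * norm (Xop (\<Gamma> s)) \<le> p s / 2" by simp
    have "1 \<le> exp ((2 * L + 1) * (T - s))" using s L by simp
    then have "c0 * 1 \<le> p s" unfolding p_def using c00 by (intro mult_left_mono)
    then show ?thesis using 1 unfolding c0_def by simp
  qed
  have "pd (\<lambda>x y. \<Gamma> t x y - mild_step 1 \<Gamma> t x y)" if t: "t \<in> {0..T}" for t
  proof -
    note b2 = bpath_add_scaleR[OF bp pd_path, of 2] and b3 = bpath_Gop[OF pd_path order_refl]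
    let ?G = "\<lambda>s x y. p s *\<^sub>R mat 1 + 2 *\<^sub>R \<Gamma> s x y"
    have G: "\<Gamma> t x y = Jop 1 ?G t x y" for x y
    proof (cases "x \<in> space M \<and> y \<in> space M")
      case True
      have "\<Gamma> t x y = Jop (- 1 + 2) ?G t x y"
        by (rule J_shift[OF bp _ t]) (use True in \<open>auto simp: \<Gamma>_def\<close>)
      then show ?thesis by simp
    next
      case False
      then show ?thesis using pd_pathD(4)[OF pd_path, of t x y] by (auto simp: Jop_def)
    qed
    have "pd (Jop 1 (\<lambda>s x y. ?G s x y - Gop 1 (\<Gamma> s) x y) t)"
    proof (rule J_pd[OF bpath_diff[OF b2 b3] _ t])
      fix s assume s: "s \<in> {0..T}"
      show "pd1 (\<lambda>x y. ?G s x y - Gop 1 (\<Gamma> s) x y)"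
        unfolding pd1_def
      proof (intro allI impI)
        fix \<nu> \<rho> and \<psi> :: "'x \<Rightarrow> real^'d"
        assume dom: "dominating_measure M r \<nu> \<rho>" and ps: "integrable \<nu> \<psi>"
        interpret dominating_measure M r \<nu> \<rho> by (rule dom)
        define a where "a = (\<integral>x. \<psi> x \<partial>\<nu>)"
        note i1 = nu2.integral_inner_fst_snd[OF ps ps, of "mat 1", simplified]
        note i2 = form_integrable[OF pd_pathD(2)[OF pd_path] integrable_Lw[OF ps] integrable_Lw[OF ps], of s]
        note i3 = form_Gop(1)[OF dom pd_pathD(2)[OF pd_path] ps zero_less_one, of s]
        have e: "v \<bullet> ((?G s x y - Gop 1 (\<Gamma> s) x y) *v u) = p s * (v \<bullet> u) + 2 * (v \<bullet> (\<Gamma> s x y *v u)) - v \<bullet> (Gop 1 (\<Gamma> s) x y *v u)" for v u x y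
          by (simp add: matrix_vector_mult_diff_rdistrib matrix_vector_mult_add_rdistrib inner_diff_right inner_add_right scaleR_matrix_vector_assoc[symmetric])
        have "form \<nu> (\<lambda>x y. ?G s x y - Gop 1 (\<Gamma> s) x y) \<psi> \<psi> = p s * (a \<bullet> a) + 2 * form \<nu> (\<Gamma> s) \<psi> \<psi> - form \<nu> (Gop 1 (\<Gamma> s)) \<psi> \<psi>"
          unfolding form_def e a_def using i1 i2 i3 by simp
        moreover have "form \<nu> (Gop 1 (\<Gamma> s)) \<psi> \<psi> \<le> p s * (norm a)\<^sup>2 + 2 * form \<nu> (\<Gamma> s) \<psi> \<psi>"
          using Gop_upper[OF pd_pathD(2)[OF pd_path] pd_pathD(3)[OF pd_path s] dom ps] mult_right_mono[OF source[OF s], of "(norm a)\<^sup>2"]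
          unfolding a_def by simp
        ultimately show "0 \<le> form \<nu> (\<lambda>x y. ?G s x y - Gop 1 (\<Gamma> s) x y) \<psi> \<psi>"
          by (simp add: power2_norm_eq_inner)
      qed
    qed simp
    then show ?thesis unfolding J_diff[OF b2 b3, symmetric] G[symmetric] mild_step_def .
  qed
  then show ?thesis using pd_path by blast
qed

lemma pd_path_solution_exists: "\<exists>K \<Gamma>. pd_path K \<Gamma> \<and> Jop 0 (\<lambda>s. Rop 0 (\<Gamma> s)) = \<Gamma>"
proof -
  obtain K \<Gamma>t where "pd_path K \<Gamma>t" "\<forall>t\<in>{0..T}. pd (\<lambda>x y. \<Gamma>t t x y - mild_step 1 \<Gamma>t t x y)"
    using supersolution_exists by blast
  then show ?thesis using solution_from_supersolution[of K \<Gamma>t] by blast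
qed

end

section \<open>Lipschitz dependence of the nonlinearity\<close>

context pair_sigma_finite begin

lemma nn_integral_times_fst_snd:
  assumes [measurable]: "f \<in> borel_measurable M1" "g \<in> borel_measurable M2"
  shows "(\<integral>\<^sup>+z. f (fst z) * g (snd z) \<partial>(M1 \<Otimes>\<^sub>M M2)) = (\<integral>\<^sup>+x. f x \<partial>M1) * (\<integral>\<^sup>+y. g y \<partial>M2)"
proof -
  have "(\<integral>\<^sup>+z. f (fst z) * g (snd z) \<partial>(M1 \<Otimes>\<^sub>M M2)) = (\<integral>\<^sup>+x. \<integral>\<^sup>+y. f x * g y \<partial>M2 \<partial>M1)"
    by (subst M2.nn_integral_fst[symmetric]) auto
  also have "\<dots> = (\<integral>\<^sup>+x. f x * (\<integral>\<^sup>+y. g y \<partial>M2) \<partial>M1)"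
    by (simp add: nn_integral_cmult)
  also have "\<dots> = (\<integral>\<^sup>+x. f x \<partial>M1) * (\<integral>\<^sup>+y. g y \<partial>M2)"
    by (simp add: nn_integral_multc)
  finally show ?thesis .
qed

lemma AE_fstI: 
  assumes "AE x in M1. P x" shows "AE z in M1 \<Otimes>\<^sub>M M2. P (fst z)"
proof -
  obtain S where S: "{x\<in>space M1. \<not> P x} \<subseteq> S" "emeasure M1 S = 0" "S \<in> sets M1"
    using assms by (elim AE_E)
  have "emeasure (M1 \<Otimes>\<^sub>M M2) (S \<times> space M2) = 0"
    using M2.emeasure_pair_measure_Times[OF S(3) sets.top] S(2) by simp
  then show ?thesis
    using S by (intro AE_I[of _ _ "S \<times> space M2"]) (auto simp: space_pair_measure)
qed

lemma AE_sndI: 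
  assumes "AE y in M2. P y" shows "AE z in M1 \<Otimes>\<^sub>M M2. P (snd z)"
proof -
  obtain S where S: "{x\<in>space M2. \<not> P x} \<subseteq> S" "emeasure M2 S = 0" "S \<in> sets M2"
    using assms by (elim AE_E)
  have "emeasure (M1 \<Otimes>\<^sub>M M2) (space M1 \<times> S) = 0"
    using M2.emeasure_pair_measure_Times[OF sets.top S(3)] S(2) by simp
  then show ?thesis
    using S by (intro AE_I[of _ _ "space M1 \<times> S"]) (auto simp: space_pair_measure)
qed

end

context riccati_data begin

lemma integrable_hT_mult:
  assumes i: "integrable (M \<Otimes>\<^sub>M M) (\<lambda>z. \<Gamma> (fst z) (snd z))"
  shows "integrable (M \<Otimes>\<^sub>M M) (\<lambda>z. transpose (h (fst z)) ** \<Gamma> (fst z) (snd z))"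
proof (rule Bochner_Integration.integrable_bound)
  show "integrable (M \<Otimes>\<^sub>M M) (\<lambda>z. c * norm (\<Gamma> (fst z) (snd z)))" using i by simp
  note [measurable] = borel_measurable_integrable[OF i]
  have "(\<lambda>z. transpose (h (fst z))) \<in> borel_measurable (M \<Otimes>\<^sub>M M)" by measurable
  then show "(\<lambda>z. transpose (h (fst z)) ** \<Gamma> (fst z) (snd z)) \<in> borel_measurable (M \<Otimes>\<^sub>M M)"
    by (intro borel_measurable_matrix_mult borel_measurable_integrable[OF i])
  show "AE z in M \<Otimes>\<^sub>M M. norm (transpose (h (fst z)) ** \<Gamma> (fst z) (snd z)) \<le> norm (c * norm (\<Gamma> (fst z) (snd z)))"
    using MM.AE_fstI[OF h_bound]
  proof eventually_elim
    case (elim z)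
    have "norm (transpose (h (fst z)) ** \<Gamma> (fst z) (snd z)) \<le> c * norm (\<Gamma> (fst z) (snd z))"
      using elim by (intro norm_matrix_mult2_le) auto
    then show ?case using c_nonneg by simp
  qed
qed

lemma integrable_Yop:
  assumes i: "integrable (M \<Otimes>\<^sub>M M) (\<lambda>z. \<Gamma> (fst z) (snd z))"
  shows "integrable M (Yop \<Gamma>)" "AE y in M. integrable M (\<lambda>x. transpose (h x) ** \<Gamma> x y)"
  using MM.integrable_snd[of "\<lambda>x y. transpose (h x) ** \<Gamma> x y"] MM.AE_integrable_snd[of "\<lambda>x y. transpose (h x) ** \<Gamma> x y"]
    integrable_hT_mult[OF i] by (simp_all add: split_beta' Yop_def[abs_def])

lemma integrable_mult_h:
  fixes f :: "'x \<Rightarrow> real^'d^'k"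
  assumes i: "integrable M f"
  shows "integrable M (\<lambda>y. f y ** h y)"
proof (rule Bochner_Integration.integrable_bound)
  show "integrable M (\<lambda>y. norm (f y) * c)" using i by simp
  note [measurable] = borel_measurable_integrable[OF i]
  show "(\<lambda>y. f y ** h y) \<in> borel_measurable M" by measurable
  show "AE y in M. norm (f y ** h y) \<le> norm (norm (f y) * c)"
    using h_bound
  proof eventually_elim
    case (elim y)
    have "norm (f y ** h y) \<le> norm (f y) * c" using elim by (intro norm_matrix_mult2_le) auto
    then show ?case using c_nonneg by simp
  qed
qed

text \<open>
  The kernel is merely integrable here, so that its sections are integrable only almost everywhere.
\<close>

lemma Xop_eq_product_integral:
  assumes i: "integrable (M \<Otimes>\<^sub>M M) (\<lambda>z. \<Gamma> (fst z) (snd z))"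
  shows "integrable (M \<Otimes>\<^sub>M M) (\<lambda>z. transpose (h (fst z)) ** \<Gamma> (fst z) (snd z) ** h (snd z))"
    "Xop \<Gamma> = (\<integral>z. transpose (h (fst z)) ** \<Gamma> (fst z) (snd z) ** h (snd z) \<partial>(M \<Otimes>\<^sub>M M))"
proof -
  note j = integrable_hT_mult[OF i]
  show int: "integrable (M \<Otimes>\<^sub>M M) (\<lambda>z. transpose (h (fst z)) ** \<Gamma> (fst z) (snd z) ** h (snd z))"
  proof (rule Bochner_Integration.integrable_bound)
    show "integrable (M \<Otimes>\<^sub>M M) (\<lambda>z. norm (transpose (h (fst z)) ** \<Gamma> (fst z) (snd z)) * c)" using j by simp
    show "(\<lambda>z. transpose (h (fst z)) ** \<Gamma> (fst z) (snd z) ** h (snd z)) \<in> borel_measurable (M \<Otimes>\<^sub>M M)"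
      by (intro borel_measurable_matrix_mult[OF borel_measurable_integrable[OF j]]) measurable
    show "AE z in M \<Otimes>\<^sub>M M. norm (transpose (h (fst z)) ** \<Gamma> (fst z) (snd z) ** h (snd z))
       \<le> norm (norm (transpose (h (fst z)) ** \<Gamma> (fst z) (snd z)) * c)"
      using MM.AE_sndI[OF h_bound]
    proof eventually_elim
      case (elim z)
      have "norm (transpose (h (fst z)) ** \<Gamma> (fst z) (snd z) ** h (snd z)) \<le> norm (transpose (h (fst z)) ** \<Gamma> (fst z) (snd z)) * c"
        using elim by (intro norm_matrix_mult2_le) auto
      then show ?case using c_nonneg by simp
    qed
  qed
  have "(\<integral>z. transpose (h (fst z)) ** \<Gamma> (fst z) (snd z) ** h (snd z) \<partial>(M \<Otimes>\<^sub>M M))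
     = (\<integral>y. \<integral>x. transpose (h x) ** \<Gamma> x y ** h y \<partial>M \<partial>M)"
    using MM.integral_snd[of "\<lambda>x y. transpose (h x) ** \<Gamma> x y ** h y"] int by (simp add: split_beta')
  also have "\<dots> = Xop \<Gamma>"
    unfolding Xop_def
  proof (rule integral_cong_AE)
    show "(\<lambda>y. \<integral>x. transpose (h x) ** \<Gamma> x y ** h y \<partial>M) \<in> borel_measurable M"
      using MM.integrable_snd[of "\<lambda>x y. transpose (h x) ** \<Gamma> x y ** h y"] int by (simp add: split_beta' borel_measurable_integrable)
    show "(\<lambda>y. Yop \<Gamma> y ** h y) \<in> borel_measurable M"
      by (rule borel_measurable_integrable[OF integrable_mult_h[OF integrable_Yop(1)[OF i]]])
    show "AE y in M. (\<integral>x. transpose (h x) ** \<Gamma> x y ** h y \<partial>M) = Yop \<Gamma> y ** h y"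
      using integrable_Yop(2)[OF i]
    proof eventually_elim
      case (elim y)
      show ?case
        unfolding Yop_def
        by (rule integral_bounded_linear[OF bounded_linear_matrix_mult_left elim])
    qed
  qed
  finally show "Xop \<Gamma> = (\<integral>z. transpose (h (fst z)) ** \<Gamma> (fst z) (snd z) ** h (snd z) \<partial>(M \<Otimes>\<^sub>M M))" ..
qed

definition Zop :: "('x \<Rightarrow> 'x \<Rightarrow> real^'d^'d) \<Rightarrow> 'x \<Rightarrow> real^'e^'d" where
  "Zop \<Gamma> x = (\<integral>y. \<Gamma> x y ** h y \<partial>M)"

lemma Zop_eq:
  assumes i: "integrable M (\<lambda>y. transpose (h y) ** \<Gamma> y x)"
    and m: "(\<lambda>y. \<Gamma> x y) \<in> borel_measurable M" and s: "AE y in M. \<Gamma> x y = transpose (\<Gamma> y x)"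
  shows "Zop \<Gamma> x = transpose (Yop \<Gamma> x)"
proof -
  have "transpose (Yop \<Gamma> x) = (\<integral>y. transpose (transpose (h y) ** \<Gamma> y x) \<partial>M)"
    unfolding Yop_def by (rule integral_bounded_linear[OF bounded_linear_transpose i, symmetric])
  also have "\<dots> = Zop \<Gamma> x"
    unfolding Zop_def
  proof (rule integral_cong_AE)
    show "(\<lambda>y. transpose (transpose (h y) ** \<Gamma> y x)) \<in> borel_measurable M"
      by (intro borel_measurable_transpose borel_measurable_integrable[OF i])
    show "(\<lambda>y. \<Gamma> x y ** h y) \<in> borel_measurable M"
      by (intro borel_measurable_matrix_mult[OF m h_measurable])
    show "AE y in M. transpose (transpose (h y) ** \<Gamma> y x) = \<Gamma> x y ** h y"
      using s by eventually_elim (simp add: matrix_transpose_mul transpose_transpose)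
  qed
  finally show ?thesis ..
qed

text \<open>
  A Lipschitz constant for the nonlinearity near arguments of norm at most \<open>k\<close>. Here \<open>p\<close> bounds the
  inverse matrices, \<open>\<sigma>\<close> the factor \<open>Salg\<close> at the first argument, and \<open>q\<close> is the Lipschitz constant of \<open>Salg\<close>.
\<close>

definition Rlip :: "real \<Rightarrow> real \<Rightarrow> real" where
  "Rlip k \<delta>m = (let p = (real CARD('m))\<^sup>2 / l; q = norm C + norm F * norm D; \<sigma> = Sbound k k in
     norm D * norm D + 2 * norm B + p * q * \<sigma> + p * q * q * (1 + \<delta>m) + \<sigma> * p * p * norm F * norm F * \<sigma>
      + \<sigma> * p * p * norm F * norm F * q * \<delta>m + \<sigma> * p * q)"

text \<open>
  Norm bounds are assumed on one side only: \<open>X'\<close>, \<open>U'\<close>, \<open>V'\<close> enter through their distances to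
  \<open>X\<close>, \<open>U\<close>, \<open>V\<close> and the positivity of \<open>X'\<close>. Products with \<open>\<delta>\<close> are absorbed by \<open>\<delta> \<le> \<delta>m\<close>. The product
  \<open>\<alpha> * \<beta>\<close> has to stay, since \<open>\<alpha>\<close> and \<open>\<beta>\<close> will be unbounded functions of \<open>x\<close> and of \<open>y\<close>.
\<close>

lemma Ralg_diff_bound:
  fixes k \<delta>m :: real
  assumes X: "norm X \<le> k" and U: "norm U \<le> k" and V: "norm V \<le> k"
    and X0: "\<And>u. 0 \<le> u \<bullet> (X *v u)" and X0': "\<And>u. 0 \<le> u \<bullet> (X' *v u)"
    and dX: "norm (X' - X) \<le> \<delta>" and dU: "norm (U' - U) \<le> \<alpha>" and dV: "norm (V' - V) \<le> \<beta>" and dm: "\<delta> \<le> \<delta>m"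
  shows "norm (Ralg 0 X' U' V' - Ralg 0 X U V) \<le> Rlip k \<delta>m * (\<delta> + \<alpha> + \<beta> + \<alpha> * \<beta>)"
    and "0 \<le> Rlip k \<delta>m"
proof -
  define p where "p = (real CARD('m))\<^sup>2 / l"
  define q where "q = norm C + norm F * norm D"
  define \<sigma> where "\<sigma> = Sbound k k"
  define L where "L = Rlip k \<delta>m"
  have L: "L = norm D * norm D + 2 * norm B + p * q * \<sigma> + p * q * q * (1 + \<delta>m) + \<sigma> * p * p * norm F * norm F * \<sigma>
      + \<sigma> * p * p * norm F * norm F * q * \<delta>m + \<sigma> * p * q"
    unfolding L_def Rlip_def Let_def p_def q_def \<sigma>_def ..
  have k0: "0 \<le> k" using norm_ge_zero[of X] X by linarith
  have nn: "0 \<le> \<delta>" "0 \<le> \<alpha>" "0 \<le> \<beta>" using norm_ge_zero order_trans dX dU dV by blast+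
  have p0: "0 \<le> p" "0 \<le> q" "0 \<le> \<sigma>" "0 \<le> \<delta>m" using l_pos k0 nn dm unfolding p_def q_def \<sigma>_def Sbound_def by auto
  show "0 \<le> Rlip k \<delta>m" unfolding L_def[symmetric] L using p0 by (intro add_nonneg_nonneg mult_nonneg_nonneg) auto
  define P where "P = cramer_inv (Nalg 0 X)"
  define P' where "P' = cramer_inv (Nalg 0 X')"
  note co = Nalg_coercive[OF X0 order_refl] and co' = Nalg_coercive[OF X0' order_refl]
  note inv = coercive_invertible[OF l_pos co] and inv' = coercive_invertible[OF l_pos co']
  have P: "norm P \<le> p" "norm P' \<le> p"
    using norm_inv_coercive_le[OF l_pos co] norm_inv_coercive_le[OF l_pos co']
    unfolding P_def P'_def p_def matrix_inv_eq_cramer[OF inv] matrix_inv_eq_cramer[OF inv'] by auto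
  have PP: "P' - P = P' ** (transpose F ** (X - X') ** F) ** P"
  proof -
    have N: "Nalg 0 X - Nalg 0 X' = transpose F ** (X - X') ** F"
      unfolding Nalg_def by (simp add: matrix_mult_diff_left matrix_mult_diff_right)
    have "P' ** (Nalg 0 X - Nalg 0 X') ** P = P' ** (Nalg 0 X ** P) - (P' ** Nalg 0 X') ** P"
      by (simp add: matrix_mult_diff_left matrix_mult_diff_right matrix_mul_assoc)
    also have "\<dots> = P' - P"
      using matrix_inv_right[OF inv] matrix_inv_left[OF inv'] unfolding matrix_inv_eq_cramer[OF inv] matrix_inv_eq_cramer[OF inv'] P_def P'_def by simp
    finally show ?thesis unfolding N ..
  qed
  have dX': "norm (X - X') \<le> \<delta>" using dX by (simp add: norm_minus_commute)
  have dP: "norm (P' - P) \<le> p * (norm F * \<delta> * norm F) * p"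
    unfolding PP by (intro norm_matrix_mult3_le P dX') auto
  have dS: "norm (Salg 0 X' W' - Salg 0 X W) \<le> q * (\<gamma> + \<delta>)" if "norm (W' - W) \<le> \<gamma>" for W W' \<gamma>
  proof -
    have g: "0 \<le> \<gamma>" using norm_ge_zero order_trans that by blast
    have "Salg 0 X' W' - Salg 0 X W = transpose C ** (W' - W) + transpose F ** (X' - X) ** D"
      unfolding Salg_def by (simp add: matrix_mult_diff_left matrix_mult_diff_right)
    moreover have "norm (transpose C ** (W' - W)) \<le> norm C * \<gamma>" using that by (intro norm_matrix_mult2_le) auto
    moreover have "norm (transpose F ** (X' - X) ** D) \<le> norm F * \<delta> * norm D" using dX by (intro norm_matrix_mult3_le) auto
    ultimately have "norm (Salg 0 X' W' - Salg 0 X W) \<le> norm C * \<gamma> + norm F * \<delta> * norm D"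
      by (metis norm_triangle_mono)
    also have "\<dots> \<le> q * (\<gamma> + \<delta>)" unfolding q_def using nn g by (simp add: algebra_simps)
    finally show ?thesis .
  qed
  define SU where "SU = Salg 0 X U"
  define SV where "SV = Salg 0 X V"
  define SU' where "SU' = Salg 0 X' U'"
  define SV' where "SV' = Salg 0 X' V'"
  have S: "norm SU \<le> \<sigma>" "norm SV \<le> \<sigma>" unfolding SU_def SV_def \<sigma>_def using X U V by (auto intro!: Salg_bound)
  have dSU: "norm (transpose (SU' - SU)) \<le> q * (\<alpha> + \<delta>)" unfolding SU_def SU'_def using dS[OF dU] by simp
  have dSV: "norm (SV' - SV) \<le> q * (\<beta> + \<delta>)" unfolding SV_def SV'_def by (rule dS[OF dV])
  have SV': "norm SV' \<le> \<sigma> + q * (\<beta> + \<delta>)"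
    using norm_triangle_ineq[of SV "SV' - SV"] S(2) dSV by simp
  have split: "transpose SU' ** P' ** SV' - transpose SU ** P ** SV
     = transpose (SU' - SU) ** P' ** SV' + transpose SU ** (P' - P) ** SV' + transpose SU ** P ** (SV' - SV)"
    by (simp add: transpose_diff matrix_mult_diff_left matrix_mult_diff_right)
  have 3: "norm (transpose SU' ** P' ** SV' - transpose SU ** P ** SV)
     \<le> (q * (\<alpha> + \<delta>)) * p * (\<sigma> + q * (\<beta> + \<delta>)) + \<sigma> * (p * (norm F * \<delta> * norm F) * p) * (\<sigma> + q * (\<beta> + \<delta>)) + \<sigma> * p * (q * (\<beta> + \<delta>))"
    unfolding split using S by (intro norm_sum3_le norm_matrix_mult3_le dSU P SV' dP dSV) auto
  have eq: "Ralg 0 X' U' V' - Ralg 0 X U V = transpose D ** (X' - X) ** D + transpose B ** (V' - V) + transpose (U' - U) ** B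
      - (transpose SU' ** P' ** SV' - transpose SU ** P ** SV)"
    unfolding Ralg_def SU_def SV_def SU'_def SV'_def P_def P'_def
    by (simp add: transpose_diff matrix_mult_diff_left matrix_mult_diff_right)
  have 1: "norm (transpose D ** (X' - X) ** D) \<le> norm D * \<delta> * norm D" using dX by (intro norm_matrix_mult3_le) auto
  have 2: "norm (transpose B ** (V' - V)) \<le> norm B * \<beta>" using dV by (intro norm_matrix_mult2_le) auto
  have twoU: "norm (transpose (U' - U) ** B) \<le> \<alpha> * norm B" using dU by (intro norm_matrix_mult2_le) auto
  have "norm (Ralg 0 X' U' V' - Ralg 0 X U V) \<le> norm D * \<delta> * norm D + norm B * \<beta> + \<alpha> * norm B
      + ((q * (\<alpha> + \<delta>)) * p * (\<sigma> + q * (\<beta> + \<delta>)) + \<sigma> * (p * (norm F * \<delta> * norm F) * p) * (\<sigma> + q * (\<beta> + \<delta>)) + \<sigma> * p * (q * (\<beta> + \<delta>)))"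
    unfolding eq by (intro norm_triangle_le_diff add_mono norm_sum3_le 1 2 twoU 3)
  also have "\<dots> \<le> L * (\<delta> + \<alpha> + \<beta> + \<alpha> * \<beta>)"
  proof -
    define E where "E = \<delta> + \<alpha> + \<beta> + \<alpha> * \<beta>"
    have ab: "0 \<le> \<alpha> * \<beta>" using nn by simp
    have E: "\<delta> \<le> E" "\<alpha> \<le> E" "\<beta> \<le> E" "\<alpha> + \<delta> \<le> E" "\<beta> + \<delta> \<le> E" "\<alpha> + \<beta> \<le> E" unfolding E_def using nn ab by auto
    have d1: "\<delta> * (\<beta> + \<delta>) \<le> \<delta>m * E" using dm nn E p0 by (intro mult_mono) auto
    have d2: "(\<alpha> + \<delta>) * (\<beta> + \<delta>) \<le> (1 + \<delta>m) * E"
    proof -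
      have "(\<alpha> + \<delta>) * (\<beta> + \<delta>) = \<alpha> * \<beta> + \<delta> * (\<alpha> + \<beta> + \<delta>)" by (simp add: algebra_simps)
      also have "\<dots> \<le> E + \<delta>m * E"
      proof -
        have "\<alpha> * \<beta> \<le> E" "\<alpha> + \<beta> + \<delta> \<le> E" "0 \<le> \<alpha> + \<beta> + \<delta>" unfolding E_def using nn ab by auto
        then show ?thesis using mult_mono[OF dm, of "\<alpha> + \<beta> + \<delta>" E] p0(4) by linarith
      qed
      finally show ?thesis by (simp add: algebra_simps)
    qed
    have "norm D * \<delta> * norm D \<le> (norm D * norm D) * E" using mult_left_mono[OF E(1), of "norm D * norm D"] by (simp add: ac_simps)
    moreover have "norm B * \<beta> + \<alpha> * norm B \<le> 2 * norm B * E" using mult_left_mono[OF E(2), of "norm B"] mult_left_mono[OF E(3), of "norm B"] by (simp add: ac_simps)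
    moreover have "(q * (\<alpha> + \<delta>)) * p * (\<sigma> + q * (\<beta> + \<delta>)) \<le> (p * q * \<sigma>) * E + (p * q * q * (1 + \<delta>m)) * E"
    proof -
      have "(q * (\<alpha> + \<delta>)) * p * (\<sigma> + q * (\<beta> + \<delta>)) = (p * q * \<sigma>) * (\<alpha> + \<delta>) + (p * q * q) * ((\<alpha> + \<delta>) * (\<beta> + \<delta>))" by (simp add: algebra_simps)
      also have "\<dots> \<le> (p * q * \<sigma>) * E + (p * q * q) * ((1 + \<delta>m) * E)" using p0 E d2 by (intro add_mono mult_left_mono) auto
      finally show ?thesis by (simp add: mult.assoc)
    qed
    moreover have "\<sigma> * (p * (norm F * \<delta> * norm F) * p) * (\<sigma> + q * (\<beta> + \<delta>)) \<le> (\<sigma> * p * p * norm F * norm F * \<sigma>) * E + (\<sigma> * p * p * norm F * norm F * q * \<delta>m) * E"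
    proof -
      have "\<sigma> * (p * (norm F * \<delta> * norm F) * p) * (\<sigma> + q * (\<beta> + \<delta>))
         = (\<sigma> * p * p * norm F * norm F * \<sigma>) * \<delta> + (\<sigma> * p * p * norm F * norm F * q) * (\<delta> * (\<beta> + \<delta>))" by (simp add: algebra_simps)
      also have "\<dots> \<le> (\<sigma> * p * p * norm F * norm F * \<sigma>) * E + (\<sigma> * p * p * norm F * norm F * q) * (\<delta>m * E)"
        using p0 E d1 by (intro add_mono mult_left_mono) auto
      finally show ?thesis by (simp add: mult.assoc)
    qed
    moreover have "\<sigma> * p * (q * (\<beta> + \<delta>)) \<le> (\<sigma> * p * q) * E"
      using mult_left_mono[OF E(5), of "\<sigma> * p * q"] p0 by (simp add: mult.assoc)
    ultimately show ?thesis unfolding L E_def[symmetric] distrib_right by linarith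
  qed
  finally show "norm (Ralg 0 X' U' V' - Ralg 0 X U V) \<le> Rlip k \<delta>m * (\<delta> + \<alpha> + \<beta> + \<alpha> * \<beta>)"
    unfolding L_def .
qed

end

section \<open>A Gronwall inequality with a Laplace transform as kernel\<close>

lemma ennreal_le_one_plus_square: "k \<le> 1 + k * k" for k :: ennreal
proof (cases "k \<le> 1")
  case True
  then show ?thesis by (simp add: add_increasing2)
next
  case False
  then have "k * 1 \<le> k * k" by (intro mult_left_mono) auto
  then show ?thesis by (simp add: add_increasing)
qed

context riccati_time begin

definition laplace :: "real \<Rightarrow> ennreal" where
  "laplace u = (\<integral>\<^sup>+x. ennreal (exp (- r x * u)) \<partial>M)"

lemma measurable_laplace [measurable]: "laplace \<in> borel_measurable borel"
  unfolding laplace_def[abs_def] by measurable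

text \<open>
  By Fubini, the part with the square of the Laplace transform is, for \<open>\<beta> = 2 * L\<close>, at most the
  double integral of \<open>1 / (r x + r y + 2 * L)\<close>, and this is at most \<open>(kap L)\<^sup>2\<close>.
\<close>

lemma gronwall_kernel_small:
  fixes \<epsilon> :: real
  assumes "0 < \<epsilon>"
  obtains \<beta> :: real where "0 < \<beta>"
    "\<And>t. 0 \<le> t \<Longrightarrow> t \<le> T \<Longrightarrow> (\<integral>\<^sup>+s. indicator {t..T} s * (1 + laplace (s - t) * laplace (s - t)) * ennreal (exp (- \<beta> * (s - t))) \<partial>lborel) \<le> ennreal \<epsilon>"
proof -
  obtain L0 where L0: "1 \<le> L0" "kap L0 < min 1 (\<epsilon> / 2)" using kap_small[of "min 1 (\<epsilon> / 2)"] assms by auto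
  define L where "L = max L0 (1 / \<epsilon>)"
  have L: "1 \<le> L" "1 / \<epsilon> \<le> L" using L0 by (auto simp: L_def)
  have "kap L \<le> kap L0"
    unfolding kap_def
  proof (rule integral_mono[OF integrable_kap[OF L(1)] integrable_kap[OF L0(1)]])
    fix x
    have "sqrt (r x + L0) \<le> sqrt (r x + L)" "0 < r x + L0" using r_nonneg[of x] L0 by (auto simp: L_def)
    then show "1 / sqrt (r x + L) \<le> 1 / sqrt (r x + L0)" by (intro frac_le) auto
  qed
  then have kL: "kap L \<le> 1" "kap L \<le> \<epsilon> / 2" "0 \<le> kap L" using L0 kap_nonneg[OF L(1)] by auto
  have kL2: "(kap L)\<^sup>2 \<le> \<epsilon> / 2"
    using mult_mono[OF kL(1,2)] kL assms by (simp add: power2_eq_square)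
  have iL: "1 / (2 * L) \<le> \<epsilon> / 2" using L assms by (simp add: field_simps)
  have ind: "indicator {t..T} s = ennreal (indicator {t..T} s)" for t s :: real by (simp add: indicator_def)
  have ex: "(\<integral>\<^sup>+s. indicator {t..T} s * ennreal (exp (- b * (s - t))) \<partial>lborel) \<le> ennreal (1 / b)"
    if "0 < b" "t \<le> T" for b t
  proof -
    have hb: "has_bochner_integral lborel (\<lambda>s. indicator {t..T} s * exp (- b * (s - t))) ((1 - exp (- b * (T - t))) / b)"
      using that by (intro has_bochner_integral_exp) auto
    have "(\<integral>\<^sup>+s. indicator {t..T} s * ennreal (exp (- b * (s - t))) \<partial>lborel) = (\<integral>\<^sup>+s. ennreal (indicator {t..T} s * exp (- b * (s - t))) \<partial>lborel)"
      by (intro nn_integral_cong) (simp add: ennreal_mult ind)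
    also have "\<dots> = ennreal ((1 - exp (- b * (T - t))) / b)"
      using hb by (subst nn_integral_eq_integral) (auto simp: has_bochner_integral_iff)
    also have "\<dots> \<le> ennreal (1 / b)" using that by (intro ennreal_leI divide_right_mono) auto
    finally show ?thesis .
  qed
  have "(\<integral>\<^sup>+s. indicator {t..T} s * (1 + laplace (s - t) * laplace (s - t)) * ennreal (exp (- (2 * L) * (s - t))) \<partial>lborel) \<le> ennreal \<epsilon>"
    if t: "0 \<le> t" "t \<le> T" for t
  proof -
    interpret P: sigma_finite_measure "M \<Otimes>\<^sub>M M" by (rule MM.sigma_finite_measure_axioms)
    interpret PL: pair_sigma_finite "M \<Otimes>\<^sub>M M" lborel ..
    define f where "f z s = indicator {t..T} s * ennreal (exp (- (r (fst z) + r (snd z) + 2 * L) * (s - t)))" for z s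
    have ind': "indicator {t..T} s = (if t \<le> s \<and> s \<le> T then 1 else (0::ennreal))" for s by (simp add: indicator_def)
    have fm: "(\<lambda>(z, s). f z s) \<in> borel_measurable ((M \<Otimes>\<^sub>M M) \<Otimes>\<^sub>M lborel)"
      unfolding f_def split_beta' ind' by measurable
    have ll: "laplace u * laplace u = (\<integral>\<^sup>+z. ennreal (exp (- r (fst z) * u)) * ennreal (exp (- r (snd z) * u)) \<partial>(M \<Otimes>\<^sub>M M))" for u
      unfolding laplace_def by (subst MM.nn_integral_times_fst_snd) auto
    have eq: "indicator {t..T} s * (laplace (s - t) * laplace (s - t)) * ennreal (exp (- (2 * L) * (s - t))) = (\<integral>\<^sup>+z. f z s \<partial>(M \<Otimes>\<^sub>M M))" for s
    proof -
      define k where "k = (indicator {t..T} s * ennreal (exp (- (2 * L) * (s - t))) :: ennreal)"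
      define g where "g z = ennreal (exp (- r (fst z) * (s - t))) * ennreal (exp (- r (snd z) * (s - t)))" for z
      have [measurable]: "g \<in> borel_measurable (M \<Otimes>\<^sub>M M)" unfolding g_def by measurable
      have "f z s = k * g z" for z
        unfolding f_def k_def g_def by (simp add: ennreal_mult[symmetric] exp_add[symmetric] mult.assoc algebra_simps)
      then have "(\<integral>\<^sup>+z. f z s \<partial>(M \<Otimes>\<^sub>M M)) = k * (\<integral>\<^sup>+z. g z \<partial>(M \<Otimes>\<^sub>M M))"
        by (simp only: nn_integral_cmult[OF \<open>g \<in> borel_measurable (M \<Otimes>\<^sub>M M)\<close>])
      then show ?thesis unfolding ll g_def[symmetric] k_def by (simp only: ac_simps)
    qed
    have "(\<integral>\<^sup>+s. indicator {t..T} s * (1 + laplace (s - t) * laplace (s - t)) * ennreal (exp (- (2 * L) * (s - t))) \<partial>lborel)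
      = (\<integral>\<^sup>+s. indicator {t..T} s * ennreal (exp (- (2 * L) * (s - t))) + indicator {t..T} s * (laplace (s - t) * laplace (s - t)) * ennreal (exp (- (2 * L) * (s - t))) \<partial>lborel)"
      by (intro nn_integral_cong) (simp add: distrib_left distrib_right)
    also have "\<dots> = (\<integral>\<^sup>+s. indicator {t..T} s * ennreal (exp (- (2 * L) * (s - t))) \<partial>lborel)
       + (\<integral>\<^sup>+s. indicator {t..T} s * (laplace (s - t) * laplace (s - t)) * ennreal (exp (- (2 * L) * (s - t))) \<partial>lborel)"
      by (rule nn_integral_add) measurable
    also have "(\<integral>\<^sup>+s. indicator {t..T} s * (laplace (s - t) * laplace (s - t)) * ennreal (exp (- (2 * L) * (s - t))) \<partial>lborel)
       = (\<integral>\<^sup>+z. \<integral>\<^sup>+s. f z s \<partial>lborel \<partial>(M \<Otimes>\<^sub>M M))"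
      unfolding eq by (rule PL.Fubini'[OF fm])
    also have "\<dots> \<le> (\<integral>\<^sup>+z. ennreal (1 / sqrt (r (fst z) + L)) * ennreal (1 / sqrt (r (snd z) + L)) \<partial>(M \<Otimes>\<^sub>M M))"
    proof (rule nn_integral_mono)
      fix z
      have "(\<integral>\<^sup>+s. f z s \<partial>lborel) \<le> ennreal (1 / (r (fst z) + r (snd z) + 2 * L))"
        unfolding f_def using r_nonneg[of "fst z"] r_nonneg[of "snd z"] L t by (intro ex) auto
      also have "\<dots> \<le> ennreal (1 / sqrt (r (fst z) + L) * (1 / sqrt (r (snd z) + L)))"
        by (intro ennreal_leI inverse_sum_le L)
      also have "\<dots> = ennreal (1 / sqrt (r (fst z) + L)) * ennreal (1 / sqrt (r (snd z) + L))"
        using r_nonneg[of "fst z"] r_nonneg[of "snd z"] L by (intro ennreal_mult) auto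
      finally show "(\<integral>\<^sup>+s. f z s \<partial>lborel) \<le> ennreal (1 / sqrt (r (fst z) + L)) * ennreal (1 / sqrt (r (snd z) + L))" .
    qed
    also have "\<dots> = ennreal ((kap L)\<^sup>2)"
    proof -
      have "(\<integral>\<^sup>+x. ennreal (1 / sqrt (r x + L)) \<partial>M) = ennreal (kap L)"
        unfolding kap_def using r_nonneg L by (intro nn_integral_eq_integral integrable_kap) (auto simp: add_nonneg_nonneg)
      then show ?thesis
        using kL by (subst MM.nn_integral_times_fst_snd) (auto simp: ennreal_mult[symmetric] power2_eq_square)
    qed
    finally have "(\<integral>\<^sup>+s. indicator {t..T} s * (1 + laplace (s - t) * laplace (s - t)) * ennreal (exp (- (2 * L) * (s - t))) \<partial>lborel)
      \<le> ennreal (1 / (2 * L)) + ennreal ((kap L)\<^sup>2)"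
      using ex[of "2 * L" t] t L by (meson add_mono order_trans order_refl mult_pos_pos zero_less_numeral less_le_trans zero_less_one)
    also have "\<dots> \<le> ennreal (\<epsilon> / 2) + ennreal (\<epsilon> / 2)" by (intro add_mono ennreal_leI iL kL2)
    also have "\<dots> = ennreal \<epsilon>" using assms by (simp add: ennreal_plus[symmetric] del: ennreal_plus)
    finally show ?thesis .
  qed
  then show ?thesis using that[of "2 * L"] L by simp
qed

text \<open>
  If \<open>\<phi> t \<le> a * exp (\<beta> * (T - t))\<close> on \<open>[0,T]\<close>, then the hypothesis improves this to \<open>a / 2\<close> in place of
  \<open>a\<close>, provided that \<open>\<beta>\<close> makes the weighted mass of the kernel at most \<open>1 / (2 * \<kappa>)\<close>.
\<close>

lemma gronwall:
  fixes \<phi> :: "real \<Rightarrow> ennreal" and \<kappa> A :: real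
  assumes bd: "\<And>t. t \<in> {0..T} \<Longrightarrow> \<phi> t \<le> ennreal A"
    and le: "\<And>t. t \<in> {0..T} \<Longrightarrow> \<phi> t \<le> ennreal \<kappa> * (\<integral>\<^sup>+s. indicator {t..T} s * ((1 + laplace (s - t) * laplace (s - t)) * \<phi> s) \<partial>lborel)"
    and t: "t \<in> {0..T}" and \<kappa>: "0 < \<kappa>"
  shows "\<phi> t = 0"
proof -
  obtain \<beta> where \<beta>: "0 < \<beta>" and small: "\<And>t. 0 \<le> t \<Longrightarrow> t \<le> T \<Longrightarrow>
    (\<integral>\<^sup>+s. indicator {t..T} s * (1 + laplace (s - t) * laplace (s - t)) * ennreal (exp (- \<beta> * (s - t))) \<partial>lborel) \<le> ennreal (1 / (2 * \<kappa>))"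
    using gronwall_kernel_small[of "1 / (2 * \<kappa>)"] \<kappa> by auto
  define A' where "A' = max 0 A"
  have step: "\<phi> t \<le> ennreal (A' / 2 ^ j * exp (\<beta> * (T - t)))" if "t \<in> {0..T}" for j t
    using that
  proof (induction j arbitrary: t)
    case 0
    have "1 \<le> exp (\<beta> * (T - t))" using 0 \<beta> by simp
    then have "A' * 1 \<le> A' * exp (\<beta> * (T - t))" unfolding A'_def by (intro mult_left_mono) auto
    then have "ennreal A \<le> ennreal (A' * exp (\<beta> * (T - t)))" unfolding A'_def by (intro ennreal_leI) auto
    then show ?case using bd[OF 0] by (auto intro: order_trans)
  next
    case (Suc j)
    define a where "a = A' / 2 ^ j"
    have a: "0 \<le> a" unfolding a_def A'_def by simp
    have "(\<integral>\<^sup>+s. indicator {t..T} s * ((1 + laplace (s - t) * laplace (s - t)) * \<phi> s) \<partial>lborel)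
      \<le> (\<integral>\<^sup>+s. ennreal (a * exp (\<beta> * (T - t))) * (indicator {t..T} s * (1 + laplace (s - t) * laplace (s - t)) * ennreal (exp (- \<beta> * (s - t)))) \<partial>lborel)"
    proof (rule nn_integral_mono)
      fix s
      show "indicator {t..T} s * ((1 + laplace (s - t) * laplace (s - t)) * \<phi> s)
        \<le> ennreal (a * exp (\<beta> * (T - t))) * (indicator {t..T} s * (1 + laplace (s - t) * laplace (s - t)) * ennreal (exp (- \<beta> * (s - t))))"
      proof (cases "s \<in> {t..T}")
        case True
        then have "s \<in> {0..T}" using Suc by auto
        from Suc.IH[OF this] have "\<phi> s \<le> ennreal (a * exp (\<beta> * (T - s)))" by (simp add: a_def)
        also have "a * exp (\<beta> * (T - s)) = (a * exp (\<beta> * (T - t))) * exp (- \<beta> * (s - t))"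
          by (simp add: exp_add[symmetric] algebra_simps)
        also have "ennreal \<dots> = ennreal (a * exp (\<beta> * (T - t))) * ennreal (exp (- \<beta> * (s - t)))"
          using a by (intro ennreal_mult) auto
        finally have "(1 + laplace (s - t) * laplace (s - t)) * \<phi> s \<le> (1 + laplace (s - t) * laplace (s - t)) * (ennreal (a * exp (\<beta> * (T - t))) * ennreal (exp (- \<beta> * (s - t))))"
          by (intro mult_left_mono) auto
        then show ?thesis using True by (simp add: ac_simps)
      qed simp
    qed
    also have "\<dots> = ennreal (a * exp (\<beta> * (T - t))) * (\<integral>\<^sup>+s. indicator {t..T} s * (1 + laplace (s - t) * laplace (s - t)) * ennreal (exp (- \<beta> * (s - t))) \<partial>lborel)"
      by (rule nn_integral_cmult) measurable
    also have "\<dots> \<le> ennreal (a * exp (\<beta> * (T - t))) * ennreal (1 / (2 * \<kappa>))"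
      using Suc by (intro mult_left_mono small) auto
    finally have "\<phi> t \<le> ennreal \<kappa> * (ennreal (a * exp (\<beta> * (T - t))) * ennreal (1 / (2 * \<kappa>)))"
      using le[OF Suc.prems] by (meson mult_left_mono order_trans zero_le)
    also have "\<dots> = ennreal (\<kappa> * (a * exp (\<beta> * (T - t)) * (1 / (2 * \<kappa>))))"
      using a \<kappa> by (simp add: ennreal_mult[symmetric] del: ennreal_mult) 
    also have "\<kappa> * (a * exp (\<beta> * (T - t)) * (1 / (2 * \<kappa>))) = A' / 2 ^ Suc j * exp (\<beta> * (T - t))"
      unfolding a_def using \<kappa> by (simp add: field_simps)
    finally show ?case .
  qed
  have "(\<lambda>j. ennreal (A' * exp (\<beta> * (T - t)) * (1 / 2) ^ j)) \<longlonglongrightarrow> ennreal (A' * exp (\<beta> * (T - t)) * 0)"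
    by (intro tendsto_ennrealI tendsto_mult_left LIMSEQ_realpow_zero) auto
  then have "\<phi> t \<le> ennreal (A' * exp (\<beta> * (T - t)) * 0)"
    by (rule LIMSEQ_le_const) (use step[OF t] in \<open>auto simp: power_one_over field_simps\<close>)
  then show ?thesis by simp
qed

text \<open>
  All four terms are products of a function of \<open>x\<close> and one of \<open>y\<close>. A factor without \<open>a\<close> integrates to
  \<open>laplace u\<close>, one with \<open>a\<close> to at most \<open>A\<close>.
\<close>

lemma nn_integral_exp_product_le:
  fixes a :: "'x \<Rightarrow> ennreal" and \<delta> A :: ennreal and A0 :: real
  assumes [measurable]: "a \<in> borel_measurable M" and A: "(\<integral>\<^sup>+x. a x \<partial>M) \<le> A" and A0: "A \<le> ennreal A0" and u: "0 \<le> u" and \<delta>: "\<delta> \<le> ennreal b * A"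
  shows "(\<integral>\<^sup>+z. ennreal (exp (- (r (fst z) + r (snd z)) * u)) * (\<delta> + a (fst z) + a (snd z) + a (fst z) * a (snd z)) \<partial>(M \<Otimes>\<^sub>M M))
    \<le> (ennreal b + 2 + ennreal A0) * (1 + laplace u * laplace u) * A"
proof -
  define e where "e x = ennreal (exp (- r x * u))" for x
  have [measurable]: "e \<in> borel_measurable M" unfolding e_def by measurable
  have e1: "e x \<le> 1" for x unfolding e_def using r_nonneg[of x] u by (simp add: mult_nonneg_nonneg)
  have le: "(\<integral>\<^sup>+x. e x \<partial>M) = laplace u" unfolding e_def laplace_def ..
  have ea: "(\<integral>\<^sup>+x. e x * a x \<partial>M) \<le> A"
  proof -
    have "(\<integral>\<^sup>+x. e x * a x \<partial>M) \<le> (\<integral>\<^sup>+x. 1 * a x \<partial>M)" by (intro nn_integral_mono mult_right_mono e1) auto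
    then show ?thesis using A by simp
  qed
  have split: "ennreal (exp (- (r x + r y) * u)) = e x * e y" for x y
    unfolding e_def by (simp add: ennreal_mult[symmetric] exp_add[symmetric] algebra_simps)
  have "(\<integral>\<^sup>+z. ennreal (exp (- (r (fst z) + r (snd z)) * u)) * (\<delta> + a (fst z) + a (snd z) + a (fst z) * a (snd z)) \<partial>(M \<Otimes>\<^sub>M M))
     = (\<integral>\<^sup>+z. (\<delta> * e (fst z)) * e (snd z) + (e (fst z) * a (fst z)) * e (snd z) + e (fst z) * (e (snd z) * a (snd z))
         + (e (fst z) * a (fst z)) * (e (snd z) * a (snd z)) \<partial>(M \<Otimes>\<^sub>M M))"
    unfolding split by (intro nn_integral_cong) (simp add: distrib_left ac_simps)
  also have "\<dots> = (\<integral>\<^sup>+z. (\<delta> * e (fst z)) * e (snd z) \<partial>(M \<Otimes>\<^sub>M M)) + (\<integral>\<^sup>+z. (e (fst z) * a (fst z)) * e (snd z) \<partial>(M \<Otimes>\<^sub>M M))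
      + (\<integral>\<^sup>+z. e (fst z) * (e (snd z) * a (snd z)) \<partial>(M \<Otimes>\<^sub>M M)) + (\<integral>\<^sup>+z. (e (fst z) * a (fst z)) * (e (snd z) * a (snd z)) \<partial>(M \<Otimes>\<^sub>M M))"
    by (simp add: nn_integral_add)
  also have "\<dots> = \<delta> * laplace u * laplace u + (\<integral>\<^sup>+x. e x * a x \<partial>M) * laplace u + laplace u * (\<integral>\<^sup>+x. e x * a x \<partial>M) + (\<integral>\<^sup>+x. e x * a x \<partial>M) * (\<integral>\<^sup>+x. e x * a x \<partial>M)"
    using MM.nn_integral_times_fst_snd[of "\<lambda>x. \<delta> * e x" e] MM.nn_integral_times_fst_snd[of "\<lambda>x. e x * a x" e]
      MM.nn_integral_times_fst_snd[of e "\<lambda>x. e x * a x"] MM.nn_integral_times_fst_snd[of "\<lambda>x. e x * a x" "\<lambda>x. e x * a x"]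
    by (simp add: nn_integral_cmult le)
  also have "\<dots> \<le> (ennreal b * A) * (laplace u * laplace u) + A * (1 + laplace u * laplace u) + (1 + laplace u * laplace u) * A + A * ennreal A0"
  proof (intro add_mono)
    show "\<delta> * laplace u * laplace u \<le> (ennreal b * A) * (laplace u * laplace u)"
      unfolding mult.assoc[of \<delta>] by (intro mult_right_mono \<delta>) auto
    show "(\<integral>\<^sup>+x. e x * a x \<partial>M) * laplace u \<le> A * (1 + laplace u * laplace u)"
      by (rule mult_mono[OF ea ennreal_le_one_plus_square]) auto
    show "laplace u * (\<integral>\<^sup>+x. e x * a x \<partial>M) \<le> (1 + laplace u * laplace u) * A"
      by (rule mult_mono[OF ennreal_le_one_plus_square ea]) auto
    show "(\<integral>\<^sup>+x. e x * a x \<partial>M) * (\<integral>\<^sup>+x. e x * a x \<partial>M) \<le> A * ennreal A0"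
      by (rule mult_mono[OF ea order_trans[OF ea A0]]) auto
  qed
  also have "\<dots> \<le> (ennreal b * A) * (1 + laplace u * laplace u) + A * (1 + laplace u * laplace u) + (1 + laplace u * laplace u) * A + A * ennreal A0 * (1 + laplace u * laplace u)"
  proof (intro add_mono order_refl mult_left_mono)
    have "A * ennreal A0 * 1 \<le> A * ennreal A0 * (1 + laplace u * laplace u)" by (intro mult_left_mono) auto
    then show "A * ennreal A0 \<le> A * ennreal A0 * (1 + laplace u * laplace u)" by simp
  qed auto
  also have "\<dots> = (ennreal b + 2 + ennreal A0) * (1 + laplace u * laplace u) * A"
  proof -
    define g where "g = 1 + laplace u * laplace u"
    have "(2::ennreal) = 1 + 1" by simp
    then show ?thesis unfolding g_def[symmetric] by (simp only: distrib_right distrib_left ac_simps mult_1_left mult_1_right)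
  qed
  finally show ?thesis .
qed

end

section \<open>Uniqueness\<close>

context riccati_data begin

lemma Yop_diff_bound:
  assumes i1: "integrable (M \<Otimes>\<^sub>M M) (\<lambda>z. G1 (fst z) (snd z))" and i2: "integrable (M \<Otimes>\<^sub>M M) (\<lambda>z. G2 (fst z) (snd z))"
  shows "AE y in M. ennreal (norm (Yop G1 y - Yop G2 y)) \<le> ennreal c * (\<integral>\<^sup>+x. ennreal (norm (G1 x y - G2 x y)) \<partial>M)"
  using integrable_Yop(2)[OF i1] integrable_Yop(2)[OF i2] AE_space
proof eventually_elim
  case (elim y)
  note [measurable] = borel_measurable_integrable[OF i1] borel_measurable_integrable[OF i2]
  have sec: "(\<lambda>x. G x y) \<in> borel_measurable M" if "(\<lambda>z. G (fst z) (snd z)) \<in> borel_measurable (M \<Otimes>\<^sub>M M)" for G :: "'x \<Rightarrow> 'x \<Rightarrow> real^'d^'d"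
    using measurable_compose[OF measurable_Pair2'[OF elim(3)] that] by simp
  note [measurable] = sec[OF borel_measurable_integrable[OF i1]] sec[OF borel_measurable_integrable[OF i2]]
  have eq: "Yop G1 y - Yop G2 y = (\<integral>x. transpose (h x) ** (G1 x y - G2 x y) \<partial>M)"
    unfolding Yop_def using elim by (simp add: matrix_mult_diff_right)
  have i: "integrable M (\<lambda>x. transpose (h x) ** (G1 x y - G2 x y))"
    using elim by (simp add: matrix_mult_diff_right)
  have "ennreal (norm (Yop G1 y - Yop G2 y)) \<le> (\<integral>\<^sup>+x. ennreal (norm (transpose (h x) ** (G1 x y - G2 x y))) \<partial>M)"
    unfolding eq by (rule integral_norm_bound_ennreal[OF i])
  also have "\<dots> \<le> (\<integral>\<^sup>+x. ennreal c * ennreal (norm (G1 x y - G2 x y)) \<partial>M)"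
  proof (rule nn_integral_mono_AE)
    show "AE x in M. ennreal (norm (transpose (h x) ** (G1 x y - G2 x y))) \<le> ennreal c * ennreal (norm (G1 x y - G2 x y))"
      using h_bound
    proof eventually_elim
      case (elim x)
      have "norm (transpose (h x) ** (G1 x y - G2 x y)) \<le> c * norm (G1 x y - G2 x y)"
        using elim by (intro norm_matrix_mult2_le) auto
      then show ?case using c_nonneg by (simp add: ennreal_mult[symmetric] ennreal_leI)
    qed
  qed
  also have "\<dots> = ennreal c * (\<integral>\<^sup>+x. ennreal (norm (G1 x y - G2 x y)) \<partial>M)"
    by (rule nn_integral_cmult) measurable
  finally show ?case .
qed

lemma Xop_diff_bound:
  assumes i1: "integrable (M \<Otimes>\<^sub>M M) (\<lambda>z. G1 (fst z) (snd z))" and i2: "integrable (M \<Otimes>\<^sub>M M) (\<lambda>z. G2 (fst z) (snd z))"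
  shows "ennreal (norm (Xop G1 - Xop G2)) \<le> ennreal c * (ennreal c * (\<integral>\<^sup>+z. ennreal (norm (G1 (fst z) (snd z) - G2 (fst z) (snd z))) \<partial>(M \<Otimes>\<^sub>M M)))"
proof -
  note j1 = integrable_mult_h[OF integrable_Yop(1)[OF i1]] and j2 = integrable_mult_h[OF integrable_Yop(1)[OF i2]]
  note [measurable] = borel_measurable_integrable[OF i1] borel_measurable_integrable[OF i2]
  let ?f = "\<lambda>z. ennreal (norm (G1 (fst z) (snd z) - G2 (fst z) (snd z)))"
  have fm: "?f \<in> borel_measurable (M \<Otimes>\<^sub>M M)" by measurable
  have i: "integrable M (\<lambda>y. (Yop G1 y - Yop G2 y) ** h y)"
    using j1 j2 by (simp add: matrix_mult_diff_left)
  have eq: "Xop G1 - Xop G2 = (\<integral>y. (Yop G1 y - Yop G2 y) ** h y \<partial>M)"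
    unfolding Xop_def using j1 j2 by (simp add: matrix_mult_diff_left)
  have am: "(\<lambda>y. \<integral>\<^sup>+x. ?f (x, y) \<partial>M) \<in> borel_measurable M"
  proof -
    have "(\<lambda>(y, x). ?f (x, y)) \<in> borel_measurable (M \<Otimes>\<^sub>M M)"
      using measurable_compose[OF measurable_pair_swap' fm] by (simp add: split_beta' case_prod_beta')
    then show ?thesis by (rule borel_measurable_nn_integral)
  qed
  have "ennreal (norm (Xop G1 - Xop G2)) \<le> (\<integral>\<^sup>+y. ennreal (norm ((Yop G1 y - Yop G2 y) ** h y)) \<partial>M)"
    unfolding eq by (rule integral_norm_bound_ennreal[OF i])
  also have "\<dots> \<le> (\<integral>\<^sup>+y. ennreal c * (ennreal c * (\<integral>\<^sup>+x. ?f (x, y) \<partial>M)) \<partial>M)"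
  proof (rule nn_integral_mono_AE)
    show "AE y in M. ennreal (norm ((Yop G1 y - Yop G2 y) ** h y)) \<le> ennreal c * (ennreal c * (\<integral>\<^sup>+x. ?f (x, y) \<partial>M))"
      using h_bound Yop_diff_bound[OF i1 i2]
    proof eventually_elim
      case (elim y)
      have "norm ((Yop G1 y - Yop G2 y) ** h y) \<le> norm (Yop G1 y - Yop G2 y) * c"
        using elim by (intro norm_matrix_mult2_le) auto
      then have "ennreal (norm ((Yop G1 y - Yop G2 y) ** h y)) \<le> ennreal c * ennreal (norm (Yop G1 y - Yop G2 y))"
        using c_nonneg by (simp add: ennreal_mult[symmetric] ennreal_leI mult.commute)
      also have "\<dots> \<le> ennreal c * (ennreal c * (\<integral>\<^sup>+x. ?f (x, y) \<partial>M))"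
        using elim by (intro mult_left_mono) auto
      finally show ?case .
    qed
  qed
  also have "\<dots> = ennreal c * (ennreal c * (\<integral>\<^sup>+y. \<integral>\<^sup>+x. ?f (x, y) \<partial>M \<partial>M))"
    using am by (simp add: nn_integral_cmult)
  also have "(\<integral>\<^sup>+y. \<integral>\<^sup>+x. ?f (x, y) \<partial>M \<partial>M) = (\<integral>\<^sup>+z. ?f z \<partial>(M \<Otimes>\<^sub>M M))"
    by (rule MM.nn_integral_snd[OF fm])
  finally show ?thesis .
qed

lemma kern_integrable:
  assumes k: "kern K \<Gamma>"
  shows "integrable (M \<Otimes>\<^sub>M M) (\<lambda>z. \<Gamma> (fst z) (snd z))"
    "(\<integral>z. norm (\<Gamma> (fst z) (snd z)) \<partial>(M \<Otimes>\<^sub>M M)) \<le> K * (\<integral>z. w (fst z) * w (snd z) \<partial>(M \<Otimes>\<^sub>M M))"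
proof -
  have iw: "integrable (M \<Otimes>\<^sub>M M) (\<lambda>z. K * (w (fst z) * w (snd z)))"
    by (intro integrable_mult_right MM.integrable_times_fst_snd integrable_weight)
  have bd: "norm (\<Gamma> (fst z) (snd z)) \<le> K * (w (fst z) * w (snd z))" for z
    using kern_bound[OF k, of "fst z" "snd z"] by (simp add: mult.assoc)
  show i: "integrable (M \<Otimes>\<^sub>M M) (\<lambda>z. \<Gamma> (fst z) (snd z))"
    by (rule Bochner_Integration.integrable_bound[OF iw kern_measurable[OF k]])
      (intro always_eventually allI, unfold real_norm_def, rule order_trans[OF bd abs_ge_self])
  have "(\<integral>z. norm (\<Gamma> (fst z) (snd z)) \<partial>(M \<Otimes>\<^sub>M M)) \<le> (\<integral>z. K * (w (fst z) * w (snd z)) \<partial>(M \<Otimes>\<^sub>M M))"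
    by (intro integral_mono[OF integrable_norm[OF i] iw] bd)
  then show "(\<integral>z. norm (\<Gamma> (fst z) (snd z)) \<partial>(M \<Otimes>\<^sub>M M)) \<le> K * (\<integral>z. w (fst z) * w (snd z) \<partial>(M \<Otimes>\<^sub>M M))"
    by simp
qed

text \<open>
  The nonlinearity with the right integral \<open>Zop \<Gamma>\<close> as in the Riccati equation. In \<open>Rop\<close> it is replaced
  by the transpose of \<open>Yop \<Gamma>\<close>, which agrees with it for symmetric kernels, but only almost everywhere if
  the symmetry holds only almost everywhere.
\<close>

definition Rgen :: "('x \<Rightarrow> 'x \<Rightarrow> real^'d^'d) \<Rightarrow> 'x \<Rightarrow> 'x \<Rightarrow> real^'d^'d" where
  "Rgen \<Gamma> x y = Rop 0 \<Gamma> x y + (Zop \<Gamma> x - transpose (Yop \<Gamma> x)) ** B"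

lemma Zop_eq_AE:
  assumes i: "integrable (M \<Otimes>\<^sub>M M) (\<lambda>z. \<Gamma> (fst z) (snd z))"
    and s: "AE z in M \<Otimes>\<^sub>M M. \<Gamma> (fst z) (snd z) = transpose (\<Gamma> (snd z) (fst z))"
  shows "AE x in M. Zop \<Gamma> x = transpose (Yop \<Gamma> x)"
  using integrable_Yop(2)[OF i] MM.AE_pair[OF s] AE_space
proof eventually_elim
  case (elim x)
  have "(\<lambda>y. \<Gamma> x y) \<in> borel_measurable M"
    using measurable_compose[OF measurable_Pair1'[OF elim(3)] borel_measurable_integrable[OF i]] by simp
  then show ?case using elim by (intro Zop_eq) auto
qed

text \<open>
  Lemma \<open>Ralg_diff_bound\<close> at almost every pair of points, with \<open>a\<close> at the two points as \<open>\<alpha>\<close> and \<open>\<beta>\<close>. The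
  function \<open>a\<close> is integrable, hence finite almost everywhere.
\<close>

lemma Rgen_diff_AE:
  assumes k: "kern K \<Gamma>" and pd: "pd \<Gamma>"
    and i: "integrable (M \<Otimes>\<^sub>M M) (\<lambda>z. \<Gamma>' (fst z) (snd z))"
    and s: "AE z in M \<Otimes>\<^sub>M M. \<Gamma>' (fst z) (snd z) = transpose (\<Gamma>' (snd z) (fst z))"
    and X0: "\<And>u. 0 \<le> u \<bullet> (Xop \<Gamma>' *v u)"
    and \<phi>: "(\<integral>\<^sup>+z. ennreal (norm (\<Gamma>' (fst z) (snd z) - \<Gamma> (fst z) (snd z))) \<partial>(M \<Otimes>\<^sub>M M)) \<le> ennreal A"
    and \<sigma>: "k = max (c * K * W1) (c * K * W1 * c * W1)" "0 \<le> A"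
    and L: "L = Rlip k (c * c * A)"
  defines "\<delta> \<equiv> ennreal c * (ennreal c * (\<integral>\<^sup>+z. ennreal (norm (\<Gamma>' (fst z) (snd z) - \<Gamma> (fst z) (snd z))) \<partial>(M \<Otimes>\<^sub>M M)))"
    and "a \<equiv> \<lambda>y. ennreal c * (\<integral>\<^sup>+x. ennreal (norm (\<Gamma>' x y - \<Gamma> x y)) \<partial>M)"
  shows "AE z in M \<Otimes>\<^sub>M M. ennreal (norm (Rgen \<Gamma>' (fst z) (snd z) - Rop 0 \<Gamma> (fst z) (snd z)))
     \<le> ennreal L * (\<delta> + a (fst z) + a (snd z) + a (fst z) * a (snd z))"
    and "0 \<le> L" and "a \<in> borel_measurable M"
    and "(\<integral>\<^sup>+y. a y \<partial>M) = ennreal c * (\<integral>\<^sup>+z. ennreal (norm (\<Gamma>' (fst z) (snd z) - \<Gamma> (fst z) (snd z))) \<partial>(M \<Otimes>\<^sub>M M))"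
proof -
  note ik = kern_integrable(1)[OF k]
  note [measurable] = borel_measurable_integrable[OF i] borel_measurable_integrable[OF ik]
  let ?f = "\<lambda>z. ennreal (norm (\<Gamma>' (fst z) (snd z) - \<Gamma> (fst z) (snd z)))"
  have fm: "?f \<in> borel_measurable (M \<Otimes>\<^sub>M M)" by measurable
  have "(\<lambda>(y, x). ?f (x, y)) \<in> borel_measurable (M \<Otimes>\<^sub>M M)"
    using measurable_compose[OF measurable_pair_swap' fm] by (simp add: split_beta' case_prod_beta')
  from borel_measurable_nn_integral[OF this] have a1: "(\<lambda>y. \<integral>\<^sup>+x. ennreal (norm (\<Gamma>' x y - \<Gamma> x y)) \<partial>M) \<in> borel_measurable M"
    by simp
  then show am: "a \<in> borel_measurable M" unfolding a_def by measurable
  have "(\<integral>\<^sup>+y. \<integral>\<^sup>+x. ennreal (norm (\<Gamma>' x y - \<Gamma> x y)) \<partial>M \<partial>M) = (\<integral>\<^sup>+z. ?f z \<partial>(M \<Otimes>\<^sub>M M))"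
    using MM.nn_integral_snd[OF fm] by simp
  then show aint: "(\<integral>\<^sup>+y. a y \<partial>M) = ennreal c * (\<integral>\<^sup>+z. ?f z \<partial>(M \<Otimes>\<^sub>M M))"
    unfolding a_def using a1 by (simp add: nn_integral_cmult)
  have afin: "AE y in M. a y \<noteq> \<infinity>"
  proof (rule nn_integral_PInf_AE[OF am])
    have "(\<integral>\<^sup>+y. a y \<partial>M) \<le> ennreal c * ennreal A" unfolding aint by (intro mult_left_mono \<phi>) auto
    also have "\<dots> < \<infinity>" by (simp add: ennreal_mult_less_top)
    finally show "(\<integral>\<^sup>+y. a y \<partial>M) \<noteq> \<infinity>" by simp
  qed
  have \<delta>le: "\<delta> \<le> ennreal (c * c * A)"
  proof -
    have "\<delta> \<le> ennreal c * (ennreal c * ennreal A)" unfolding \<delta>_def by (intro mult_left_mono \<phi>) auto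
    then show ?thesis using c_nonneg \<sigma>(2) by (simp add: ennreal_mult[symmetric] mult.assoc)
  qed
  then have \<delta>fin: "\<delta> < top" by (rule order.strict_trans1) simp
  have Yb: "norm (Yop \<Gamma> x) \<le> k" for x
  proof -
    have "norm (Yop \<Gamma> x) \<le> c * K * W1 * w x" by (rule Y_bound[OF k])
    also have "\<dots> \<le> c * K * W1 * 1"
      using c_nonneg kern_nonneg[OF k] W1_nonneg weight_le_1 by (intro mult_left_mono mult_nonneg_nonneg) auto
    finally show ?thesis using \<sigma> by simp
  qed
  have Xb: "norm (Xop \<Gamma>) \<le> k" using X_bound[OF k] \<sigma> by simp
  have dX: "norm (Xop \<Gamma>' - Xop \<Gamma>) \<le> enn2real \<delta>"
    using Xop_diff_bound[OF i ik] \<delta>fin unfolding \<delta>_def[symmetric]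
    by (metis enn2real_ennreal enn2real_mono norm_ge_zero)
  have \<delta>m: "enn2real \<delta> \<le> c * c * A"
    using enn2real_mono[OF \<delta>le] c_nonneg \<sigma>(2) by simp
  have main: "norm (Ralg 0 (Xop \<Gamma>') U' V' - Ralg 0 (Xop \<Gamma>) (Yop \<Gamma> x) (Yop \<Gamma> y)) \<le> L * (enn2real \<delta> + \<alpha> + \<beta> + \<alpha> * \<beta>)"
    and L0: "0 \<le> L" if "norm (U' - Yop \<Gamma> x) \<le> \<alpha>" "norm (V' - Yop \<Gamma> y) \<le> \<beta>" for U' V' x y \<alpha> \<beta>
    unfolding L using Ralg_diff_bound[OF Xb Yb Yb Xop_nonneg[OF k pd] X0 dX that \<delta>m] by auto
  show L0: "0 \<le> L" using L0[of "Yop \<Gamma> x" x 0 "Yop \<Gamma> x" x 0 for x] by simp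
  show "AE z in M \<Otimes>\<^sub>M M. ennreal (norm (Rgen \<Gamma>' (fst z) (snd z) - Rop 0 \<Gamma> (fst z) (snd z)))
     \<le> ennreal L * (\<delta> + a (fst z) + a (snd z) + a (fst z) * a (snd z))"
    using MM.AE_fstI[OF Zop_eq_AE[OF i s]] MM.AE_fstI[OF afin] MM.AE_sndI[OF afin]
      MM.AE_fstI[OF Yop_diff_bound[OF i ik]] MM.AE_sndI[OF Yop_diff_bound[OF i ik]]
  proof eventually_elim
    case (elim z)
    let ?x = "fst z" and ?y = "snd z"
    have fin: "a ?x < top" "a ?y < top" using elim(2,3) by (auto simp: less_top)
    have "norm (Yop \<Gamma>' ?x - Yop \<Gamma> ?x) \<le> enn2real (a ?x)" "norm (Yop \<Gamma>' ?y - Yop \<Gamma> ?y) \<le> enn2real (a ?y)"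
      using enn2real_mono[OF elim(4)[folded a_def]] enn2real_mono[OF elim(5)[folded a_def]] fin unfolding a_def by auto
    from main[OF this] have "norm (Rop 0 \<Gamma>' ?x ?y - Rop 0 \<Gamma> ?x ?y) \<le> L * (enn2real \<delta> + enn2real (a ?x) + enn2real (a ?y) + enn2real (a ?x) * enn2real (a ?y))"
      unfolding Rop_def .
    moreover have "Rgen \<Gamma>' ?x ?y = Rop 0 \<Gamma>' ?x ?y"
      unfolding Rgen_def elim(1) by (simp add: matrix_mult_zero_left)
    ultimately have "ennreal (norm (Rgen \<Gamma>' ?x ?y - Rop 0 \<Gamma> ?x ?y))
       \<le> ennreal (L * (enn2real \<delta> + enn2real (a ?x) + enn2real (a ?y) + enn2real (a ?x) * enn2real (a ?y)))"
      by (intro ennreal_leI) simp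
    also have "\<dots> = ennreal L * (\<delta> + a ?x + a ?y + a ?x * a ?y)"
      using L0 fin \<delta>fin by (simp add: ennreal_mult ennreal_plus)
    finally show ?case .
  qed
qed

end

context riccati_time begin

lemma pmeas_Rgen:
  assumes pm: "pmeas \<Gamma>"
  shows "pmeas (\<lambda>s. Rgen (\<Gamma> s))"
proof -
  have "(\<lambda>q. (\<lambda>p. \<Gamma> (fst p) (fst (snd p)) (snd (snd p))) (fst (fst q), (snd (fst q), snd q))) \<in> borel_measurable ((borel \<Otimes>\<^sub>M M) \<Otimes>\<^sub>M M)"
    by (rule measurable_compose[OF _ pm[unfolded pmeas_def]]) measurable
  then have [measurable]: "(\<lambda>q. \<Gamma> (fst (fst q)) (snd (fst q)) (snd q)) \<in> borel_measurable ((borel \<Otimes>\<^sub>M M) \<Otimes>\<^sub>M M)"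
    by simp
  have "(\<lambda>(p, y). \<Gamma> (fst p) (snd p) y ** h y) \<in> borel_measurable ((borel \<Otimes>\<^sub>M M) \<Otimes>\<^sub>M M)"
    unfolding split_beta' by measurable
  then have Z: "(\<lambda>p. Zop (\<Gamma> (fst p)) (snd p)) \<in> borel_measurable (borel \<Otimes>\<^sub>M M)"
    unfolding Zop_def by (rule borel_measurable_lebesgue_integral)
  have m: "(\<lambda>p. (fst p, fst (snd p))) \<in> (borel \<Otimes>\<^sub>M (M \<Otimes>\<^sub>M M)) \<rightarrow>\<^sub>M (borel \<Otimes>\<^sub>M M)" by measurable
  have ZY: "(\<lambda>p. Zop (\<Gamma> (fst p)) (fst (snd p))) \<in> borel_measurable (borel \<Otimes>\<^sub>M (M \<Otimes>\<^sub>M M))"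
    "(\<lambda>p. Yop (\<Gamma> (fst p)) (fst (snd p))) \<in> borel_measurable (borel \<Otimes>\<^sub>M (M \<Otimes>\<^sub>M M))"
    using measurable_compose[OF m Z] measurable_compose[OF m pmeas_Yop[OF pm]] by simp_all
  show ?thesis
    using pmeas_Rop[OF pm, of 0] ZY unfolding pmeas_def Rgen_def
    by (intro borel_measurable_add borel_measurable_diff borel_measurable_matrix_mult borel_measurable_transpose borel_measurable_const)
qed

text \<open>
  The \<open>L\<^sup>1\<close> distance \<open>\<phi>\<close> of the two solutions satisfies the hypothesis of \<open>gronwall\<close>: the bound of
  \<open>Rgen_diff_AE\<close> is integrated against \<open>exp (- (r x + r y) * (s - t))\<close> with the help of
  \<open>nn_integral_exp_product_le\<close>.
\<close>

lemma mild_solution_unique: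
  assumes a: "pd_path K \<Gamma>" and sol: "Jop 0 (\<lambda>s. Rop 0 (\<Gamma> s)) = \<Gamma>"
    and pm: "pmeas \<Gamma>'"
    and int: "\<And>t. t \<in> {0..T} \<Longrightarrow> integrable (M \<Otimes>\<^sub>M M) (\<lambda>z. \<Gamma>' t (fst z) (snd z))"
    and bdd: "\<And>t. t \<in> {0..T} \<Longrightarrow> (\<integral>z. norm (\<Gamma>' t (fst z) (snd z)) \<partial>(M \<Otimes>\<^sub>M M)) \<le> Dm"
    and sym: "\<And>t. t \<in> {0..T} \<Longrightarrow> AE z in M \<Otimes>\<^sub>M M. \<Gamma>' t (fst z) (snd z) = transpose (\<Gamma>' t (snd z) (fst z))"
    and X0: "\<And>t u. t \<in> {0..T} \<Longrightarrow> 0 \<le> u \<bullet> (Xop (\<Gamma>' t) *v u)"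
    and eq: "\<And>t. t \<in> {0..T} \<Longrightarrow> AE z in M \<Otimes>\<^sub>M M.
        set_integrable lborel {t..T} (\<lambda>s. exp (- (r (fst z) + r (snd z)) * (s - t)) *\<^sub>R Rgen (\<Gamma>' s) (fst z) (snd z)) \<and>
        \<Gamma>' t (fst z) (snd z) = (LINT s:{t..T}|lborel. exp (- (r (fst z) + r (snd z)) * (s - t)) *\<^sub>R Rgen (\<Gamma>' s) (fst z) (snd z))"
    and t: "t \<in> {0..T}"
  shows "AE z in M \<Otimes>\<^sub>M M. \<Gamma>' t (fst z) (snd z) = \<Gamma> t (fst z) (snd z)"
proof -
  define \<phi> where "\<phi> s = (\<integral>\<^sup>+z. ennreal (norm (\<Gamma>' s (fst z) (snd z) - \<Gamma> s (fst z) (snd z))) \<partial>(M \<Otimes>\<^sub>M M))" for s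
  define A where "A = max 0 Dm + K * (\<integral>z. w (fst z) * w (snd z) \<partial>(M \<Otimes>\<^sub>M M))"
  have A0: "0 \<le> A" unfolding A_def using kern_nonneg[OF pd_pathD(2)[OF a]] weight_nonneg
    by (intro add_nonneg_nonneg mult_nonneg_nonneg integral_nonneg_AE) auto
  note ik = kern_integrable[OF pd_pathD(2)[OF a]]
  have \<phi>A: "\<phi> s \<le> ennreal A" if s: "s \<in> {0..T}" for s
  proof -
    note m [measurable] = borel_measurable_integrable[OF int[OF s]] borel_measurable_integrable[OF ik(1)[of s]]
    have "\<phi> s \<le> (\<integral>\<^sup>+z. ennreal (norm (\<Gamma>' s (fst z) (snd z))) + ennreal (norm (\<Gamma> s (fst z) (snd z))) \<partial>(M \<Otimes>\<^sub>M M))"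
      unfolding \<phi>_def by (intro nn_integral_mono) (simp add: ennreal_plus[symmetric] norm_triangle_ineq4 del: ennreal_plus)
    also have "\<dots> = ennreal (\<integral>z. norm (\<Gamma>' s (fst z) (snd z)) \<partial>(M \<Otimes>\<^sub>M M)) + ennreal (\<integral>z. norm (\<Gamma> s (fst z) (snd z)) \<partial>(M \<Otimes>\<^sub>M M))"
      using int[OF s] ik(1)[of s] by (subst nn_integral_add) (auto simp: nn_integral_eq_integral)
    also have "\<dots> \<le> ennreal (max 0 Dm) + ennreal (K * (\<integral>z. w (fst z) * w (snd z) \<partial>(M \<Otimes>\<^sub>M M)))"
      using bdd[OF s] ik(2)[of s] by (intro add_mono ennreal_leI) auto
    also have "\<dots> = ennreal A" unfolding A_def using kern_nonneg[OF pd_pathD(2)[OF a]] weight_nonneg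
      by (intro ennreal_plus[symmetric] mult_nonneg_nonneg integral_nonneg_AE) auto
    finally show ?thesis .
  qed
  obtain k L where kL: "k = max (c * K * W1) (c * K * W1 * c * W1)" "L = Rlip k (c * c * A)" by blast
  note diff = Rgen_diff_AE[OF pd_pathD(2)[OF a] pd_pathD(3)[OF a] int sym X0 \<phi>A[unfolded \<phi>_def] kL(1) A0 kL(2)]
  have L0: "0 \<le> L" using diff(2)[OF t t t t t] .
  define \<kappa> where "\<kappa> = L * ((c + 2 + c * A) * c) + 1"
  have \<kappa>: "0 < \<kappa>" unfolding \<kappa>_def using L0 c_nonneg A0 by (intro add_nonneg_pos mult_nonneg_nonneg) auto
  interpret P: sigma_finite_measure "M \<Otimes>\<^sub>M M" by (rule MM.sigma_finite_measure_axioms)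
  interpret PL: pair_sigma_finite "M \<Otimes>\<^sub>M M" lborel ..
  define G where "G z s = ennreal (norm (Rgen (\<Gamma>' s) (fst z) (snd z) - Rop 0 (\<Gamma> s) (fst z) (snd z)))" for z s
  have Gm: "(\<lambda>q. G (fst q) (snd q)) \<in> borel_measurable ((M \<Otimes>\<^sub>M M) \<Otimes>\<^sub>M lborel)"
  proof -
    have sw: "(\<lambda>q. (snd q, fst q)) \<in> ((M \<Otimes>\<^sub>M M) \<Otimes>\<^sub>M lborel) \<rightarrow>\<^sub>M (borel \<Otimes>\<^sub>M (M \<Otimes>\<^sub>M M))" by measurable
    have "(\<lambda>q. Rgen (\<Gamma>' (snd q)) (fst (fst q)) (snd (fst q))) \<in> borel_measurable ((M \<Otimes>\<^sub>M M) \<Otimes>\<^sub>M lborel)"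
      "(\<lambda>q. Rop 0 (\<Gamma> (snd q)) (fst (fst q)) (snd (fst q))) \<in> borel_measurable ((M \<Otimes>\<^sub>M M) \<Otimes>\<^sub>M lborel)"
      using measurable_compose[OF sw pmeas_Rgen[OF pm, unfolded pmeas_def]]
        measurable_compose[OF sw pmeas_Rop[OF pd_pathD(1)[OF a], of 0, unfolded pmeas_def]] by simp_all
    then show ?thesis unfolding G_def by measurable
  qed
  have bR: "bpath (Rbd K) (\<lambda>s. Rop 0 (\<Gamma> s))" by (rule bpath_Rop[OF a]) auto
  have step: "\<phi> t \<le> ennreal \<kappa> * (\<integral>\<^sup>+s. indicator {t..T} s * ((1 + laplace (s - t) * laplace (s - t)) * \<phi> s) \<partial>lborel)"
    if t: "t \<in> {0..T}" for t
  proof -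
    define f where "f z s = indicator {t..T} s * (ennreal (exp (- (r (fst z) + r (snd z)) * (s - t))) * G z s)" for z s
    have ind: "indicator {t..T} s = (if t \<le> s \<and> s \<le> T then 1 else (0::ennreal))" for s by (simp add: indicator_def)
    have fm: "(\<lambda>(z, s). f z s) \<in> borel_measurable ((M \<Otimes>\<^sub>M M) \<Otimes>\<^sub>M lborel)"
      unfolding f_def split_beta' ind using Gm by measurable
    have "\<phi> t \<le> (\<integral>\<^sup>+z. \<integral>\<^sup>+s. f z s \<partial>lborel \<partial>(M \<Otimes>\<^sub>M M))"
      unfolding \<phi>_def
    proof (rule nn_integral_mono_AE)
      show "AE z in M \<Otimes>\<^sub>M M. ennreal (norm (\<Gamma>' t (fst z) (snd z) - \<Gamma> t (fst z) (snd z))) \<le> (\<integral>\<^sup>+s. f z s \<partial>lborel)"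
        using eq[OF t] AE_space
      proof eventually_elim
        case (elim z)
        then have sp: "fst z \<in> space M" "snd z \<in> space M" by (auto simp: space_pair_measure)
        let ?e = "\<lambda>s. exp (- (r (fst z) + r (snd z)) * (s - t))"
        have i2: "set_integrable lborel {t..T} (\<lambda>s. ?e s *\<^sub>R Rop 0 (\<Gamma> s) (fst z) (snd z))"
          using J_integrable[OF bR t sp, of "r (fst z) + r (snd z)"] .
        have "\<Gamma> t (fst z) (snd z) = (LINT s:{t..T}|lborel. ?e s *\<^sub>R Rop 0 (\<Gamma> s) (fst z) (snd z))"
          using fun_cong[OF fun_cong[OF fun_cong[OF sol]], of t "fst z" "snd z"] t sp by (simp add: Jop_def)
        then have "\<Gamma>' t (fst z) (snd z) - \<Gamma> t (fst z) (snd z)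
            = (LINT s:{t..T}|lborel. ?e s *\<^sub>R Rgen (\<Gamma>' s) (fst z) (snd z) - ?e s *\<^sub>R Rop 0 (\<Gamma> s) (fst z) (snd z))"
          using elim(1) i2 by simp
        also have "\<dots> = (\<integral>s. indicator {t..T} s *\<^sub>R (?e s *\<^sub>R (Rgen (\<Gamma>' s) (fst z) (snd z) - Rop 0 (\<Gamma> s) (fst z) (snd z))) \<partial>lborel)"
          unfolding set_lebesgue_integral_def by (simp add: scaleR_diff_right)
        finally have d: "\<Gamma>' t (fst z) (snd z) - \<Gamma> t (fst z) (snd z) = (\<integral>s. indicator {t..T} s *\<^sub>R (?e s *\<^sub>R (Rgen (\<Gamma>' s) (fst z) (snd z) - Rop 0 (\<Gamma> s) (fst z) (snd z))) \<partial>lborel)" .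
        have i: "integrable lborel (\<lambda>s. indicator {t..T} s *\<^sub>R (?e s *\<^sub>R (Rgen (\<Gamma>' s) (fst z) (snd z) - Rop 0 (\<Gamma> s) (fst z) (snd z))))"
          using Bochner_Integration.integrable_diff[OF elim(1)[THEN conjunct1, unfolded set_integrable_def] i2[unfolded set_integrable_def]]
          by (simp add: scaleR_diff_right)
        have "ennreal (norm (\<Gamma>' t (fst z) (snd z) - \<Gamma> t (fst z) (snd z)))
          \<le> (\<integral>\<^sup>+s. ennreal (norm (indicator {t..T} s *\<^sub>R (?e s *\<^sub>R (Rgen (\<Gamma>' s) (fst z) (snd z) - Rop 0 (\<Gamma> s) (fst z) (snd z))))) \<partial>lborel)"
          unfolding d by (rule integral_norm_bound_ennreal[OF i])
        also have "\<dots> = (\<integral>\<^sup>+s. f z s \<partial>lborel)"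
          unfolding f_def G_def by (intro nn_integral_cong) (simp add: indicator_def ennreal_mult)
        finally show ?case .
      qed
    qed
    also have "\<dots> = (\<integral>\<^sup>+s. \<integral>\<^sup>+z. f z s \<partial>(M \<Otimes>\<^sub>M M) \<partial>lborel)"
      by (rule PL.Fubini'[OF fm, symmetric])
    also have "\<dots> \<le> (\<integral>\<^sup>+s. ennreal \<kappa> * (indicator {t..T} s * ((1 + laplace (s - t) * laplace (s - t)) * \<phi> s)) \<partial>lborel)"
    proof (rule nn_integral_mono)
      fix s :: real
      show "(\<integral>\<^sup>+z. f z s \<partial>(M \<Otimes>\<^sub>M M)) \<le> ennreal \<kappa> * (indicator {t..T} s * ((1 + laplace (s - t) * laplace (s - t)) * \<phi> s))"
      proof (cases "s \<in> {t..T}")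
        case False
        then show ?thesis by (simp add: f_def)
      next
        case True
        then have s: "s \<in> {0..T}" using t by auto
        define al where "al y = ennreal c * (\<integral>\<^sup>+x. ennreal (norm (\<Gamma>' s x y - \<Gamma> s x y)) \<partial>M)" for y
        define \<delta> where "\<delta> = ennreal c * (ennreal c * \<phi> s)"
        have alm [measurable]: "al \<in> borel_measurable M" and ali: "(\<integral>\<^sup>+y. al y \<partial>M) = ennreal c * \<phi> s"
          using diff(3,4)[OF s s s s s] unfolding al_def[abs_def] \<phi>_def by auto
        have "(\<integral>\<^sup>+z. f z s \<partial>(M \<Otimes>\<^sub>M M)) = (\<integral>\<^sup>+z. ennreal (exp (- (r (fst z) + r (snd z)) * (s - t))) * G z s \<partial>(M \<Otimes>\<^sub>M M))"
          using True by (simp add: f_def)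
        also have "\<dots> \<le> (\<integral>\<^sup>+z. ennreal L * (ennreal (exp (- (r (fst z) + r (snd z)) * (s - t))) * (\<delta> + al (fst z) + al (snd z) + al (fst z) * al (snd z))) \<partial>(M \<Otimes>\<^sub>M M))"
        proof (rule nn_integral_mono_AE)
          show "AE z in M \<Otimes>\<^sub>M M. ennreal (exp (- (r (fst z) + r (snd z)) * (s - t))) * G z s
            \<le> ennreal L * (ennreal (exp (- (r (fst z) + r (snd z)) * (s - t))) * (\<delta> + al (fst z) + al (snd z) + al (fst z) * al (snd z)))"
            using diff(1)[OF s s s s s]
          proof eventually_elim
            case (elim z)
            then have "G z s \<le> ennreal L * (\<delta> + al (fst z) + al (snd z) + al (fst z) * al (snd z))"
              unfolding G_def al_def \<delta>_def \<phi>_def .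
            from mult_left_mono[OF this, of "ennreal (exp (- (r (fst z) + r (snd z)) * (s - t)))"] show ?case
              by (simp add: mult.left_commute)
          qed
        qed
        also have "\<dots> = ennreal L * (\<integral>\<^sup>+z. ennreal (exp (- (r (fst z) + r (snd z)) * (s - t))) * (\<delta> + al (fst z) + al (snd z) + al (fst z) * al (snd z)) \<partial>(M \<Otimes>\<^sub>M M))"
          by (rule nn_integral_cmult) measurable
        also have "\<dots> \<le> ennreal L * ((ennreal c + 2 + ennreal (c * A)) * (1 + laplace (s - t) * laplace (s - t)) * (ennreal c * \<phi> s))"
        proof (intro mult_left_mono nn_integral_exp_product_le alm)
          show "(\<integral>\<^sup>+x. al x \<partial>M) \<le> ennreal c * \<phi> s" unfolding ali ..
          show "ennreal c * \<phi> s \<le> ennreal (c * A)"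
            using mult_left_mono[OF \<phi>A[OF s], of "ennreal c"] c_nonneg A0 by (simp add: ennreal_mult)
          show "0 \<le> s - t" using True by simp
          show "\<delta> \<le> ennreal c * (ennreal c * \<phi> s)" unfolding \<delta>_def ..
        qed simp
        also have "\<dots> = ennreal (L * ((c + 2 + c * A) * c)) * ((1 + laplace (s - t) * laplace (s - t)) * \<phi> s)"
        proof -
          have "ennreal (L * ((c + 2 + c * A) * c)) = ennreal L * ((ennreal c + 2 + ennreal (c * A)) * ennreal c)"
            using L0 c_nonneg A0 by (simp add: ennreal_mult ennreal_plus)
          then show ?thesis by (simp only: ac_simps)
        qed
        also have "\<dots> \<le> ennreal \<kappa> * ((1 + laplace (s - t) * laplace (s - t)) * \<phi> s)"
          unfolding \<kappa>_def by (intro mult_right_mono ennreal_leI) auto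
        finally show ?thesis using True by simp
      qed
    qed
    also have "\<dots> = ennreal \<kappa> * (\<integral>\<^sup>+s. indicator {t..T} s * ((1 + laplace (s - t) * laplace (s - t)) * \<phi> s) \<partial>lborel)"
    proof (rule nn_integral_cmult)
      have "(\<lambda>q. ennreal (norm (\<Gamma>' (fst q) (fst (snd q)) (snd (snd q)) - \<Gamma> (fst q) (fst (snd q)) (snd (snd q))))) \<in> borel_measurable (borel \<Otimes>\<^sub>M (M \<Otimes>\<^sub>M M))"
        using pm pd_pathD(1)[OF a] unfolding pmeas_def by measurable
      then have "\<phi> \<in> borel_measurable borel"
        unfolding \<phi>_def[abs_def] by (intro sigma_finite_measure.borel_measurable_nn_integral[OF MM.sigma_finite_measure_axioms]) (simp add: split_beta')
      then show "(\<lambda>s. indicator {t..T} s * ((1 + laplace (s - t) * laplace (s - t)) * \<phi> s)) \<in> borel_measurable lborel" by measurable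
    qed
    finally show ?thesis .
  qed
  have "\<phi> t = 0" by (rule gronwall[OF \<phi>A step t \<kappa>])
  moreover note m [measurable] = borel_measurable_integrable[OF int[OF t]] borel_measurable_integrable[OF ik(1)[of t]]
  ultimately have "AE z in M \<Otimes>\<^sub>M M. ennreal (norm (\<Gamma>' t (fst z) (snd z) - \<Gamma> t (fst z) (snd z))) = 0"
    unfolding \<phi>_def by (subst (asm) nn_integral_0_iff_AE) auto
  then show ?thesis by eventually_elim simp
qed

end

section \<open>The kernel Riccati equation of a signed measure\<close>

lemma weight_eq:
  assumes "0 \<le> \<theta>"
  shows "(if \<theta> = 0 then 1 else min 1 (\<theta> powr (- 1 / 2))) = weight (max 0 \<theta>)"
proof (cases "\<theta> = 0")
  case True then show ?thesis by (simp add: weight_def)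
next
  case False
  then have \<theta>: "0 < \<theta>" using assms by simp
  have p: "\<theta> powr (- 1 / 2) = 1 / sqrt \<theta>"
    using \<theta> by (simp add: powr_minus_divide powr_half_sqrt)
  show ?thesis unfolding p weight_def if_not_P[OF False]
  proof (cases "\<theta> \<le> 1")
    case True
    then have "1 \<le> 1 / sqrt \<theta>" using \<theta> by simp
    then show "min 1 (1 / sqrt \<theta>) = 1 / sqrt (max 1 (max 0 \<theta>))" using True \<theta> by simp
  next
    case False
    then have "1 / sqrt \<theta> \<le> 1" using \<theta> by simp
    then show "min 1 (1 / sqrt \<theta>) = 1 / sqrt (max 1 (max 0 \<theta>))" using False \<theta> by simp
  qed
qed

text \<open>
  On \<open>{0..R}\<close> the weight is bounded below by its value at \<open>R\<close>.
\<close>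

lemma locally_finite_of_weight:
  fixes \<mu> :: "real set \<Rightarrow> 'a::euclidean_space"
  assumes "signed_measure \<mu>" and fin: "(\<integral>\<^sup>+\<theta>. ennreal (weight (max 0 \<theta>)) \<partial>total_variation \<mu>) < \<infinity>"
  shows "locally_finite_signed_measure \<mu>"
proof
  show "signed_measure \<mu>" by fact
  fix R :: real
  have S: "{0..R} \<in> sets (total_variation \<mu>)"
    by (intro bounded_borel_sets_total_variation) (simp add: bounded_borel_def)
  have "ennreal (weight (max 0 R)) * emeasure (total_variation \<mu>) {0..R} = (\<integral>\<^sup>+\<theta>. ennreal (weight (max 0 R)) * indicator {0..R} \<theta> \<partial>total_variation \<mu>)"
    using S by (simp add: nn_integral_cmult_indicator)
  also have "\<dots> \<le> (\<integral>\<^sup>+\<theta>. ennreal (weight (max 0 \<theta>)) \<partial>total_variation \<mu>)"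
  proof (rule nn_integral_mono)
    fix \<theta>
    show "ennreal (weight (max 0 R)) * indicator {0..R} \<theta> \<le> ennreal (weight (max 0 \<theta>))"
    proof (cases "\<theta> \<in> {0..R}")
      case True
      then have "weight (max 0 R) \<le> weight (max 0 \<theta>)"
        unfolding weight_def by (intro divide_left_mono) (auto simp: max_def less_max_iff_disj)
      then show ?thesis using True by (simp add: ennreal_leI)
    qed simp
  qed
  also note fin
  finally show "emeasure (total_variation \<mu>) {0..R} < \<infinity>"
    using weight_pos[of "max 0 R"] by (auto simp: ennreal_mult_less_top)
qed

locale riccati_signed = locally_finite_signed_measure \<mu>
  for \<mu> :: "real set \<Rightarrow> real^'e^'d" +
  fixes T :: real and B D :: "real^'d^'e" and C F :: "real^'m^'e" and Q :: "real^'d^'d" and N :: "real^'m^'m" and l :: real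
  assumes T: "0 < T" and Q: "psd Q" and l: "0 < l" and N: "psd (N - l *\<^sub>R mat 1)"
    and weight_finite: "(\<integral>\<^sup>+\<theta>. ennreal (weight (max 0 \<theta>)) \<partial>total_variation \<mu>) < \<infinity>"
begin

abbreviation h :: "real \<Rightarrow> real^'e^'d" where "h \<equiv> polar_density \<mu>"

abbreviation rate :: "real \<Rightarrow> real" where "rate \<equiv> max 0"

sublocale R: riccati_time tv rate h "real DIM(real^'e^'d)" B D C F Q N l T
proof
  show "rate \<in> borel_measurable tv" by (simp add: measurable_cong_sets[OF sets_total_variation refl] measurable_restrict_space1)
  show "0 \<le> rate x" for x :: real by simp
  show "integrable tv (\<lambda>x. weight (rate x))"
  proof (rule integrableI_nonneg)
    show "(\<lambda>x. weight (rate x)) \<in> borel_measurable tv"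
      by (intro borel_measurable_weight) (simp add: measurable_cong_sets[OF sets_total_variation refl] measurable_restrict_space1)
  qed (use weight_finite weight_nonneg in auto)
  show "{a} \<in> sets tv" if "a \<in> space tv" for a
    using that by (intro bounded_borel_sets_total_variation) (auto simp: bounded_borel_def)
  show "AE x in tv. norm (h x) \<le> real DIM(real^'e^'d)" by (rule norm_polar_density_le)
qed (use T Q l N in auto)

lemma int_left_eq: "int_left \<mu> \<Gamma> = R.Yop \<Gamma>"
  unfolding int_left_def R.Yop_def by simp

lemma int_right_eq: "int_right \<mu> \<Gamma> = R.Zop \<Gamma>"
  unfolding int_right_def R.Zop_def by simp

lemma kernel_L1_iff: "kernel_L1 \<mu> \<Gamma> \<longleftrightarrow> integrable (tv_prod \<mu>) (\<lambda>z. \<Gamma> (fst z) (snd z))"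
  unfolding kernel_L1_def by (simp add: split_beta')

lemma int_both_eq: "kernel_L1 \<mu> \<Gamma> \<Longrightarrow> int_both \<mu> \<Gamma> = R.Xop \<Gamma>"
  unfolding int_both_def kernel_L1_iff by (simp add: R.Xop_eq_product_integral(2) split_beta')

lemma riccati_Nhat_eq: "kernel_L1 \<mu> \<Gamma> \<Longrightarrow> riccati_Nhat \<mu> F N \<Gamma> = R.Nalg 0 (R.Xop \<Gamma>)"
  unfolding riccati_Nhat_def R.Nalg_def by (simp add: int_both_eq)

lemma riccati_R_eq:
  assumes "kernel_L1 \<mu> \<Gamma>" "invertible (riccati_Nhat \<mu> F N \<Gamma>)"
  shows "riccati_R \<mu> B C D F Q N \<Gamma> = R.Rgen \<Gamma>"
proof (intro ext)
  fix x y
  have S: "riccati_S \<mu> C D F \<Gamma> z = R.Salg 0 (R.Xop \<Gamma>) (R.Yop \<Gamma> z)" for z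
    unfolding riccati_S_def R.Salg_def by (simp add: int_both_eq[OF assms(1)] int_left_eq)
  show "riccati_R \<mu> B C D F Q N \<Gamma> x y = R.Rgen \<Gamma> x y"
    unfolding riccati_R_def R.Rgen_def R.Rop_def R.Ralg_def S int_both_eq[OF assms(1)] int_left_eq int_right_eq
      riccati_Nhat_eq[OF assms(1)] matrix_inv_eq_cramer[OF assms(2)[unfolded riccati_Nhat_eq[OF assms(1)]]]
    by (simp add: matrix_mult_diff_left)
qed

lemma integrable_bounded_support:
  fixes u :: "real^'e" shows "integrable tv (\<lambda>\<theta>. indicator {0..R} \<theta> *\<^sub>R u)"
  using locally_finite[of R] bounded_borel_sets_total_variation[OF interval_bounded_borel, of R]
  by (intro integrable_scaleR_left integrable_real_indicator) auto

text \<open>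
  A constant test function would give this at once, but it is not integrable if \<open>|\<mu>|\<close> is infinite. It is
  approximated by its restrictions to bounded intervals.
\<close>

lemma Xop_nonneg_of_kernel_psd:
  assumes L1: "kernel_L1 \<mu> \<Gamma>" and psd: "kernel_psd \<mu> \<Gamma>"
  shows "0 \<le> u \<bullet> (R.Xop \<Gamma> *v u)"
proof -
  note i = L1[unfolded kernel_L1_iff]
  note X = R.Xop_eq_product_integral[OF i]
  note [measurable] = borel_measurable_integrable[OF i]
  let ?\<phi> = "\<lambda>n \<theta>. indicator {0..real n} \<theta> *\<^sub>R u"
  let ?F = "\<lambda>z. u \<bullet> ((transpose (h (fst z)) ** \<Gamma> (fst z) (snd z) ** h (snd z)) *v u)"
  let ?F' = "\<lambda>n z. (h (fst z) *v ?\<phi> n (fst z)) \<bullet> (\<Gamma> (fst z) (snd z) *v (h (snd z) *v ?\<phi> n (snd z)))"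
  have bl: "bounded_linear (\<lambda>A::real^'e^'e. u \<bullet> (A *v u))"
    by (rule bounded_linear_compose[OF bounded_linear_inner_right bounded_linear_matrix_vector_left])
  have F: "integrable (tv_prod \<mu>) ?F" "(\<integral>z. ?F z \<partial>tv_prod \<mu>) = u \<bullet> (R.Xop \<Gamma> *v u)"
    using integrable_bounded_linear[OF bl X(1)] integral_bounded_linear[OF bl X(1)] unfolding X(2) by auto
  have eq: "?F' n z = (indicator {0..real n} (fst z) * indicator {0..real n} (snd z)) * ?F z" for n z
    by (simp add: matrix_vector_mult_scaleR matrix_vector_mul_assoc[symmetric] inner_vector_matrix mult.assoc)
  have "(\<lambda>n. \<integral>z. ?F' n z \<partial>tv_prod \<mu>) \<longlonglongrightarrow> (\<integral>z. ?F z \<partial>tv_prod \<mu>)"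
    unfolding eq
  proof (rule integral_dominated_convergence)
    show "integrable (tv_prod \<mu>) (\<lambda>z. norm (?F z))" using F(1) by (rule integrable_norm)
    show Fm: "?F \<in> borel_measurable (tv_prod \<mu>)" by (rule borel_measurable_integrable[OF F(1)])
    have im: "(\<lambda>\<theta>. indicator {0..real n} \<theta> :: real) \<in> borel_measurable tv" for n
      by (rule borel_measurable_indicator[OF bounded_borel_sets_total_variation[OF interval_bounded_borel]])
    show "(\<lambda>z. (indicator {0..real n} (fst z) * indicator {0..real n} (snd z)) * ?F z) \<in> borel_measurable (tv_prod \<mu>)" for n
      by (intro borel_measurable_times Fm measurable_compose[OF measurable_fst im] measurable_compose[OF measurable_snd im])
    show "AE z in tv_prod \<mu>. (\<lambda>n. (indicator {0..real n} (fst z) * indicator {0..real n} (snd z)) * ?F z) \<longlonglongrightarrow> ?F z"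
    proof (rule AE_I2)
      fix z assume "z \<in> space (tv_prod \<mu>)"
      then have z: "0 \<le> fst z" "0 \<le> snd z" by (auto simp: space_pair_measure)
      obtain n0 :: nat where n0: "max (fst z) (snd z) \<le> real n0" using real_arch_simple by blast
      have "\<forall>\<^sub>F n in sequentially. (indicator {0..real n} (fst z) * indicator {0..real n} (snd z)) * ?F z = ?F z"
        using eventually_ge_at_top[of n0]
      proof eventually_elim
        case (elim n)
        then have "real n0 \<le> real n" by simp
        then show ?case using n0 z by (simp add: indicator_def)
      qed
      then show "(\<lambda>n. (indicator {0..real n} (fst z) * indicator {0..real n} (snd z)) * ?F z) \<longlonglongrightarrow> ?F z"
        by (rule tendsto_eventually)
    qed
    show "AE z in tv_prod \<mu>. norm ((indicator {0..real n} (fst z) * indicator {0..real n} (snd z)) * ?F z) \<le> norm (?F z)" for n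
      by (intro always_eventually allI) (auto simp: indicator_def)
  qed
  moreover have "0 \<le> (\<integral>z. ?F' n z \<partial>tv_prod \<mu>)" for n
  proof -
    have "0 \<le> (\<integral>z. (h (fst z) *v \<phi> (fst z)) \<bullet> (\<Gamma> (fst z) (snd z) *v (h (snd z) *v \<phi> (snd z))) \<partial>tv_prod \<mu>)"
      if "integrable tv \<phi>" for \<phi> :: "real \<Rightarrow> real^'e"
      using psd that unfolding kernel_psd_def split_beta' by blast
    from this[OF integrable_bounded_support] show ?thesis .
  qed
  ultimately show ?thesis unfolding F(2)[symmetric] by (intro LIMSEQ_le_const) auto
qed

text \<open>
  Each \<open>\<Gamma> t x y\<close> is continuous in \<open>t\<close>, being an integral with variable lower limit; continuity in
  \<open>L\<^sup>1\<close> follows by domination with \<open>K * w x * w y\<close>. Positivity in the sense of \<open>kernel_psd\<close> is the case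
  \<open>\<nu> = |\<mu>|\<close>, \<open>\<psi> = h \<phi>\<close> of \<open>pd\<close>.
\<close>

lemma pd_path_solution:
  assumes a: "R.pd_path K \<Gamma>" and sol: "R.Jop 0 (\<lambda>s. R.Rop 0 (\<Gamma> s)) = \<Gamma>"
  shows "riccati_solution T \<mu> B C D F Q N \<Gamma>"
    and "\<And>t. t \<in> {0..T} \<Longrightarrow> kernel_psd \<mu> (\<Gamma> t)"
    and "\<exists>M>0. \<forall>t\<in>{0..T}. AE \<theta> in tv. (\<integral>\<^sup>+ \<tau>. ennreal (norm (\<Gamma> t \<theta> \<tau>)) \<partial>tv) \<le> ennreal M"
proof -
  note k = R.pd_pathD(2)[OF a] and pd = R.pd_pathD(3)[OF a]
  have K0: "0 \<le> K" using R.kern_nonneg[OF k] .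
  have L1: "kernel_L1 \<mu> (\<Gamma> t)" for t unfolding kernel_L1_iff by (rule R.kern_integrable(1)[OF k])
  have bR: "R.bpath (R.Rbd K) (\<lambda>s. R.Rop 0 (\<Gamma> s))" by (rule R.bpath_Rop[OF a]) auto
  have inv: "invertible (riccati_Nhat \<mu> F N (\<Gamma> t))" if "t \<in> {0..T}" for t
    unfolding riccati_Nhat_eq[OF L1] by (rule R.Nalg_invertible[OF k pd[OF that]]) simp
  have Zeq: "R.Zop (\<Gamma> t) x = transpose (R.Yop (\<Gamma> t) x)" if x: "x \<in> space tv" for t x
    by (rule R.Zop_eq[OF R.Y_integrable[OF k x] R.kern_section_measurable(2)[OF k x]]) (simp add: R.kern_sym[OF k])
  have Req: "riccati_R \<mu> B C D F Q N (\<Gamma> t) x y = R.Rop 0 (\<Gamma> t) x y" if "t \<in> {0..T}" "x \<in> space tv" for t x y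
    unfolding riccati_R_eq[OF L1 inv[OF that(1)]] R.Rgen_def Zeq[OF that(2)]
    by (simp add: matrix_mult_zero_left)
  have time: "continuous_on {0..T} (\<lambda>t. \<Gamma> t x y)" if xy: "x \<in> space tv" "y \<in> space tv" for x y
  proof -
    define g where "g s = exp (- (x + y) * s) *\<^sub>R R.Rop 0 (\<Gamma> s) x y" for s
    have gi: "set_integrable lborel {t..T} g" if t: "t \<in> {0..T}" for t
    proof -
      have "set_integrable lborel {t..T} (\<lambda>s. exp (- (x + y) * t) *\<^sub>R (exp (- (x + y) * (s - t)) *\<^sub>R R.Rop 0 (\<Gamma> s) x y))"
        using R.J_integrable[OF bR t xy, of "x + y"] by (intro set_integrable_scaleR_right) auto
      then show ?thesis unfolding g_def by (simp add: exp_add[symmetric] algebra_simps)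
    qed
    have G: "\<Gamma> t x y = exp ((x + y) * t) *\<^sub>R integral {t..T} g" if t: "t \<in> {0..T}" for t
    proof -
      have "\<Gamma> t x y = (LINT s:{t..T}|lborel. exp (- (x + y) * (s - t)) *\<^sub>R R.Rop 0 (\<Gamma> s) x y)"
        using fun_cong[OF fun_cong[OF fun_cong[OF sol]], of t x y] t xy by (simp add: R.Jop_def)
      also have "\<dots> = (LINT s:{t..T}|lborel. exp ((x + y) * t) *\<^sub>R g s)"
        unfolding g_def by (simp add: exp_add[symmetric] algebra_simps)
      also have "\<dots> = exp ((x + y) * t) *\<^sub>R (LINT s:{t..T}|lborel. g s)"
        by (rule set_integral_scaleR_right)
      also have "(LINT s:{t..T}|lborel. g s) = integral {t..T} g"
        by (rule set_borel_integral_eq_integral(2)[OF gi[OF t]])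
      finally show ?thesis .
    qed
    have "continuous_on {0..T} (\<lambda>t. exp ((x + y) * t) *\<^sub>R integral {t..T} g)"
      using set_borel_integral_eq_integral(1)[OF gi[of 0]] T
      by (intro continuous_intros indefinite_integral_continuous_1') auto
    then show ?thesis by (subst continuous_on_cong[OF refl G])
  qed
  have cont: "continuous_kernel_L1 T \<mu> \<Gamma>"
    unfolding continuous_kernel_L1_def
  proof (intro conjI ballI L1)
    have "(\<lambda>p. (fst p, snd p)) \<in> (restrict_space borel {0..T} \<Otimes>\<^sub>M tv_prod \<mu>) \<rightarrow>\<^sub>M (borel \<Otimes>\<^sub>M tv_prod \<mu>)"
      by (intro measurable_Pair measurable_snd measurable_compose[OF measurable_fst] measurable_restrict_space1) simp
    from measurable_compose[OF this R.pd_pathD(1)[OF a, unfolded R.pmeas_def]]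
    show "(\<lambda>(t, \<theta>, \<tau>). \<Gamma> t \<theta> \<tau>) \<in> borel_measurable (restrict_space borel {0..T} \<Otimes>\<^sub>M tv_prod \<mu>)"
      by (simp add: split_beta')
    fix t assume t: "t \<in> {0..T}"
    show "((\<lambda>s. kernel_L1_norm \<mu> (\<lambda>\<theta> \<tau>. \<Gamma> s \<theta> \<tau> - \<Gamma> t \<theta> \<tau>)) \<longlongrightarrow> 0) (at t within {0..T})"
      unfolding tendsto_at_iff_sequentially
    proof (intro allI impI)
      fix X :: "nat \<Rightarrow> real" assume X: "\<forall>i. X i \<in> {0..T} - {t}" "X \<longlonglongrightarrow> t"
      have "(\<lambda>i. \<integral>z. norm (\<Gamma> (X i) (fst z) (snd z) - \<Gamma> t (fst z) (snd z)) \<partial>tv_prod \<mu>) \<longlonglongrightarrow> (\<integral>z. 0 \<partial>tv_prod \<mu>)"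
      proof (rule integral_dominated_convergence)
        show "integrable (tv_prod \<mu>) (\<lambda>z. (K + K) * (weight (rate (fst z)) * weight (rate (snd z))))"
          by (intro integrable_mult_right R.MM.integrable_times_fst_snd R.integrable_weight)
        show "(\<lambda>z. norm (\<Gamma> (X i) (fst z) (snd z) - \<Gamma> t (fst z) (snd z))) \<in> borel_measurable (tv_prod \<mu>)" for i
          using R.kern_measurable[OF k] by (intro borel_measurable_norm borel_measurable_diff measurable_compose[OF _ borel_measurable_norm])
        show "AE z in tv_prod \<mu>. (\<lambda>i. norm (\<Gamma> (X i) (fst z) (snd z) - \<Gamma> t (fst z) (snd z))) \<longlonglongrightarrow> 0"
        proof (rule AE_I2)
          fix z assume "z \<in> space (tv_prod \<mu>)"
          then have "fst z \<in> space tv" "snd z \<in> space tv" by (auto simp: space_pair_measure)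
          from time[OF this] have "(\<lambda>i. \<Gamma> (X i) (fst z) (snd z)) \<longlonglongrightarrow> \<Gamma> t (fst z) (snd z)"
            using X t unfolding continuous_on_sequentially by (auto simp: o_def)
          then show "(\<lambda>i. norm (\<Gamma> (X i) (fst z) (snd z) - \<Gamma> t (fst z) (snd z))) \<longlonglongrightarrow> 0"
            by (intro tendsto_norm_zero LIM_zero)
        qed
        show "AE z in tv_prod \<mu>. norm (norm (\<Gamma> (X i) (fst z) (snd z) - \<Gamma> t (fst z) (snd z))) \<le> (K + K) * (weight (rate (fst z)) * weight (rate (snd z)))" for i
        proof (intro always_eventually allI)
          fix z :: "real \<times> real"
          show "norm (norm (\<Gamma> (X i) (fst z) (snd z) - \<Gamma> t (fst z) (snd z))) \<le> (K + K) * (weight (rate (fst z)) * weight (rate (snd z)))"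
            using R.kern_bound[OF R.kern_diff[OF k[of "X i"] k[of t]], of "fst z" "snd z"] by (simp add: mult.assoc)
        qed
      qed simp
      then show "((\<lambda>s. kernel_L1_norm \<mu> (\<lambda>\<theta> \<tau>. \<Gamma> s \<theta> \<tau> - \<Gamma> t \<theta> \<tau>)) \<circ> X) \<longlonglongrightarrow> 0"
        unfolding kernel_L1_norm_def by (simp add: o_def split_beta')
    qed
  qed
  show "riccati_solution T \<mu> B C D F Q N \<Gamma>"
    unfolding riccati_solution_def
  proof (intro conjI ballI cont inv)
    fix t assume t: "t \<in> {0..T}"
    show "AE (\<theta>, \<tau>) in tv_prod \<mu>.
        set_integrable lborel {t..T} (\<lambda>s. exp (- (\<theta> + \<tau>) * (s - t)) *\<^sub>R riccati_R \<mu> B C D F Q N (\<Gamma> s) \<theta> \<tau>) \<and>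
        \<Gamma> t \<theta> \<tau> = (LINT s:{t..T}|lborel. exp (- (\<theta> + \<tau>) * (s - t)) *\<^sub>R riccati_R \<mu> B C D F Q N (\<Gamma> s) \<theta> \<tau>)"
    proof (rule AE_I2, clarify)
      fix x y assume "(x, y) \<in> space (tv_prod \<mu>)"
      then have xy: "x \<in> space tv" "y \<in> space tv" by (auto simp: space_pair_measure)
      have i: "set_integrable lborel {t..T} (\<lambda>s. exp (- (x + y) * (s - t)) *\<^sub>R R.Rop 0 (\<Gamma> s) x y)"
        by (rule R.J_integrable[OF bR t xy])
      have "set_integrable lborel {t..T} (\<lambda>s. exp (- (x + y) * (s - t)) *\<^sub>R riccati_R \<mu> B C D F Q N (\<Gamma> s) x y)
         = set_integrable lborel {t..T} (\<lambda>s. exp (- (x + y) * (s - t)) *\<^sub>R R.Rop 0 (\<Gamma> s) x y)"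
        using t Req xy by (intro set_integrable_cong) auto
      moreover have "(LINT s:{t..T}|lborel. exp (- (x + y) * (s - t)) *\<^sub>R riccati_R \<mu> B C D F Q N (\<Gamma> s) x y)
         = (LINT s:{t..T}|lborel. exp (- (x + y) * (s - t)) *\<^sub>R R.Rop 0 (\<Gamma> s) x y)"
        using t Req xy by (intro set_lebesgue_integral_cong) auto
      moreover have "\<Gamma> t x y = (LINT s:{t..T}|lborel. exp (- (x + y) * (s - t)) *\<^sub>R R.Rop 0 (\<Gamma> s) x y)"
        using fun_cong[OF fun_cong[OF fun_cong[OF sol]], of t x y] t xy by (simp add: R.Jop_def)
      ultimately show "set_integrable lborel {t..T} (\<lambda>s. exp (- (x + y) * (s - t)) *\<^sub>R riccati_R \<mu> B C D F Q N (\<Gamma> s) x y) \<and>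
        \<Gamma> t x y = (LINT s:{t..T}|lborel. exp (- (x + y) * (s - t)) *\<^sub>R riccati_R \<mu> B C D F Q N (\<Gamma> s) x y)"
        using i by simp
    qed
  qed
  show "kernel_psd \<mu> (\<Gamma> t)" if t: "t \<in> {0..T}" for t
    unfolding kernel_psd_def
  proof (intro conjI allI impI)
    show "kernel_Linf \<mu> (\<Gamma> t)"
      unfolding kernel_Linf_def
    proof (intro conjI exI)
      show "(\<lambda>(\<theta>, \<tau>). \<Gamma> t \<theta> \<tau>) \<in> borel_measurable (tv_prod \<mu>)"
        using R.kern_measurable[OF k] by (simp add: split_beta')
      show "AE (\<theta>, \<tau>) in tv_prod \<mu>. norm (\<Gamma> t \<theta> \<tau>) \<le> K"
        by (rule always_eventually) (auto intro: R.pd_path_bound[OF a])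
    qed
    show "AE (\<theta>, \<tau>) in tv_prod \<mu>. \<Gamma> t \<theta> \<tau> = transpose (\<Gamma> t \<tau> \<theta>)"
      by (rule always_eventually) (auto simp: R.kern_sym[OF k])
    fix \<phi> :: "real \<Rightarrow> real^'e" assume p: "integrable tv \<phi>"
    interpret d: dominating_measure tv rate tv "\<lambda>_. 1" by (rule R.dominating_self)
    note [measurable] = borel_measurable_integrable[OF p]
    have "integrable tv (\<lambda>\<theta>. h \<theta> *v \<phi> \<theta>)"
    proof (rule Bochner_Integration.integrable_bound)
      show "integrable tv (\<lambda>\<theta>. real DIM(real^'e^'d) * norm (\<phi> \<theta>))" using p by simp
      show "(\<lambda>\<theta>. h \<theta> *v \<phi> \<theta>) \<in> borel_measurable tv" by measurable
      show "AE \<theta> in tv. norm (h \<theta> *v \<phi> \<theta>) \<le> norm (real DIM(real^'e^'d) * norm (\<phi> \<theta>))"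
        using norm_polar_density_le
      proof eventually_elim
        case (elim \<theta>)
        have "norm (h \<theta> *v \<phi> \<theta>) \<le> norm (h \<theta>) * norm (\<phi> \<theta>)" by (rule norm_matrix_vector_mult_le)
        also have "\<dots> \<le> real DIM(real^'e^'d) * norm (\<phi> \<theta>)" using elim by (intro mult_right_mono) auto
        finally show ?case by simp
      qed
    qed
    then have "0 \<le> R.form tv (\<Gamma> t) (\<lambda>\<theta>. h \<theta> *v \<phi> \<theta>) (\<lambda>\<theta>. h \<theta> *v \<phi> \<theta>)"
      by (intro R.pdD[OF pd[OF t] R.dominating_self] d.integrable_Lw)
    then show "0 \<le> (LINT (\<theta>, \<tau>)|tv_prod \<mu>. (h \<theta> *v \<phi> \<theta>) \<bullet> (\<Gamma> t \<theta> \<tau> *v (h \<tau> *v \<phi> \<tau>)))"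
      unfolding R.form_def by (simp add: split_beta')
  qed
  show "\<exists>M>0. \<forall>t\<in>{0..T}. AE \<theta> in tv. (\<integral>\<^sup>+ \<tau>. ennreal (norm (\<Gamma> t \<theta> \<tau>)) \<partial>tv) \<le> ennreal M"
  proof (intro exI conjI ballI always_eventually allI)
    show "0 < K * R.W1 + 1" using K0 R.W1_nonneg by (simp add: add_nonneg_pos)
    fix t \<theta>
    have "(\<integral>\<^sup>+ \<tau>. ennreal (norm (\<Gamma> t \<theta> \<tau>)) \<partial>tv) \<le> (\<integral>\<^sup>+ \<tau>. ennreal (K * weight (rate \<tau>)) \<partial>tv)"
    proof (intro nn_integral_mono ennreal_leI)
      fix \<tau>
      have "norm (\<Gamma> t \<theta> \<tau>) \<le> K * weight (rate \<theta>) * weight (rate \<tau>)" by (rule R.kern_bound[OF k])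
      also have "\<dots> \<le> K * 1 * weight (rate \<tau>)"
        using K0 weight_nonneg weight_le_1 by (intro mult_right_mono mult_left_mono) auto
      finally show "norm (\<Gamma> t \<theta> \<tau>) \<le> K * weight (rate \<tau>)" by simp
    qed
    also have "\<dots> = ennreal (\<integral>\<tau>. K * weight (rate \<tau>) \<partial>tv)"
      using K0 weight_nonneg R.integrable_weight by (intro nn_integral_eq_integral integrable_mult_right always_eventually allI mult_nonneg_nonneg) auto
    also have "(\<integral>\<tau>. K * weight (rate \<tau>) \<partial>tv) = K * R.W1" unfolding R.W1_def by simp
    also have "ennreal (K * R.W1) \<le> ennreal (K * R.W1 + 1)" by (intro ennreal_leI) simp
    finally show "(\<integral>\<^sup>+ \<tau>. ennreal (norm (\<Gamma> t \<theta> \<tau>)) \<partial>tv) \<le> ennreal (K * R.W1 + 1)" .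
  qed
qed

text \<open>
  The norm is a continuous function on a compact interval.
\<close>

lemma L1_norm_bounded:
  assumes c: "continuous_kernel_L1 T \<mu> \<Gamma>"
  shows "\<exists>Dm. \<forall>t\<in>{0..T}. (\<integral>z. norm (\<Gamma> t (fst z) (snd z)) \<partial>tv_prod \<mu>) \<le> Dm"
proof -
  define n where "n t = (\<integral>z. norm (\<Gamma> t (fst z) (snd z)) \<partial>tv_prod \<mu>)" for t
  have i: "integrable (tv_prod \<mu>) (\<lambda>z. \<Gamma> t (fst z) (snd z))" if "t \<in> {0..T}" for t
    using c that unfolding continuous_kernel_L1_def kernel_L1_iff by blast
  have "continuous_on {0..T} n"
    unfolding continuous_on_def
  proof
    fix t assume t: "t \<in> {0..T}"
    have le: "dist (n s) (n t) \<le> kernel_L1_norm \<mu> (\<lambda>\<theta> \<tau>. \<Gamma> s \<theta> \<tau> - \<Gamma> t \<theta> \<tau>)" if s: "s \<in> {0..T}" for s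
    proof -
      have "\<bar>n s - n t\<bar> = \<bar>\<integral>z. norm (\<Gamma> s (fst z) (snd z)) - norm (\<Gamma> t (fst z) (snd z)) \<partial>tv_prod \<mu>\<bar>"
        unfolding n_def using i[OF s] i[OF t] by simp
      also have "\<dots> \<le> (\<integral>z. norm (\<Gamma> s (fst z) (snd z) - \<Gamma> t (fst z) (snd z)) \<partial>tv_prod \<mu>)"
        unfolding real_norm_def[symmetric]
      proof (rule norm_integral_le)
        show "integrable (tv_prod \<mu>) (\<lambda>z. norm (\<Gamma> s (fst z) (snd z) - \<Gamma> t (fst z) (snd z)))" using i[OF s] i[OF t] by simp
        show "AE z in tv_prod \<mu>. norm (norm (\<Gamma> s (fst z) (snd z)) - norm (\<Gamma> t (fst z) (snd z))) \<le> norm (\<Gamma> s (fst z) (snd z) - \<Gamma> t (fst z) (snd z))"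
          by (intro always_eventually allI) (simp add: norm_triangle_ineq3)
      qed
      finally show ?thesis unfolding kernel_L1_norm_def dist_real_def by (simp add: split_beta')
    qed
    have lim: "((\<lambda>s. kernel_L1_norm \<mu> (\<lambda>\<theta> \<tau>. \<Gamma> s \<theta> \<tau> - \<Gamma> t \<theta> \<tau>)) \<longlongrightarrow> 0) (at t within {0..T})"
      using c t unfolding continuous_kernel_L1_def by blast
    show "(n \<longlongrightarrow> n t) (at t within {0..T})"
    proof (rule metric_tendsto_imp_tendsto[OF lim])
      show "\<forall>\<^sub>F s in at t within {0..T}. dist (n s) (n t) \<le> dist (kernel_L1_norm \<mu> (\<lambda>\<theta> \<tau>. \<Gamma> s \<theta> \<tau> - \<Gamma> t \<theta> \<tau>)) 0"
        unfolding eventually_at_filter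
      proof (intro always_eventually allI impI)
        fix s assume s: "s \<in> {0..T}"
        show "dist (n s) (n t) \<le> dist (kernel_L1_norm \<mu> (\<lambda>\<theta> \<tau>. \<Gamma> s \<theta> \<tau> - \<Gamma> t \<theta> \<tau>)) 0"
          using le[OF s] unfolding dist_0_norm dist_norm[of _ 0] diff_zero real_norm_def by (rule order_trans[OF _ abs_ge_self])
      qed
    qed
  qed
  then have "bounded (n ` {0..T})" by (intro compact_imp_bounded compact_continuous_image) auto
  then obtain Dm where "\<forall>x\<in>n ` {0..T}. norm x \<le> Dm" unfolding bounded_iff by blast
  then show ?thesis unfolding n_def by (intro exI[of _ Dm]) (auto simp: abs_le_iff)
qed

lemma solution_unique:
  assumes a: "R.pd_path K \<Gamma>" and sol: "R.Jop 0 (\<lambda>s. R.Rop 0 (\<Gamma> s)) = \<Gamma>"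
    and s: "riccati_solution T \<mu> B C D F Q N \<Gamma>'" and psd: "\<And>t. t \<in> {0..T} \<Longrightarrow> kernel_psd \<mu> (\<Gamma>' t)"
    and t: "t \<in> {0..T}"
  shows "AE (\<theta>, \<tau>) in tv_prod \<mu>. \<Gamma>' t \<theta> \<tau> = \<Gamma> t \<theta> \<tau>"
proof -
  \<comment> \<open>A solution is known to be measurable in time on \<open>[0,T]\<close> only; outside it is continued by its values at the end points.\<close>
  define clip where "clip s = max 0 (min T s)" for s
  define \<Gamma>0 where "\<Gamma>0 s = \<Gamma>' (clip s)" for s
  have clip: "clip s = s" if "s \<in> {0..T}" for s using that by (auto simp: clip_def)
  have G0: "\<Gamma>0 s = \<Gamma>' s" if "s \<in> {0..T}" for s unfolding \<Gamma>0_def clip[OF that] ..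
  have c: "continuous_kernel_L1 T \<mu> \<Gamma>'" using s unfolding riccati_solution_def by blast
  have L1: "kernel_L1 \<mu> (\<Gamma>' s)" if "s \<in> {0..T}" for s using c that unfolding continuous_kernel_L1_def by blast
  have inv: "invertible (riccati_Nhat \<mu> F N (\<Gamma>' s))" if "s \<in> {0..T}" for s using s that unfolding riccati_solution_def by blast
  have pm: "R.pmeas \<Gamma>0"
  proof -
    have "clip \<in> borel \<rightarrow>\<^sub>M restrict_space borel {0..T}"
      using T by (intro measurable_restrict_space2) (auto simp: clip_def[abs_def])
    then have "(\<lambda>p. (clip (fst p), snd p)) \<in> (borel \<Otimes>\<^sub>M tv_prod \<mu>) \<rightarrow>\<^sub>M (restrict_space borel {0..T} \<Otimes>\<^sub>M tv_prod \<mu>)"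
      by measurable
    from measurable_compose[OF this conjunct1[OF c[unfolded continuous_kernel_L1_def]]]
    show ?thesis unfolding R.pmeas_def \<Gamma>0_def split_beta' fst_conv snd_conv .
  qed
  obtain Dm where Dm: "\<forall>s\<in>{0..T}. (\<integral>z. norm (\<Gamma>' s (fst z) (snd z)) \<partial>tv_prod \<mu>) \<le> Dm"
    using L1_norm_bounded[OF c] by blast
  have "AE z in tv_prod \<mu>. \<Gamma>0 t (fst z) (snd z) = \<Gamma> t (fst z) (snd z)"
  proof (rule R.mild_solution_unique[OF a sol pm, of Dm])
    show "t \<in> {0..T}" by (rule t)
    fix s assume s': "s \<in> {0..T}"
    show "integrable (tv_prod \<mu>) (\<lambda>z. \<Gamma>0 s (fst z) (snd z))" unfolding G0[OF s'] using L1[OF s'] by (simp add: kernel_L1_iff)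
    show "(\<integral>z. norm (\<Gamma>0 s (fst z) (snd z)) \<partial>tv_prod \<mu>) \<le> Dm" unfolding G0[OF s'] using Dm s' by blast
    show "AE z in tv_prod \<mu>. \<Gamma>0 s (fst z) (snd z) = transpose (\<Gamma>0 s (snd z) (fst z))"
      unfolding G0[OF s'] using psd[OF s'] unfolding kernel_psd_def by (simp add: split_beta')
    show "0 \<le> u \<bullet> (R.Xop (\<Gamma>0 s) *v u)" for u
      unfolding G0[OF s'] by (rule Xop_nonneg_of_kernel_psd[OF L1[OF s'] psd[OF s']])
    have "AE z in tv_prod \<mu>. set_integrable lborel {s..T} (\<lambda>v. exp (- (fst z + snd z) * (v - s)) *\<^sub>R riccati_R \<mu> B C D F Q N (\<Gamma>' v) (fst z) (snd z)) \<and>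
        \<Gamma>' s (fst z) (snd z) = (LINT v:{s..T}|lborel. exp (- (fst z + snd z) * (v - s)) *\<^sub>R riccati_R \<mu> B C D F Q N (\<Gamma>' v) (fst z) (snd z))"
      using s s' unfolding riccati_solution_def split_beta' by blast
    then show "AE z in tv_prod \<mu>. set_integrable lborel {s..T} (\<lambda>v. exp (- (rate (fst z) + rate (snd z)) * (v - s)) *\<^sub>R R.Rgen (\<Gamma>0 v) (fst z) (snd z)) \<and>
        \<Gamma>0 s (fst z) (snd z) = (LINT v:{s..T}|lborel. exp (- (rate (fst z) + rate (snd z)) * (v - s)) *\<^sub>R R.Rgen (\<Gamma>0 v) (fst z) (snd z))"
      using AE_space
    proof eventually_elim
      case (elim z)
      then have r: "rate (fst z) = fst z" "rate (snd z) = snd z" by (auto simp: space_pair_measure)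
      have R: "riccati_R \<mu> B C D F Q N (\<Gamma>' v) (fst z) (snd z) = R.Rgen (\<Gamma>0 v) (fst z) (snd z)" if "v \<in> {s..T}" for v
      proof -
        have v: "v \<in> {0..T}" using that s' by auto
        show ?thesis unfolding riccati_R_eq[OF L1[OF v] inv[OF v]] G0[OF v] ..
      qed
      have "set_integrable lborel {s..T} (\<lambda>v. exp (- (fst z + snd z) * (v - s)) *\<^sub>R riccati_R \<mu> B C D F Q N (\<Gamma>' v) (fst z) (snd z))
         = set_integrable lborel {s..T} (\<lambda>v. exp (- (fst z + snd z) * (v - s)) *\<^sub>R R.Rgen (\<Gamma>0 v) (fst z) (snd z))"
        using R by (intro set_integrable_cong) auto
      moreover have "(LINT v:{s..T}|lborel. exp (- (fst z + snd z) * (v - s)) *\<^sub>R riccati_R \<mu> B C D F Q N (\<Gamma>' v) (fst z) (snd z))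
         = (LINT v:{s..T}|lborel. exp (- (fst z + snd z) * (v - s)) *\<^sub>R R.Rgen (\<Gamma>0 v) (fst z) (snd z))"
        using R by (intro set_lebesgue_integral_cong) auto
      ultimately show ?case unfolding r G0[OF s'] using elim(1) by simp
    qed
  qed
  then show ?thesis unfolding G0[OF t] by (simp add: split_beta')
qed

end

theorem theorem2p4:
  fixes T :: real
    and \<mu> :: "real set \<Rightarrow> real^'e^'d"
    and B D :: "real^'d^'e"
    and C F :: "real^'m^'e"
    and Q :: "real^'d^'d"
    and N :: "real^'m^'m"
  assumes "T > 0"
    and "signed_measure \<mu>"
    and "(\<integral>\<^sup>+ \<theta>. ennreal (if \<theta> = 0 then 1 else min 1 (\<theta> powr (- 1 / 2))) \<partial>total_variation \<mu>) < \<infinity>"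
    and "psd Q"
    and "\<exists>l>0. psd (N - l *\<^sub>R mat 1)"
  shows "\<exists>\<Gamma> :: real \<Rightarrow> real \<Rightarrow> real \<Rightarrow> real^'d^'d.
    riccati_solution T \<mu> B C D F Q N \<Gamma> \<and> (\<forall>t\<in>{0..T}. kernel_psd \<mu> (\<Gamma> t)) \<and>
    (\<forall>\<Gamma>'. riccati_solution T \<mu> B C D F Q N \<Gamma>' \<and> (\<forall>t\<in>{0..T}. kernel_psd \<mu> (\<Gamma>' t)) \<longrightarrow>
       (\<forall>t\<in>{0..T}. AE (\<theta>, \<tau>) in tv_prod \<mu>. \<Gamma>' t \<theta> \<tau> = \<Gamma> t \<theta> \<tau>)) \<and>
    (\<exists>M>0. \<forall>t\<in>{0..T}. AE \<theta> in total_variation \<mu>.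
       (\<integral>\<^sup>+ \<tau>. ennreal (norm (\<Gamma> t \<theta> \<tau>)) \<partial>total_variation \<mu>) \<le> ennreal M)"
proof -
  obtain l where l: "0 < l" "psd (N - l *\<^sub>R mat 1)" using assms(5) by blast
  have "(\<integral>\<^sup>+ \<theta>. ennreal (if \<theta> = 0 then 1 else min 1 (\<theta> powr (- 1 / 2))) \<partial>total_variation \<mu>)
      = (\<integral>\<^sup>+\<theta>. ennreal (weight (max 0 \<theta>)) \<partial>total_variation \<mu>)"
    by (intro nn_integral_cong) (simp only: weight_eq space_total_variation atLeast_iff)
  then have fin: "(\<integral>\<^sup>+\<theta>. ennreal (weight (max 0 \<theta>)) \<partial>total_variation \<mu>) < \<infinity>" using assms(3) by simp
  interpret riccati_signed \<mu> T B D C F Q N l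
    using locally_finite_of_weight[OF assms(2) fin] assms(1,4) l fin
    by (intro riccati_signed.intro riccati_signed_axioms.intro)
  obtain K \<Gamma> where a: "R.pd_path K \<Gamma>" and sol: "R.Jop 0 (\<lambda>s. R.Rop 0 (\<Gamma> s)) = \<Gamma>"
    using R.pd_path_solution_exists by blast
  show ?thesis
  proof (intro exI[of _ \<Gamma>] conjI ballI allI impI)
    show "riccati_solution T \<mu> B C D F Q N \<Gamma>" by (rule pd_path_solution(1)[OF a sol])
    show "kernel_psd \<mu> (\<Gamma> t)" if "t \<in> {0..T}" for t by (rule pd_path_solution(2)[OF a sol that])
    show "\<exists>M>0. \<forall>t\<in>{0..T}. AE \<theta> in tv. (\<integral>\<^sup>+ \<tau>. ennreal (norm (\<Gamma> t \<theta> \<tau>)) \<partial>tv) \<le> ennreal M"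
      by (rule pd_path_solution(3)[OF a sol])
    fix \<Gamma>' t
    assume "riccati_solution T \<mu> B C D F Q N \<Gamma>' \<and> (\<forall>t\<in>{0..T}. kernel_psd \<mu> (\<Gamma>' t))" "t \<in> {0..T}"
    then show "AE (\<theta>, \<tau>) in tv_prod \<mu>. \<Gamma>' t \<theta> \<tau> = \<Gamma> t \<theta> \<tau>"
      using solution_unique[OF a sol] by blast
  qed
qed

end
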